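(* Let $\mathcal{A},\mathcal{B}$ be $\Bbbk$-linear categories with $\mathcal{B}$ additive, let $F,G\colon\mathcal{A}\to\mathrm{Ch}^b(\mathcal{B})$ be dg functors, and let $\mathbf{F},\mathbf{G}\colon\mathrm{Ch}^b(\mathcal{A})\to\mathrm{Ch}^b(\mathcal{B})$ denote the lifts of $F,G$. Let $\tau\colon\mathrm{Bar}_{\mathcal{A}}\to M^F_G$ be a closed degree zero $A_\infty$-natural transformation. Then: (1) We may lift $\tau$ to a closed degree zero bimodule map $\tau'\colon\mathrm{Bar}_{\mathrm{Ch}^b(\mathcal{A}),\mathcal{A}}\to M^{\mathbf{F}}_{\mathbf{G}}$ via $$\tau'([f_0,\dots,f_{r+1}])=(-1)^{r|f_0|}\,\mathbf{F}(f_0)\circ\tau\big([\mathrm{id}_{Y_0},f_1,\dots,f_r,\mathrm{id}_{Y_r}]\big)\circ\mathbf{G}(f_{r+1}),$$ where $f_0\colon Y_0\to\mathbf{X}$, $f_u\colon Y_u\to Y_{u-1}$ $(1\le u\le r)$, $f_{r+1}\colon\mathbf{X}'\to Y_r$ with $Y_u\in\mathcal{A}$ and $\mathbf{X},\mathbf{X}'\in\mathrm{Ch}^b(\mathcal{A})$. (2) We have an induced closed degree zero bimodule map $\boldsymbol\tau\colon\mathrm{Bar}_{\mathrm{Ch}^b(\mathcal{A})}\to M^{\mathbf{F}}_{\mathbf{G}}$ defined by $\boldsymbol\tau:=\tau'\circ\Xi$.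
   Context: $\Bbbk$ is a commutative ring. $\mathrm{Ch}^b$ denotes the dg category of bounded cochain complexes with $\underline{\mathrm{Hom}}^k(X,Y)=\prod_i\mathrm{Hom}(X^i,Y^{i+k})$, $d(f)=\delta_Yf-(-1)^{|f|}f\delta_X$; $\mathcal{A}\subset\mathrm{Ch}^b(\mathcal{A})$ as complexes in degree $0$. A dg functor $F\colon\mathcal{A}\to\mathrm{Ch}^b(\mathcal{B})$ is a $\Bbbk$-linear functor to complexes and chain maps. Its lift $\mathbf{F}$ sends $(X,\delta)$ to the complex with degree $k$ chain object $\bigoplus_{i+j=k}F(X^i)^j$ and differential the sum of $F(\delta^i)^j$ and $(-1)^i\delta^j_{F(X^i)}$; on morphisms $\mathbf{F}(f)|_{F(X^i)^j}=F(f|_{X^i})^j$. Bimodules over a dg category $\mathcal{C}$: families of complexes $B(X,Y)$ with unital associative action of $\mathrm{Hom}(X,X')$ on the left and $\mathrm{Hom}(Y',Y)$ on the right; a degree $l$ bimodule map satisfies $\phi(f\cdot b\cdot g)=(-1)^{l|f|}f\cdot\phi(b)\cdot g$. For dg functors $F,G\colon\mathcal{C}\to\mathcal{D}$, $M^F_G(X,X')=\mathrm{Hom}_{\mathcal{D}}(G(X'),F(X))$ with $a\cdot m\cdot b=F(a)\circ m\circ G(b)$. An $A_\infty$-natural transformation $G\to F$ is a bimodule map $\mathrm{Bar}_{\mathcal{C}}\to M^F_G$. Bar complex: $\mathrm{Bar}_{\mathcal{C}}(X,X')=\bigoplus_{r\ge0}\bigoplus_{X_0,\dots,X_r}\mathrm{Hom}(X_0,X)\otimes\mathrm{Hom}(X_1,X_0)\otimes\cdots\otimes\mathrm{Hom}(X',X_r)[r]$,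 elements $[f_0,\dots,f_{r+1}]$ (also written with bars), differential the internal one (on the shift $[r]$) plus $\sum_{i=0}^r(-1)^i[\dots,f_i\circ f_{i+1},\dots]$, bimodule structure $g\cdot[f_0,\dots,f_{r+1}]\cdot g'=(-1)^{r|g|}[g\circ f_0,f_1,\dots,f_r,f_{r+1}\circ g']$. The relative bar complex $\mathrm{Bar}_{\mathrm{Ch}^b(\mathcal{A}),\mathcal{A}}$ is the $(\mathrm{Ch}^b(\mathcal{A}),\mathrm{Ch}^b(\mathcal{A}))$-bimodule defined by the same formulas with $\mathcal{C}=\mathrm{Ch}^b(\mathcal{A})$, but with all intermediate objects $X_0,\dots,X_r$ required to lie in $\mathcal{A}$. The map $\Xi\colon\mathrm{Bar}_{\mathrm{Ch}^b(\mathcal{A})}\to\mathrm{Bar}_{\mathrm{Ch}^b(\mathcal{A}),\mathcal{A}}$: for a complex $\mathbf{X}_u$ let $\sigma_u^a\colon X_u^a\to\mathbf{X}_u$ (degree $a$) and $\pi_u^a\colon\mathbf{X}_u\to X_u^a$ (degree $-a$) be the inclusion and projection of the $a$-th chain object, where $X_u^a\in\mathcal{A}$ is placed in degree $0$. For a composable sequence $g_0,\dots,g_{s+1}$ with intermediate complexes and $\vec a=(a_0,\dots,a_s)\in\mathbb{Z}^{s+1}$ put $[g_0|\cdots|g_{s+1}]^{\vec a}=[g_0\sigma^{a_0}|\pi^{a_0}g_1\sigma^{a_1}|\cdots|\pi^{a_{s-1}}g_s\sigma^{a_s}|\pi^{a_s}g_{s+1}]$. Then for $f_u\colon\mathbf{X}_u\to\mathbf{X}_{u-1}$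 of degree $k_u$ (with $\mathbf{X}_{-1}=\mathbf{X}$, $\mathbf{X}_{r+1}=\mathbf{X}'$) and $\delta_u$ the differential of $\mathbf{X}_u$, $$\Xi([f_0|\cdots|f_{r+1}])=\sum_{\vec n,\vec a}(-1)^{\mathrm{sgn}}[f_0|\delta_0^{*n_0}|f_1|\cdots|\delta_r^{*n_r}|f_{r+1}]^{\vec a},$$ where $\delta_u^{*n_u}$ is $\delta_u$ repeated $n_u$ times, $\vec n=(n_0,\dots,n_r)\in\mathbb{Z}_{\ge0}^{r+1}$, $s=r+n_0+\cdots+n_r$, $\vec a\in\mathbb{Z}^{s+1}$, and $\mathrm{sgn}=\binom{s-r+1}{2}+\sum_{0\le u\le r}(r-u)n_u+\sum_{0\le u\le u'\le r}k_un_{u'}$. It is a known result that $\Xi$ is a closed degree zero bimodule map and a homotopy equivalence. *)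

theory Defs
  imports "HOL-Algebra.AbelCoset" "HOL-Algebra.Module"
begin

section \<open>Modules\<close>

text \<open>The ring fields \<open>mult\<close> and \<open>one\<close> of a \<open>module\<close> record play no role for modules and are
  left undefined throughout.\<close>

definition linear_maps :: "'k ring \<Rightarrow> ('k,'x) module \<Rightarrow> ('k,'y) module \<Rightarrow> ('x \<Rightarrow> 'y) set" where
  "linear_maps K M N = {\<phi>. \<phi> \<in> carrier M \<rightarrow> carrier N \<and>
     (\<forall>x\<in>carrier M. \<forall>y\<in>carrier M. \<phi> (x \<oplus>\<^bsub>M\<^esub> y) = \<phi> x \<oplus>\<^bsub>N\<^esub> \<phi> y) \<and>
     (\<forall>c\<in>carrier K. \<forall>x\<in>carrier M. \<phi> (c \<odot>\<^bsub>M\<^esub> x) = c \<odot>\<^bsub>N\<^esub> \<phi> x)}"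

text \<open>\<open>signed M e x\<close> is \<open>(-1)^e x\<close>.\<close>

definition signed :: "('k,'x) module \<Rightarrow> int \<Rightarrow> 'x \<Rightarrow> 'x" where
  "signed M e x = (if even e then x else \<ominus>\<^bsub>M\<^esub> x)"

definition zero_module :: "('k,'x) module" where
  "zero_module = \<lparr>carrier = {undefined}, monoid.mult = undefined, one = undefined,
     zero = undefined, add = (\<lambda>x y. undefined), smult = (\<lambda>c x. undefined)\<rparr>"

definition prod_module :: "('i \<Rightarrow> ('k,'x) module) \<Rightarrow> ('k, 'i \<Rightarrow> 'x) module" where
  "prod_module M = \<lparr>carrier = {x. \<forall>i. x i \<in> carrier (M i)}, monoid.mult = undefined,
     one = undefined, zero = (\<lambda>i. \<zero>\<^bsub>M i\<^esub>), add = (\<lambda>x y i. x i \<oplus>\<^bsub>M i\<^esub> y i),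
     smult = (\<lambda>c x i. c \<odot>\<^bsub>M i\<^esub> x i)\<rparr>"

definition free_module :: "'k ring \<Rightarrow> 's set \<Rightarrow> ('k, 's \<Rightarrow> 'k) module" where
  "free_module K S = \<lparr>carrier = {x. range x \<subseteq> carrier K \<and> finite {s. x s \<noteq> \<zero>\<^bsub>K\<^esub>} \<and>
       {s. x s \<noteq> \<zero>\<^bsub>K\<^esub>} \<subseteq> S},
     monoid.mult = undefined, one = undefined, zero = (\<lambda>s. \<zero>\<^bsub>K\<^esub>),
     add = (\<lambda>x y s. x s \<oplus>\<^bsub>K\<^esub> y s), smult = (\<lambda>c x s. c \<otimes>\<^bsub>K\<^esub> x s)\<rparr>"

definition generator :: "'k ring \<Rightarrow> 's \<Rightarrow> ('s \<Rightarrow> 'k)" where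
  "generator K s = (\<lambda>t. if t = s then \<one>\<^bsub>K\<^esub> else \<zero>\<^bsub>K\<^esub>)"

definition span :: "'k ring \<Rightarrow> ('k,'x) module \<Rightarrow> 'x set \<Rightarrow> 'x set" where
  "span K M R = \<Inter> {N. submodule N K M \<and> R \<subseteq> N}"

definition quotient_module :: "('k,'x) module \<Rightarrow> 'x set \<Rightarrow> ('k,'x set) module" where
  "quotient_module M N = \<lparr>carrier = a_rcosets\<^bsub>M\<^esub> N, monoid.mult = undefined, one = undefined,
     zero = N, add = set_add M, smult = (\<lambda>c U. \<Union>x\<in>U. N +>\<^bsub>M\<^esub> (c \<odot>\<^bsub>M\<^esub> x))\<rparr>"

text \<open>The linear map from a quotient of a free module to \<open>N\<close> given by \<open>\<phi>\<close> on the basis.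
  The value on a coset is computed from a representative; this is meaningful only if the
  linear extension of \<open>\<phi>\<close> vanishes on the relations.\<close>

definition lin_ext :: "'k ring \<Rightarrow> ('k,'y) module \<Rightarrow> ('s \<Rightarrow> 'y) \<Rightarrow> ('s \<Rightarrow> 'k) set \<Rightarrow> 'y" where
  "lin_ext K N \<phi> U = (let x = (SOME x. x \<in> U) in
     finsum N (\<lambda>s. x s \<odot>\<^bsub>N\<^esub> \<phi> s) {s. x s \<noteq> \<zero>\<^bsub>K\<^esub>})"

text \<open>The sum of a family with finitely many nonzero terms.\<close>

definition fin_supp_sum :: "('k,'x) module \<Rightarrow> ('i \<Rightarrow> 'x) \<Rightarrow> 'i set \<Rightarrow> 'x" where
  "fin_supp_sum M x I = finsum M x {i\<in>I. x i \<noteq> \<zero>\<^bsub>M\<^esub>}"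


section \<open>Linear categories\<close>

text \<open>\<open>Hom A X Y\<close> is the module of morphisms from \<open>X\<close> to \<open>Y\<close>, and \<open>Comp A X Y Z g f\<close> is the composite
  \<open>g \<circ> f\<close> of \<open>f : X \<rightarrow> Y\<close> and \<open>g : Y \<rightarrow> Z\<close>. Hom-sets need not be disjoint.\<close>

record ('k,'o,'m) lincat =
  Obj :: "'o set"
  Hom :: "'o \<Rightarrow> 'o \<Rightarrow> ('k,'m) module"
  Comp :: "'o \<Rightarrow> 'o \<Rightarrow> 'o \<Rightarrow> 'm \<Rightarrow> 'm \<Rightarrow> 'm"
  Ident :: "'o \<Rightarrow> 'm"

locale linear_category =
  fixes K :: "'k ring" and A :: "('k,'o,'m) lincat"
  assumes cring_K: "cring K"
    and module_Hom: "\<lbrakk>X \<in> Obj A; Y \<in> Obj A\<rbrakk> \<Longrightarrow> module K (Hom A X Y)"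
    and Ident_in: "X \<in> Obj A \<Longrightarrow> Ident A X \<in> carrier (Hom A X X)"
    and Comp_linear_left: "\<lbrakk>X \<in> Obj A; Y \<in> Obj A; Z \<in> Obj A; f \<in> carrier (Hom A X Y)\<rbrakk> \<Longrightarrow>
      (\<lambda>g. Comp A X Y Z g f) \<in> linear_maps K (Hom A Y Z) (Hom A X Z)"
    and Comp_linear_right: "\<lbrakk>X \<in> Obj A; Y \<in> Obj A; Z \<in> Obj A; g \<in> carrier (Hom A Y Z)\<rbrakk> \<Longrightarrow>
      (\<lambda>f. Comp A X Y Z g f) \<in> linear_maps K (Hom A X Y) (Hom A X Z)"
    and Comp_assoc: "\<lbrakk>W \<in> Obj A; X \<in> Obj A; Y \<in> Obj A; Z \<in> Obj A; f \<in> carrier (Hom A W X);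
        g \<in> carrier (Hom A X Y); h \<in> carrier (Hom A Y Z)\<rbrakk> \<Longrightarrow>
      Comp A W X Z (Comp A X Y Z h g) f = Comp A W Y Z h (Comp A W X Y g f)"
    and Comp_Ident_left: "\<lbrakk>X \<in> Obj A; Y \<in> Obj A; f \<in> carrier (Hom A X Y)\<rbrakk> \<Longrightarrow>
      Comp A X Y Y (Ident A Y) f = f"
    and Comp_Ident_right: "\<lbrakk>X \<in> Obj A; Y \<in> Obj A; f \<in> carrier (Hom A X Y)\<rbrakk> \<Longrightarrow>
      Comp A X X Y f (Ident A X) = f"

text \<open>\<open>b\<close> with the inclusions \<open>inc\<close> and projections \<open>prj\<close> is a direct sum of \<open>(c i)\<^sub>i\<close> over the finite set
  \<open>I\<close>.\<close>

definition is_direct_sum ::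
    "('k,'o,'m) lincat \<Rightarrow> int set \<Rightarrow> (int \<Rightarrow> 'o) \<Rightarrow> 'o \<Rightarrow> (int \<Rightarrow> 'm) \<Rightarrow> (int \<Rightarrow> 'm) \<Rightarrow> bool" where
  "is_direct_sum A I c b inc prj \<longleftrightarrow> b \<in> Obj A \<and>
     (\<forall>i\<in>I. inc i \<in> carrier (Hom A (c i) b) \<and> prj i \<in> carrier (Hom A b (c i)) \<and>
        Comp A (c i) b (c i) (prj i) (inc i) = Ident A (c i)) \<and>
     (\<forall>i\<in>I. \<forall>j\<in>I. i \<noteq> j \<longrightarrow> Comp A (c i) b (c j) (prj j) (inc i) = \<zero>\<^bsub>Hom A (c i) (c j)\<^esub>) \<and>
     finsum (Hom A b b) (\<lambda>i. Comp A b (c i) b (inc i) (prj i)) I = Ident A b"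

text \<open>All finite direct sums exist; the empty one is a zero object.\<close>

definition additive :: "('k,'o,'m) lincat \<Rightarrow> bool" where
  "additive A \<longleftrightarrow> (\<forall>I c. finite I \<and> c ` I \<subseteq> Obj A \<longrightarrow> (\<exists>b inc prj. is_direct_sum A I c b inc prj))"

text \<open>A linear category need not have a zero object, so we adjoin one: the object \<open>None\<close> of
  \<open>adj_zero A\<close>. A bounded complex over \<open>A\<close> is then a complex over \<open>adj_zero A\<close> all but finitely
  many of whose chain objects are \<open>None\<close>.\<close>

definition adj_zero :: "('k,'o,'m) lincat \<Rightarrow> ('k,'o option,'m) lincat" where
  "adj_zero A = \<lparr>Obj = insert None (Some ` Obj A),
     Hom = (\<lambda>x y. case (x, y) of (Some X, Some Y) \<Rightarrow> Hom A X Y | _ \<Rightarrow> zero_module),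
     Comp = (\<lambda>x y z g f. case (x, z) of
        (Some X, Some Z) \<Rightarrow> (case y of Some Y \<Rightarrow> Comp A X Y Z g f | None \<Rightarrow> \<zero>\<^bsub>Hom A X Z\<^esub>)
      | _ \<Rightarrow> undefined),
     Ident = (\<lambda>x. case x of Some X \<Rightarrow> Ident A X | None \<Rightarrow> undefined)\<rparr>"


section \<open>Dg categories, dg functors and bimodules\<close>

text \<open>A homogeneous morphism carries its source, target and degree.\<close>

datatype ('o,'v) harr = Arr (src: 'o) (tgt: 'o) (deg: int) (val: 'v)

definition tag_module :: "'o \<Rightarrow> 'o \<Rightarrow> int \<Rightarrow> ('k,'v) module \<Rightarrow> ('k,('o,'v) harr) module" where
  "tag_module X Y k M = \<lparr>carrier = Arr X Y k ` carrier M, monoid.mult = undefined, one = undefined,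
     zero = Arr X Y k \<zero>\<^bsub>M\<^esub>, add = (\<lambda>f g. Arr X Y k (val f \<oplus>\<^bsub>M\<^esub> val g)),
     smult = (\<lambda>c f. Arr X Y k (c \<odot>\<^bsub>M\<^esub> val f))\<rparr>"

record ('k,'o,'v) dgcat =
  dgOb :: "'o set"
  gHom :: "'o \<Rightarrow> 'o \<Rightarrow> int \<Rightarrow> ('k,('o,'v) harr) module"
  dif :: "('o,'v) harr \<Rightarrow> ('o,'v) harr"
  gComp :: "('o,'v) harr \<Rightarrow> ('o,'v) harr \<Rightarrow> ('o,'v) harr"
  idt :: "'o \<Rightarrow> ('o,'v) harr"

record ('o,'v,'p,'w) dgfun =
  fobj :: "'o \<Rightarrow> 'p"
  fmor :: "('o,'v) harr \<Rightarrow> ('p,'w) harr"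

definition dg_functor ::
    "'k ring \<Rightarrow> ('k,'o,'v) dgcat \<Rightarrow> ('k,'p,'w) dgcat \<Rightarrow> ('o,'v,'p,'w) dgfun \<Rightarrow> bool" where
  "dg_functor K C D F \<longleftrightarrow>
     (\<forall>X\<in>dgOb C. fobj F X \<in> dgOb D \<and> fmor F (idt C X) = idt D (fobj F X)) \<and>
     (\<forall>X\<in>dgOb C. \<forall>Y\<in>dgOb C. \<forall>k.
        fmor F \<in> linear_maps K (gHom C X Y k) (gHom D (fobj F X) (fobj F Y) k) \<and>
        (\<forall>f\<in>carrier (gHom C X Y k). fmor F (dif C f) = dif D (fmor F f))) \<and>
     (\<forall>X\<in>dgOb C. \<forall>Y\<in>dgOb C. \<forall>Z\<in>dgOb C. \<forall>k l. \<forall>g\<in>carrier (gHom C Y Z k).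
        \<forall>f\<in>carrier (gHom C X Y l). fmor F (gComp C g f) = gComp D (fmor F g) (fmor F f))"

text \<open>For a bimodule \<open>B\<close>, \<open>bmod B X Y n\<close> is the degree \<open>n\<close> part of \<open>B(X,Y)\<close> and
  \<open>bdif B X Y n\<close> its differential; \<open>lact B f Y n b\<close> is \<open>f \<cdot> b\<close> for \<open>b\<close> of degree \<open>n\<close> in
  \<open>B(src f, Y)\<close>, and \<open>ract B X n b g\<close> is \<open>b \<cdot> g\<close> for \<open>b\<close> of degree \<open>n\<close> in \<open>B(X, tgt g)\<close>.\<close>

record ('k,'o,'v,'x) bimodule =
  bmod :: "'o \<Rightarrow> 'o \<Rightarrow> int \<Rightarrow> ('k,'x) module"
  bdif :: "'o \<Rightarrow> 'o \<Rightarrow> int \<Rightarrow> 'x \<Rightarrow> 'x"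
  lact :: "('o,'v) harr \<Rightarrow> 'o \<Rightarrow> int \<Rightarrow> 'x \<Rightarrow> 'x"
  ract :: "'o \<Rightarrow> int \<Rightarrow> 'x \<Rightarrow> ('o,'v) harr \<Rightarrow> 'x"

definition bimodule_map ::
    "'k ring \<Rightarrow> ('k,'o,'v) dgcat \<Rightarrow> ('k,'o,'v,'x) bimodule \<Rightarrow> ('k,'o,'v,'y) bimodule \<Rightarrow> int \<Rightarrow>
     ('o \<Rightarrow> 'o \<Rightarrow> int \<Rightarrow> 'x \<Rightarrow> 'y) \<Rightarrow> bool" where
  "bimodule_map K C B B' l \<phi> \<longleftrightarrow>
     (\<forall>X\<in>dgOb C. \<forall>Y\<in>dgOb C. \<forall>n. \<phi> X Y n \<in> linear_maps K (bmod B X Y n) (bmod B' X Y (n + l))) \<and>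
     (\<forall>X\<in>dgOb C. \<forall>X'\<in>dgOb C. \<forall>Y\<in>dgOb C. \<forall>Y'\<in>dgOb C. \<forall>j n m.
        \<forall>f\<in>carrier (gHom C X X' j). \<forall>b\<in>carrier (bmod B X Y n). \<forall>g\<in>carrier (gHom C Y' Y m).
          \<phi> X' Y' (j + n + m) (ract B X' (j + n) (lact B f Y n b) g) =
          signed (bmod B' X' Y' (j + n + m + l)) (l * j)
            (ract B' X' (j + n + l) (lact B' f Y (n + l) (\<phi> X Y n b)) g))"

definition closed_map ::
    "('k,'o,'v) dgcat \<Rightarrow> ('k,'o,'v,'x) bimodule \<Rightarrow> ('k,'o,'v,'y) bimodule \<Rightarrow> int \<Rightarrow>
     ('o \<Rightarrow> 'o \<Rightarrow> int \<Rightarrow> 'x \<Rightarrow> 'y) \<Rightarrow> bool" where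
  "closed_map C B B' l \<phi> \<longleftrightarrow>
     (\<forall>X\<in>dgOb C. \<forall>Y\<in>dgOb C. \<forall>n. \<forall>b\<in>carrier (bmod B X Y n).
        bdif B' X Y (n + l) (\<phi> X Y n b) =
        signed (bmod B' X Y (n + l + 1)) l (\<phi> X Y (n + 1) (bdif B X Y n b)))"

text \<open>The bimodule \<open>M\<^sup>F\<^sub>G\<close>, with \<open>M\<^sup>F\<^sub>G(X,X') = Hom(G(X'),F(X))\<close>.\<close>

definition functor_bimodule ::
    "('k,'p,'w) dgcat \<Rightarrow> ('o,'v,'p,'w) dgfun \<Rightarrow> ('o,'v,'p,'w) dgfun \<Rightarrow>
     ('k,'o,'v,('p,'w) harr) bimodule" where
  "functor_bimodule D F G = \<lparr>bmod = (\<lambda>X X' n. gHom D (fobj G X') (fobj F X) n),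
     bdif = (\<lambda>X X' n. dif D),
     lact = (\<lambda>f X' n m. gComp D (fmor F f) m),
     ract = (\<lambda>X n m g. gComp D m (fmor G g))\<rparr>"


section \<open>Bar complexes\<close>

text \<open>The symbols \<open>[f\<^sub>0,\<dots>,f\<^sub>r\<^sub>+\<^sub>1]\<close> of degree \<open>n\<close> with \<open>f\<^sub>0\<close> ending at \<open>X\<close>, \<open>f\<^sub>r\<^sub>+\<^sub>1\<close> starting at \<open>X'\<close> and all
  intermediate objects in \<open>S\<close>.\<close>

definition bar_symbols ::
    "('k,'o,'v) dgcat \<Rightarrow> 'o set \<Rightarrow> 'o \<Rightarrow> 'o \<Rightarrow> int \<Rightarrow> ('o,'v) harr list set" where
  "bar_symbols C S X X' n = {fs. 2 \<le> length fs \<and>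
     (\<forall>f\<in>set fs. src f \<in> dgOb C \<and> tgt f \<in> dgOb C \<and> f \<in> carrier (gHom C (src f) (tgt f) (deg f))) \<and>
     tgt (hd fs) = X \<and> src (last fs) = X' \<and>
     (\<forall>i. i + 1 < length fs \<longrightarrow> src (fs ! i) = tgt (fs ! (i + 1)) \<and> src (fs ! i) \<in> S) \<and>
     (\<Sum>f\<leftarrow>fs. deg f) - (int (length fs) - 2) = n}"

text \<open>The direct sum over \<open>r\<close>, over the intermediate objects and over the degrees of the factors, of
  the tensor products of the corresponding Hom modules is constructed in one step: it is the free
  module on the symbols modulo multilinearity in each entry.\<close>

definition bar_relations ::
    "'k ring \<Rightarrow> ('k,'o,'v) dgcat \<Rightarrow> 'o set \<Rightarrow> 'o \<Rightarrow> 'o \<Rightarrow> int \<Rightarrow>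
     (('o,'v) harr list \<Rightarrow> 'k) set" where
  "bar_relations K C S X X' n =
     (let M = free_module K (bar_symbols C S X X' n) in span K M
       ({generator K (us @ [f \<oplus>\<^bsub>gHom C Y Z k\<^esub> g] @ vs) \<ominus>\<^bsub>M\<^esub>
           (generator K (us @ [f] @ vs) \<oplus>\<^bsub>M\<^esub> generator K (us @ [g] @ vs)) | us vs f g Y Z k.
           f \<in> carrier (gHom C Y Z k) \<and> g \<in> carrier (gHom C Y Z k) \<and>
           us @ [f] @ vs \<in> bar_symbols C S X X' n \<and> us @ [g] @ vs \<in> bar_symbols C S X X' n} \<union>
        {generator K (us @ [c \<odot>\<^bsub>gHom C Y Z k\<^esub> f] @ vs) \<ominus>\<^bsub>M\<^esub>
           (c \<odot>\<^bsub>M\<^esub> generator K (us @ [f] @ vs)) | us vs c f Y Z k.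
           c \<in> carrier K \<and> f \<in> carrier (gHom C Y Z k) \<and>
           us @ [f] @ vs \<in> bar_symbols C S X X' n}))"

definition bar_module ::
    "'k ring \<Rightarrow> ('k,'o,'v) dgcat \<Rightarrow> 'o set \<Rightarrow> 'o \<Rightarrow> 'o \<Rightarrow> int \<Rightarrow>
     ('k,(('o,'v) harr list \<Rightarrow> 'k) set) module" where
  "bar_module K C S X X' n =
     quotient_module (free_module K (bar_symbols C S X X' n)) (bar_relations K C S X X' n)"

definition bar_elem ::
    "'k ring \<Rightarrow> ('k,'o,'v) dgcat \<Rightarrow> 'o set \<Rightarrow> 'o \<Rightarrow> 'o \<Rightarrow> int \<Rightarrow> ('o,'v) harr list \<Rightarrow>
     (('o,'v) harr list \<Rightarrow> 'k) set" where
  "bar_elem K C S X X' n fs =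
     bar_relations K C S X X' n +>\<^bsub>free_module K (bar_symbols C S X X' n)\<^esub> generator K fs"

text \<open>On \<open>[f\<^sub>0,\<dots>,f\<^sub>r\<^sub>+\<^sub>1]\<close>, the internal differential is the Koszul-signed differential of the tensor
  product, times \<open>(-1)^r\<close> for the shift. The composition terms lower \<open>r\<close> by one, so there are none
  for \<open>r = 0\<close>.\<close>

definition bar_dif ::
    "'k ring \<Rightarrow> ('k,'o,'v) dgcat \<Rightarrow> 'o set \<Rightarrow> 'o \<Rightarrow> 'o \<Rightarrow> int \<Rightarrow>
     ('o,'v) harr list \<Rightarrow> (('o,'v) harr list \<Rightarrow> 'k) set" where
  "bar_dif K C S X X' n fs =
     (let r = length fs - 2;
          M = bar_module K C S X X' (n + 1);
          cl = bar_elem K C S X X' (n + 1)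
      in finsum M (\<lambda>i. signed M (int r + (\<Sum>j<i. deg (fs ! j))) (cl (fs[i := dif C (fs ! i)]))) {0..r+1}
         \<oplus>\<^bsub>M\<^esub>
         finsum M (\<lambda>i. signed M (int i)
             (cl (take i fs @ [gComp C (fs ! i) (fs ! (i + 1))] @ drop (i + 2) fs)))
           {i. 0 < r \<and> i \<le> r})"

definition rel_Bar ::
    "'k ring \<Rightarrow> ('k,'o,'v) dgcat \<Rightarrow> 'o set \<Rightarrow>
     ('k,'o,'v,(('o,'v) harr list \<Rightarrow> 'k) set) bimodule" where
  "rel_Bar K C S = \<lparr>bmod = bar_module K C S,
     bdif = (\<lambda>X X' n. lin_ext K (bar_module K C S X X' (n + 1)) (bar_dif K C S X X' n)),
     lact = (\<lambda>g X' n. let M = bar_module K C S (tgt g) X' (deg g + n) in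
        lin_ext K M (\<lambda>fs. signed M (int (length fs - 2) * deg g)
          (bar_elem K C S (tgt g) X' (deg g + n) (gComp C g (hd fs) # tl fs)))),
     ract = (\<lambda>X n x g. lin_ext K (bar_module K C S X (src g) (n + deg g))
        (\<lambda>fs. bar_elem K C S X (src g) (n + deg g) (butlast fs @ [gComp C (last fs) g])) x)\<rparr>"

definition Bar ::
    "'k ring \<Rightarrow> ('k,'o,'v) dgcat \<Rightarrow> ('k,'o,'v,(('o,'v) harr list \<Rightarrow> 'k) set) bimodule" where
  "Bar K C = rel_Bar K C (dgOb C)"

definition A_inf_nat_trans ::
    "'k ring \<Rightarrow> ('k,'o,'v) dgcat \<Rightarrow> ('k,'p,'w) dgcat \<Rightarrow> ('o,'v,'p,'w) dgfun \<Rightarrow>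
     ('o,'v,'p,'w) dgfun \<Rightarrow> int \<Rightarrow>
     ('o \<Rightarrow> 'o \<Rightarrow> int \<Rightarrow> (('o,'v) harr list \<Rightarrow> 'k) set \<Rightarrow> ('p,'w) harr) \<Rightarrow> bool" where
  "A_inf_nat_trans K C D G F l \<tau> \<longleftrightarrow> bimodule_map K C (Bar K C) (functor_bimodule D F G) l \<tau>"


section \<open>Bounded complexes\<close>

datatype ('o,'m) cplx = Cplx (cob: "int \<Rightarrow> 'o option") (cdif: "int \<Rightarrow> 'm")

definition supp :: "('o,'m) cplx \<Rightarrow> int set" where
  "supp X = {i. cob X i \<noteq> None}"

definition Chb :: "('k,'o,'m) lincat \<Rightarrow> ('k,('o,'m) cplx,int \<Rightarrow> 'm) dgcat" where
  "Chb A = (let H = Hom (adj_zero A); cmp = Comp (adj_zero A) in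
   \<lparr>dgOb = {X. finite (supp X) \<and>
        (\<forall>i. cob X i \<in> Obj (adj_zero A) \<and>
             cdif X i \<in> carrier (H (cob X i) (cob X (i + 1))) \<and>
             cmp (cob X i) (cob X (i + 1)) (cob X (i + 2)) (cdif X (i + 1)) (cdif X i) =
               \<zero>\<^bsub>H (cob X i) (cob X (i + 2))\<^esub>)},
     gHom = (\<lambda>X Y k. tag_module X Y k (prod_module (\<lambda>i. H (cob X i) (cob Y (i + k))))),
     dif = (\<lambda>f. case f of Arr X Y k v \<Rightarrow> Arr X Y (k + 1) (\<lambda>i.
        let M = H (cob X i) (cob Y (i + k + 1)) in
        cmp (cob X i) (cob Y (i + k)) (cob Y (i + k + 1)) (cdif Y (i + k)) (v i)
        \<ominus>\<^bsub>M\<^esub>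
        signed M k (cmp (cob X i) (cob X (i + 1)) (cob Y (i + 1 + k)) (v (i + 1)) (cdif X i)))),
     gComp = (\<lambda>g f. Arr (src f) (tgt g) (deg g + deg f) (\<lambda>i.
        cmp (cob (src f) i) (cob (tgt f) (i + deg f)) (cob (tgt g) (i + deg f + deg g))
          (val g (i + deg f)) (val f i))),
     idt = (\<lambda>X. Arr X X 0 (\<lambda>i. Ident (adj_zero A) (cob X i)))\<rparr>)"

text \<open>\<open>A\<close> as a dg category in degree \<open>0\<close>, and its embedding into \<open>Chb A\<close>. Components between
  zero objects are \<open>undefined\<close>, the only element of \<open>zero_module\<close>.\<close>

definition dg_of :: "('k,'o,'m) lincat \<Rightarrow> ('k,'o,'m) dgcat" where
  "dg_of A = \<lparr>dgOb = Obj A,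
     gHom = (\<lambda>X Y k. tag_module X Y k
        (if k = 0 then Hom A X Y else (Hom A X Y)\<lparr>carrier := {\<zero>\<^bsub>Hom A X Y\<^esub>}\<rparr>)),
     dif = (\<lambda>f. Arr (src f) (tgt f) (deg f + 1) \<zero>\<^bsub>Hom A (src f) (tgt f)\<^esub>),
     gComp = (\<lambda>g f. Arr (src f) (tgt g) (deg g + deg f)
        (Comp A (src f) (tgt f) (tgt g) (val g) (val f))),
     idt = (\<lambda>X. Arr X X 0 (Ident A X))\<rparr>"

definition emb_ob :: "'o \<Rightarrow> ('o,'m) cplx" where
  "emb_ob a = Cplx (\<lambda>i. if i = 0 then Some a else None) (\<lambda>i. undefined)"

definition emb_mor :: "('o,'m) harr \<Rightarrow> (('o,'m) cplx, int \<Rightarrow> 'm) harr" where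
  "emb_mor f = Arr (emb_ob (src f)) (emb_ob (tgt f)) (deg f)
     (\<lambda>i. if i = 0 \<and> deg f = 0 then val f else undefined)"


section \<open>Lifting dg functors to complexes\<close>

text \<open>A choice of direct sums in \<open>adj_zero B\<close>. It is arbitrary, except that zero summands are dropped
  and a direct sum with a single nonzero summand is that summand itself. Hence the lift of a functor
  \<open>F\<close> agrees strictly with \<open>F\<close> on complexes in degree \<open>0\<close>.\<close>

definition chosen_sum ::
    "('k,'o,'m) lincat \<Rightarrow> int set \<Rightarrow> (int \<Rightarrow> 'o option) \<Rightarrow>
     'o option \<times> (int \<Rightarrow> 'm) \<times> (int \<Rightarrow> 'm)" where
  "chosen_sum B I c = (SOME (b, inc, prj).
     is_direct_sum (adj_zero B) I c b inc prj \<and>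
     ((\<forall>i\<in>I. c i = None) \<longrightarrow> b = None) \<and>
     (\<forall>i\<in>I. (\<forall>j\<in>I. j \<noteq> i \<longrightarrow> c j = None) \<longrightarrow>
        b = c i \<and> inc i = Ident (adj_zero B) (c i) \<and> prj i = Ident (adj_zero B) (c i)))"

context
  fixes B :: "('k,'p,'n) lincat"
    and F :: "('o,'m,('p,'n) cplx,int \<Rightarrow> 'n) dgfun"
begin

text \<open>The summands \<open>F(X\<^sup>i)\<^sup>k\<^sup>-\<^sup>i\<close> of the degree \<open>k\<close> chain object of the lift.\<close>

definition summand :: "('o,'m) cplx \<Rightarrow> int \<Rightarrow> int \<Rightarrow> 'p option" where
  "summand X k i = (case cob X i of None \<Rightarrow> None | Some a \<Rightarrow> cob (fobj F a) (k - i))"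

definition lift_sum ::
    "('o,'m) cplx \<Rightarrow> int \<Rightarrow> 'p option \<times> (int \<Rightarrow> 'n) \<times> (int \<Rightarrow> 'n)" where
  "lift_sum X k = chosen_sum B (supp X) (summand X k)"

definition lift_chain :: "('o,'m) cplx \<Rightarrow> int \<Rightarrow> 'p option" where
  "lift_chain X k = fst (lift_sum X k)"

text \<open>The morphism from the degree \<open>k\<close> chain object of the lift of \<open>X\<close> to the degree \<open>l\<close> chain object
  of the lift of \<open>Y\<close> whose only nonzero matrix entry is \<open>\<phi>\<close>, from the \<open>i\<close>-th to the \<open>j\<close>-th summand.\<close>

definition matrix_entry ::
    "('o,'m) cplx \<Rightarrow> int \<Rightarrow> int \<Rightarrow> ('o,'m) cplx \<Rightarrow> int \<Rightarrow> int \<Rightarrow> 'n \<Rightarrow> 'n" where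
  "matrix_entry X k i Y l j \<phi> =
     Comp (adj_zero B) (lift_chain X k) (summand Y l j) (lift_chain Y l)
       (fst (snd (lift_sum Y l)) j)
       (Comp (adj_zero B) (lift_chain X k) (summand X k i) (summand Y l j)
         \<phi> (snd (snd (lift_sum X k)) i))"

text \<open>\<open>F(\<phi>)\<^sup>j\<close> for a morphism \<open>\<phi>\<close> of the underlying category.\<close>

definition chain_comp :: "'o option \<Rightarrow> 'o option \<Rightarrow> 'm \<Rightarrow> int \<Rightarrow> 'n" where
  "chain_comp x y \<phi> j = val (fmor F (Arr (the x) (the y) 0 \<phi>)) j"

definition lift_ob :: "('o,'m) cplx \<Rightarrow> ('p,'n) cplx" where
  "lift_ob X = Cplx (lift_chain X) (\<lambda>k.
     let M = Hom (adj_zero B) (lift_chain X k) (lift_chain X (k + 1)) in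
     finsum M (\<lambda>i. matrix_entry X k i X (k + 1) (i + 1)
         (chain_comp (cob X i) (cob X (i + 1)) (cdif X i) (k - i)))
       {i\<in>supp X. i + 1 \<in> supp X}
     \<oplus>\<^bsub>M\<^esub>
     finsum M (\<lambda>i. signed M i (matrix_entry X k i X (k + 1) i
         (cdif (fobj F (the (cob X i))) (k - i))))
       (supp X))"

definition lift_mor ::
    "(('o,'m) cplx,int \<Rightarrow> 'm) harr \<Rightarrow> (('p,'n) cplx,int \<Rightarrow> 'n) harr" where
  "lift_mor f = (let X = src f; Y = tgt f; l = deg f in
     Arr (lift_ob X) (lift_ob Y) l (\<lambda>k.
       finsum (Hom (adj_zero B) (lift_chain X k) (lift_chain Y (k + l)))
         (\<lambda>i. matrix_entry X k i Y (k + l) (i + l)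
           (chain_comp (cob X i) (cob Y (i + l)) (val f i) (k - i)))
         {i\<in>supp X. i + l \<in> supp Y}))"

definition lift ::
    "(('o,'m) cplx,int \<Rightarrow> 'm,('p,'n) cplx,int \<Rightarrow> 'n) dgfun" where
  "lift = \<lparr>fobj = lift_ob, fmor = lift_mor\<rparr>"

end


section \<open>The map from the bar complex to the relative bar complex\<close>

definition rel_Bar_Chb ::
    "'k ring \<Rightarrow> ('k,'o,'m) lincat \<Rightarrow> ('k,('o,'m) cplx,int \<Rightarrow> 'm,
       ((('o,'m) cplx,int \<Rightarrow> 'm) harr list \<Rightarrow> 'k) set) bimodule" where
  "rel_Bar_Chb K A = rel_Bar K (Chb A) (emb_ob ` Obj A)"

definition delta :: "('o,'m) cplx \<Rightarrow> (('o,'m) cplx,int \<Rightarrow> 'm) harr" where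
  "delta X = Arr X X 1 (cdif X)"

definition incl ::
    "('k,'o,'m) lincat \<Rightarrow> ('o,'m) cplx \<Rightarrow> int \<Rightarrow> (('o,'m) cplx,int \<Rightarrow> 'm) harr" where
  "incl A X a = Arr (emb_ob (the (cob X a))) X a
     (\<lambda>i. if i = 0 then Ident A (the (cob X a)) else undefined)"

definition proj ::
    "('k,'o,'m) lincat \<Rightarrow> ('o,'m) cplx \<Rightarrow> int \<Rightarrow> (('o,'m) cplx,int \<Rightarrow> 'm) harr" where
  "proj A X a = Arr X (emb_ob (the (cob X a))) (- a)
     (\<lambda>i. if i = a then Ident A (the (cob X a)) else undefined)"

text \<open>\<open>f\<^sub>0 | \<delta>\<^sub>0 | \<dots> | \<delta>\<^sub>0 | f\<^sub>1 | \<dots> | \<delta>\<^sub>r | f\<^sub>r\<^sub>+\<^sub>1\<close> with \<open>ns ! u\<close> copies of \<open>\<delta>\<^sub>u\<close>; the intermediate complex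
  \<open>X\<^sub>u\<close> is the source of \<open>f\<^sub>u\<close>.\<close>

definition insert_deltas ::
    "(('o,'m) cplx,int \<Rightarrow> 'm) harr list \<Rightarrow> nat list \<Rightarrow> (('o,'m) cplx,int \<Rightarrow> 'm) harr list" where
  "insert_deltas fs ns =
     concat (map (\<lambda>u. fs ! u # replicate (ns ! u) (delta (src (fs ! u)))) [0..<length fs - 1])
     @ [last fs]"

definition cut ::
    "('k,'o,'m) lincat \<Rightarrow> (('o,'m) cplx,int \<Rightarrow> 'm) harr list \<Rightarrow> int list \<Rightarrow>
     (('o,'m) cplx,int \<Rightarrow> 'm) harr list" where
  "cut A gs as = map (\<lambda>t.
     let h = (if t < length gs - 1 then gComp (Chb A) (gs ! t) (incl A (src (gs ! t)) (as ! t))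
              else gs ! t)
     in if 0 < t then gComp (Chb A) (proj A (src (gs ! (t - 1))) (as ! (t - 1))) h else h)
     [0..<length gs]"

definition Xi_sign :: "(('o,'m) cplx,int \<Rightarrow> 'm) harr list \<Rightarrow> nat list \<Rightarrow> int" where
  "Xi_sign fs ns = (let r = length fs - 2 in
     int ((sum_list ns + 1) choose 2) + (\<Sum>u\<in>{0..r}. int (r - u) * int (ns ! u)) +
     (\<Sum>u\<in>{0..r}. \<Sum>v\<in>{u..r}. deg (fs ! u) * int (ns ! v)))"

text \<open>Chain objects equal to \<open>None\<close> are zero and do not contribute.\<close>

definition Xi_index ::
    "(('o,'m) cplx,int \<Rightarrow> 'm) harr list \<Rightarrow> (nat list \<times> int list) set" where
  "Xi_index fs = {(ns, as). length ns = length fs - 1 \<and>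
     length as = length (insert_deltas fs ns) - 1 \<and>
     (\<forall>t<length as. as ! t \<in> supp (src (insert_deltas fs ns ! t)))}"

definition Xi ::
    "'k ring \<Rightarrow> ('k,'o,'m) lincat \<Rightarrow> ('o,'m) cplx \<Rightarrow> ('o,'m) cplx \<Rightarrow> int \<Rightarrow>
     ((('o,'m) cplx,int \<Rightarrow> 'm) harr list \<Rightarrow> 'k) set \<Rightarrow>
     ((('o,'m) cplx,int \<Rightarrow> 'm) harr list \<Rightarrow> 'k) set" where
  "Xi K A X X' n = (let M = bmod (rel_Bar_Chb K A) X X' n in
     lin_ext K M (\<lambda>fs. fin_supp_sum M (\<lambda>(ns, as). signed M (Xi_sign fs ns)
         (bar_elem K (Chb A) (emb_ob ` Obj A) X X' n (cut A (insert_deltas fs ns) as)))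
       (Xi_index fs)))"

end

theory Submission
  imports Defs "HOL-Library.Poly_Mapping"
begin

text \<open>
  The formula for \<open>\<tau>'\<close> is multilinear in the entries of a symbol, so it defines a map on the relative bar
  complex. It is closed because objects of \<open>A\<close> have zero differential and \<open>\<tau>\<close> is closed; the terms
  merging the outer entries match since \<open>\<tau>\<close> is a bimodule map.

  That \<open>\<Xi>\<close> is closed is a cancellation of formal sums of words. For the map sending \<open>h\<close> to
  \<open>\<Sum>\<^sub>a [h]\<^sup>a\<close>, merging two cut entries amounts to merging before cutting, because
  \<open>\<Sum>\<^sub>a \<sigma>\<^sup>a\<pi>\<^sup>a = id\<close>. In the word \<open>f\<^sub>0|\<delta>|\<dots>|\<delta>|f\<^sub>1|\<dots>\<close> the merges \<open>\<delta>\<delta>\<close> vanish,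
  and merging an \<open>f\<^sub>u\<close> with an adjacent \<open>\<delta>\<close> produces the terms \<open>\<delta>f\<^sub>u\<close> and \<open>f\<^sub>u\<delta>\<close> of the
  internal differential. The signs of \<open>\<Xi>\<close> satisfy a recursion on the first entry, which allows the
  identity to be proved by induction in the free abelian group on words. Words with long blocks of
  \<open>\<delta>\<close> may be ignored since they are cut to zero.
\<close>

section \<open>Modules and linear maps\<close>

text \<open>\<open>lin_ext\<close> evaluates at an arbitrarily chosen representative of a coset, so
  a formula on symbols can be computed with only after it is known to be multilinear; from then on
  linear maps are compared on symbols. The formula for \<open>tau'\<close> rests on two facts.
  Morphisms of nonzero degree between objects of \<open>A\<close> vanish, so the middle part of a
  relative symbol lives over \<open>A\<close>. And \<open>chosen_sum\<close> is strict on a single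
  summand, so the lifts restrict to \<open>F\<close> and \<open>G\<close> by equality; up to
  isomorphism, values of \<open>\<tau>\<close> and of the lifted functors could not be composed
  literally. In \<open>Xi\<close> infinitely many block lengths occur, and one cutoff must serve a
  symbol, its differentials, its merges and its images under the actions; it is therefore computed
  from a set of source complexes. The sign induction needs a type of class
  \<open>ab_group_add\<close>, while a bar module is a carrier set inside a type. In the formal
  combinations used instead, a word whose sum of cuts vanishes is itself replaced by zero, so that
  the cancellations take place there and not only after evaluation.\<close>

lemma linear_mapsI:
  assumes "\<And>x. x \<in> carrier M \<Longrightarrow> \<phi> x \<in> carrier N"
    and "\<And>x y. x \<in> carrier M \<Longrightarrow> y \<in> carrier M \<Longrightarrow> \<phi> (x \<oplus>\<^bsub>M\<^esub> y) = \<phi> x \<oplus>\<^bsub>N\<^esub> \<phi> y"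
    and "\<And>c x. c \<in> carrier K \<Longrightarrow> x \<in> carrier M \<Longrightarrow> \<phi> (c \<odot>\<^bsub>M\<^esub> x) = c \<odot>\<^bsub>N\<^esub> \<phi> x"
  shows "\<phi> \<in> linear_maps K M N"
  using assms by (auto simp: linear_maps_def)

lemma linear_mapsD:
  assumes "\<phi> \<in> linear_maps K M N"
  shows "x \<in> carrier M \<Longrightarrow> \<phi> x \<in> carrier N"
    and "x \<in> carrier M \<Longrightarrow> y \<in> carrier M \<Longrightarrow> \<phi> (x \<oplus>\<^bsub>M\<^esub> y) = \<phi> x \<oplus>\<^bsub>N\<^esub> \<phi> y"
    and "c \<in> carrier K \<Longrightarrow> x \<in> carrier M \<Longrightarrow> \<phi> (c \<odot>\<^bsub>M\<^esub> x) = c \<odot>\<^bsub>N\<^esub> \<phi> x"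
  using assms by (auto simp: linear_maps_def)

text \<open>\<open>linear_maps\<close> constrains a function on the carrier only, so a map may be
  traded for any formula that agrees with it there; the module axioms keep sums and multiples inside
  the carrier.\<close>

lemma linear_maps_cong:
  assumes "\<phi> \<in> linear_maps K M N" "module K M" "\<And>x. x \<in> carrier M \<Longrightarrow> \<psi> x = \<phi> x"
  shows "\<psi> \<in> linear_maps K M N"
proof -
  interpret M: module K M by fact
  show ?thesis using assms(1,3) by (auto simp: linear_maps_def)
qed

lemma linear_maps_comp:
  assumes "\<phi> \<in> linear_maps K M N" "\<psi> \<in> linear_maps K N P"
  shows "(\<lambda>x. \<psi> (\<phi> x)) \<in> linear_maps K M P"
  by (rule linear_mapsI) (simp_all add: linear_mapsD[OF assms(1)] linear_mapsD[OF assms(2)])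

lemma linear_maps_id: "(\<lambda>x. x) \<in> linear_maps K M M"
  by (auto simp: linear_maps_def)

lemma linear_map_zero:
  assumes "module K M" "module K N" "\<phi> \<in> linear_maps K M N"
  shows "\<phi> \<zero>\<^bsub>M\<^esub> = \<zero>\<^bsub>N\<^esub>"
proof -
  interpret M: module K M by fact
  interpret N: module K N by fact
  have "\<phi> (\<zero>\<^bsub>K\<^esub> \<odot>\<^bsub>M\<^esub> \<zero>\<^bsub>M\<^esub>) = \<zero>\<^bsub>K\<^esub> \<odot>\<^bsub>N\<^esub> \<phi> \<zero>\<^bsub>M\<^esub>"
    by (intro linear_mapsD(3)[OF assms(3)]) simp_all
  then show ?thesis using linear_mapsD(1)[OF assms(3), of "\<zero>\<^bsub>M\<^esub>"] by simp
qed

lemma linear_map_neg: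
  assumes "module K M" "module K N" "\<phi> \<in> linear_maps K M N" "x \<in> carrier M"
  shows "\<phi> (\<ominus>\<^bsub>M\<^esub> x) = \<ominus>\<^bsub>N\<^esub> \<phi> x"
proof -
  interpret M: module K M by fact
  interpret N: module K N by fact
  have "\<phi> ((\<ominus>\<^bsub>K\<^esub> \<one>\<^bsub>K\<^esub>) \<odot>\<^bsub>M\<^esub> x) = (\<ominus>\<^bsub>K\<^esub> \<one>\<^bsub>K\<^esub>) \<odot>\<^bsub>N\<^esub> \<phi> x"
    using assms(4) by (intro linear_mapsD(3)[OF assms(3)]) simp_all
  then show ?thesis
    using linear_mapsD(1)[OF assms(3,4)] assms(4) by (simp add: M.smult_l_minus N.smult_l_minus)
qed

lemma linear_map_minus:
  assumes "module K M" "module K N" "\<phi> \<in> linear_maps K M N" "x \<in> carrier M" "y \<in> carrier M"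
  shows "\<phi> (x \<ominus>\<^bsub>M\<^esub> y) = \<phi> x \<ominus>\<^bsub>N\<^esub> \<phi> y"
proof -
  interpret M: module K M by fact
  interpret N: module K N by fact
  show ?thesis
    using assms(4,5) by (simp add: a_minus_def linear_mapsD[OF assms(3)] linear_map_neg[OF assms(1-3)])
qed

text \<open>For infinite \<open>I\<close> both sums are zero by the convention of
  \<open>finsum\<close>, and linear maps preserve zero.\<close>

lemma linear_map_finsum:
  assumes "module K M" "module K N" "\<phi> \<in> linear_maps K M N" "f \<in> I \<rightarrow> carrier M"
  shows "\<phi> (finsum M f I) = finsum N (\<lambda>i. \<phi> (f i)) I"
proof -
  interpret M: module K M by fact
  interpret N: module K N by fact
  show ?thesis using assms(4)
  proof (induction I rule: infinite_finite_induct)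
    case (insert x F)
    then have "f \<in> F \<rightarrow> carrier M" "f x \<in> carrier M" by auto
    with insert show ?case
      using linear_mapsD[OF assms(3)] by (simp add: Pi_def)
  qed (simp_all add: linear_map_zero[OF assms(1-3)])
qed

lemma linear_map_signed:
  assumes "module K M" "module K N" "\<phi> \<in> linear_maps K M N" "x \<in> carrier M"
  shows "\<phi> (signed M e x) = signed N e (\<phi> x)"
  by (simp add: signed_def linear_map_neg[OF assms])

lemma signed_closed:
  assumes "module K M" "x \<in> carrier M"
  shows "signed M e x \<in> carrier M"
proof -
  interpret M: module K M by fact
  show ?thesis using assms(2) by (simp add: signed_def)
qed

lemma signed_signed:
  assumes "module K M" "x \<in> carrier M"
  shows "signed M e (signed M e' x) = signed M (e + e') x"
proof -
  interpret M: module K M by fact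
  show ?thesis using assms(2) by (simp add: signed_def)
qed

lemma signed_cong: "even (e - e') \<Longrightarrow> signed M e x = signed M e' x"
  by (auto simp: signed_def)

lemma signed_0 [simp]: "signed M 0 x = x"
  by (simp add: signed_def)

lemma signed_add:
  assumes "module K M" "x \<in> carrier M" "y \<in> carrier M"
  shows "signed M e (x \<oplus>\<^bsub>M\<^esub> y) = signed M e x \<oplus>\<^bsub>M\<^esub> signed M e y"
proof -
  interpret M: module K M by fact
  show ?thesis using assms(2,3) by (simp add: signed_def M.M.minus_add)
qed

lemma signed_zero:
  assumes "module K M"
  shows "signed M e \<zero>\<^bsub>M\<^esub> = \<zero>\<^bsub>M\<^esub>"
proof -
  interpret M: module K M by fact
  show ?thesis by (simp add: signed_def)
qed

lemma signed_linear:
  assumes "module K M"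
  shows "signed M e \<in> linear_maps K M M"
proof -
  interpret M: module K M by fact
  show ?thesis
    by (rule linear_mapsI)
       (auto simp: signed_def M.smult_r_minus M.M.minus_add)
qed

lemma signed_finsum:
  fixes K :: "'k ring"
  assumes "module K M" "f \<in> I \<rightarrow> carrier M"
  shows "signed M e (finsum M f I) = finsum M (\<lambda>i. signed M e (f i)) I"
  by (rule linear_map_finsum[OF assms(1) assms(1) signed_linear[OF assms(1)] assms(2)])

lemma linear_maps_signed:
  assumes "module K N" "\<phi> \<in> linear_maps K M N"
  shows "(\<lambda>x. signed N e (\<phi> x)) \<in> linear_maps K M N"
  by (rule linear_maps_comp[OF assms(2) signed_linear[OF assms(1)]])

lemma linear_maps_add:
  assumes "module K N" "\<phi> \<in> linear_maps K M N" "\<psi> \<in> linear_maps K M N"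
  shows "(\<lambda>x. \<phi> x \<oplus>\<^bsub>N\<^esub> \<psi> x) \<in> linear_maps K M N"
proof -
  interpret N: module K N by fact
  show ?thesis
    using linear_mapsD[OF assms(2)] linear_mapsD[OF assms(3)]
    by (intro linear_mapsI) (simp_all add: N.M.a_ac N.smult_r_distr)
qed

lemma linear_maps_minus:
  assumes "module K N" "\<phi> \<in> linear_maps K M N" "\<psi> \<in> linear_maps K M N"
  shows "(\<lambda>x. \<phi> x \<ominus>\<^bsub>N\<^esub> \<psi> x) \<in> linear_maps K M N"
  using linear_maps_add[OF assms(1,2) linear_maps_signed[OF assms(1,3), of 1]]
  by (simp add: signed_def a_minus_def)

lemma linear_maps_finsum:
  assumes "module K M" "module K N" "\<And>i. i \<in> I \<Longrightarrow> \<phi> i \<in> linear_maps K M N"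
  shows "(\<lambda>x. finsum N (\<lambda>i. \<phi> i x) I) \<in> linear_maps K M N"
proof -
  interpret M: module K M by fact
  interpret N: module K N by fact
  have cl: "\<And>i x. i \<in> I \<Longrightarrow> x \<in> carrier M \<Longrightarrow> \<phi> i x \<in> carrier N"
    using assms(3) linear_mapsD(1) by metis
  have c: "\<And>x. x \<in> carrier M \<Longrightarrow> (\<lambda>i. \<phi> i x) \<in> I \<rightarrow> carrier N"
    using cl by blast
  show ?thesis
  proof (rule linear_mapsI)
    fix x y assume x: "x \<in> carrier M" "y \<in> carrier M"
    have "finsum N (\<lambda>i. \<phi> i (x \<oplus>\<^bsub>M\<^esub> y)) I = finsum N (\<lambda>i. \<phi> i x \<oplus>\<^bsub>N\<^esub> \<phi> i y) I"
      using x assms(3) by (intro N.M.finsum_cong') (auto simp: linear_mapsD(2)[OF assms(3)] cl)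
    then show "finsum N (\<lambda>i. \<phi> i (x \<oplus>\<^bsub>M\<^esub> y)) I = finsum N (\<lambda>i. \<phi> i x) I \<oplus>\<^bsub>N\<^esub> finsum N (\<lambda>i. \<phi> i y) I"
      using c x by (simp add: N.M.finsum_addf)
  next
    fix a x assume x: "a \<in> carrier K" "x \<in> carrier M"
    have s: "(\<lambda>y. a \<odot>\<^bsub>N\<^esub> y) \<in> linear_maps K N N"
      using x(1) by (intro linear_mapsI)
        (simp_all add: N.smult_r_distr N.smult_assoc1[symmetric] M.m_comm)
    have "finsum N (\<lambda>i. \<phi> i (a \<odot>\<^bsub>M\<^esub> x)) I = finsum N (\<lambda>i. a \<odot>\<^bsub>N\<^esub> \<phi> i x) I"
      using x assms(3) by (intro N.M.finsum_cong') (auto simp: linear_mapsD(3)[OF assms(3)] cl)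
    then show "finsum N (\<lambda>i. \<phi> i (a \<odot>\<^bsub>M\<^esub> x)) I = a \<odot>\<^bsub>N\<^esub> finsum N (\<lambda>i. \<phi> i x) I"
      using linear_map_finsum[OF assms(2,2) s c] x by simp
  qed (use c in simp)
qed

section \<open>Finite sums in abelian groups\<close>

lemma (in abelian_group) minus_eq_zeroD:
  assumes "x \<in> carrier G" "y \<in> carrier G" "x \<ominus> y = \<zero>"
  shows "x = y"
  using assms by (metis a_minus_def minus_equality minus_minus a_inv_closed)

lemma (in abelian_monoid) finsum_one_nonzero:
  assumes "i \<in> A" "finite A" "f i \<in> carrier G" "\<And>j. j \<in> A \<Longrightarrow> j \<noteq> i \<Longrightarrow> f j = \<zero>"
  shows "finsum G f A = f i"
proof -
  have "finsum G f A = finsum G f {i}"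
    using assms(1-3) assms(4) by (intro add.finprod_mono_neutral_cong_right) (auto, metis zero_closed)
  then show ?thesis using assms by (simp add: Pi_def)
qed

lemma (in abelian_monoid) finsum_all_zero:
  "(\<And>i. i \<in> A \<Longrightarrow> f i = \<zero>) \<Longrightarrow> finsum G f A = \<zero>"
  by (rule add.finprod_one_eqI)

lemma (in abelian_monoid) finsum_Sigma:
  assumes "finite A" "\<And>i. i \<in> A \<Longrightarrow> finite (B i)"
    and "\<And>i j. i \<in> A \<Longrightarrow> j \<in> B i \<Longrightarrow> f (i, j) \<in> carrier G"
  shows "finsum G f (Sigma A B) = finsum G (\<lambda>i. finsum G (\<lambda>j. f (i, j)) (B i)) A"
  using assms
proof (induction A rule: finite_induct)
  case (insert x F)
  have e: "Sigma (insert x F) B = Pair x ` B x \<union> Sigma F B" by auto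
  have "finsum G f (Sigma (insert x F) B) = finsum G f (Pair x ` B x) \<oplus> finsum G f (Sigma F B)"
    unfolding e using insert by (intro finsum_Un_disjoint) (auto simp: Pi_def)
  moreover have "finsum G f (Pair x ` B x) = finsum G (\<lambda>j. f (x, j)) (B x)"
    using insert by (intro finsum_reindex) (auto simp: Pi_def inj_on_def)
  ultimately show ?case using insert by (simp add: Pi_def)
qed simp

lemma (in abelian_monoid) finsum_swap:
  assumes "finite A" "finite B" "\<And>i j. i \<in> A \<Longrightarrow> j \<in> B \<Longrightarrow> f i j \<in> carrier G"
  shows "finsum G (\<lambda>i. finsum G (f i) B) A = finsum G (\<lambda>j. finsum G (\<lambda>i. f i j) A) B"
  using assms(1,3)
proof (induction A rule: finite_induct)
  case (insert x F)
  have "finsum G (\<lambda>j. finsum G (\<lambda>i. f i j) (insert x F)) B =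
    finsum G (\<lambda>j. f x j \<oplus> finsum G (\<lambda>i. f i j) F) B"
    using insert by (intro finsum_cong') (auto simp: Pi_def)
  also have "\<dots> = finsum G (f x) B \<oplus> finsum G (\<lambda>j. finsum G (\<lambda>i. f i j) F) B"
    using insert by (intro finsum_addf) (auto simp: Pi_def)
  finally show ?case using insert by (simp add: Pi_def)
qed (simp add: assms(2))

section \<open>Free modules, quotients and their universal property\<close>

lemma free_module_module:
  assumes "cring K"
  shows "module K (free_module K S)"
proof -
  interpret K: cring K by fact
  have fin: "finite {s. x s \<oplus>\<^bsub>K\<^esub> y s \<noteq> \<zero>\<^bsub>K\<^esub>} \<and> {s. x s \<oplus>\<^bsub>K\<^esub> y s \<noteq> \<zero>\<^bsub>K\<^esub>} \<subseteq> S"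
    if "x \<in> carrier (free_module K S)" "y \<in> carrier (free_module K S)" for x y
  proof -
    have "{s. x s \<oplus>\<^bsub>K\<^esub> y s \<noteq> \<zero>\<^bsub>K\<^esub>} \<subseteq> {s. x s \<noteq> \<zero>\<^bsub>K\<^esub>} \<union> {s. y s \<noteq> \<zero>\<^bsub>K\<^esub>}" by auto
    with that show ?thesis
      by (auto simp: free_module_def intro: finite_subset)
  qed
  have fins: "finite {s. c \<otimes>\<^bsub>K\<^esub> x s \<noteq> \<zero>\<^bsub>K\<^esub>} \<and> {s. c \<otimes>\<^bsub>K\<^esub> x s \<noteq> \<zero>\<^bsub>K\<^esub>} \<subseteq> S"
    if "x \<in> carrier (free_module K S)" "c \<in> carrier K" for c x
  proof -
    have "{s. c \<otimes>\<^bsub>K\<^esub> x s \<noteq> \<zero>\<^bsub>K\<^esub>} \<subseteq> {s. x s \<noteq> \<zero>\<^bsub>K\<^esub>}" using that by auto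
    with that show ?thesis
      by (auto simp: free_module_def intro: finite_subset)
  qed
  have val: "x s \<in> carrier K" if "x \<in> carrier (free_module K S)" for x s
    using that by (auto simp: free_module_def)
  have ops: "\<zero>\<^bsub>free_module K S\<^esub> = (\<lambda>s. \<zero>\<^bsub>K\<^esub>)" "x \<oplus>\<^bsub>free_module K S\<^esub> y = (\<lambda>s. x s \<oplus>\<^bsub>K\<^esub> y s)"
    "c \<odot>\<^bsub>free_module K S\<^esub> x = (\<lambda>s. c \<otimes>\<^bsub>K\<^esub> x s)" for c x y
    by (simp_all add: free_module_def)
  have cI: "x \<in> carrier (free_module K S)"
    if "\<And>s. x s \<in> carrier K" "finite {s. x s \<noteq> \<zero>\<^bsub>K\<^esub>} \<and> {s. x s \<noteq> \<zero>\<^bsub>K\<^esub>} \<subseteq> S" for x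
    using that by (auto simp: free_module_def)
  show ?thesis
  proof (rule moduleI)
    show "abelian_group (free_module K S)"
    proof (rule abelian_groupI, goal_cases)
      case (6 x)
      \<comment> \<open>The inverse is written as a multiple by minus one, because
        \<open>fins\<close> already controls the support of multiples.\<close>
      have "(\<lambda>s. (\<ominus>\<^bsub>K\<^esub> \<one>\<^bsub>K\<^esub>) \<otimes>\<^bsub>K\<^esub> x s) \<in> carrier (free_module K S)"
        using 6 fins[OF 6] by (intro cI) (auto simp: val)
      then show ?case
        by (rule bexI[rotated]) (use 6 in \<open>auto simp: ops val fun_eq_iff K.l_minus K.l_neg\<close>)
    qed (use fin in \<open>auto simp: ops val fun_eq_iff K.a_ac intro!: cI\<close>)
  qed (use fins assms in \<open>auto simp: ops val fun_eq_iff K.m_assoc K.l_distr K.r_distr intro!: cI\<close>)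
qed

lemma generator_closed: "cring K \<Longrightarrow> s \<in> S \<Longrightarrow> generator K s \<in> carrier (free_module K S)"
proof -
  assume "cring K" "s \<in> S"
  then interpret K: cring K by simp
  have "{t. generator K s t \<noteq> \<zero>\<^bsub>K\<^esub>} \<subseteq> {s}" by (auto simp: generator_def)
  then have "finite {t. generator K s t \<noteq> \<zero>\<^bsub>K\<^esub>} \<and> {t. generator K s t \<noteq> \<zero>\<^bsub>K\<^esub>} \<subseteq> S"
    using \<open>s \<in> S\<close> by (meson dual_order.trans empty_subsetI finite.emptyI finite.insertI finite_subset insert_subset)
  then show ?thesis
    by (auto simp: free_module_def) (auto simp: generator_def)
qed

text \<open>The value of \<open>lin_ext\<close> once a representative is given. It separates linear
  algebra on the free module from the choice of representative.\<close>

definition free_ext :: "'k ring \<Rightarrow> ('k,'y) module \<Rightarrow> ('s \<Rightarrow> 'y) \<Rightarrow> ('s \<Rightarrow> 'k) \<Rightarrow> 'y" where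
  "free_ext K N \<phi> x = finsum N (\<lambda>s. x s \<odot>\<^bsub>N\<^esub> \<phi> s) {s. x s \<noteq> \<zero>\<^bsub>K\<^esub>}"

text \<open>Summing over a larger finite set lets the supports of two elements and of their sum be
  replaced by one common index set.\<close>

lemma free_ext_superset:
  assumes "module K N" "\<And>s. s \<in> S \<Longrightarrow> \<phi> s \<in> carrier N" "x \<in> carrier (free_module K S)"
    "finite T" "{s. x s \<noteq> \<zero>\<^bsub>K\<^esub>} \<subseteq> T" "T \<subseteq> S"
  shows "free_ext K N \<phi> x = finsum N (\<lambda>s. x s \<odot>\<^bsub>N\<^esub> \<phi> s) T"
proof -
  interpret N: module K N by fact
  have "x s \<in> carrier K" for s using assms(3) by (auto simp: free_module_def)
  then show ?thesis unfolding free_ext_def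
    using assms by (intro N.M.add.finprod_mono_neutral_cong_left) (auto simp: subset_iff)
qed

lemma free_ext_linear:
  assumes "module K N" "\<And>s. s \<in> S \<Longrightarrow> \<phi> s \<in> carrier N"
  shows "free_ext K N \<phi> \<in> linear_maps K (free_module K S) N"
proof -
  interpret N: module K N by fact
  interpret F: module K "free_module K S" by (rule free_module_module) (rule N.is_cring)
  have xc: "x s \<in> carrier K" if "x \<in> carrier (free_module K S)" for x s
    using that by (auto simp: free_module_def)
  have fin: "finite {s. x s \<noteq> \<zero>\<^bsub>K\<^esub>}" "{s. x s \<noteq> \<zero>\<^bsub>K\<^esub>} \<subseteq> S" if "x \<in> carrier (free_module K S)" for x
    using that by (auto simp: free_module_def)
  show ?thesis
  proof (rule linear_mapsI)
    fix x assume x: "x \<in> carrier (free_module K S)"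
    show "free_ext K N \<phi> x \<in> carrier N" unfolding free_ext_def
      using fin(2)[OF x] by (intro N.M.finsum_closed) (auto simp: xc[OF x] assms(2))
  next
    fix x y assume x: "x \<in> carrier (free_module K S)" and y: "y \<in> carrier (free_module K S)"
    let ?T = "{s. x s \<noteq> \<zero>\<^bsub>K\<^esub>} \<union> {s. y s \<noteq> \<zero>\<^bsub>K\<^esub>}"
    have T: "finite ?T" "?T \<subseteq> S" using fin x y by auto
    have xy: "(x \<oplus>\<^bsub>free_module K S\<^esub> y) s = x s \<oplus>\<^bsub>K\<^esub> y s" for s by (simp add: free_module_def)
    have pc: "\<And>s. s \<in> ?T \<Longrightarrow> \<phi> s \<in> carrier N" using T assms(2) by blast
    have "free_ext K N \<phi> (x \<oplus>\<^bsub>free_module K S\<^esub> y) = finsum N (\<lambda>s. (x \<oplus>\<^bsub>free_module K S\<^esub> y) s \<odot>\<^bsub>N\<^esub> \<phi> s) ?T"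
      using x y T by (intro free_ext_superset[OF assms]) (auto simp: xy)
    also have "\<dots> = finsum N (\<lambda>s. x s \<odot>\<^bsub>N\<^esub> \<phi> s \<oplus>\<^bsub>N\<^esub> y s \<odot>\<^bsub>N\<^esub> \<phi> s) ?T"
      using pc by (intro N.M.finsum_cong') (auto simp: xy xc[OF x] xc[OF y] N.smult_l_distr)
    also have "\<dots> = finsum N (\<lambda>s. x s \<odot>\<^bsub>N\<^esub> \<phi> s) ?T \<oplus>\<^bsub>N\<^esub> finsum N (\<lambda>s. y s \<odot>\<^bsub>N\<^esub> \<phi> s) ?T"
      using pc by (intro N.M.finsum_addf) (auto simp: xc[OF x] xc[OF y])
    also have "\<dots> = free_ext K N \<phi> x \<oplus>\<^bsub>N\<^esub> free_ext K N \<phi> y"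
      using free_ext_superset[OF assms x T(1) _ T(2)] free_ext_superset[OF assms y T(1) _ T(2)] by auto
    finally show "free_ext K N \<phi> (x \<oplus>\<^bsub>free_module K S\<^esub> y) = free_ext K N \<phi> x \<oplus>\<^bsub>N\<^esub> free_ext K N \<phi> y" .
  next
    fix c x assume c: "c \<in> carrier K" and x: "x \<in> carrier (free_module K S)"
    let ?T = "{s. x s \<noteq> \<zero>\<^bsub>K\<^esub>}"
    have T: "finite ?T" "?T \<subseteq> S" using fin x by auto
    have cx: "(c \<odot>\<^bsub>free_module K S\<^esub> x) s = c \<otimes>\<^bsub>K\<^esub> x s" for s by (simp add: free_module_def)
    have pc: "\<And>s. s \<in> ?T \<Longrightarrow> \<phi> s \<in> carrier N" using T assms(2) by blast
    have "free_ext K N \<phi> (c \<odot>\<^bsub>free_module K S\<^esub> x) = finsum N (\<lambda>s. (c \<odot>\<^bsub>free_module K S\<^esub> x) s \<odot>\<^bsub>N\<^esub> \<phi> s) ?T"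
      using x c T by (intro free_ext_superset[OF assms]) (auto simp: cx)
    also have "\<dots> = finsum N (\<lambda>s. c \<odot>\<^bsub>N\<^esub> (x s \<odot>\<^bsub>N\<^esub> \<phi> s)) ?T"
      using pc c by (intro N.M.finsum_cong') (auto simp: cx xc[OF x] N.smult_assoc1)
    also have "\<dots> = c \<odot>\<^bsub>N\<^esub> free_ext K N \<phi> x"
      unfolding free_ext_def using pc c T by (intro N.finsum_smult_ldistr[symmetric]) (auto simp: xc[OF x])
    finally show "free_ext K N \<phi> (c \<odot>\<^bsub>free_module K S\<^esub> x) = c \<odot>\<^bsub>N\<^esub> free_ext K N \<phi> x" .
  qed
qed

lemma free_ext_generator:
  assumes "module K N" "\<And>s. s \<in> S \<Longrightarrow> \<phi> s \<in> carrier N" "s \<in> S"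
  shows "free_ext K N \<phi> (generator K s) = \<phi> s"
proof -
  interpret N: module K N by fact
  have "free_ext K N \<phi> (generator K s) = finsum N (\<lambda>t. generator K s t \<odot>\<^bsub>N\<^esub> \<phi> t) {s}"
    using assms by (intro free_ext_superset[where S=S] generator_closed) (auto simp: generator_def N.is_cring)
  also have "\<dots> = \<phi> s" using assms(2,3) by (simp add: generator_def Pi_def)
  finally show ?thesis .
qed

text \<open>Induction on the support, splitting off one multiple of a generator at a time.\<close>

lemma free_module_maps_eq:
  assumes "module K N" "\<phi> \<in> linear_maps K (free_module K S) N" "\<psi> \<in> linear_maps K (free_module K S) N"
    and "\<And>s. s \<in> S \<Longrightarrow> \<phi> (generator K s) = \<psi> (generator K s)" "x \<in> carrier (free_module K S)"
  shows "\<phi> x = \<psi> x"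
proof -
  interpret N: module K N by fact
  interpret F: module K "free_module K S" by (rule free_module_module) (rule N.is_cring)
  have "finite {s. x s \<noteq> \<zero>\<^bsub>K\<^esub>}" using assms(5) by (auto simp: free_module_def)
  moreover have "finite T \<Longrightarrow> \<forall>x\<in>carrier (free_module K S). {s. x s \<noteq> \<zero>\<^bsub>K\<^esub>} = T \<longrightarrow> \<phi> x = \<psi> x" for T
  proof (induction T rule: finite_induct)
    case empty
    have "x = \<zero>\<^bsub>free_module K S\<^esub>" if "{s. x s \<noteq> \<zero>\<^bsub>K\<^esub>} = {}" for x
      using that by (auto simp: free_module_def fun_eq_iff)
    then show ?case
      using linear_map_zero[OF F.module_axioms assms(1,2)] linear_map_zero[OF F.module_axioms assms(1,3)] by metis
  next
    case (insert t T)
    show ?case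
    proof (intro ballI impI)
      fix x assume x: "x \<in> carrier (free_module K S)" "{s. x s \<noteq> \<zero>\<^bsub>K\<^esub>} = insert t T"
      have xc: "\<And>s. x s \<in> carrier K" and tS: "t \<in> S" using x by (auto simp: free_module_def)
      define y where "y = (\<lambda>s. if s = t then \<zero>\<^bsub>K\<^esub> else x s)"
      have yT: "{s. y s \<noteq> \<zero>\<^bsub>K\<^esub>} = T" using x(2) insert(2) by (auto simp: y_def)
      have y: "y \<in> carrier (free_module K S)"
        using x insert(1) yT xc by (auto simp: free_module_def) (auto simp: y_def)
      have g: "generator K t \<in> carrier (free_module K S)" using tS N.is_cring by (simp add: generator_closed)
      have xe: "x = y \<oplus>\<^bsub>free_module K S\<^esub> (x t \<odot>\<^bsub>free_module K S\<^esub> generator K t)"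
        using xc by (auto simp: free_module_def y_def generator_def fun_eq_iff)
      have "\<phi> y = \<psi> y" using insert.IH y yT by blast
      then show "\<phi> x = \<psi> x"
        using y g xc[of t] assms(4)[OF tS]
        by (subst (1 2) xe) (simp add: linear_mapsD[OF assms(2)] linear_mapsD[OF assms(3)])
    qed
  qed
  ultimately show ?thesis using assms(5) by blast
qed

section \<open>Spans of relations and quotient modules\<close>

lemma span_submodule:
  assumes "module K M" "R \<subseteq> carrier M"
  shows "submodule (span K M R) K M" "R \<subseteq> span K M R"
proof -
  interpret M: module K M by fact
  show "R \<subseteq> span K M R" by (auto simp: span_def)
  \<comment> \<open>The carrier is thus one of the submodules intersected in \<open>span\<close>,
    which confines the span to it.\<close>
  have c: "submodule (carrier M) K M" by (rule M.carrier_is_submodule)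
  note E = M.submoduleE
  have z: "\<zero>\<^bsub>M\<^esub> \<in> N" if "submodule N K M" for N
    using submodule.axioms(1)[OF that] by (auto dest: subgroup.one_closed)
  show "submodule (span K M R) K M"
    by (rule M.submoduleI) (use c assms(2) E z in \<open>auto simp: span_def\<close>)
qed

text \<open>The kernel is one of the submodules whose intersection is the span.\<close>

lemma span_kernel:
  assumes "module K M" "module K N" "\<phi> \<in> linear_maps K M N" "R \<subseteq> carrier M"
    "\<And>r. r \<in> R \<Longrightarrow> \<phi> r = \<zero>\<^bsub>N\<^esub>" "x \<in> span K M R"
  shows "\<phi> x = \<zero>\<^bsub>N\<^esub>"
proof -
  interpret M: module K M by fact
  interpret N: module K N by fact
  have "submodule {x \<in> carrier M. \<phi> x = \<zero>\<^bsub>N\<^esub>} K M"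
    by (rule M.submoduleI)
       (auto simp: linear_mapsD[OF assms(3)] linear_map_zero[OF assms(1-3)] linear_map_neg[OF assms(1-3)])
  then have "span K M R \<subseteq> {x \<in> carrier M. \<phi> x = \<zero>\<^bsub>N\<^esub>}"
    using assms(4,5) by (auto simp: span_def)
  then show ?thesis using assms(6) by blast
qed

locale quotient = M: module K M for K :: "'k ring" and M :: "('k,'x) module" +
  fixes N assumes sub: "submodule N K M"
begin

sublocale N: abelian_subgroup N M
  by (rule abelian_subgroupI3)
     (auto intro: additive_subgroup.intro submodule.axioms(1)[OF sub] M.M.abelian_group_axioms)

abbreviation Q where "Q \<equiv> quotient_module M N"
abbreviation cl where "cl \<equiv> \<lambda>x. N +>\<^bsub>M\<^esub> x"

lemma Q_carrier: "U \<in> carrier Q \<longleftrightarrow> (\<exists>x\<in>carrier M. U = cl x)"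
  by (auto simp: quotient_module_def A_RCOSETS_def')

lemma Q_cases:
  assumes "U \<in> carrier Q" obtains x where "x \<in> carrier M" "U = cl x"
  using assms by (auto simp: Q_carrier)

lemma cl_closed: "x \<in> carrier M \<Longrightarrow> cl x \<in> carrier Q"
  by (auto simp: Q_carrier)

lemma cl_add: "x \<in> carrier M \<Longrightarrow> y \<in> carrier M \<Longrightarrow> cl x \<oplus>\<^bsub>Q\<^esub> cl y = cl (x \<oplus>\<^bsub>M\<^esub> y)"
  by (simp add: quotient_module_def N.a_rcos_sum)

lemma cl_eq_iff: "x \<in> carrier M \<Longrightarrow> y \<in> carrier M \<Longrightarrow> cl x = cl y \<longleftrightarrow> x \<ominus>\<^bsub>M\<^esub> y \<in> N"
  by (metis N.a_rcos_module N.a_repr_independence' N.a_rcos_self a_minus_def)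

text \<open>Scalar multiplication on the quotient is a union over all representatives; they all give
  the same coset, so the union is that coset.\<close>

lemma cl_smult: "c \<in> carrier K \<Longrightarrow> x \<in> carrier M \<Longrightarrow> c \<odot>\<^bsub>Q\<^esub> cl x = cl (c \<odot>\<^bsub>M\<^esub> x)"
proof -
  assume a: "c \<in> carrier K" "x \<in> carrier M"
  have sm: "submodule N K M" by (rule sub)
  have "cl (c \<odot>\<^bsub>M\<^esub> y) = cl (c \<odot>\<^bsub>M\<^esub> x)" if "y \<in> cl x" for y
  proof -
    have y: "y \<in> carrier M" using that a N.a_elemrcos_carrier by blast
    have "y \<ominus>\<^bsub>M\<^esub> x \<in> N" using that N.a_rcos_module_imp[of x y] a by (simp add: a_minus_def)
    then have "c \<odot>\<^bsub>M\<^esub> (y \<ominus>\<^bsub>M\<^esub> x) \<in> N" using submodule.smult_closed[OF sm] a by blast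
    moreover have "c \<odot>\<^bsub>M\<^esub> (y \<ominus>\<^bsub>M\<^esub> x) = c \<odot>\<^bsub>M\<^esub> y \<ominus>\<^bsub>M\<^esub> c \<odot>\<^bsub>M\<^esub> x"
      using a y by (simp add: a_minus_def M.smult_r_distr M.smult_r_minus)
    ultimately show ?thesis using a y by (subst cl_eq_iff) auto
  qed
  moreover have "cl x \<noteq> {}" using N.a_rcos_self[OF a(2)] by blast
  ultimately show ?thesis by (simp add: quotient_module_def)
qed

lemma Q_module: "module K Q"
proof -
  have z: "\<zero>\<^bsub>Q\<^esub> = cl \<zero>\<^bsub>M\<^esub>"
    by (simp add: quotient_module_def M.a_coset_add_zero N.a_subset)
  have zc: "\<zero>\<^bsub>Q\<^esub> \<in> carrier Q" using z cl_closed by simp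
  show ?thesis
  proof (rule moduleI)
    show "abelian_group Q"
    proof (rule abelian_groupI, goal_cases)
      case (6 x)
      then obtain a where a: "a \<in> carrier M" "x = cl a" by (auto simp: Q_carrier)
      show ?case by (rule bexI[of _ "cl (\<ominus>\<^bsub>M\<^esub> a)"]) (use a in \<open>auto simp: cl_add cl_closed z M.M.l_neg\<close>)
    qed (use zc in \<open>auto elim!: Q_cases simp: cl_add cl_closed z M.M.a_ac\<close>)
  qed (use M.is_cring in \<open>auto elim!: Q_cases simp: cl_add cl_smult cl_closed M.smult_l_distr M.smult_r_distr
      M.smult_assoc1\<close>)
qed

lemma cl_linear: "cl \<in> linear_maps K M Q"
  by (rule linear_mapsI) (auto simp: cl_closed cl_add cl_smult)

end

section \<open>Bar modules over a dg category\<close>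

text \<open>Both \<open>Chb A\<close> and \<open>dg_of A\<close> are instances, so bar modules are
  treated once for the two. \<open>arr_data\<close> ties the Hom modules to the source, target and
  degree stored in a morphism and thereby makes them disjoint.\<close>

locale dg_category =
  fixes K :: "'k ring" and C :: "('k,'o,'v) dgcat"
  assumes cring_K: "cring K"
    and module_gHom: "\<lbrakk>X \<in> dgOb C; Y \<in> dgOb C\<rbrakk> \<Longrightarrow> module K (gHom C X Y k)"
    and arr_data: "f \<in> carrier (gHom C X Y k) \<Longrightarrow> src f = X \<and> tgt f = Y \<and> deg f = k"
    and gComp_linear_left: "\<lbrakk>X \<in> dgOb C; Y \<in> dgOb C; Z \<in> dgOb C; f \<in> carrier (gHom C X Y k)\<rbrakk> \<Longrightarrow>
      (\<lambda>g. gComp C g f) \<in> linear_maps K (gHom C Y Z l) (gHom C X Z (l + k))"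
    and gComp_linear_right: "\<lbrakk>X \<in> dgOb C; Y \<in> dgOb C; Z \<in> dgOb C; g \<in> carrier (gHom C Y Z l)\<rbrakk> \<Longrightarrow>
      (\<lambda>f. gComp C g f) \<in> linear_maps K (gHom C X Y k) (gHom C X Z (l + k))"
    and gComp_assoc: "\<lbrakk>W \<in> dgOb C; X \<in> dgOb C; Y \<in> dgOb C; Z \<in> dgOb C; f \<in> carrier (gHom C W X k);
        g \<in> carrier (gHom C X Y l); h \<in> carrier (gHom C Y Z m)\<rbrakk> \<Longrightarrow>
      gComp C (gComp C h g) f = gComp C h (gComp C g f)"
    and idt_closed: "X \<in> dgOb C \<Longrightarrow> idt C X \<in> carrier (gHom C X X 0)"
    and gComp_idt_left: "\<lbrakk>X \<in> dgOb C; Y \<in> dgOb C; f \<in> carrier (gHom C X Y k)\<rbrakk> \<Longrightarrow>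
      gComp C (idt C Y) f = f"
    and gComp_idt_right: "\<lbrakk>X \<in> dgOb C; Y \<in> dgOb C; f \<in> carrier (gHom C X Y k)\<rbrakk> \<Longrightarrow>
      gComp C f (idt C X) = f"
    and dif_linear: "\<lbrakk>X \<in> dgOb C; Y \<in> dgOb C\<rbrakk> \<Longrightarrow>
      dif C \<in> linear_maps K (gHom C X Y k) (gHom C X Y (k + 1))"
    and dif_gComp: "\<lbrakk>X \<in> dgOb C; Y \<in> dgOb C; Z \<in> dgOb C; f \<in> carrier (gHom C X Y k);
        g \<in> carrier (gHom C Y Z l)\<rbrakk> \<Longrightarrow>
      dif C (gComp C g f) = gComp C (dif C g) f \<oplus>\<^bsub>gHom C X Z (l + k + 1)\<^esub>
        signed (gHom C X Z (l + k + 1)) l (gComp C g (dif C f))"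
    and dif_idt: "X \<in> dgOb C \<Longrightarrow> dif C (idt C X) = \<zero>\<^bsub>gHom C X X 1\<^esub>"
begin

definition arr :: "('o,'v) harr \<Rightarrow> bool" where
  "arr f \<longleftrightarrow> src f \<in> dgOb C \<and> tgt f \<in> dgOb C \<and> f \<in> carrier (gHom C (src f) (tgt f) (deg f))"

lemma arrI: "X \<in> dgOb C \<Longrightarrow> Y \<in> dgOb C \<Longrightarrow> f \<in> carrier (gHom C X Y k) \<Longrightarrow> arr f"
  using arr_data[of f X Y k] by (simp add: arr_def)

lemma gComp_closed:
  "\<lbrakk>X \<in> dgOb C; Y \<in> dgOb C; Z \<in> dgOb C; f \<in> carrier (gHom C X Y k); g \<in> carrier (gHom C Y Z l)\<rbrakk>
    \<Longrightarrow> gComp C g f \<in> carrier (gHom C X Z (l + k))"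
  using linear_mapsD(1)[OF gComp_linear_left] by blast

lemma arr_gComp:
  assumes "arr f" "arr g" "src g = tgt f"
  shows "arr (gComp C g f)" "src (gComp C g f) = src f" "tgt (gComp C g f) = tgt g"
    "deg (gComp C g f) = deg g + deg f"
proof -
  have "gComp C g f \<in> carrier (gHom C (src f) (tgt g) (deg g + deg f))"
    using assms by (intro gComp_closed[of _ "tgt f"]) (auto simp: arr_def)
  moreover note arr_data[OF this]
  ultimately show "arr (gComp C g f)" "src (gComp C g f) = src f" "tgt (gComp C g f) = tgt g"
    "deg (gComp C g f) = deg g + deg f"
    using assms by (auto simp: arr_def)
qed

lemma arr_assoc:
  assumes "arr f" "arr g" "arr h" "src g = tgt f" "src h = tgt g"
  shows "gComp C (gComp C h g) f = gComp C h (gComp C g f)"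
  using assms by (intro gComp_assoc[of "src f" "tgt f" "tgt g" "tgt h"]) (auto simp: arr_def)

lemma arr_dif:
  assumes "arr f"
  shows "arr (dif C f)" "src (dif C f) = src f" "tgt (dif C f) = tgt f" "deg (dif C f) = deg f + 1"
proof -
  have "dif C f \<in> carrier (gHom C (src f) (tgt f) (deg f + 1))"
    using assms linear_mapsD(1)[OF dif_linear] by (auto simp: arr_def)
  moreover note arr_data[OF this]
  ultimately show "arr (dif C f)" "src (dif C f) = src f" "tgt (dif C f) = tgt f" "deg (dif C f) = deg f + 1"
    using assms by (auto simp: arr_def)
qed

lemma arr_idt: "X \<in> dgOb C \<Longrightarrow> arr (idt C X)" "X \<in> dgOb C \<Longrightarrow> src (idt C X) = X"
  "X \<in> dgOb C \<Longrightarrow> tgt (idt C X) = X" "X \<in> dgOb C \<Longrightarrow> deg (idt C X) = 0"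
  using idt_closed[of X] arr_data[of "idt C X" X X 0] by (auto simp: arr_def)

definition merge :: "nat \<Rightarrow> ('o,'v) harr list \<Rightarrow> ('o,'v) harr list" where
  "merge i fs = take i fs @ [gComp C (fs ! i) (fs ! (i + 1))] @ drop (i + 2) fs"

lemma merge_append: "length us = i \<Longrightarrow> merge i (us @ f # g # vs) = us @ gComp C f g # vs"
  by (simp add: merge_def nth_append)

lemma merge_append1: "i + 1 < length us \<Longrightarrow> merge i (us @ vs) = merge i us @ vs"
  by (simp add: merge_def nth_append)

lemma merge_append2: "merge (length us + i) (us @ vs) = us @ merge i vs"
  by (simp add: merge_def nth_append)

lemma merge_0: "merge 0 (f # g # fs) = gComp C f g # fs"
  by (simp add: merge_def)

lemma merge_Suc: "merge (Suc i) (f # fs) = f # merge i fs"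
  by (simp add: merge_def)

lemma split_pair:
  assumes "i + 1 < length fs"
  obtains us f g vs where "fs = us @ f # g # vs" "length us = i"
proof -
  have 1: "fs = take i fs @ fs ! i # drop (Suc i) fs"
    using assms by (intro id_take_nth_drop) simp
  have 2: "drop (Suc i) fs = fs ! (i + 1) # drop (i + 2) fs"
    using assms by (simp add: Cons_nth_drop_Suc[symmetric])
  have "length (take i fs) = i" using assms by simp
  with 1 show ?thesis using that[of "take i fs" "fs ! i"] unfolding 2 by blast
qed

end

text \<open>The signs put on a symbol are functions of this data, which stays the same when an entry
  is exchanged within its Hom module; hence signs do not disturb multilinearity.\<close>

definition shape :: "('o,'v) harr list \<Rightarrow> ('o \<times> 'o \<times> int) list" where
  "shape fs = map (\<lambda>f. (src f, tgt f, deg f)) fs"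

lemma shape_length: "shape fs = shape gs \<Longrightarrow> length fs = length gs"
  by (drule arg_cong[of _ _ length]) (simp add: shape_def)

lemma shape_nth:
  assumes "shape fs = shape gs" "i < length fs"
  shows "src (fs ! i) = src (gs ! i)" "tgt (fs ! i) = tgt (gs ! i)" "deg (fs ! i) = deg (gs ! i)"
proof -
  have "shape fs ! i = shape gs ! i" using assms by simp
  then show "src (fs ! i) = src (gs ! i)" "tgt (fs ! i) = tgt (gs ! i)" "deg (fs ! i) = deg (gs ! i)"
    using assms shape_length[OF assms(1)] by (simp_all add: shape_def)
qed

text \<open>\<open>S\<close> is the set of admissible intermediate objects: all objects for the bar
  complex, those coming from \<open>A\<close> for the relative one.\<close>

locale rel_bar = dg_category K C for K :: "'k ring" and C :: "('k,'o,'v) dgcat" +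
  fixes S :: "'o set"
  assumes S_sub: "S \<subseteq> dgOb C"
begin

abbreviation "Sym \<equiv> bar_symbols C S"
abbreviation "BM \<equiv> bar_module K C S"
abbreviation "el \<equiv> bar_elem K C S"

text \<open>The index condition on neighbours becomes \<open>successively\<close>, which splits
  along append and cons.\<close>

lemma Sym_iff:
  "fs \<in> Sym X X' n \<longleftrightarrow> 2 \<le> length fs \<and> (\<forall>f\<in>set fs. arr f) \<and>
     successively (\<lambda>f g. src f = tgt g \<and> src f \<in> S) fs \<and> tgt (hd fs) = X \<and> src (last fs) = X' \<and>
     (\<Sum>f\<leftarrow>fs. deg f) - (int (length fs) - 2) = n"
  by (auto simp: bar_symbols_def successively_conv_nth arr_def)

lemma shape_replace:
  "f \<in> carrier (gHom C Y Z k) \<Longrightarrow> g \<in> carrier (gHom C Y Z k) \<Longrightarrow>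
    shape (us @ f # vs) = shape (us @ g # vs)"
  using arr_data[of f Y Z k] arr_data[of g Y Z k] by (simp add: shape_def)

lemma Sym_slot_obj:
  assumes "us @ f # vs \<in> Sym X X' n" "f \<in> carrier (gHom C Y Z k)"
  shows "Y \<in> dgOb C" "Z \<in> dgOb C" "module K (gHom C Y Z k)"
proof -
  have "arr f" using assms(1) by (simp add: Sym_iff)
  then show "Y \<in> dgOb C" "Z \<in> dgOb C" using arr_data[OF assms(2)] by (auto simp: arr_def)
  then show "module K (gHom C Y Z k)" by (rule module_gHom)
qed

text \<open>The shift \<open>d\<close> is 0 when an entry is exchanged within its Hom module and 1
  when the differential is applied to it.\<close>

lemma Sym_cong:
  assumes "us @ f # vs \<in> Sym X X' n" "arr g" "src g = src f" "tgt g = tgt f" "deg g = deg f + d" "n' = n + d"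
  shows "us @ g # vs \<in> Sym X X' n'"
proof -
  have 1: "tgt (hd (us @ g # vs)) = tgt (hd (us @ f # vs))" using assms(4) by (cases us) simp_all
  have 2: "src (last (us @ g # vs)) = src (last (us @ f # vs))" using assms(3) by (cases vs) simp_all
  have 3: "successively (\<lambda>f g. src f = tgt g \<and> src f \<in> S) (us @ g # vs) =
    successively (\<lambda>f g. src f = tgt g \<and> src f \<in> S) (us @ f # vs)"
    using assms(3,4) by (cases vs) (simp_all add: successively_append_iff successively_Cons)
  note b = assms(1)[unfolded Sym_iff]
  note b2 = b[THEN conjunct2] note b3 = b2[THEN conjunct2] note b4 = b3[THEN conjunct2]
  note b5 = b4[THEN conjunct2]
  have 4: "\<forall>f\<in>set (us @ g # vs). arr f" using b2[THEN conjunct1] assms(2) by simp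
  have 5: "2 \<le> length (us @ g # vs)" using b[THEN conjunct1] by simp
  have 6: "(\<Sum>f\<leftarrow>us @ g # vs. deg f) - (int (length (us @ g # vs)) - 2) = n'"
    using assms(5,6) b5[THEN conjunct2] by simp
  show ?thesis unfolding Sym_iff
    by (intro conjI 4 5 6 iffD2[OF 3 b3[THEN conjunct1]] trans[OF 1 b4[THEN conjunct1]]
        trans[OF 2 b5[THEN conjunct1]])
qed

lemma Sym_replace:
  assumes "us @ f # vs \<in> Sym X X' n" "f \<in> carrier (gHom C Y Z k)" "g \<in> carrier (gHom C Y Z k)"
  shows "us @ g # vs \<in> Sym X X' n"
proof -
  have "arr g" by (rule arrI[OF Sym_slot_obj(1,2)[OF assms(1,2)] assms(3)])
  then show ?thesis
    by (rule Sym_cong[OF assms(1), of _ 0]) (use arr_data[OF assms(2)] arr_data[OF assms(3)] in simp_all)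
qed

text \<open>Some entry must remain besides the merged pair, since a symbol has at least two entries.
  The degree rises by one because the shift by \<open>r\<close> drops by one.\<close>

lemma Sym_merge:
  assumes "us @ f # g # vs \<in> Sym X X' n" "us \<noteq> [] \<or> vs \<noteq> []"
  shows "us @ gComp C f g # vs \<in> Sym X X' (n + 1)"
proof -
  have fg: "arr f" "arr g" "src f = tgt g"
    using assms(1) by (simp_all add: Sym_iff successively_append_iff)
  note c = arr_gComp[OF fg(2,1,3)]
  have 1: "tgt (hd (us @ gComp C f g # vs)) = tgt (hd (us @ f # g # vs))" using c by (cases us) simp_all
  have 2: "src (last (us @ gComp C f g # vs)) = src (last (us @ f # g # vs))" using c by (cases vs) simp_all
  have 3: "successively (\<lambda>f g. src f = tgt g \<and> src f \<in> S) (us @ f # g # vs) \<Longrightarrow>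
    successively (\<lambda>f g. src f = tgt g \<and> src f \<in> S) (us @ gComp C f g # vs)"
    using c by (cases vs) (auto simp: successively_append_iff successively_Cons)
  have 4: "2 \<le> length (us @ gComp C f g # vs)" using assms(2) by (cases us; cases vs) simp_all
  note b = assms(1)[unfolded Sym_iff]
  note b2 = b[THEN conjunct2] note b3 = b2[THEN conjunct2] note b4 = b3[THEN conjunct2]
  note b5 = b4[THEN conjunct2]
  have 5: "\<forall>f\<in>set (us @ gComp C f g # vs). arr f" using b2[THEN conjunct1] c(1) by simp
  have 6: "(\<Sum>f\<leftarrow>us @ gComp C f g # vs. deg f) - (int (length (us @ gComp C f g # vs)) - 2) = n + 1"
    using b5[THEN conjunct2] c(4) by simp
  show ?thesis unfolding Sym_iff
    by (intro conjI 4 5 6 3[OF b3[THEN conjunct1]] trans[OF 1 b4[THEN conjunct1]]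
        trans[OF 2 b5[THEN conjunct1]])
qed

lemma Sym_merge':
  assumes "fs \<in> Sym X X' n" "i + 1 < length fs" "2 < length fs"
  shows "merge i fs \<in> Sym X X' (n + 1)"
proof -
  obtain us f g vs where e: "fs = us @ f # g # vs" "length us = i"
    using split_pair[OF assms(2)] .
  then have "us \<noteq> [] \<or> vs \<noteq> []" using assms(3) by auto
  then show ?thesis using Sym_merge[of us f g vs] assms(1) e by (simp add: merge_append)
qed

lemma Sym_dif:
  assumes "fs \<in> Sym X X' n" "i < length fs"
  shows "fs[i := dif C (fs ! i)] \<in> Sym X X' (n + 1)"
proof -
  have "arr (fs ! i)" using assms by (simp add: Sym_iff)
  note d = arr_dif[OF this]
  have e: "take i fs @ fs ! i # drop (Suc i) fs \<in> Sym X X' n"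
    using assms by (simp only: id_take_nth_drop[symmetric])
  show ?thesis unfolding upd_conv_take_nth_drop[OF assms(2)]
    by (rule Sym_cong[OF e d refl])
qed

lemma Sym_left:
  assumes "fs \<in> Sym X Y n" "f \<in> carrier (gHom C X X' j)" "X' \<in> dgOb C"
  shows "gComp C f (hd fs) # tl fs \<in> Sym X' Y (j + n)"
proof -
  obtain a t where fs: "fs = a # t" "t \<noteq> []" using assms(1)
    by (cases fs; cases "tl fs") (simp_all add: Sym_iff)
  have a: "arr a" "tgt a = X" using assms(1) by (simp_all add: Sym_iff fs)
  then have f: "arr f" "src f = X" "tgt f = X'" "deg f = j"
    using arr_data[OF assms(2)] assms(3) arrI[OF _ _ assms(2)] by (auto simp: arr_def)
  show ?thesis using assms(1) arr_gComp[of a f] a f fs by (auto simp: Sym_iff successively_Cons)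
qed

lemma Sym_right:
  assumes "fs \<in> Sym X Y n" "g \<in> carrier (gHom C Y' Y m)" "Y' \<in> dgOb C"
  shows "butlast fs @ [gComp C (last fs) g] \<in> Sym X Y' (n + m)"
proof -
  obtain t b where fs: "fs = t @ [b]" "t \<noteq> []" using assms(1)
    by (cases fs rule: rev_cases; cases "butlast fs") (simp_all add: Sym_iff)
  have a: "arr b" "src b = Y" using assms(1) by (simp_all add: Sym_iff fs)
  then have f: "arr g" "src g = Y'" "tgt g = Y" "deg g = m"
    using arr_data[OF assms(2)] assms(3) arrI[OF _ _ assms(2)] by (auto simp: arr_def)
  show ?thesis using assms(1) arr_gComp[of g b] a f fs by (auto simp: Sym_iff successively_append_iff)
qed

section \<open>Multilinear functions on symbols\<close>

definition multilinear :: "'o \<Rightarrow> 'o \<Rightarrow> int \<Rightarrow> ('k,'y) module \<Rightarrow> (('o,'v) harr list \<Rightarrow> 'y) \<Rightarrow> bool" where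
  "multilinear X X' n P \<phi> \<longleftrightarrow> (\<forall>fs\<in>Sym X X' n. \<phi> fs \<in> carrier P) \<and>
     (\<forall>us vs Y Z k. \<forall>f\<in>carrier (gHom C Y Z k). us @ f # vs \<in> Sym X X' n \<longrightarrow>
        (\<lambda>g. \<phi> (us @ g # vs)) \<in> linear_maps K (gHom C Y Z k) P)"

lemma multilinear_closed: "multilinear X X' n P \<phi> \<Longrightarrow> fs \<in> Sym X X' n \<Longrightarrow> \<phi> fs \<in> carrier P"
  by (simp add: multilinear_def)

lemma multilinear_linear:
  "multilinear X X' n P \<phi> \<Longrightarrow> us @ f # vs \<in> Sym X X' n \<Longrightarrow> f \<in> carrier (gHom C Y Z k) \<Longrightarrow>
    (\<lambda>g. \<phi> (us @ g # vs)) \<in> linear_maps K (gHom C Y Z k) P"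
  unfolding multilinear_def by blast

lemma multilinear_zero:
  assumes "multilinear X X' n P \<phi>" "module K P" "us @ \<zero>\<^bsub>gHom C Y Z k\<^esub> # vs \<in> Sym X X' n"
    "Y \<in> dgOb C" "Z \<in> dgOb C"
  shows "\<phi> (us @ \<zero>\<^bsub>gHom C Y Z k\<^esub> # vs) = \<zero>\<^bsub>P\<^esub>"
proof -
  interpret H: module K "gHom C Y Z k" using assms by (intro module_gHom)
  show ?thesis
    by (rule linear_map_zero[OF H.module_axioms assms(2) multilinear_linear[OF assms(1,3)]]) simp
qed

text \<open>A rewriting of symbols that moves the varied entry linearly into one slot and fixes the
  rest preserves linearity. Compositions, the differential and cutting are all of this kind.\<close>

lemma multilinear_slot:
  assumes "multilinear X X' n P \<phi>" "L \<in> linear_maps K (gHom C Y Z k) (gHom C Y' Z' k')"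
    "f \<in> carrier (gHom C Y Z k)" "us @ L f # vs \<in> Sym X X' n"
    "module K (gHom C Y Z k)" "\<And>g. g \<in> carrier (gHom C Y Z k) \<Longrightarrow> T g = us @ L g # vs"
  shows "(\<lambda>g. \<phi> (T g)) \<in> linear_maps K (gHom C Y Z k) P"
proof -
  have "(\<lambda>g. \<phi> (us @ g # vs)) \<in> linear_maps K (gHom C Y' Z' k') P"
    using assms by (intro multilinear_linear[where f="L f"]) (auto dest: linear_mapsD(1))
  from linear_maps_comp[OF assms(2) this] show ?thesis
    by (rule linear_maps_cong) (use assms in auto)
qed

text \<open>Any filling of a slot from the same Hom module is again a symbol of the same shape, so
  both facts may be assumed when linearity is checked.\<close>

lemma multilinearI:
  assumes "\<And>fs. fs \<in> Sym X X' n \<Longrightarrow> \<phi> fs \<in> carrier P"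
    and "\<And>us vs Y Z k f. \<lbrakk>f \<in> carrier (gHom C Y Z k); us @ f # vs \<in> Sym X X' n;
        Y \<in> dgOb C; Z \<in> dgOb C; module K (gHom C Y Z k);
        \<And>g. g \<in> carrier (gHom C Y Z k) \<Longrightarrow> us @ g # vs \<in> Sym X X' n;
        \<And>g. g \<in> carrier (gHom C Y Z k) \<Longrightarrow> shape (us @ g # vs) = shape (us @ f # vs)\<rbrakk> \<Longrightarrow>
      (\<lambda>g. \<phi> (us @ g # vs)) \<in> linear_maps K (gHom C Y Z k) P"
  shows "multilinear X X' n P \<phi>"
  unfolding multilinear_def
proof (intro conjI ballI allI impI)
  fix us vs Y Z k f
  assume f: "f \<in> carrier (gHom C Y Z k)" "us @ f # vs \<in> Sym X X' n"
  show "(\<lambda>g. \<phi> (us @ g # vs)) \<in> linear_maps K (gHom C Y Z k) P"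
    by (rule assms(2)[OF f Sym_slot_obj[OF f(2,1)]])
       (erule Sym_replace[OF f(2,1)], erule shape_replace[OF _ f(1)])
next show "\<And>fs. fs \<in> Sym X X' n \<Longrightarrow> \<phi> fs \<in> carrier P" by (rule assms(1)) qed

abbreviation "FM X X' n \<equiv> free_module K (Sym X X' n)"

lemma FM_module: "module K (FM X X' n)"
  by (rule free_module_module) (rule cring_K)

text \<open>The generating relations inside \<open>bar_relations\<close>, named so that maps can be
  tested on them before the span is taken.\<close>

definition rels :: "'o \<Rightarrow> 'o \<Rightarrow> int \<Rightarrow> (('o,'v) harr list \<Rightarrow> 'k) set" where
  "rels X X' n = {generator K (us @ [f \<oplus>\<^bsub>gHom C Y Z k\<^esub> g] @ vs) \<ominus>\<^bsub>FM X X' n\<^esub>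
           (generator K (us @ [f] @ vs) \<oplus>\<^bsub>FM X X' n\<^esub> generator K (us @ [g] @ vs)) | us vs f g Y Z k.
           f \<in> carrier (gHom C Y Z k) \<and> g \<in> carrier (gHom C Y Z k) \<and>
           us @ [f] @ vs \<in> bar_symbols C S X X' n \<and> us @ [g] @ vs \<in> bar_symbols C S X X' n} \<union>
        {generator K (us @ [c \<odot>\<^bsub>gHom C Y Z k\<^esub> f] @ vs) \<ominus>\<^bsub>FM X X' n\<^esub>
           (c \<odot>\<^bsub>FM X X' n\<^esub> generator K (us @ [f] @ vs)) | us vs c f Y Z k.
           c \<in> carrier K \<and> f \<in> carrier (gHom C Y Z k) \<and>
           us @ [f] @ vs \<in> bar_symbols C S X X' n}"

lemma bar_relations_eq: "bar_relations K C S X X' n = span K (FM X X' n) (rels X X' n)"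
  by (simp only: bar_relations_def rels_def Let_def)

lemma rels_addI:
  assumes "f \<in> carrier (gHom C Y Z k)" "g \<in> carrier (gHom C Y Z k)"
    "us @ f # vs \<in> Sym X X' n" "us @ g # vs \<in> Sym X X' n"
  shows "generator K (us @ (f \<oplus>\<^bsub>gHom C Y Z k\<^esub> g) # vs) \<ominus>\<^bsub>FM X X' n\<^esub>
    (generator K (us @ f # vs) \<oplus>\<^bsub>FM X X' n\<^esub> generator K (us @ g # vs)) \<in> rels X X' n"
  unfolding rels_def
  by (rule UnI1, rule CollectI, rule exI[of _ us], rule exI[of _ vs], rule exI[of _ f], rule exI[of _ g],
      rule exI[of _ Y], rule exI[of _ Z], rule exI[of _ k]) (use assms in simp)

lemma rels_smultI:
  assumes "f \<in> carrier (gHom C Y Z k)" "c \<in> carrier K" "us @ f # vs \<in> Sym X X' n"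
  shows "generator K (us @ (c \<odot>\<^bsub>gHom C Y Z k\<^esub> f) # vs) \<ominus>\<^bsub>FM X X' n\<^esub>
    (c \<odot>\<^bsub>FM X X' n\<^esub> generator K (us @ f # vs)) \<in> rels X X' n"
  unfolding rels_def
  by (rule UnI2, rule CollectI, rule exI[of _ us], rule exI[of _ vs], rule exI[of _ c], rule exI[of _ f],
      rule exI[of _ Y], rule exI[of _ Z], rule exI[of _ k]) (use assms in simp)

lemma slot_in:
  assumes "f \<in> carrier (gHom C Y Z k)" "us @ f # vs \<in> Sym X X' n"
  shows "g \<in> carrier (gHom C Y Z k) \<Longrightarrow> us @ (f \<oplus>\<^bsub>gHom C Y Z k\<^esub> g) # vs \<in> Sym X X' n"
    "c \<in> carrier K \<Longrightarrow> us @ (c \<odot>\<^bsub>gHom C Y Z k\<^esub> f) # vs \<in> Sym X X' n"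
proof -
  interpret H: module K "gHom C Y Z k" by (rule Sym_slot_obj[OF assms(2,1)])
  show "g \<in> carrier (gHom C Y Z k) \<Longrightarrow> us @ (f \<oplus>\<^bsub>gHom C Y Z k\<^esub> g) # vs \<in> Sym X X' n"
    "c \<in> carrier K \<Longrightarrow> us @ (c \<odot>\<^bsub>gHom C Y Z k\<^esub> f) # vs \<in> Sym X X' n"
    using assms(1) by (simp_all add: Sym_replace[OF assms(2,1)])
qed

lemma rels_sub: "rels X X' n \<subseteq> carrier (FM X X' n)"
proof -
  interpret F: module K "FM X X' n" by (rule FM_module)
  note g = generator_closed[OF cring_K]
  show ?thesis
  proof
    fix r assume "r \<in> rels X X' n"
    then consider (a) us vs f g Y Z k where "f \<in> carrier (gHom C Y Z k)" "g \<in> carrier (gHom C Y Z k)"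
        "us @ f # vs \<in> Sym X X' n" "us @ g # vs \<in> Sym X X' n"
        "r = generator K (us @ (f \<oplus>\<^bsub>gHom C Y Z k\<^esub> g) # vs) \<ominus>\<^bsub>FM X X' n\<^esub>
           (generator K (us @ f # vs) \<oplus>\<^bsub>FM X X' n\<^esub> generator K (us @ g # vs))"
      | (b) us vs c f Y Z k where "f \<in> carrier (gHom C Y Z k)" "c \<in> carrier K"
        "us @ f # vs \<in> Sym X X' n"
        "r = generator K (us @ (c \<odot>\<^bsub>gHom C Y Z k\<^esub> f) # vs) \<ominus>\<^bsub>FM X X' n\<^esub>
           (c \<odot>\<^bsub>FM X X' n\<^esub> generator K (us @ f # vs))"
      unfolding rels_def by auto
    then show "r \<in> carrier (FM X X' n)"
    proof cases
      case a
      then show ?thesis using slot_in(1)[OF a(1,3,2)] by (simp add: g)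
    next
      case b
      then show ?thesis using slot_in(2)[OF b(1,3,2)] by (simp add: g)
    qed
  qed
qed

sublocale Q: quotient K "FM X X' n" "bar_relations K C S X X' n" for X X' n
  unfolding bar_relations_eq
  by (intro quotient.intro FM_module quotient_axioms.intro span_submodule(1) rels_sub)

lemma BM_module: "module K (BM X X' n)"
  unfolding bar_module_def by (rule Q.Q_module)

lemma el_closed: "fs \<in> Sym X X' n \<Longrightarrow> el X X' n fs \<in> carrier (BM X X' n)"
  unfolding bar_module_def bar_elem_def by (intro Q.cl_closed generator_closed cring_K)

lemma multilinear_el: "multilinear X X' n (BM X X' n) (el X X' n)"
proof (rule multilinearI)
  fix us vs Y Z k f
  assume f: "f \<in> carrier (gHom C Y Z k)" "us @ f # vs \<in> Sym X X' n" "module K (gHom C Y Z k)"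
    and r: "\<And>g. g \<in> carrier (gHom C Y Z k) \<Longrightarrow> us @ g # vs \<in> Sym X X' n"
  interpret H: module K "gHom C Y Z k" by fact
  interpret F: module K "FM X X' n" by (rule FM_module)
  have gc: "generator K (us @ g # vs) \<in> carrier (FM X X' n)" if "g \<in> carrier (gHom C Y Z k)" for g
    by (intro generator_closed cring_K r that)
  have sp: "rels X X' n \<subseteq> bar_relations K C S X X' n"
    unfolding bar_relations_eq by (intro span_submodule(2) FM_module rels_sub)
  show "(\<lambda>g. el X X' n (us @ g # vs)) \<in> linear_maps K (gHom C Y Z k) (BM X X' n)"
    unfolding bar_module_def
  proof (rule linear_mapsI)
    fix x y assume x: "x \<in> carrier (gHom C Y Z k)" and y: "y \<in> carrier (gHom C Y Z k)"
    have "generator K (us @ (x \<oplus>\<^bsub>gHom C Y Z k\<^esub> y) # vs) \<ominus>\<^bsub>FM X X' n\<^esub>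
           (generator K (us @ x # vs) \<oplus>\<^bsub>FM X X' n\<^esub> generator K (us @ y # vs)) \<in> rels X X' n"
      by (rule rels_addI[OF x y r[OF x] r[OF y]])
    then have "generator K (us @ (x \<oplus>\<^bsub>gHom C Y Z k\<^esub> y) # vs) \<ominus>\<^bsub>FM X X' n\<^esub>
           (generator K (us @ x # vs) \<oplus>\<^bsub>FM X X' n\<^esub> generator K (us @ y # vs)) \<in> bar_relations K C S X X' n"
      using sp by blast
    then show "el X X' n (us @ (x \<oplus>\<^bsub>gHom C Y Z k\<^esub> y) # vs) =
      el X X' n (us @ x # vs) \<oplus>\<^bsub>quotient_module (FM X X' n) (bar_relations K C S X X' n)\<^esub> el X X' n (us @ y # vs)"
      unfolding bar_elem_def using gc x y by (subst Q.cl_add) (auto simp: Q.cl_eq_iff)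
  next
    fix c x assume c: "c \<in> carrier K" and x: "x \<in> carrier (gHom C Y Z k)"
    have "generator K (us @ (c \<odot>\<^bsub>gHom C Y Z k\<^esub> x) # vs) \<ominus>\<^bsub>FM X X' n\<^esub>
           (c \<odot>\<^bsub>FM X X' n\<^esub> generator K (us @ x # vs)) \<in> rels X X' n"
      by (rule rels_smultI[OF x c r[OF x]])
    then have "generator K (us @ (c \<odot>\<^bsub>gHom C Y Z k\<^esub> x) # vs) \<ominus>\<^bsub>FM X X' n\<^esub>
           (c \<odot>\<^bsub>FM X X' n\<^esub> generator K (us @ x # vs)) \<in> bar_relations K C S X X' n"
      using sp by blast
    then show "el X X' n (us @ (c \<odot>\<^bsub>gHom C Y Z k\<^esub> x) # vs) =
      c \<odot>\<^bsub>quotient_module (FM X X' n) (bar_relations K C S X X' n)\<^esub> el X X' n (us @ x # vs)"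
      unfolding bar_elem_def using gc x c by (subst Q.cl_smult) (auto simp: Q.cl_eq_iff)
  qed (use r el_closed in \<open>auto simp: bar_module_def\<close>)
qed (rule el_closed)

text \<open>Multilinearity sends the generating relations to zero, and the kernel then contains
  their span.\<close>

lemma free_ext_rels:
  assumes "module K P" "multilinear X X' n P \<phi>" "x \<in> bar_relations K C S X X' n"
  shows "free_ext K P \<phi> x = \<zero>\<^bsub>P\<^esub>"
proof -
  interpret P: module K P by fact
  interpret F: module K "FM X X' n" by (rule FM_module)
  note cl = multilinear_closed[OF assms(2)]
  have lin: "free_ext K P \<phi> \<in> linear_maps K (FM X X' n) P"
    by (rule free_ext_linear[OF assms(1)]) (rule cl)
  have gen: "free_ext K P \<phi> (generator K s) = \<phi> s" if "s \<in> Sym X X' n" for s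
    using assms(1) _ that by (rule free_ext_generator) (rule cl)
  show ?thesis
  proof (rule span_kernel[OF FM_module assms(1) lin rels_sub _ assms(3)[unfolded bar_relations_eq]])
    fix r assume "r \<in> rels X X' n"
    then consider (a) us vs f g Y Z k where "f \<in> carrier (gHom C Y Z k)" "g \<in> carrier (gHom C Y Z k)"
        "us @ f # vs \<in> Sym X X' n" "us @ g # vs \<in> Sym X X' n"
        "r = generator K (us @ (f \<oplus>\<^bsub>gHom C Y Z k\<^esub> g) # vs) \<ominus>\<^bsub>FM X X' n\<^esub>
           (generator K (us @ f # vs) \<oplus>\<^bsub>FM X X' n\<^esub> generator K (us @ g # vs))"
      | (b) us vs c f Y Z k where "f \<in> carrier (gHom C Y Z k)" "c \<in> carrier K"
        "us @ f # vs \<in> Sym X X' n"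
        "r = generator K (us @ (c \<odot>\<^bsub>gHom C Y Z k\<^esub> f) # vs) \<ominus>\<^bsub>FM X X' n\<^esub>
           (c \<odot>\<^bsub>FM X X' n\<^esub> generator K (us @ f # vs))"
      unfolding rels_def by auto
    then show "free_ext K P \<phi> r = \<zero>\<^bsub>P\<^esub>"
    proof cases
      case a
      note l = linear_mapsD(2)[OF multilinear_linear[OF assms(2) a(3,1)] a(1,2)]
      have s: "us @ (f \<oplus>\<^bsub>gHom C Y Z k\<^esub> g) # vs \<in> Sym X X' n" using a slot_in by blast
      show ?thesis unfolding a(5)
        using a s l cl by (simp add: linear_map_minus[OF FM_module assms(1) lin] generator_closed[OF cring_K]
            linear_mapsD(2)[OF lin] gen P.M.r_neg P.M.minus_eq)
    next
      case b
      note l = linear_mapsD(3)[OF multilinear_linear[OF assms(2) b(3,1)] b(2,1)]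
      have s: "us @ (c \<odot>\<^bsub>gHom C Y Z k\<^esub> f) # vs \<in> Sym X X' n" using b slot_in by blast
      show ?thesis unfolding b(4)
        using b s l cl by (simp add: linear_map_minus[OF FM_module assms(1) lin] generator_closed[OF cring_K]
            linear_mapsD(3)[OF lin] gen P.M.r_neg P.M.minus_eq)
    qed
  qed
qed

text \<open>The representative picked by \<open>lin_ext\<close> differs from \<open>x\<close> by a
  relation, on which the linear extension vanishes. From here on the choice no longer shows.\<close>

lemma lin_ext_cl:
  assumes "module K P" "multilinear X X' n P \<phi>" "x \<in> carrier (FM X X' n)"
  shows "lin_ext K P \<phi> (bar_relations K C S X X' n +>\<^bsub>FM X X' n\<^esub> x) = free_ext K P \<phi> x"
proof -
  interpret P: module K P by fact
  interpret F: module K "FM X X' n" by (rule FM_module)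
  let ?N = "bar_relations K C S X X' n"
  note cl = multilinear_closed[OF assms(2)]
  have lin: "free_ext K P \<phi> \<in> linear_maps K (FM X X' n) P"
    by (rule free_ext_linear[OF assms(1)]) (rule cl)
  define y where "y = (SOME y. y \<in> ?N +>\<^bsub>FM X X' n\<^esub> x)"
  have y: "y \<in> ?N +>\<^bsub>FM X X' n\<^esub> x" unfolding y_def
    by (rule someI[of "\<lambda>y. y \<in> bar_relations K C S X X' n +>\<^bsub>FM X X' n\<^esub> x"], rule Q.N.a_rcos_self[OF assms(3)])
  then have yc: "y \<in> carrier (FM X X' n)" using Q.N.a_elemrcos_carrier[OF assms(3)] by blast
  have "y \<ominus>\<^bsub>FM X X' n\<^esub> x \<in> ?N" using Q.N.a_rcos_module_imp[OF assms(3) y] by (simp add: a_minus_def)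
  then have "free_ext K P \<phi> (y \<ominus>\<^bsub>FM X X' n\<^esub> x) = \<zero>\<^bsub>P\<^esub>" by (rule free_ext_rels[OF assms(1,2)])
  then have "free_ext K P \<phi> y \<ominus>\<^bsub>P\<^esub> free_ext K P \<phi> x = \<zero>\<^bsub>P\<^esub>"
    using linear_map_minus[OF FM_module assms(1) lin yc assms(3)] by simp
  then have "free_ext K P \<phi> y = free_ext K P \<phi> x"
    by (rule P.M.minus_eq_zeroD[OF linear_mapsD(1)[OF lin yc] linear_mapsD(1)[OF lin assms(3)]])
  then show ?thesis by (simp add: lin_ext_def Let_def free_ext_def y_def)
qed

lemma lin_ext_linear:
  assumes "module K P" "multilinear X X' n P \<phi>"
  shows "lin_ext K P \<phi> \<in> linear_maps K (BM X X' n) P"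
proof -
  interpret F: module K "FM X X' n" by (rule FM_module)
  have lin: "free_ext K P \<phi> \<in> linear_maps K (FM X X' n) P"
    by (rule free_ext_linear[OF assms(1)]) (rule multilinear_closed[OF assms(2)])
  note c = lin_ext_cl[OF assms]
  show ?thesis unfolding bar_module_def
    by (rule linear_mapsI)
       (auto elim!: Q.Q_cases simp: Q.cl_add Q.cl_smult c linear_mapsD[OF lin])
qed

lemma lin_ext_el:
  assumes "module K P" "multilinear X X' n P \<phi>" "fs \<in> Sym X X' n"
  shows "lin_ext K P \<phi> (el X X' n fs) = \<phi> fs"
  unfolding bar_elem_def
  using lin_ext_cl[OF assms(1,2) generator_closed[OF cring_K assms(3)]]
    free_ext_generator[of K P "Sym X X' n" \<phi>, OF assms(1) multilinear_closed[OF assms(2)] assms(3)] by simp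

text \<open>Generators of the free module map onto the classes of symbols, so agreement there is
  agreement everywhere; identities between maps out of a bar module are reduced to symbols in this
  way.\<close>

lemma BM_maps_eq:
  assumes "module K P" "\<phi> \<in> linear_maps K (BM X X' n) P" "\<psi> \<in> linear_maps K (BM X X' n) P"
    "\<And>fs. fs \<in> Sym X X' n \<Longrightarrow> \<phi> (el X X' n fs) = \<psi> (el X X' n fs)" "x \<in> carrier (BM X X' n)"
  shows "\<phi> x = \<psi> x"
proof -
  obtain y where y: "y \<in> carrier (FM X X' n)" "x = bar_relations K C S X X' n +>\<^bsub>FM X X' n\<^esub> y"
    using assms(5) unfolding bar_module_def by (rule Q.Q_cases)
  note l = linear_maps_comp[OF Q.cl_linear, folded bar_module_def]
  show ?thesis
    unfolding y(2) by (rule free_module_maps_eq[OF assms(1) l[OF assms(2)] l[OF assms(3)] _ y(1)])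
      (use assms(4) in \<open>simp add: bar_elem_def\<close>)
qed

lemma multilinear_signed:
  assumes "multilinear X X' n P \<phi>" "module K P" "\<And>fs gs. shape fs = shape gs \<Longrightarrow> e fs = e gs"
  shows "multilinear X X' n P (\<lambda>fs. signed P (e fs) (\<phi> fs))"
proof (rule multilinearI)
  show "signed P (e fs) (\<phi> fs) \<in> carrier P" if "fs \<in> Sym X X' n" for fs
    using multilinear_closed[OF assms(1) that] by (rule signed_closed[OF assms(2)])
next
  fix us vs Y Z k f
  assume f: "f \<in> carrier (gHom C Y Z k)" "us @ f # vs \<in> Sym X X' n" "module K (gHom C Y Z k)"
    "\<And>g. g \<in> carrier (gHom C Y Z k) \<Longrightarrow> shape (us @ g # vs) = shape (us @ f # vs)"
  show "(\<lambda>g. signed P (e (us @ g # vs)) (\<phi> (us @ g # vs))) \<in> linear_maps K (gHom C Y Z k) P"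
    using linear_maps_signed[OF assms(2) multilinear_linear[OF assms(1) f(2,1)], of "e (us @ f # vs)"] f(3)
    by (rule linear_maps_cong) (use assms(3)[OF f(4)] in simp)
qed

lemma multilinear_transform:
  assumes "multilinear X1 X1' n1 P \<phi>"
    "\<And>fs. fs \<in> Sym X X' n \<Longrightarrow> T fs \<in> Sym X1 X1' n1"
    "\<And>us f vs Y Z k. \<lbrakk>f \<in> carrier (gHom C Y Z k); us @ f # vs \<in> Sym X X' n; Y \<in> dgOb C; Z \<in> dgOb C\<rbrakk> \<Longrightarrow>
      \<exists>us' vs' Y' Z' k' L. L \<in> linear_maps K (gHom C Y Z k) (gHom C Y' Z' k') \<and>
        (\<forall>g\<in>carrier (gHom C Y Z k). T (us @ g # vs) = us' @ L g # vs')"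
  shows "multilinear X X' n P (\<lambda>fs. \<phi> (T fs))"
proof (rule multilinearI)
  show "\<phi> (T fs) \<in> carrier P" if "fs \<in> Sym X X' n" for fs
    using multilinear_closed[OF assms(1) assms(2)[OF that]] .
next
  fix us vs Y Z k f
  assume f: "f \<in> carrier (gHom C Y Z k)" "us @ f # vs \<in> Sym X X' n" "Y \<in> dgOb C" "Z \<in> dgOb C"
    "module K (gHom C Y Z k)"
  obtain us' vs' Y' Z' k' L where L: "L \<in> linear_maps K (gHom C Y Z k) (gHom C Y' Z' k')"
    "\<And>g. g \<in> carrier (gHom C Y Z k) \<Longrightarrow> T (us @ g # vs) = us' @ L g # vs'"
    using assms(3)[OF f(1-4)] by blast
  show "(\<lambda>g. \<phi> (T (us @ g # vs))) \<in> linear_maps K (gHom C Y Z k) P"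
    by (rule multilinear_slot[OF assms(1) L(1) f(1) _ f(5) L(2)])
       (use assms(2)[OF f(2)] L(2)[OF f(1)] in simp_all)
qed

text \<open>The differentiated entry lies before, in or after the varied slot; only in the middle
  case does the slot undergo a nontrivial linear map.\<close>

lemma slot_dif:
  assumes "multilinear X X' (n + 1) P \<phi>" "f \<in> carrier (gHom C Y Z k)" "us @ f # vs \<in> Sym X X' n"
    "i < length (us @ f # vs)"
  shows "(\<lambda>g. \<phi> ((us @ g # vs)[i := dif C ((us @ g # vs) ! i)])) \<in> linear_maps K (gHom C Y Z k) P"
proof -
  note o = Sym_slot_obj[OF assms(3,2)]
  note s = Sym_dif[OF assms(3,4)]
  consider "i < length us" | "i = length us" | j where "i = length us + Suc j"
    by (metis less_iff_Suc_add linorder_neqE_nat add_Suc_right)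
  then show ?thesis
  proof cases
    case 1
    show ?thesis
      by (rule multilinear_slot[OF assms(1) linear_maps_id assms(2) _ o(3), of "us[i := dif C (us ! i)]" vs])
         (use 1 s in \<open>simp_all add: list_update_append nth_append\<close>)
  next
    case 2
    show ?thesis
      by (rule multilinear_slot[OF assms(1) dif_linear[OF o(1,2)] assms(2) _ o(3), of us vs])
         (use 2 s in \<open>simp_all add: list_update_append nth_append\<close>)
  next
    case 3
    show ?thesis
      by (rule multilinear_slot[OF assms(1) linear_maps_id assms(2) _ o(3), of us "vs[j := dif C (vs ! j)]"])
         (use 3 s in \<open>simp_all add: list_update_append nth_append\<close>)
  qed
qed

text \<open>Four positions of the merged pair relative to the varied slot. In the two middle cases
  the varied entry is composed with a fixed neighbour on one side.\<close>

lemma slot_merge: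
  assumes "multilinear X X' (n + 1) P \<phi>" "f \<in> carrier (gHom C Y Z k)" "us @ f # vs \<in> Sym X X' n"
    "i + 1 < length (us @ f # vs)" "2 < length (us @ f # vs)"
  shows "(\<lambda>g. \<phi> (merge i (us @ g # vs))) \<in> linear_maps K (gHom C Y Z k) P"
proof -
  note o = Sym_slot_obj[OF assms(3,2)]
  note s = Sym_merge'[OF assms(3,4,5)]
  consider "i + 1 < length us" | "i + 1 = length us" | "i = length us" | j where "i = length us + Suc j"
    by (metis Suc_eq_plus1 Suc_lessI less_iff_Suc_add linorder_neqE_nat add_Suc_right)
  then show ?thesis
  proof cases
    case 1
    show ?thesis
      by (rule multilinear_slot[OF assms(1) linear_maps_id assms(2) _ o(3), of "merge i us" vs])
         (use 1 s in \<open>simp_all add: merge_append1\<close>)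
  next
    case 2
    then obtain us0 u where us: "us = us0 @ [u]" by (cases us rule: rev_cases) auto
    have m: "merge i (us @ g # vs) = us0 @ gComp C u g # vs" for g
      using 2 us merge_append[of us0 i u g vs] by simp
    have u: "arr u" "src u = Z" using assms(3) arr_data[OF assms(2)] us
      by (auto simp: Sym_iff successively_append_iff)
    have u': "u \<in> carrier (gHom C Z (tgt u) (deg u))" "tgt u \<in> dgOb C" using u by (auto simp: arr_def)
    show ?thesis
      by (rule multilinear_slot[OF assms(1) gComp_linear_right[OF o(1,2) u'(2,1)] assms(2) _ o(3), of us0 vs])
         (use s m in simp_all)
  next
    case 3
    then obtain v vs0 where vs: "vs = v # vs0" using assms(4) by (cases vs) auto
    have m: "merge i (us @ g # vs) = us @ gComp C g v # vs0" for g
      using 3 vs merge_append[of us i g v vs0] by simp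
    have v: "arr v" "tgt v = Y" using assms(3) arr_data[OF assms(2)] vs
      by (auto simp: Sym_iff successively_append_iff successively_Cons)
    have v': "v \<in> carrier (gHom C (src v) Y (deg v))" "src v \<in> dgOb C" using v by (auto simp: arr_def)
    show ?thesis
      by (rule multilinear_slot[OF assms(1) gComp_linear_left[OF v'(2) o(1,2) v'(1)] assms(2) _ o(3), of us vs0])
         (use s m in simp_all)
  next
    case 4
    have m: "merge i (us @ g # vs) = us @ g # merge j vs" for g
      unfolding 4 merge_append2 merge_Suc ..
    show ?thesis
      by (rule multilinear_slot[OF assms(1) linear_maps_id assms(2) _ o(3), of us "merge j vs"])
         (use s m in simp_all)
  qed
qed

section \<open>The bar differential and the two actions\<close>

lemma Sym_obj: assumes "fs \<in> Sym X X' n" shows "X \<in> dgOb C" "X' \<in> dgOb C"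
proof -
  have "fs \<noteq> []" "\<forall>f\<in>set fs. arr f" "tgt (hd fs) = X" "src (last fs) = X'"
    using assms by (auto simp: Sym_iff)
  then show "X \<in> dgOb C" "X' \<in> dgOb C" by (auto simp: arr_def dest: hd_in_set last_in_set)
qed

text \<open>The formula of the bar differential with the class of a symbol replaced by an arbitrary
  function \<open>\<phi>\<close> into \<open>P\<close>. For \<open>el\<close> it is the differential
  itself; for the values of a map on symbols it is the other side of the closedness
  equation.\<close>

definition bar_dif_ext :: "('k,'y) module \<Rightarrow> (('o,'v) harr list \<Rightarrow> 'y) \<Rightarrow> ('o,'v) harr list \<Rightarrow> 'y" where
  "bar_dif_ext P \<phi> fs =
     finsum P (\<lambda>i. signed P (int (length fs - 2) + (\<Sum>j<i. deg (fs ! j))) (\<phi> (fs[i := dif C (fs ! i)])))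
       {0..length fs - 2 + 1} \<oplus>\<^bsub>P\<^esub>
     finsum P (\<lambda>i. signed P (int i) (\<phi> (merge i fs))) {i. 0 < length fs - 2 \<and> i \<le> length fs - 2}"

lemma bar_dif_eq: "bar_dif K C S X X' n fs = bar_dif_ext (BM X X' (n + 1)) (el X X' (n + 1)) fs"
  by (simp add: bar_dif_def bar_dif_ext_def merge_def Let_def)

lemma bar_dif_terms_closed:
  assumes "multilinear X X' (n + 1) P \<phi>" "module K P" "fs \<in> Sym X X' n"
  shows "(\<lambda>i. signed P (e i) (\<phi> (fs[i := dif C (fs ! i)]))) \<in> {0..length fs - 2 + 1} \<rightarrow> carrier P"
    "(\<lambda>i. signed P (e i) (\<phi> (merge i fs))) \<in> {i. 0 < length fs - 2 \<and> i \<le> length fs - 2} \<rightarrow> carrier P"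
proof -
  have l: "2 \<le> length fs" using assms(3) by (simp add: Sym_iff)
  show "(\<lambda>i. signed P (e i) (\<phi> (fs[i := dif C (fs ! i)]))) \<in> {0..length fs - 2 + 1} \<rightarrow> carrier P"
  proof
    fix i assume "i \<in> {0..length fs - 2 + 1}"
    then have "i < length fs" using l by auto
    then show "signed P (e i) (\<phi> (fs[i := dif C (fs ! i)])) \<in> carrier P"
      by (intro signed_closed[OF assms(2)] multilinear_closed[OF assms(1)] Sym_dif[OF assms(3)])
  qed
  show "(\<lambda>i. signed P (e i) (\<phi> (merge i fs))) \<in> {i. 0 < length fs - 2 \<and> i \<le> length fs - 2} \<rightarrow> carrier P"
  proof
    fix i assume "i \<in> {i. 0 < length fs - 2 \<and> i \<le> length fs - 2}"
    then have "i + 1 < length fs" "2 < length fs" using l by auto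
    then show "signed P (e i) (\<phi> (merge i fs)) \<in> carrier P"
      by (intro signed_closed[OF assms(2)] multilinear_closed[OF assms(1)] Sym_merge'[OF assms(3)])
  qed
qed

lemma multilinear_bar_dif:
  assumes "multilinear X X' (n + 1) P \<phi>" "module K P"
  shows "multilinear X X' n P (bar_dif_ext P \<phi>)"
proof -
  interpret P: module K P by fact
  show ?thesis
proof (rule multilinearI)
  show "bar_dif_ext P \<phi> fs \<in> carrier P" if "fs \<in> Sym X X' n" for fs
    unfolding bar_dif_ext_def
    by (intro P.M.a_closed P.M.finsum_closed bar_dif_terms_closed[OF assms that])
next
  fix us vs Y Z k f
  assume f: "f \<in> carrier (gHom C Y Z k)" "us @ f # vs \<in> Sym X X' n" "module K (gHom C Y Z k)"
    and sh: "\<And>g. g \<in> carrier (gHom C Y Z k) \<Longrightarrow> shape (us @ g # vs) = shape (us @ f # vs)"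
  let ?l = "length (us @ f # vs)"
  define e where "e i = int (?l - 2) + (\<Sum>j<i. deg ((us @ f # vs) ! j))" for i
  have l: "2 \<le> ?l" using f(2) unfolding Sym_iff by blast
  have e: "e i = int (length (us @ g # vs) - 2) + (\<Sum>j<i. deg ((us @ g # vs) ! j))"
    if "g \<in> carrier (gHom C Y Z k)" "i \<in> {0..?l - 2 + 1}" for g i
    unfolding e_def using shape_nth[OF sh[OF that(1)]] that(2) l
    by (intro arg_cong2[where f="(+)"] sum.cong) auto
  show "(\<lambda>g. bar_dif_ext P \<phi> (us @ g # vs)) \<in> linear_maps K (gHom C Y Z k) P"
  proof (rule linear_maps_cong[OF linear_maps_add[OF assms(2)
      linear_maps_finsum[OF f(3) assms(2)] linear_maps_finsum[OF f(3) assms(2)]] f(3)])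
    fix i assume "i \<in> {0..?l - 2 + 1}"
    then show "(\<lambda>g. signed P (e i) (\<phi> ((us @ g # vs)[i := dif C ((us @ g # vs) ! i)])))
        \<in> linear_maps K (gHom C Y Z k) P"
      using l by (intro linear_maps_signed[OF assms(2)] slot_dif[OF assms(1) f(1,2)]) auto
  next
    fix i assume "i \<in> {i. 0 < ?l - 2 \<and> i \<le> ?l - 2}"
    then show "(\<lambda>g. signed P (int i) (\<phi> (merge i (us @ g # vs)))) \<in> linear_maps K (gHom C Y Z k) P"
      using l by (intro linear_maps_signed[OF assms(2)] slot_merge[OF assms(1) f(1,2)]) auto
  next
    fix g assume g: "g \<in> carrier (gHom C Y Z k)"
    have gs: "us @ g # vs \<in> Sym X X' n" by (rule Sym_replace[OF f(2,1) g])
    have lg: "length (us @ g # vs) = ?l" by simp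
    show "bar_dif_ext P \<phi> (us @ g # vs) =
      finsum P (\<lambda>i. signed P (e i) (\<phi> ((us @ g # vs)[i := dif C ((us @ g # vs) ! i)]))) {0..?l - 2 + 1} \<oplus>\<^bsub>P\<^esub>
      finsum P (\<lambda>i. signed P (int i) (\<phi> (merge i (us @ g # vs)))) {i. 0 < ?l - 2 \<and> i \<le> ?l - 2}"
      unfolding bar_dif_ext_def lg
      by (intro arg_cong2[where f="\<lambda>x y. x \<oplus>\<^bsub>P\<^esub> y"] refl P.M.finsum_cong' bar_dif_terms_closed(1)[OF assms gs, unfolded lg])
         (use e[OF g] lg in simp)
  qed
qed
qed

text \<open>Turns closedness of a linear map on bar modules into an identity between its values on
  symbols.\<close>

lemma linear_bar_dif_ext:
  assumes "module K P" "module K P'" "\<psi> \<in> linear_maps K P P'" "multilinear X X' (n + 1) P \<phi>" "fs \<in> Sym X X' n"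
    "\<And>gs. gs \<in> Sym X X' (n + 1) \<Longrightarrow> \<psi> (\<phi> gs) = \<phi>' gs"
  shows "\<psi> (bar_dif_ext P \<phi> fs) = bar_dif_ext P' \<phi>' fs"
proof -
  interpret P: module K P by fact
  interpret P': module K P' by fact
  note c = bar_dif_terms_closed[OF assms(4,1,5)]
  have l: "2 \<le> length fs" using assms(5) by (simp add: Sym_iff)
  have 1: "\<psi> (signed P e (\<phi> gs)) = signed P' e (\<phi>' gs)" if "gs \<in> Sym X X' (n + 1)" for gs e
    using linear_map_signed[OF assms(1-3) multilinear_closed[OF assms(4) that]] assms(6)[OF that] by simp
  have 2: "\<phi>' gs \<in> carrier P'" if "gs \<in> Sym X X' (n + 1)" for gs
    using linear_mapsD(1)[OF assms(3) multilinear_closed[OF assms(4) that]] assms(6)[OF that] by simp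
  have 3: "fs[i := dif C (fs ! i)] \<in> Sym X X' (n + 1)" if "i \<in> {0..length fs - 2 + 1}" for i
    using that l by (intro Sym_dif[OF assms(5)]) auto
  have 4: "merge i fs \<in> Sym X X' (n + 1)" if "i \<in> {i. 0 < length fs - 2 \<and> i \<le> length fs - 2}" for i
    using that l by (intro Sym_merge'[OF assms(5)]) auto
  show ?thesis unfolding bar_dif_ext_def
    using c by (simp only: linear_mapsD(2)[OF assms(3)] P.M.finsum_closed linear_map_finsum[OF assms(1-3)])
       (intro arg_cong2[where f="\<lambda>x y. x \<oplus>\<^bsub>P'\<^esub> y"] P'.M.finsum_cong' refl 1 3 4 Pi_I signed_closed[OF assms(2)] 2)
qed

lemma bdif_el:
  "fs \<in> Sym X X' n \<Longrightarrow> bdif (rel_Bar K C S) X X' n (el X X' n fs) =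
    bar_dif_ext (BM X X' (n + 1)) (el X X' (n + 1)) fs"
  unfolding rel_Bar_def bimodule.simps bar_dif_eq[abs_def]
  by (rule lin_ext_el[OF BM_module multilinear_bar_dif[OF multilinear_el BM_module]])

lemma bdif_linear:
  "bdif (rel_Bar K C S) X X' n \<in> linear_maps K (BM X X' n) (BM X X' (n + 1))"
  unfolding rel_Bar_def bimodule.simps bar_dif_eq[abs_def]
  by (rule lin_ext_linear[OF BM_module multilinear_bar_dif[OF multilinear_el BM_module]])

lemma multilinear_left:
  assumes f: "f \<in> carrier (gHom C X X' j)" "X' \<in> dgOb C" and "multilinear X' Y (j + n) P \<phi>"
  shows "multilinear X Y n P (\<lambda>fs. \<phi> (gComp C f (hd fs) # tl fs))"
proof (rule multilinear_transform[OF assms(3) Sym_left[OF _ assms(1,2)]])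
  fix us h vs U V k
  assume h: "h \<in> carrier (gHom C U V k)" "us @ h # vs \<in> Sym X Y n" "U \<in> dgOb C" "V \<in> dgOb C"
  show "\<exists>us' vs' Y' Z' k' L. L \<in> linear_maps K (gHom C U V k) (gHom C Y' Z' k') \<and>
        (\<forall>g\<in>carrier (gHom C U V k). gComp C f (hd (us @ g # vs)) # tl (us @ g # vs) = us' @ L g # vs')"
  proof (cases us)
    case Nil
    then have "V = X" using h(2) arr_data[OF h(1)] unfolding Sym_iff by simp
    then show ?thesis
      using Nil gComp_linear_right[OF h(3,4) assms(2), of f j k] f(1)
      by (intro exI[of _ "[]"] exI[of _ vs] exI[of _ U] exI[of _ X'] exI[of _ "j + k"] exI[of _ "gComp C f"]) auto
  next
    case (Cons u us0)
    then show ?thesis using linear_maps_id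
      by (intro exI[of _ "gComp C f u # us0"] exI[of _ vs] exI[of _ U] exI[of _ V] exI[of _ k] exI[of _ "\<lambda>x. x"]) auto
  qed
qed

lemma multilinear_right:
  assumes g: "g \<in> carrier (gHom C Y' Y m)" "Y' \<in> dgOb C" and "multilinear X Y' (n + m) P \<phi>"
  shows "multilinear X Y n P (\<lambda>fs. \<phi> (butlast fs @ [gComp C (last fs) g]))"
proof (rule multilinear_transform[OF assms(3) Sym_right[OF _ assms(1,2)]])
  fix us h vs U V k
  assume h: "h \<in> carrier (gHom C U V k)" "us @ h # vs \<in> Sym X Y n" "U \<in> dgOb C" "V \<in> dgOb C"
  show "\<exists>us' vs' Y' Z' k' L. L \<in> linear_maps K (gHom C U V k) (gHom C Y' Z' k') \<and>
        (\<forall>x\<in>carrier (gHom C U V k). butlast (us @ x # vs) @ [gComp C (last (us @ x # vs)) g] = us' @ L x # vs')"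
  proof (cases vs rule: rev_cases)
    case Nil
    then have "U = Y" using h(2) arr_data[OF h(1)] unfolding Sym_iff by simp
    then show ?thesis
      using Nil gComp_linear_left[OF assms(2) h(3,4), of g m k] g(1)
      by (intro exI[of _ us] exI[of _ "[]"] exI[of _ Y'] exI[of _ V] exI[of _ "k + m"] exI[of _ "\<lambda>x. gComp C x g"])
         (auto simp: butlast_append)
  next
    case (snoc vs0 v)
    have e: "us @ x # vs0 @ [v] = (us @ x # vs0) @ [v]" for x by simp
    show ?thesis unfolding snoc e butlast_snoc last_snoc using linear_maps_id
      by (intro exI[of _ us] exI[of _ "vs0 @ [gComp C v g]"] exI[of _ U] exI[of _ V] exI[of _ k] exI[of _ "\<lambda>x. x"]) auto
  qed
qed

lemma lact_props:
  assumes f: "f \<in> carrier (gHom C X X' j)" "X' \<in> dgOb C"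
  shows "lact (rel_Bar K C S) f Y n \<in> linear_maps K (BM X Y n) (BM X' Y (j + n))"
    and "fs \<in> Sym X Y n \<Longrightarrow> lact (rel_Bar K C S) f Y n (el X Y n fs) =
      signed (BM X' Y (j + n)) (int (length fs - 2) * j) (el X' Y (j + n) (gComp C f (hd fs) # tl fs))"
proof -
  have f': "tgt f = X'" "deg f = j" using arr_data[OF f(1)] by auto
  have m: "multilinear X Y n (BM X' Y (j + n)) (\<lambda>fs. signed (BM X' Y (j + n)) (int (length fs - 2) * j)
      (el X' Y (j + n) (gComp C f (hd fs) # tl fs)))"
    using multilinear_left[OF f multilinear_el] BM_module by (rule multilinear_signed) (metis shape_length)
  show "lact (rel_Bar K C S) f Y n \<in> linear_maps K (BM X Y n) (BM X' Y (j + n))"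
    using lin_ext_linear[OF BM_module m] by (simp add: rel_Bar_def f' Let_def)
  show "fs \<in> Sym X Y n \<Longrightarrow> lact (rel_Bar K C S) f Y n (el X Y n fs) =
      signed (BM X' Y (j + n)) (int (length fs - 2) * j) (el X' Y (j + n) (gComp C f (hd fs) # tl fs))"
    using lin_ext_el[OF BM_module m] by (simp add: rel_Bar_def f' Let_def)
qed

lemma ract_props:
  assumes g: "g \<in> carrier (gHom C Y' Y m)" "Y' \<in> dgOb C"
  shows "(\<lambda>x. ract (rel_Bar K C S) X n x g) \<in> linear_maps K (BM X Y n) (BM X Y' (n + m))"
    and "fs \<in> Sym X Y n \<Longrightarrow> ract (rel_Bar K C S) X n (el X Y n fs) g =
      el X Y' (n + m) (butlast fs @ [gComp C (last fs) g])"
proof -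
  have g': "src g = Y'" "deg g = m" using arr_data[OF g(1)] by auto
  note m = multilinear_right[OF g multilinear_el]
  show "(\<lambda>x. ract (rel_Bar K C S) X n x g) \<in> linear_maps K (BM X Y n) (BM X Y' (n + m))"
    using lin_ext_linear[OF BM_module m] by (simp add: rel_Bar_def g')
  show "fs \<in> Sym X Y n \<Longrightarrow> ract (rel_Bar K C S) X n (el X Y n fs) g =
      el X Y' (n + m) (butlast fs @ [gComp C (last fs) g])"
    using lin_ext_el[OF BM_module m] by (simp add: rel_Bar_def g')
qed

end

section \<open>Bimodule maps and closedness tested on symbols\<close>

definition lin_bimodule :: "'k ring \<Rightarrow> ('k,'o,'v) dgcat \<Rightarrow> ('k,'o,'v,'x) bimodule \<Rightarrow> bool" where
  "lin_bimodule K C B \<longleftrightarrow>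
     (\<forall>X\<in>dgOb C. \<forall>Y\<in>dgOb C. \<forall>n. module K (bmod B X Y n) \<and>
        bdif B X Y n \<in> linear_maps K (bmod B X Y n) (bmod B X Y (n + 1))) \<and>
     (\<forall>X\<in>dgOb C. \<forall>X'\<in>dgOb C. \<forall>Y\<in>dgOb C. \<forall>j n. \<forall>f\<in>carrier (gHom C X X' j).
        lact B f Y n \<in> linear_maps K (bmod B X Y n) (bmod B X' Y (j + n))) \<and>
     (\<forall>X\<in>dgOb C. \<forall>Y\<in>dgOb C. \<forall>Y'\<in>dgOb C. \<forall>m n. \<forall>g\<in>carrier (gHom C Y' Y m).
        (\<lambda>b. ract B X n b g) \<in> linear_maps K (bmod B X Y n) (bmod B X Y' (n + m)))"

lemma lin_bimoduleD:
  assumes "lin_bimodule K C B" "X \<in> dgOb C" "Y \<in> dgOb C"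
  shows "module K (bmod B X Y n)" "bdif B X Y n \<in> linear_maps K (bmod B X Y n) (bmod B X Y (n + 1))"
    "X' \<in> dgOb C \<Longrightarrow> f \<in> carrier (gHom C X X' j) \<Longrightarrow> lact B f Y n \<in> linear_maps K (bmod B X Y n) (bmod B X' Y (j + n))"
    "Y' \<in> dgOb C \<Longrightarrow> g \<in> carrier (gHom C Y' Y m) \<Longrightarrow>
      (\<lambda>b. ract B X n b g) \<in> linear_maps K (bmod B X Y n) (bmod B X Y' (n + m))"
  using assms unfolding lin_bimodule_def by blast+

lemma (in rel_bar) lin_bimodule_rel_Bar: "lin_bimodule K C (rel_Bar K C S)"
proof -
  have b: "bmod (rel_Bar K C S) = bar_module K C S" by (simp add: rel_Bar_def)
  show ?thesis unfolding lin_bimodule_def b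
    using BM_module bdif_linear lact_props(1) ract_props(1) by blast
qed

text \<open>Compatibility with both actions at once is split into the left and the right one, each a
  comparison of linear maps on symbols. The sign in \<open>L\<close> is the one carried by the left
  action on a symbol.\<close>

lemma (in rel_bar) bimodule_map_lin_ext:
  assumes B: "lin_bimodule K C B"
    and ml: "\<And>X Y n. X \<in> dgOb C \<Longrightarrow> Y \<in> dgOb C \<Longrightarrow> multilinear X Y n (bmod B X Y n) (\<Phi> X Y n)"
    and L: "\<And>X X' Y j n f fs. \<lbrakk>X \<in> dgOb C; X' \<in> dgOb C; Y \<in> dgOb C; f \<in> carrier (gHom C X X' j); fs \<in> Sym X Y n\<rbrakk> \<Longrightarrow>
      signed (bmod B X' Y (j + n)) (int (length fs - 2) * j) (\<Phi> X' Y (j + n) (gComp C f (hd fs) # tl fs)) =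
      lact B f Y n (\<Phi> X Y n fs)"
    and R: "\<And>X Y Y' m n g fs. \<lbrakk>X \<in> dgOb C; Y \<in> dgOb C; Y' \<in> dgOb C; g \<in> carrier (gHom C Y' Y m); fs \<in> Sym X Y n\<rbrakk> \<Longrightarrow>
      \<Phi> X Y' (n + m) (butlast fs @ [gComp C (last fs) g]) = ract B X n (\<Phi> X Y n fs) g"
  shows "bimodule_map K C (rel_Bar K C S) B 0 (\<lambda>X Y n. lin_ext K (bmod B X Y n) (\<Phi> X Y n))"
proof -
  let ?\<phi> = "\<lambda>X Y n. lin_ext K (bmod B X Y n) (\<Phi> X Y n)"
  have b: "bmod (rel_Bar K C S) = BM" by (simp add: rel_Bar_def)
  note D = lin_bimoduleD[OF B]
  have lin: "?\<phi> X Y n \<in> linear_maps K (BM X Y n) (bmod B X Y n)" if "X \<in> dgOb C" "Y \<in> dgOb C" for X Y n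
    by (rule lin_ext_linear[OF D(1)[OF that] ml[OF that]])
  have el: "?\<phi> X Y n (el X Y n fs) = \<Phi> X Y n fs" if "X \<in> dgOb C" "Y \<in> dgOb C" "fs \<in> Sym X Y n" for X Y n fs
    by (rule lin_ext_el[OF D(1)[OF that(1,2)] ml[OF that(1,2)] that(3)])
  have left: "?\<phi> X' Y (j + n) (lact (rel_Bar K C S) f Y n x) = lact B f Y n (?\<phi> X Y n x)"
    if o: "X \<in> dgOb C" "X' \<in> dgOb C" "Y \<in> dgOb C" and f: "f \<in> carrier (gHom C X X' j)" and x: "x \<in> carrier (BM X Y n)"
    for X X' Y j n f x
  proof (rule BM_maps_eq[OF D(1)[OF o(2,3)]
      linear_maps_comp[OF lact_props(1)[OF f o(2)] lin[OF o(2,3)]]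
      linear_maps_comp[OF lin[OF o(1,3)] D(3)[OF o(1,3,2) f]] _ x])
    fix fs assume fs: "fs \<in> Sym X Y n"
    have s: "gComp C f (hd fs) # tl fs \<in> Sym X' Y (j + n)" by (rule Sym_left[OF fs f o(2)])
    show "?\<phi> X' Y (j + n) (lact (rel_Bar K C S) f Y n (el X Y n fs)) = lact B f Y n (?\<phi> X Y n (el X Y n fs))"
      unfolding lact_props(2)[OF f o(2) fs] el[OF o(1,3) fs] L[OF o f fs, symmetric]
      using linear_map_signed[OF BM_module D(1)[OF o(2,3)] lin[OF o(2,3)] el_closed[OF s]] el[OF o(2,3) s] by simp
  qed
  have right: "?\<phi> X Y' (n + m) (ract (rel_Bar K C S) X n x g) = ract B X n (?\<phi> X Y n x) g"
    if o: "X \<in> dgOb C" "Y \<in> dgOb C" "Y' \<in> dgOb C" and g: "g \<in> carrier (gHom C Y' Y m)" and x: "x \<in> carrier (BM X Y n)"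
    for X Y Y' m n g x
  proof (rule BM_maps_eq[OF D(1)[OF o(1,3)]
      linear_maps_comp[OF ract_props(1)[OF g o(3)] lin[OF o(1,3)]]
      linear_maps_comp[OF lin[OF o(1,2)] D(4)[OF o g]] _ x])
    fix fs assume fs: "fs \<in> Sym X Y n"
    have s: "butlast fs @ [gComp C (last fs) g] \<in> Sym X Y' (n + m)" by (rule Sym_right[OF fs g o(3)])
    show "?\<phi> X Y' (n + m) (ract (rel_Bar K C S) X n (el X Y n fs) g) = ract B X n (?\<phi> X Y n (el X Y n fs)) g"
      unfolding ract_props(2)[OF g o(3) fs] el[OF o(1,2) fs] R[OF o g fs, symmetric] by (rule el[OF o(1,3) s])
  qed
  show ?thesis unfolding bimodule_map_def b
  proof (intro conjI ballI allI)
    fix X Y n assume "X \<in> dgOb C" "Y \<in> dgOb C"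
    from lin[OF this] show "?\<phi> X Y n \<in> linear_maps K (BM X Y n) (bmod B X Y (n + 0))" by simp
  next
    fix X X' Y Y' j n m f x g
    assume a: "X \<in> dgOb C" "X' \<in> dgOb C" "Y \<in> dgOb C" "Y' \<in> dgOb C" "f \<in> carrier (gHom C X X' j)"
      "x \<in> carrier (BM X Y n)" "g \<in> carrier (gHom C Y' Y m)"
    have lx: "lact (rel_Bar K C S) f Y n x \<in> carrier (BM X' Y (j + n))"
      by (rule linear_mapsD(1)[OF lact_props(1)[OF a(5,2)] a(6)])
    show "?\<phi> X' Y' (j + n + m) (ract (rel_Bar K C S) X' (j + n) (lact (rel_Bar K C S) f Y n x) g) =
      signed (bmod B X' Y' (j + n + m + 0)) (0 * j) (ract B X' (j + n + 0) (lact B f Y (n + 0) (?\<phi> X Y n x)) g)"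
      using right[OF a(2,3,4,7) lx] left[OF a(1,2,3,5,6)] by simp
  qed
qed

lemma (in rel_bar) closed_map_lin_ext:
  assumes B: "lin_bimodule K C B"
    and ml: "\<And>X Y n. X \<in> dgOb C \<Longrightarrow> Y \<in> dgOb C \<Longrightarrow> multilinear X Y n (bmod B X Y n) (\<Phi> X Y n)"
    and cl: "\<And>X Y n fs. \<lbrakk>X \<in> dgOb C; Y \<in> dgOb C; fs \<in> Sym X Y n\<rbrakk> \<Longrightarrow>
      bdif B X Y n (\<Phi> X Y n fs) = bar_dif_ext (bmod B X Y (n + 1)) (\<Phi> X Y (n + 1)) fs"
  shows "closed_map C (rel_Bar K C S) B 0 (\<lambda>X Y n. lin_ext K (bmod B X Y n) (\<Phi> X Y n))"
proof -
  let ?\<phi> = "\<lambda>X Y n. lin_ext K (bmod B X Y n) (\<Phi> X Y n)"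
  have b: "bmod (rel_Bar K C S) = BM" by (simp add: rel_Bar_def)
  note D = lin_bimoduleD[OF B]
  show ?thesis unfolding closed_map_def b
  proof (intro ballI allI)
    fix X Y n x assume o: "X \<in> dgOb C" "Y \<in> dgOb C" and x: "x \<in> carrier (BM X Y n)"
    note lin = lin_ext_linear[OF D(1)[OF o] ml[OF o]]
    note el = lin_ext_el[OF D(1)[OF o] ml[OF o]]
    have "bdif B X Y n (?\<phi> X Y n x) = ?\<phi> X Y (n + 1) (bdif (rel_Bar K C S) X Y n x)"
    proof (rule BM_maps_eq[OF D(1)[OF o] linear_maps_comp[OF lin D(2)[OF o]]
        linear_maps_comp[OF bdif_linear lin] _ x])
      fix fs assume fs: "fs \<in> Sym X Y n"
      show "bdif B X Y n (?\<phi> X Y n (el X Y n fs)) = ?\<phi> X Y (n + 1) (bdif (rel_Bar K C S) X Y n (el X Y n fs))"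
        unfolding el[OF fs] cl[OF o fs] bdif_el[OF fs]
        by (rule linear_bar_dif_ext[OF BM_module D(1)[OF o] lin multilinear_el fs el, symmetric])
    qed
    then show "bdif B X Y (n + 0) (?\<phi> X Y n x) =
      signed (bmod B X Y (n + 0 + 1)) 0 (?\<phi> X Y (n + 1) (bdif (rel_Bar K C S) X Y n x))" by simp
  qed
qed

lemma bimodule_map0D:
  assumes "bimodule_map K C B B' 0 \<phi>" "X \<in> dgOb C" "Y \<in> dgOb C"
  shows "\<phi> X Y n \<in> linear_maps K (bmod B X Y n) (bmod B' X Y n)"
    and "\<lbrakk>X' \<in> dgOb C; Y' \<in> dgOb C; f \<in> carrier (gHom C X X' j); b \<in> carrier (bmod B X Y n);
        g \<in> carrier (gHom C Y' Y m)\<rbrakk> \<Longrightarrow>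
      \<phi> X' Y' (j + n + m) (ract B X' (j + n) (lact B f Y n b) g) =
      ract B' X' (j + n) (lact B' f Y n (\<phi> X Y n b)) g"
proof -
  note c = assms(1)[unfolded bimodule_map_def]
  show "\<phi> X Y n \<in> linear_maps K (bmod B X Y n) (bmod B' X Y n)"
    using c[THEN conjunct1, rule_format, OF assms(2,3), of n] by simp
  assume a: "X' \<in> dgOb C" "Y' \<in> dgOb C" "f \<in> carrier (gHom C X X' j)" "b \<in> carrier (bmod B X Y n)"
    "g \<in> carrier (gHom C Y' Y m)"
  show "\<phi> X' Y' (j + n + m) (ract B X' (j + n) (lact B f Y n b) g) =
      ract B' X' (j + n) (lact B' f Y n (\<phi> X Y n b)) g"
    using c[THEN conjunct2, rule_format, OF assms(2) a(1) assms(3) a(2,3,4,5)] by simp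
qed

lemma bimodule_map_comp:
  assumes "bimodule_map K C B1 B2 0 \<psi>" "bimodule_map K C B2 B3 0 \<phi>"
  shows "bimodule_map K C B1 B3 0 (\<lambda>X Y n. \<phi> X Y n \<circ> \<psi> X Y n)"
  unfolding bimodule_map_def
proof (intro conjI ballI allI)
  fix X Y n assume o: "X \<in> dgOb C" "Y \<in> dgOb C"
  show "\<phi> X Y n \<circ> \<psi> X Y n \<in> linear_maps K (bmod B1 X Y n) (bmod B3 X Y (n + 0))"
    using linear_maps_comp[OF bimodule_map0D(1)[OF assms(1) o] bimodule_map0D(1)[OF assms(2) o]]
    by (simp add: comp_def)
next
  fix X X' Y Y' j n m f b g
  assume a: "X \<in> dgOb C" "X' \<in> dgOb C" "Y \<in> dgOb C" "Y' \<in> dgOb C" "f \<in> carrier (gHom C X X' j)"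
      "b \<in> carrier (bmod B1 X Y n)" "g \<in> carrier (gHom C Y' Y m)"
  show "(\<phi> X' Y' (j + n + m) \<circ> \<psi> X' Y' (j + n + m)) (ract B1 X' (j + n) (lact B1 f Y n b) g) =
    signed (bmod B3 X' Y' (j + n + m + 0)) (0 * j)
      (ract B3 X' (j + n + 0) (lact B3 f Y (n + 0) ((\<phi> X Y n \<circ> \<psi> X Y n) b)) g)"
    using bimodule_map0D(2)[OF assms(1) a(1,3,2,4,5,6,7)]
      bimodule_map0D(2)[OF assms(2) a(1,3,2,4,5) linear_mapsD(1)[OF bimodule_map0D(1)[OF assms(1) a(1,3)] a(6)] a(7)]
    by simp
qed

lemma closed_map_comp:
  assumes "bimodule_map K C B1 B2 0 \<psi>" "closed_map C B1 B2 0 \<psi>" "closed_map C B2 B3 0 \<phi>"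
  shows "closed_map C B1 B3 0 (\<lambda>X Y n. \<phi> X Y n \<circ> \<psi> X Y n)"
  unfolding closed_map_def
proof (intro ballI allI)
  fix X Y n b assume a: "X \<in> dgOb C" "Y \<in> dgOb C" "b \<in> carrier (bmod B1 X Y n)"
  note 2 = assms(2)[unfolded closed_map_def, rule_format, OF a, simplified]
  note 3 = assms(3)[unfolded closed_map_def, rule_format, OF a(1,2)
      linear_mapsD(1)[OF bimodule_map0D(1)[OF assms(1) a(1,2)] a(3)], simplified]
  show "bdif B3 X Y (n + 0) ((\<phi> X Y n \<circ> \<psi> X Y n) b) =
    signed (bmod B3 X Y (n + 0 + 1)) 0 ((\<phi> X Y (n + 1) \<circ> \<psi> X Y (n + 1)) (bdif B1 X Y n b))"
    using 2 3 by simp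
qed

section \<open>The dg categories of a linear category\<close>

context linear_category
begin

lemma Comp_closed:
  "\<lbrakk>X \<in> Obj A; Y \<in> Obj A; Z \<in> Obj A; f \<in> carrier (Hom A X Y); g \<in> carrier (Hom A Y Z)\<rbrakk> \<Longrightarrow>
    Comp A X Y Z g f \<in> carrier (Hom A X Z)"
  using linear_mapsD(1)[OF Comp_linear_left] by blast

lemma zero_in: "X \<in> Obj A \<Longrightarrow> Y \<in> Obj A \<Longrightarrow> \<zero>\<^bsub>Hom A X Y\<^esub> \<in> carrier (Hom A X Y)"
  by (rule abelian_monoid.zero_closed[OF abelian_group.axioms(1)[OF module.axioms(2)[OF module_Hom]]])

lemma Comp_zero_left:
  "\<lbrakk>X \<in> Obj A; Y \<in> Obj A; Z \<in> Obj A; f \<in> carrier (Hom A X Y)\<rbrakk> \<Longrightarrow>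
    Comp A X Y Z \<zero>\<^bsub>Hom A Y Z\<^esub> f = \<zero>\<^bsub>Hom A X Z\<^esub>"
  using linear_map_zero[OF module_Hom module_Hom Comp_linear_left] .

lemma Comp_zero_right:
  "\<lbrakk>X \<in> Obj A; Y \<in> Obj A; Z \<in> Obj A; g \<in> carrier (Hom A Y Z)\<rbrakk> \<Longrightarrow>
    Comp A X Y Z g \<zero>\<^bsub>Hom A X Y\<^esub> = \<zero>\<^bsub>Hom A X Z\<^esub>"
  using linear_map_zero[OF module_Hom module_Hom Comp_linear_right] .

end

lemma zero_module_module: "cring K \<Longrightarrow> module K zero_module"
  by (rule moduleI) (auto intro!: abelian_groupI simp: zero_module_def)

lemma linear_maps_const_zero:
  assumes "module K N" shows "(\<lambda>x. \<zero>\<^bsub>N\<^esub>) \<in> linear_maps K M N"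
proof -
  interpret N: module K N by fact
  show ?thesis by (rule linear_mapsI) simp_all
qed

lemma linear_maps_to_zero: "(\<And>x. \<phi> x = undefined) \<Longrightarrow> \<phi> \<in> linear_maps K M zero_module"
  by (auto simp: linear_maps_def zero_module_def)

lemma adj_zero_simps:
  "Hom (adj_zero A) (Some X) (Some Y) = Hom A X Y" "Hom (adj_zero A) None y = zero_module"
  "Hom (adj_zero A) x None = zero_module"
  "Comp (adj_zero A) (Some X) (Some Y) (Some Z) = Comp A X Y Z"
  "Comp (adj_zero A) (Some X) None (Some Z) g f = \<zero>\<^bsub>Hom A X Z\<^esub>"
  "Comp (adj_zero A) None y z g f = undefined"
  "Comp (adj_zero A) x y None g f = undefined"
  "Ident (adj_zero A) (Some X) = Ident A X" "Ident (adj_zero A) None = undefined"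
  "None \<in> Obj (adj_zero A)" "Some X \<in> Obj (adj_zero A) \<longleftrightarrow> X \<in> Obj A"
  by (auto simp: adj_zero_def split: option.split)

lemma zero_module_simps [simp]:
  "x \<in> carrier zero_module \<longleftrightarrow> x = undefined" "\<zero>\<^bsub>zero_module\<^esub> = undefined"
  "x \<oplus>\<^bsub>zero_module\<^esub> y = undefined" "c \<odot>\<^bsub>zero_module\<^esub> y = undefined"
  by (auto simp: zero_module_def)

text \<open>Composites through \<open>None\<close> are zero by definition, so each law is settled by
  distinguishing which objects are \<open>None\<close>.\<close>

lemma linear_category_adj_zero:
  assumes "linear_category K A"
  shows "linear_category K (adj_zero A)"
proof -
  interpret A: linear_category K A by fact
  have zm: "module K zero_module" by (rule zero_module_module[OF A.cring_K])
  show ?thesis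
  proof (rule linear_category.intro)
    show "cring K" by (rule A.cring_K)
  next
    fix X Y assume "X \<in> Obj (adj_zero A)" "Y \<in> Obj (adj_zero A)"
    then show "module K (Hom (adj_zero A) X Y)"
      by (cases X; cases Y) (simp_all add: adj_zero_simps A.module_Hom zm)
  next
    fix X assume "X \<in> Obj (adj_zero A)"
    then show "Ident (adj_zero A) X \<in> carrier (Hom (adj_zero A) X X)"
      by (cases X) (simp_all add: adj_zero_simps A.Ident_in)
  next
    fix X Y Z f assume "X \<in> Obj (adj_zero A)" "Y \<in> Obj (adj_zero A)" "Z \<in> Obj (adj_zero A)"
      "f \<in> carrier (Hom (adj_zero A) X Y)"
    then show "(\<lambda>g. Comp (adj_zero A) X Y Z g f) \<in> linear_maps K (Hom (adj_zero A) Y Z) (Hom (adj_zero A) X Z)"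
      by (cases X; cases Y; cases Z)
         (simp_all add: adj_zero_simps A.Comp_linear_left linear_maps_to_zero linear_maps_const_zero A.module_Hom zm)
  next
    fix X Y Z g assume "X \<in> Obj (adj_zero A)" "Y \<in> Obj (adj_zero A)" "Z \<in> Obj (adj_zero A)"
      "g \<in> carrier (Hom (adj_zero A) Y Z)"
    then show "(\<lambda>f. Comp (adj_zero A) X Y Z g f) \<in> linear_maps K (Hom (adj_zero A) X Y) (Hom (adj_zero A) X Z)"
      by (cases X; cases Y; cases Z)
         (simp_all add: adj_zero_simps A.Comp_linear_right linear_maps_to_zero linear_maps_const_zero A.module_Hom zm)
  next
    fix W X Y Z f g h assume "W \<in> Obj (adj_zero A)" "X \<in> Obj (adj_zero A)" "Y \<in> Obj (adj_zero A)" "Z \<in> Obj (adj_zero A)"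
      "f \<in> carrier (Hom (adj_zero A) W X)" "g \<in> carrier (Hom (adj_zero A) X Y)" "h \<in> carrier (Hom (adj_zero A) Y Z)"
    then show "Comp (adj_zero A) W X Z (Comp (adj_zero A) X Y Z h g) f =
      Comp (adj_zero A) W Y Z h (Comp (adj_zero A) W X Y g f)"
      by (cases W; cases X; cases Y; cases Z)
         (simp_all add: adj_zero_simps A.Comp_assoc A.Comp_zero_left A.Comp_zero_right)
  next
    fix X Y f assume "X \<in> Obj (adj_zero A)" "Y \<in> Obj (adj_zero A)" "f \<in> carrier (Hom (adj_zero A) X Y)"
    then show "Comp (adj_zero A) X Y Y (Ident (adj_zero A) Y) f = f"
      "Comp (adj_zero A) X X Y f (Ident (adj_zero A) X) = f"
      by (cases X; cases Y; simp add: adj_zero_simps A.Comp_Ident_left A.Comp_Ident_right)+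
  qed
qed

lemma tag_module_simps:
  "f \<in> carrier (tag_module X Y k M) \<longleftrightarrow> src f = X \<and> tgt f = Y \<and> deg f = k \<and> val f \<in> carrier M"
  "\<zero>\<^bsub>tag_module X Y k M\<^esub> = Arr X Y k \<zero>\<^bsub>M\<^esub>"
  "f \<oplus>\<^bsub>tag_module X Y k M\<^esub> g = Arr X Y k (val f \<oplus>\<^bsub>M\<^esub> val g)"
  "c \<odot>\<^bsub>tag_module X Y k M\<^esub> f = Arr X Y k (c \<odot>\<^bsub>M\<^esub> val f)"
proof -
  show "f \<in> carrier (tag_module X Y k M) \<longleftrightarrow> src f = X \<and> tgt f = Y \<and> deg f = k \<and> val f \<in> carrier M"
    by (cases f) (auto simp: tag_module_def)
qed (simp_all add: tag_module_def)

lemma tag_module_module: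
  assumes "module K M"
  shows "module K (tag_module X Y k M)"
proof -
  interpret M: module K M by fact
  show ?thesis
  proof (rule moduleI)
    show "abelian_group (tag_module X Y k M)"
    proof (rule abelian_groupI, goal_cases)
      case (6 x)
      then show ?case
        by (intro bexI[of _ "Arr X Y k (\<ominus>\<^bsub>M\<^esub> val x)"]) (auto simp: tag_module_simps M.M.l_neg)
    qed (auto simp: tag_module_simps M.M.a_ac intro: harr.expand)
  qed (auto simp: tag_module_simps M.smult_l_distr M.smult_r_distr M.smult_assoc1 M.is_cring intro: harr.expand)
qed

lemma val_tag_linear: "val \<in> linear_maps K (tag_module X Y k M) M"
  by (rule linear_mapsI) (auto simp: tag_module_simps)

lemma prod_module_simps:
  "x \<in> carrier (prod_module M) \<longleftrightarrow> (\<forall>i. x i \<in> carrier (M i))"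
  "\<zero>\<^bsub>prod_module M\<^esub> = (\<lambda>i. \<zero>\<^bsub>M i\<^esub>)"
  "x \<oplus>\<^bsub>prod_module M\<^esub> y = (\<lambda>i. x i \<oplus>\<^bsub>M i\<^esub> y i)"
  "c \<odot>\<^bsub>prod_module M\<^esub> x = (\<lambda>i. c \<odot>\<^bsub>M i\<^esub> x i)"
  by (simp_all add: prod_module_def)

lemma prod_module_module:
  assumes "cring K" "\<And>i. module K (M i)"
  shows "module K (prod_module M)"
proof -
  interpret M: module K "M i" for i by fact
  show ?thesis
  proof (rule moduleI)
    show "abelian_group (prod_module M)"
    proof (rule abelian_groupI, goal_cases)
      case (6 x)
      then show ?case
        by (intro bexI[of _ "\<lambda>i. \<ominus>\<^bsub>M i\<^esub> x i"]) (auto simp: prod_module_simps M.M.l_neg)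
    qed (auto simp: prod_module_simps M.M.a_ac)
  qed (auto simp: prod_module_simps M.smult_l_distr M.smult_r_distr M.smult_assoc1 assms(1))
qed

lemma prod_proj_linear: "(\<lambda>x. x i) \<in> linear_maps K (prod_module M) (M i)"
  by (rule linear_mapsI) (auto simp: prod_module_simps)

text \<open>Here \<open>a\<close>, \<open>b\<close>, \<open>c\<close> stand for
  \<open>\<delta>gf\<close>, \<open>g\<delta>f\<close> and \<open>gf\<delta>\<close>; the term in
  \<open>b\<close> is inserted with both signs.\<close>

lemma module_signed_Leibniz:
  fixes K :: "'k ring"
  assumes "module K M" "a \<in> carrier M" "b \<in> carrier M" "c \<in> carrier M"
  shows "a \<ominus>\<^bsub>M\<^esub> signed M (l + k) c = (a \<ominus>\<^bsub>M\<^esub> signed M l b) \<oplus>\<^bsub>M\<^esub> signed M l (b \<ominus>\<^bsub>M\<^esub> signed M k c)"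
proof -
  interpret M: module K M by fact
  have 1: "(a \<ominus>\<^bsub>M\<^esub> x) \<oplus>\<^bsub>M\<^esub> (x \<ominus>\<^bsub>M\<^esub> d) = a \<ominus>\<^bsub>M\<^esub> d" if "x \<in> carrier M" "d \<in> carrier M" for x d
    using that assms(2) by (metis M.M.a_assoc M.M.a_inv_closed M.M.a_closed M.M.l_neg M.M.l_zero a_minus_def)
  have "signed M l (b \<ominus>\<^bsub>M\<^esub> signed M k c) = signed M l b \<ominus>\<^bsub>M\<^esub> signed M (l + k) c"
    using linear_map_minus[OF assms(1,1) signed_linear[OF assms(1)] assms(3) signed_closed[OF assms(1,4)]]
      signed_signed[OF assms(1,4)] by simp
  then show ?thesis using 1[OF signed_closed[OF assms(1,3)] signed_closed[OF assms(1,4)]] by simp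
qed

section \<open>The dg category of bounded complexes\<close>

locale cplx_cat = A: linear_category K A for K :: "'k ring" and A :: "('k,'o,'m) lincat"
begin

sublocale Z: linear_category K "adj_zero A"
  by (rule linear_category_adj_zero) (rule A.linear_category_axioms)

abbreviation "H \<equiv> Hom (adj_zero A)"
abbreviation "cmp \<equiv> Comp (adj_zero A)"
abbreviation "Ob \<equiv> dgOb (Chb A)"
abbreviation "HC \<equiv> gHom (Chb A)"

lemma Ob_iff: "X \<in> Ob \<longleftrightarrow> finite (supp X) \<and> (\<forall>i. cob X i \<in> Obj (adj_zero A) \<and>
    cdif X i \<in> carrier (H (cob X i) (cob X (i + 1))) \<and>
    cmp (cob X i) (cob X (i + 1)) (cob X (i + 2)) (cdif X (i + 1)) (cdif X i) = \<zero>\<^bsub>H (cob X i) (cob X (i + 2))\<^esub>)"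
  by (simp add: Chb_def Let_def)

lemma ObD:
  assumes "X \<in> Ob"
  shows "finite (supp X)" "cob X i \<in> Obj (adj_zero A)" "cdif X i \<in> carrier (H (cob X i) (cob X (i + 1)))"
  using assms by (auto simp: Ob_iff)

lemma HC_eq: "HC X Y k = tag_module X Y k (prod_module (\<lambda>i. H (cob X i) (cob Y (i + k))))"
  by (simp add: Chb_def Let_def)

lemma gComp_eq: "gComp (Chb A) g f = Arr (src f) (tgt g) (deg g + deg f) (\<lambda>i.
        cmp (cob (src f) i) (cob (tgt f) (i + deg f)) (cob (tgt g) (i + deg f + deg g))
          (val g (i + deg f)) (val f i))"
  by (simp add: Chb_def Let_def)

lemma idt_eq: "idt (Chb A) X = Arr X X 0 (\<lambda>i. Ident (adj_zero A) (cob X i))"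
  by (simp add: Chb_def Let_def)

lemma HC_iff: "f \<in> carrier (HC X Y k) \<longleftrightarrow> src f = X \<and> tgt f = Y \<and> deg f = k \<and>
    (\<forall>i. val f i \<in> carrier (H (cob X i) (cob Y (i + k))))"
  by (simp add: HC_eq tag_module_simps prod_module_simps)

lemma HC_module: "X \<in> Ob \<Longrightarrow> Y \<in> Ob \<Longrightarrow> module K (HC X Y k)"
  unfolding HC_eq
  by (intro tag_module_module prod_module_module A.cring_K Z.module_Hom ObD)

lemma H_module: "X \<in> Ob \<Longrightarrow> Y \<in> Ob \<Longrightarrow> module K (H (cob X i) (cob Y j))"
  by (intro Z.module_Hom ObD)

lemma HC_val_linear: "(\<lambda>f. val f i) \<in> linear_maps K (HC X Y k) (H (cob X i) (cob Y (i + k)))"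
  unfolding HC_eq
  by (rule linear_maps_comp[OF val_tag_linear prod_proj_linear])

lemma HC_eqI:
  assumes "f \<in> carrier (HC X Y k)" "g \<in> carrier (HC X Y k)" "\<And>i. val f i = val g i"
  shows "f = g"
  using assms by (intro harr.expand) (auto simp: HC_iff)

lemma HC_ops:
  "f \<oplus>\<^bsub>HC X Y k\<^esub> g = Arr X Y k (\<lambda>i. val f i \<oplus>\<^bsub>H (cob X i) (cob Y (i + k))\<^esub> val g i)"
  "c \<odot>\<^bsub>HC X Y k\<^esub> f = Arr X Y k (\<lambda>i. c \<odot>\<^bsub>H (cob X i) (cob Y (i + k))\<^esub> val f i)"
  "\<zero>\<^bsub>HC X Y k\<^esub> = Arr X Y k (\<lambda>i. \<zero>\<^bsub>H (cob X i) (cob Y (i + k))\<^esub>)"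
  by (simp_all add: HC_eq tag_module_simps prod_module_simps)

lemma gComp_closed:
  assumes "X \<in> Ob" "Y \<in> Ob" "Z \<in> Ob" "f \<in> carrier (HC X Y k)" "g \<in> carrier (HC Y Z l)"
  shows "gComp (Chb A) g f \<in> carrier (HC X Z (l + k))"
proof -
  have "cmp (cob X i) (cob Y (i + k)) (cob Z (i + k + l)) (val g (i + k)) (val f i)
      \<in> carrier (H (cob X i) (cob Z (i + k + l)))" for i
    using assms by (intro Z.Comp_closed ObD) (auto simp: HC_iff)
  then show ?thesis using assms by (simp add: HC_iff gComp_eq algebra_simps)
qed

lemma gComp_lin_left:
  assumes "X \<in> Ob" "Y \<in> Ob" "Z \<in> Ob" "f \<in> carrier (HC X Y k)"
  shows "(\<lambda>g. gComp (Chb A) g f) \<in> linear_maps K (HC Y Z l) (HC X Z (l + k))"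
proof (rule linear_mapsI)
  have f: "src f = X" "tgt f = Y" "deg f = k" "\<And>i. val f i \<in> carrier (H (cob X i) (cob Y (i + k)))"
    using assms by (auto simp: HC_iff)
  have e: "i + (l + k) = i + k + l" for i :: int by simp
  note L = linear_mapsD[OF Z.Comp_linear_left[OF ObD(2)[OF assms(1)] ObD(2)[OF assms(2)] ObD(2)[OF assms(3)] f(4)]]
  show "gComp (Chb A) (x \<oplus>\<^bsub>HC Y Z l\<^esub> y) f = gComp (Chb A) x f \<oplus>\<^bsub>HC X Z (l + k)\<^esub> gComp (Chb A) y f"
    if "x \<in> carrier (HC Y Z l)" "y \<in> carrier (HC Y Z l)" for x y
    using that by (simp add: HC_ops gComp_eq f e HC_iff L)
  show "gComp (Chb A) (c \<odot>\<^bsub>HC Y Z l\<^esub> x) f = c \<odot>\<^bsub>HC X Z (l + k)\<^esub> gComp (Chb A) x f"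
    if "c \<in> carrier K" "x \<in> carrier (HC Y Z l)" for c x
    using that by (simp add: HC_ops gComp_eq f e HC_iff L)
qed (rule gComp_closed[OF assms])

lemma gComp_lin_right:
  assumes "X \<in> Ob" "Y \<in> Ob" "Z \<in> Ob" "g \<in> carrier (HC Y Z l)"
  shows "(\<lambda>f. gComp (Chb A) g f) \<in> linear_maps K (HC X Y k) (HC X Z (l + k))"
proof (rule linear_mapsI)
  have g: "src g = Y" "tgt g = Z" "deg g = l" "\<And>i. val g i \<in> carrier (H (cob Y i) (cob Z (i + l)))"
    using assms by (auto simp: HC_iff)
  have e: "i + (l + k) = i + k + l" for i :: int by simp
  note L = linear_mapsD[OF Z.Comp_linear_right[OF ObD(2)[OF assms(1)] ObD(2)[OF assms(2)] ObD(2)[OF assms(3)] g(4)]]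
  show "gComp (Chb A) g (x \<oplus>\<^bsub>HC X Y k\<^esub> y) = gComp (Chb A) g x \<oplus>\<^bsub>HC X Z (l + k)\<^esub> gComp (Chb A) g y"
    if "x \<in> carrier (HC X Y k)" "y \<in> carrier (HC X Y k)" for x y
    using that by (simp add: HC_ops gComp_eq g e HC_iff L)
  show "gComp (Chb A) g (c \<odot>\<^bsub>HC X Y k\<^esub> x) = c \<odot>\<^bsub>HC X Z (l + k)\<^esub> gComp (Chb A) g x"
    if "c \<in> carrier K" "x \<in> carrier (HC X Y k)" for c x
    using that by (simp add: HC_ops gComp_eq g e HC_iff L)
qed (rule gComp_closed[OF assms(1-3) _ assms(4)])

lemma gComp_ass:
  assumes "W \<in> Ob" "X \<in> Ob" "Y \<in> Ob" "Z \<in> Ob" "f \<in> carrier (HC W X k)" "g \<in> carrier (HC X Y l)" "h \<in> carrier (HC Y Z m)"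
  shows "gComp (Chb A) (gComp (Chb A) h g) f = gComp (Chb A) h (gComp (Chb A) g f)"
proof -
  have e: "i + (l + k) = i + k + l" "i + k + (m + l) = i + k + l + m" for i :: int by simp_all
  have "cmp (cob W i) (cob X (i + k)) (cob Z (i + k + l + m))
      (cmp (cob X (i + k)) (cob Y (i + k + l)) (cob Z (i + k + l + m)) (val h (i + k + l)) (val g (i + k))) (val f i) =
    cmp (cob W i) (cob Y (i + k + l)) (cob Z (i + k + l + m)) (val h (i + k + l))
      (cmp (cob W i) (cob X (i + k)) (cob Y (i + k + l)) (val g (i + k)) (val f i))" for i
    using assms by (intro Z.Comp_assoc ObD) (auto simp: HC_iff)
  then show ?thesis using assms by (simp add: gComp_eq HC_iff e)
qed

lemma delta_closed: "X \<in> Ob \<Longrightarrow> delta X \<in> carrier (HC X X 1)"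
  using ObD by (auto simp: delta_def HC_iff)

lemma delta_sq: "X \<in> Ob \<Longrightarrow> gComp (Chb A) (delta X) (delta X) = \<zero>\<^bsub>HC X X 2\<^esub>"
  by (simp add: gComp_eq HC_ops delta_def Ob_iff add.commute[of 2])

text \<open>Writing the differential as the graded commutator with \<open>delta\<close> reduces its
  linearity and the Leibniz rule to properties of composition.\<close>

lemma dif_eq:
  assumes "X \<in> Ob" "Y \<in> Ob" "f \<in> carrier (HC X Y k)"
  shows "dif (Chb A) f = gComp (Chb A) (delta Y) f \<ominus>\<^bsub>HC X Y (k + 1)\<^esub>
    signed (HC X Y (k + 1)) k (gComp (Chb A) f (delta X))"
proof (rule HC_eqI[where X=X and Y=Y and k="k+1"])
  interpret M: module K "HC X Y (k + 1)" by (rule HC_module[OF assms(1,2)])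
  interpret N: module K "H (cob X i) (cob Y (i + (k + 1)))" for i by (rule H_module[OF assms(1,2)])
  have f: "src f = X" "tgt f = Y" "deg f = k" using assms by (auto simp: HC_iff)
  then have fA: "f = Arr X Y k (val f)" by (intro harr.expand) simp
  have a: "gComp (Chb A) (delta Y) f \<in> carrier (HC X Y (k + 1))"
    using gComp_closed[OF assms(1,2,2,3) delta_closed[OF assms(2)]] by (simp add: add.commute)
  have b: "gComp (Chb A) f (delta X) \<in> carrier (HC X Y (k + 1))"
    by (rule gComp_closed[OF assms(1,1,2) delta_closed[OF assms(1)] assms(3)])
  note bs = signed_closed[OF M.module_axioms b]
  note V = HC_val_linear[of _ X Y "k + 1"]
  show c: "gComp (Chb A) (delta Y) f \<ominus>\<^bsub>HC X Y (k + 1)\<^esub> signed (HC X Y (k + 1)) k (gComp (Chb A) f (delta X))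
    \<in> carrier (HC X Y (k + 1))" using a bs by simp
  have e: "i + 1 + k = i + (k + 1)" "i + k + 1 = i + (k + 1)" for i :: int by simp_all
  show v: "val (dif (Chb A) f) i = val (gComp (Chb A) (delta Y) f \<ominus>\<^bsub>HC X Y (k + 1)\<^esub>
    signed (HC X Y (k + 1)) k (gComp (Chb A) f (delta X))) i" for i
    unfolding linear_map_minus[OF M.module_axioms N.module_axioms V a bs]
      linear_map_signed[OF M.module_axioms N.module_axioms V b]
    by (subst fA) (simp add: Chb_def Let_def delta_def f e)
  have "val (gComp (Chb A) (delta Y) f \<ominus>\<^bsub>HC X Y (k + 1)\<^esub>
    signed (HC X Y (k + 1)) k (gComp (Chb A) f (delta X))) i \<in> carrier (H (cob X i) (cob Y (i + (k + 1))))" for i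
    using c by (simp add: HC_iff)
  then show "dif (Chb A) f \<in> carrier (HC X Y (k + 1))"
    unfolding HC_iff v[symmetric] by (subst (1 2 3) fA) (simp add: Chb_def Let_def)
qed

sublocale dg: dg_category K "Chb A"
proof (rule dg_category.intro)
  show "cring K" by (rule A.cring_K)
  show "\<And>X Y k. X \<in> Ob \<Longrightarrow> Y \<in> Ob \<Longrightarrow> module K (HC X Y k)" by (rule HC_module)
  show "\<And>f X Y k. f \<in> carrier (HC X Y k) \<Longrightarrow> src f = X \<and> tgt f = Y \<and> deg f = k" by (simp add: HC_iff)
  show idt: "idt (Chb A) X \<in> carrier (HC X X 0)" if "X \<in> Ob" for X
    using that Z.Ident_in ObD by (simp add: idt_eq HC_iff)
  show idl: "gComp (Chb A) (idt (Chb A) Y) f = f" if "X \<in> Ob" "Y \<in> Ob" "f \<in> carrier (HC X Y k)" for X Y f k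
    using that ObD by (intro harr.expand) (simp add: idt_eq gComp_eq HC_iff Z.Comp_Ident_left)
  show idr: "gComp (Chb A) f (idt (Chb A) X) = f" if "X \<in> Ob" "Y \<in> Ob" "f \<in> carrier (HC X Y k)" for X Y f k
    using that ObD by (intro harr.expand) (simp add: idt_eq gComp_eq HC_iff Z.Comp_Ident_right)
  show "dif (Chb A) \<in> linear_maps K (HC X Y k) (HC X Y (k + 1))" if "X \<in> Ob" "Y \<in> Ob" for X Y k
  proof (rule linear_maps_cong[OF linear_maps_minus[OF HC_module[OF that]]  HC_module[OF that]])
    show "gComp (Chb A) (delta Y) \<in> linear_maps K (HC X Y k) (HC X Y (k + 1))"
      using gComp_lin_right[OF that that(2) delta_closed[OF that(2)], of k] unfolding add.commute[of 1 k] .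
    show "(\<lambda>f. signed (HC X Y (k + 1)) k (gComp (Chb A) f (delta X))) \<in> linear_maps K (HC X Y k) (HC X Y (k + 1))"
      by (rule linear_maps_signed[OF HC_module[OF that] gComp_lin_left[OF that(1,1,2) delta_closed[OF that(1)]]])
    show "dif (Chb A) f = gComp (Chb A) (delta Y) f \<ominus>\<^bsub>HC X Y (k + 1)\<^esub>
      signed (HC X Y (k + 1)) k (gComp (Chb A) f (delta X))" if "f \<in> carrier (HC X Y k)" for f
      by (rule dif_eq[OF \<open>X \<in> Ob\<close> \<open>Y \<in> Ob\<close> that])
  qed
  show "dif (Chb A) (idt (Chb A) X) = \<zero>\<^bsub>HC X X 1\<^esub>" if X: "X \<in> Ob" for X
  proof -
    interpret M: module K "HC X X 1" by (rule HC_module[OF X X])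
    show ?thesis
      using dif_eq[OF X X idt[OF X]] idl[OF X X delta_closed[OF X]] idr[OF X X delta_closed[OF X]] delta_closed[OF X]
      by (simp add: M.M.r_neg M.M.minus_eq)
  qed
  show "dif (Chb A) (gComp (Chb A) g f) = gComp (Chb A) (dif (Chb A) g) f \<oplus>\<^bsub>HC X Z (l + k + 1)\<^esub>
      signed (HC X Z (l + k + 1)) l (gComp (Chb A) g (dif (Chb A) f))"
    if o: "X \<in> Ob" "Y \<in> Ob" "Z \<in> Ob" and f: "f \<in> carrier (HC X Y k)" and g: "g \<in> carrier (HC Y Z l)" for X Y Z f k g l
  proof -
    interpret M: module K "HC X Z (l + k + 1)" by (rule HC_module[OF o(1,3)])
    note d = delta_closed
    have e: "l + 1 + k = l + k + 1" "1 + l = l + 1" "1 + k = k + 1" "1 + (l + k) = l + k + 1" "l + (k + 1) = l + k + 1"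
      by simp_all
    note f1 = gComp_closed[OF o(1,2,2) f d[OF o(2)], unfolded e] and f2 = gComp_closed[OF o(1,1,2) d[OF o(1)] f, unfolded e]
      and g1 = gComp_closed[OF o(2,3,3) g d[OF o(3)], unfolded e] and g2 = gComp_closed[OF o(2,2,3) d[OF o(2)] g, unfolded e]
      and gf = gComp_closed[OF o f g]
    define a where "a = gComp (Chb A) (delta Z) (gComp (Chb A) g f)"
    define b where "b = gComp (Chb A) g (gComp (Chb A) (delta Y) f)"
    define c where "c = gComp (Chb A) g (gComp (Chb A) f (delta X))"
    have abc: "a \<in> carrier (HC X Z (l + k + 1))" "b \<in> carrier (HC X Z (l + k + 1))" "c \<in> carrier (HC X Z (l + k + 1))"
      using gComp_closed[OF o(1,3,3) gf d[OF o(3)]] gComp_closed[OF o f1 g] gComp_closed[OF o f2 g]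
      by (simp_all add: a_def b_def c_def e)
    have 1: "dif (Chb A) (gComp (Chb A) g f) = a \<ominus>\<^bsub>HC X Z (l + k + 1)\<^esub> signed (HC X Z (l + k + 1)) (l + k) c"
      unfolding dif_eq[OF o(1,3) gf] a_def c_def gComp_ass[OF o(1,1,2,3) d[OF o(1)] f g] ..
    have 2: "gComp (Chb A) (dif (Chb A) g) f = a \<ominus>\<^bsub>HC X Z (l + k + 1)\<^esub> signed (HC X Z (l + k + 1)) l b"
    proof -
      note L = gComp_lin_left[OF o f, of "l + 1", unfolded e]
      note HM = HC_module[OF o(2,3)]
      show ?thesis
        unfolding dif_eq[OF o(2,3) g] linear_map_minus[OF HM M.module_axioms L g1 signed_closed[OF HM g2]]
          linear_map_signed[OF HM M.module_axioms L g2] a_def b_def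
          gComp_ass[OF o(1,2,3,3) f g d[OF o(3)]] gComp_ass[OF o(1,2,2,3) f d[OF o(2)] g] ..
    qed
    have 3: "gComp (Chb A) g (dif (Chb A) f) = b \<ominus>\<^bsub>HC X Z (l + k + 1)\<^esub> signed (HC X Z (l + k + 1)) k c"
    proof -
      note L = gComp_lin_right[OF o g, of "k + 1", unfolded e]
      note HM = HC_module[OF o(1,2)]
      show ?thesis
        unfolding dif_eq[OF o(1,2) f] linear_map_minus[OF HM M.module_axioms L f1 signed_closed[OF HM f2]]
          linear_map_signed[OF HM M.module_axioms L f2] a_def b_def c_def ..
    qed
    show ?thesis unfolding 1 2 3 by (rule module_signed_Leibniz[OF M.module_axioms abc])
  qed
qed (fact gComp_lin_left gComp_lin_right gComp_ass)+

end

section \<open>A linear category as a dg category in degree zero\<close>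

locale deg0_cat = A: linear_category K A for K :: "'k ring" and A :: "('k,'o,'m) lincat"
begin

lemma gHom_eq: "gHom (dg_of A) X Y k = tag_module X Y k
        (if k = 0 then Hom A X Y else (Hom A X Y)\<lparr>carrier := {\<zero>\<^bsub>Hom A X Y\<^esub>}\<rparr>)"
  by (simp add: dg_of_def)

lemma gHom_iff: "f \<in> carrier (gHom (dg_of A) X Y k) \<longleftrightarrow> src f = X \<and> tgt f = Y \<and> deg f = k \<and>
    val f \<in> (if k = 0 then carrier (Hom A X Y) else {\<zero>\<^bsub>Hom A X Y\<^esub>})"
  by (simp add: gHom_eq tag_module_simps)

lemma gHom_ops:
  "f \<oplus>\<^bsub>gHom (dg_of A) X Y k\<^esub> g = Arr X Y k (val f \<oplus>\<^bsub>Hom A X Y\<^esub> val g)"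
  "c \<odot>\<^bsub>gHom (dg_of A) X Y k\<^esub> f = Arr X Y k (c \<odot>\<^bsub>Hom A X Y\<^esub> val f)"
  "\<zero>\<^bsub>gHom (dg_of A) X Y k\<^esub> = Arr X Y k \<zero>\<^bsub>Hom A X Y\<^esub>"
  by (simp_all add: gHom_eq tag_module_simps)

lemma gHom_module:
  assumes "X \<in> Obj A" "Y \<in> Obj A"
  shows "module K (gHom (dg_of A) X Y k)"
proof -
  interpret M: module K "Hom A X Y" by (rule A.module_Hom[OF assms])
  have "submodule {\<zero>\<^bsub>Hom A X Y\<^esub>} K (Hom A X Y)" by (rule M.submoduleI) auto
  from submodule.submodule_is_module[OF this M.module_axioms] show ?thesis
    by (auto simp: gHom_eq intro: tag_module_module M.module_axioms)
qed

lemma gComp_eq: "gComp (dg_of A) g f = Arr (src f) (tgt g) (deg g + deg f)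
        (Comp A (src f) (tgt f) (tgt g) (val g) (val f))"
  by (simp add: dg_of_def)

lemma val_in: "X \<in> Obj A \<Longrightarrow> Y \<in> Obj A \<Longrightarrow> f \<in> carrier (gHom (dg_of A) X Y k) \<Longrightarrow> val f \<in> carrier (Hom A X Y)"
  by (auto simp: gHom_iff A.zero_in split: if_splits)

text \<open>In nonzero degree the zero morphism is the only one. Unless both degrees vanish, one
  factor is therefore zero and so is the composite, also when the two degrees cancel.\<close>

lemma gComp_closed:
  assumes "X \<in> Obj A" "Y \<in> Obj A" "Z \<in> Obj A" "f \<in> carrier (gHom (dg_of A) X Y k)" "g \<in> carrier (gHom (dg_of A) Y Z l)"
  shows "gComp (dg_of A) g f \<in> carrier (gHom (dg_of A) X Z (l + k))"
proof (cases "k = 0 \<and> l = 0")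
  case True
  then show ?thesis using assms by (auto simp: gHom_iff gComp_eq A.Comp_closed)
next
  case False
  then have "val f = \<zero>\<^bsub>Hom A X Y\<^esub> \<or> val g = \<zero>\<^bsub>Hom A Y Z\<^esub>" using assms by (auto simp: gHom_iff)
  then have "Comp A X Y Z (val g) (val f) = \<zero>\<^bsub>Hom A X Z\<^esub>"
    using assms val_in[OF assms(1,2,4)] val_in[OF assms(2,3,5)] by (auto simp: A.Comp_zero_left A.Comp_zero_right)
  then show ?thesis using assms by (auto simp: gHom_iff gComp_eq A.zero_in)
qed

sublocale dg: dg_category K "dg_of A"
proof (rule dg_category.intro)
  have Ob: "dgOb (dg_of A) = Obj A" by (simp add: dg_of_def)
  have idt: "idt (dg_of A) X = Arr X X 0 (Ident A X)" for X by (simp add: dg_of_def)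
  have dif: "dif (dg_of A) f = Arr (src f) (tgt f) (deg f + 1) \<zero>\<^bsub>Hom A (src f) (tgt f)\<^esub>" for f by (simp add: dg_of_def)
  show "cring K" by (rule A.cring_K)
  show "\<And>X Y k. X \<in> dgOb (dg_of A) \<Longrightarrow> Y \<in> dgOb (dg_of A) \<Longrightarrow> module K (gHom (dg_of A) X Y k)"
    unfolding Ob by (rule gHom_module)
  show "\<And>f X Y k. f \<in> carrier (gHom (dg_of A) X Y k) \<Longrightarrow> src f = X \<and> tgt f = Y \<and> deg f = k"
    by (simp add: gHom_iff)
  show "idt (dg_of A) X \<in> carrier (gHom (dg_of A) X X 0)" if "X \<in> dgOb (dg_of A)" for X
    using that by (simp add: Ob idt gHom_iff A.Ident_in)
  show "gComp (dg_of A) (idt (dg_of A) Y) f = f" "gComp (dg_of A) f (idt (dg_of A) X) = f"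
    if "X \<in> dgOb (dg_of A)" "Y \<in> dgOb (dg_of A)" "f \<in> carrier (gHom (dg_of A) X Y k)" for X Y f k
    using that val_in[of X Y f k] unfolding Ob
    by (intro harr.expand; simp add: idt gComp_eq gHom_iff A.Comp_Ident_left A.Comp_Ident_right)+
  have data: "src f = X" "tgt f = Y" "deg f = k" if "f \<in> carrier (gHom (dg_of A) X Y k)" for f X Y k
    using that by (simp_all add: gHom_iff)
  show "(\<lambda>g. gComp (dg_of A) g f) \<in> linear_maps K (gHom (dg_of A) Y Z l) (gHom (dg_of A) X Z (l + k))"
    if o: "X \<in> dgOb (dg_of A)" "Y \<in> dgOb (dg_of A)" "Z \<in> dgOb (dg_of A)" and f: "f \<in> carrier (gHom (dg_of A) X Y k)"
    for X Y Z f k l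
  proof (rule linear_mapsI)
    note o' = o[unfolded Ob]
    note L = linear_mapsD[OF A.Comp_linear_left[OF o' val_in[OF o'(1,2) f]]] and v = val_in[OF o'(2,3)]
    show "gComp (dg_of A) x f \<in> carrier (gHom (dg_of A) X Z (l + k))" if "x \<in> carrier (gHom (dg_of A) Y Z l)" for x
      by (rule gComp_closed[OF o' f that])
    show "gComp (dg_of A) (x \<oplus>\<^bsub>gHom (dg_of A) Y Z l\<^esub> y) f =
        gComp (dg_of A) x f \<oplus>\<^bsub>gHom (dg_of A) X Z (l + k)\<^esub> gComp (dg_of A) y f"
      if "x \<in> carrier (gHom (dg_of A) Y Z l)" "y \<in> carrier (gHom (dg_of A) Y Z l)" for x y
      by (simp add: gComp_eq gHom_ops data[OF that(1)] data[OF that(2)] data[OF f] L(2)[OF v[OF that(1)] v[OF that(2)]])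
    show "gComp (dg_of A) (c \<odot>\<^bsub>gHom (dg_of A) Y Z l\<^esub> x) f = c \<odot>\<^bsub>gHom (dg_of A) X Z (l + k)\<^esub> gComp (dg_of A) x f"
      if "c \<in> carrier K" "x \<in> carrier (gHom (dg_of A) Y Z l)" for c x
      by (simp add: gComp_eq gHom_ops data[OF that(2)] data[OF f] L(3)[OF that(1) v[OF that(2)]])
  qed
  show "gComp (dg_of A) g \<in> linear_maps K (gHom (dg_of A) X Y k) (gHom (dg_of A) X Z (l + k))"
    if o: "X \<in> dgOb (dg_of A)" "Y \<in> dgOb (dg_of A)" "Z \<in> dgOb (dg_of A)" and g: "g \<in> carrier (gHom (dg_of A) Y Z l)"
    for X Y Z g k l
  proof (rule linear_mapsI)
    note o' = o[unfolded Ob]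
    note L = linear_mapsD[OF A.Comp_linear_right[OF o' val_in[OF o'(2,3) g]]] and v = val_in[OF o'(1,2)]
    show "gComp (dg_of A) g x \<in> carrier (gHom (dg_of A) X Z (l + k))" if "x \<in> carrier (gHom (dg_of A) X Y k)" for x
      by (rule gComp_closed[OF o' that g])
    show "gComp (dg_of A) g (x \<oplus>\<^bsub>gHom (dg_of A) X Y k\<^esub> y) =
        gComp (dg_of A) g x \<oplus>\<^bsub>gHom (dg_of A) X Z (l + k)\<^esub> gComp (dg_of A) g y"
      if "x \<in> carrier (gHom (dg_of A) X Y k)" "y \<in> carrier (gHom (dg_of A) X Y k)" for x y
      by (simp add: gComp_eq gHom_ops data[OF that(1)] data[OF that(2)] data[OF g] L(2)[OF v[OF that(1)] v[OF that(2)]])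
    show "gComp (dg_of A) g (c \<odot>\<^bsub>gHom (dg_of A) X Y k\<^esub> x) = c \<odot>\<^bsub>gHom (dg_of A) X Z (l + k)\<^esub> gComp (dg_of A) g x"
      if "c \<in> carrier K" "x \<in> carrier (gHom (dg_of A) X Y k)" for c x
      by (simp add: gComp_eq gHom_ops data[OF that(2)] data[OF g] L(3)[OF that(1) v[OF that(2)]])
  qed
  show "gComp (dg_of A) (gComp (dg_of A) h g) f = gComp (dg_of A) h (gComp (dg_of A) g f)"
    if o: "W \<in> dgOb (dg_of A)" "X \<in> dgOb (dg_of A)" "Y \<in> dgOb (dg_of A)" "Z \<in> dgOb (dg_of A)"
     and f: "f \<in> carrier (gHom (dg_of A) W X k)" "g \<in> carrier (gHom (dg_of A) X Y l)" "h \<in> carrier (gHom (dg_of A) Y Z m)"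
    for W X Y Z f g h k l m
    using o f val_in[of W X f k] val_in[of X Y g l] val_in[of Y Z h m] unfolding Ob
    by (simp add: gComp_eq gHom_iff A.Comp_assoc)
  show "dif (dg_of A) \<in> linear_maps K (gHom (dg_of A) X Y k) (gHom (dg_of A) X Y (k + 1))"
    if "X \<in> dgOb (dg_of A)" "Y \<in> dgOb (dg_of A)" for X Y k
  proof (rule linear_maps_cong[OF linear_maps_const_zero])
    show "module K (gHom (dg_of A) X Y (k + 1))" "module K (gHom (dg_of A) X Y k)"
      using that gHom_module unfolding Ob by blast+
    show "dif (dg_of A) f = \<zero>\<^bsub>gHom (dg_of A) X Y (k + 1)\<^esub>" if "f \<in> carrier (gHom (dg_of A) X Y k)" for f
      using that by (simp add: dif gHom_ops gHom_iff)
  qed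
  show "dif (dg_of A) (idt (dg_of A) X) = \<zero>\<^bsub>gHom (dg_of A) X X 1\<^esub>" if "X \<in> dgOb (dg_of A)" for X
    by (simp add: dif idt gHom_ops)
  show "dif (dg_of A) (gComp (dg_of A) g f) = gComp (dg_of A) (dif (dg_of A) g) f \<oplus>\<^bsub>gHom (dg_of A) X Z (l + k + 1)\<^esub>
      signed (gHom (dg_of A) X Z (l + k + 1)) l (gComp (dg_of A) g (dif (dg_of A) f))"
    if o: "X \<in> dgOb (dg_of A)" "Y \<in> dgOb (dg_of A)" "Z \<in> dgOb (dg_of A)" and f: "f \<in> carrier (gHom (dg_of A) X Y k)"
      and g: "g \<in> carrier (gHom (dg_of A) Y Z l)" for X Y Z f k g l
  proof -
    interpret M: module K "gHom (dg_of A) X Z (l + k + 1)" using o gHom_module unfolding Ob by blast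
    have "dif (dg_of A) (gComp (dg_of A) g f) = \<zero>\<^bsub>gHom (dg_of A) X Z (l + k + 1)\<^esub>"
      "gComp (dg_of A) (dif (dg_of A) g) f = \<zero>\<^bsub>gHom (dg_of A) X Z (l + k + 1)\<^esub>"
      "gComp (dg_of A) g (dif (dg_of A) f) = \<zero>\<^bsub>gHom (dg_of A) X Z (l + k + 1)\<^esub>"
      using o f g val_in[of X Y f k] val_in[of Y Z g l] unfolding Ob
      by (simp_all add: gComp_eq dif gHom_iff gHom_ops A.Comp_zero_left A.Comp_zero_right)
    then show ?thesis by (simp add: signed_zero[OF M.module_axioms])
  qed
qed

end

lemma lin_bimodule_functor_bimodule:
  assumes "dg_category K D"
    and F: "\<And>X. X \<in> dgOb C \<Longrightarrow> fobj F X \<in> dgOb D"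
      "\<And>X Y k f. \<lbrakk>X \<in> dgOb C; Y \<in> dgOb C; f \<in> carrier (gHom C X Y k)\<rbrakk> \<Longrightarrow>
        fmor F f \<in> carrier (gHom D (fobj F X) (fobj F Y) k)"
    and G: "\<And>X. X \<in> dgOb C \<Longrightarrow> fobj G X \<in> dgOb D"
      "\<And>X Y k f. \<lbrakk>X \<in> dgOb C; Y \<in> dgOb C; f \<in> carrier (gHom C X Y k)\<rbrakk> \<Longrightarrow>
        fmor G f \<in> carrier (gHom D (fobj G X) (fobj G Y) k)"
  shows "lin_bimodule K C (functor_bimodule D F G)"
proof -
  interpret D: dg_category K D by fact
  show ?thesis unfolding lin_bimodule_def functor_bimodule_def bimodule.simps
    using D.module_gHom D.dif_linear D.gComp_linear_left D.gComp_linear_right F G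
    by (intro conjI ballI allI) (auto simp: D.gComp_linear_right)
qed

section \<open>The lift of a dg functor\<close>

text \<open>The product of two matrix entries passes through the projection after the inclusion at
  the middle object, which for a direct sum is the identity or zero.\<close>

lemma (in linear_category) entry_comp:
  assumes "b \<in> Obj A" "b' \<in> Obj A" "b'' \<in> Obj A" "c \<in> Obj A" "c1 \<in> Obj A" "c2 \<in> Obj A" "c'' \<in> Obj A"
    "p \<in> carrier (Hom A b c)" "\<phi> \<in> carrier (Hom A c c1)" "i1 \<in> carrier (Hom A c1 b')"
    "p2 \<in> carrier (Hom A b' c2)" "\<psi> \<in> carrier (Hom A c2 c'')" "i2 \<in> carrier (Hom A c'' b'')"
  shows "Comp A b b' b'' (Comp A b' c'' b'' i2 (Comp A b' c2 c'' \<psi> p2)) (Comp A b c1 b' i1 (Comp A b c c1 \<phi> p)) =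
    Comp A b c'' b'' i2 (Comp A b c c'' (Comp A c c2 c'' \<psi> (Comp A c c1 c2 (Comp A c1 b' c2 p2 i1) \<phi>)) p)"
  using assms by (simp add: Comp_assoc Comp_closed)

lemma finsum_zero_module:
  fixes K :: "'k ring"
  assumes "cring K"
  shows "finsum (zero_module :: ('k,'x) module) (\<lambda>i. undefined) I = undefined"
proof -
  interpret M: module K "zero_module :: ('k,'x) module" by (rule zero_module_module[OF assms])
  have "finsum (zero_module :: ('k,'x) module) (\<lambda>i. undefined) I \<in> carrier (zero_module :: ('k,'x) module)"
    by (rule M.M.finsum_closed) simp
  then show ?thesis by simp
qed

text \<open>Supplies the witness behind the choice in \<open>chosen_sum\<close>. The strictness
  clauses bind only when at most one summand is nonzero, and then \<open>None\<close>, or that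
  summand with identities, is a direct sum. With two nonzero summands they are vacuous, and
  additivity of \<open>B\<close> is applied to the nonzero ones.\<close>

lemma strict_direct_sum_exists:
  assumes "linear_category K B" "additive B" "finite I" "\<And>i. i \<in> I \<Longrightarrow> c i \<in> Obj (adj_zero B)"
  shows "\<exists>b inc prj. is_direct_sum (adj_zero B) I c b inc prj \<and>
     ((\<forall>i\<in>I. c i = None) \<longrightarrow> b = None) \<and>
     (\<forall>i\<in>I. (\<forall>j\<in>I. j \<noteq> i \<longrightarrow> c j = None) \<longrightarrow>
        b = c i \<and> inc i = Ident (adj_zero B) (c i) \<and> prj i = Ident (adj_zero B) (c i))"
proof -
  interpret B: linear_category K B by fact
  interpret Z: linear_category K "adj_zero B" by (rule linear_category_adj_zero[OF assms(1)])
  consider (none) "\<forall>i\<in>I. c i = None"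
    | (one) i0 x where "i0 \<in> I" "c i0 = Some x" "\<forall>j\<in>I. j \<noteq> i0 \<longrightarrow> c j = None"
    | (two) i1 i2 where "i1 \<in> I" "i2 \<in> I" "i1 \<noteq> i2" "c i1 \<noteq> None" "c i2 \<noteq> None"
    by (metis not_None_eq)
  then show ?thesis
  proof cases
    case none
    note finsum_zero_module[OF B.cring_K, of I]
    then show ?thesis using none
      by (intro exI[of _ None] exI[of _ "\<lambda>i. undefined"]) (auto simp: is_direct_sum_def adj_zero_simps)
  next
    case one
    have x: "x \<in> Obj B" using assms(4)[OF one(1)] one(2) by (simp add: adj_zero_simps)
    interpret H: module K "Hom B x x" by (rule B.module_Hom[OF x x])
    let ?u = "\<lambda>i. if i = i0 then Ident B x else undefined"
    note I = B.Ident_in[OF x]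
    have "finsum (Hom B x x) (\<lambda>i. Comp (adj_zero B) (Some x) (c i) (Some x) (?u i) (?u i)) I =
      Comp (adj_zero B) (Some x) (c i0) (Some x) (?u i0) (?u i0)"
      using one assms(3) x I by (intro H.M.finsum_one_nonzero) (auto simp: adj_zero_simps B.Comp_closed)
    also have "\<dots> = Ident B x" using one x I by (simp add: adj_zero_simps B.Comp_Ident_left)
    finally have s: "finsum (Hom B x x) (\<lambda>i. Comp (adj_zero B) (Some x) (c i) (Some x) (?u i) (?u i)) I = Ident B x" .
    have e: "c i = (if i = i0 then Some x else None)" if "i \<in> I" for i using one that by auto
    have "is_direct_sum (adj_zero B) I c (Some x) ?u ?u"
      unfolding is_direct_sum_def using x I s e
      by (auto simp: adj_zero_simps B.Comp_Ident_left)
    then show ?thesis using one e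
      by (intro exI[of _ "Some x"] exI[of _ ?u]) (auto simp: adj_zero_simps split: if_splits)
  next
    case two
    define J where "J = {i\<in>I. c i \<noteq> None}"
    have J: "finite J" "J \<subseteq> I" using assms(3) by (auto simp: J_def)
    have cJ: "c i = Some (the (c i))" "the (c i) \<in> Obj B" if "i \<in> J" for i
      using assms(4)[of i] that by (auto simp: J_def adj_zero_simps)
    have cN: "c i = None" if "i \<in> I" "i \<notin> J" for i using that by (auto simp: J_def)
    obtain b inc prj where ds: "is_direct_sum B J (\<lambda>i. the (c i)) b inc prj"
      using assms(2) J(1) cJ(2) unfolding additive_def by (metis (no_types, lifting) image_subsetI)
    have b: "b \<in> Obj B" using ds by (simp add: is_direct_sum_def)
    define inc' where "inc' i = (if i \<in> J then inc i else undefined)" for i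
    define prj' where "prj' i = (if i \<in> J then prj i else undefined)" for i
    interpret H: module K "Hom B b b" by (rule B.module_Hom[OF b b])
    have t: "inc' i \<in> carrier (Hom (adj_zero B) (c i) (Some b)) \<and> prj' i \<in> carrier (Hom (adj_zero B) (Some b) (c i)) \<and>
        Comp (adj_zero B) (c i) (Some b) (c i) (prj' i) (inc' i) = Ident (adj_zero B) (c i)" if "i \<in> I" for i
    proof (cases "i \<in> J")
      case True
      show ?thesis using ds True cJ(2)[OF True] unfolding is_direct_sum_def
        by (subst (1 2 3 4 5) cJ(1)[OF True]) (simp add: inc'_def prj'_def adj_zero_simps)
    next
      case False
      then show ?thesis using cN[OF that] by (simp add: inc'_def prj'_def adj_zero_simps)
    qed
    have o: "Comp (adj_zero B) (c i) (Some b) (c j) (prj' j) (inc' i) = \<zero>\<^bsub>Hom (adj_zero B) (c i) (c j)\<^esub>"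
      if "i \<in> I" "j \<in> I" "i \<noteq> j" for i j
    proof (cases "i \<in> J \<and> j \<in> J")
      case True
      then have i: "i \<in> J" and j: "j \<in> J" by auto
      obtain x y where xy: "c i = Some x" "c j = Some y" using cJ(1) i j by metis
      have "Comp B (the (c i)) b (the (c j)) (prj j) (inc i) = \<zero>\<^bsub>Hom B (the (c i)) (the (c j))\<^esub>"
        using ds[unfolded is_direct_sum_def, THEN conjunct2, THEN conjunct2, THEN conjunct1] i j that(3) by blast
      then show ?thesis using i j xy by (simp add: inc'_def prj'_def adj_zero_simps)
    next
      case False
      then show ?thesis using cN that by (auto simp: adj_zero_simps)
    qed
    have "finsum (Hom B b b) (\<lambda>i. Comp (adj_zero B) (Some b) (c i) (Some b) (inc' i) (prj' i)) I =
      finsum (Hom B b b) (\<lambda>i. Comp B b (the (c i)) b (inc i) (prj i)) J"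
    proof (rule H.M.add.finprod_mono_neutral_cong_right[OF assms(3) J(2)])
      fix i assume "i \<in> I - J"
      then show "Comp (adj_zero B) (Some b) (c i) (Some b) (inc' i) (prj' i) = \<zero>\<^bsub>Hom B b b\<^esub>"
        using cN by (simp add: adj_zero_simps)
    next
      fix i assume i: "i \<in> J"
      show "Comp (adj_zero B) (Some b) (c i) (Some b) (inc' i) (prj' i) = Comp B b (the (c i)) b (inc i) (prj i)"
        by (subst cJ(1)[OF i]) (use i in \<open>simp add: inc'_def prj'_def adj_zero_simps\<close>)
    next
      have "Comp (adj_zero B) (Some b) (c i) (Some b) (inc' i) (prj' i) \<in> carrier (Hom (adj_zero B) (Some b) (Some b))"
        if "i \<in> I" for i
        using t[OF that] assms(4)[OF that] b by (intro Z.Comp_closed) (auto simp: adj_zero_simps)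
      then show "(\<lambda>i. Comp (adj_zero B) (Some b) (c i) (Some b) (inc' i) (prj' i)) \<in> I \<rightarrow> carrier (Hom B b b)"
        by (simp add: adj_zero_simps)
    qed
    then have s: "finsum (Hom B b b) (\<lambda>i. Comp (adj_zero B) (Some b) (c i) (Some b) (inc' i) (prj' i)) I = Ident B b"
      using ds by (simp add: is_direct_sum_def)
    have "is_direct_sum (adj_zero B) I c (Some b) inc' prj'"
      unfolding is_direct_sum_def using t o s b by (simp add: adj_zero_simps)
    moreover have "\<not> (\<forall>i\<in>I. c i = None)" using two by auto
    moreover have "\<not> (\<forall>j\<in>I. j \<noteq> i \<longrightarrow> c j = None)" for i using two by metis
    ultimately show ?thesis
      by - (rule exI[of _ "Some b"], rule exI[of _ inc'], rule exI[of _ prj'], metis)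
  qed
qed

locale lifting = A: cplx_cat K A + B: cplx_cat K B + D: deg0_cat K A
  for K :: "'k ring" and A :: "('k,'o,'m) lincat" and B :: "('k,'p,'n) lincat" +
  fixes F :: "('o,'m,('p,'n) cplx,int \<Rightarrow> 'n) dgfun"
  assumes add: "additive B" and dgF: "dg_functor K (dg_of A) (Chb B) F"
begin

lemma F_obj: "x \<in> Obj A \<Longrightarrow> fobj F x \<in> B.Ob"
  using dgF by (simp add: dg_functor_def dg_of_def)

lemma F_idt: "x \<in> Obj A \<Longrightarrow> fmor F (idt (dg_of A) x) = idt (Chb B) (fobj F x)"
  using dgF by (simp add: dg_functor_def dg_of_def)

lemma F_lin: "x \<in> Obj A \<Longrightarrow> y \<in> Obj A \<Longrightarrow>
    fmor F \<in> linear_maps K (gHom (dg_of A) x y k) (B.HC (fobj F x) (fobj F y) k)"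
  using dgF by (simp add: dg_functor_def dg_of_def)

lemma F_dif: "x \<in> Obj A \<Longrightarrow> y \<in> Obj A \<Longrightarrow> f \<in> carrier (gHom (dg_of A) x y k) \<Longrightarrow>
    fmor F (dif (dg_of A) f) = dif (Chb B) (fmor F f)"
  using dgF unfolding dg_functor_def by (simp add: dg_of_def)

lemma F_comp: "x \<in> Obj A \<Longrightarrow> y \<in> Obj A \<Longrightarrow> z \<in> Obj A \<Longrightarrow> g \<in> carrier (gHom (dg_of A) y z k) \<Longrightarrow>
    f \<in> carrier (gHom (dg_of A) x y l) \<Longrightarrow> fmor F (gComp (dg_of A) g f) = gComp (Chb B) (fmor F g) (fmor F f)"
proof -
  assume a: "x \<in> Obj A" "y \<in> Obj A" "z \<in> Obj A" "g \<in> carrier (gHom (dg_of A) y z k)" "f \<in> carrier (gHom (dg_of A) x y l)"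
  have o: "dgOb (dg_of A) = Obj A" by (simp add: dg_of_def)
  show ?thesis
    using dgF[unfolded dg_functor_def o, THEN conjunct2, THEN conjunct2, rule_format, OF a(1,2,3,4,5)] .
qed

abbreviation "FX x y v p \<equiv> val (fmor F (Arr x y 0 v)) p"

lemma Arr0_in: "v \<in> carrier (Hom A x y) \<Longrightarrow> Arr x y 0 v \<in> carrier (gHom (dg_of A) x y 0)"
  by (simp add: D.gHom_iff)

lemma FX_linear:
  assumes "x \<in> Obj A" "y \<in> Obj A"
  shows "(\<lambda>v. FX x y v p) \<in> linear_maps K (Hom A x y) (B.H (cob (fobj F x) p) (cob (fobj F y) p))"
proof -
  have 1: "(\<lambda>v. Arr x y 0 v) \<in> linear_maps K (Hom A x y) (gHom (dg_of A) x y 0)"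
    by (rule linear_mapsI) (auto simp: D.gHom_iff D.gHom_ops)
  from linear_maps_comp[OF linear_maps_comp[OF this F_lin[OF assms]] B.HC_val_linear[of p]]
  show ?thesis by simp
qed

lemma FX_comp:
  assumes "x \<in> Obj A" "y \<in> Obj A" "z \<in> Obj A" "v \<in> carrier (Hom A x y)" "w \<in> carrier (Hom A y z)"
  shows "FX x z (Comp A x y z w v) p =
    B.cmp (cob (fobj F x) p) (cob (fobj F y) p) (cob (fobj F z) p) (FX y z w p) (FX x y v p)"
proof -
  have "fmor F (Arr x y 0 v) \<in> carrier (B.HC (fobj F x) (fobj F y) 0)"
    "fmor F (Arr y z 0 w) \<in> carrier (B.HC (fobj F y) (fobj F z) 0)"
    using assms linear_mapsD(1)[OF F_lin Arr0_in] by auto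
  then show ?thesis
    using F_comp[OF assms(1-3) Arr0_in[OF assms(5)] Arr0_in[OF assms(4)]]
    by (simp add: D.gComp_eq B.gComp_eq B.HC_iff)
qed

text \<open>Morphisms of \<open>A\<close> have zero differential and \<open>F\<close> commutes with
  differentials; the vanishing commutator is the chain map condition.\<close>

lemma FX_chain_map:
  assumes x: "x \<in> Obj A" and y: "y \<in> Obj A" and v: "v \<in> carrier (Hom A x y)"
  shows "B.cmp (cob (fobj F x) p) (cob (fobj F y) p) (cob (fobj F y) (p + 1)) (cdif (fobj F y) p) (FX x y v p) =
    B.cmp (cob (fobj F x) p) (cob (fobj F x) (p + 1)) (cob (fobj F y) (p + 1)) (FX x y v (p + 1)) (cdif (fobj F x) p)"
proof -
  note o = F_obj[OF x] F_obj[OF y]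
  let ?f = "Arr x y 0 v" let ?g = "fmor F (Arr x y 0 v)"
  have g: "?g \<in> carrier (B.HC (fobj F x) (fobj F y) 0)"
    using linear_mapsD(1)[OF F_lin[OF x y] Arr0_in[OF v]] .
  interpret M: module K "B.H (cob (fobj F x) p) (cob (fobj F y) (p + 1))" by (rule B.H_module[OF o])
  have "dif (dg_of A) ?f = \<zero>\<^bsub>gHom (dg_of A) x y 1\<^esub>" by (simp add: dg_of_def D.gHom_ops tag_module_simps)
  then have "dif (Chb B) ?g = \<zero>\<^bsub>B.HC (fobj F x) (fobj F y) 1\<^esub>"
    using F_dif[OF x y Arr0_in[OF v]] linear_map_zero[OF D.gHom_module[OF x y] B.HC_module[OF o] F_lin[OF x y]] by simp
  then have z: "val (dif (Chb B) ?g) p = \<zero>\<^bsub>B.H (cob (fobj F x) p) (cob (fobj F y) (p + 1))\<^esub>"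
    by (simp add: B.HC_ops)
  have g': "?g = Arr (fobj F x) (fobj F y) 0 (val ?g)" using g by (intro harr.expand) (simp add: B.HC_iff)
  have vv: "val (dif (Chb B) ?g) p = B.cmp (cob (fobj F x) p) (cob (fobj F y) p) (cob (fobj F y) (p + 1)) (cdif (fobj F y) p) (FX x y v p)
    \<ominus>\<^bsub>B.H (cob (fobj F x) p) (cob (fobj F y) (p + 1))\<^esub>
    B.cmp (cob (fobj F x) p) (cob (fobj F x) (p + 1)) (cob (fobj F y) (p + 1)) (FX x y v (p + 1)) (cdif (fobj F x) p)"
    by (subst g') (simp add: Chb_def Let_def)
  have gv: "FX x y v i \<in> carrier (B.H (cob (fobj F x) i) (cob (fobj F y) i))" for i using g by (simp add: B.HC_iff)
  show ?thesis
    by (rule M.M.minus_eq_zeroD[OF _ _ z[unfolded vv]]) (intro B.Z.Comp_closed B.ObD o gv)+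
qed

abbreviation "ch \<equiv> lift_chain B F"
abbreviation "sm \<equiv> summand F"
abbreviation "inc X k \<equiv> fst (snd (lift_sum B F X k))"
abbreviation "prj X k \<equiv> snd (snd (lift_sum B F X k))"
abbreviation "me \<equiv> matrix_entry B F"

lemma cob_cases:
  assumes "X \<in> A.Ob" "i \<in> supp X"
  shows "cob X i = Some (the (cob X i))" "the (cob X i) \<in> Obj A"
  using A.ObD(2)[OF assms(1), of i] assms(2) by (auto simp: supp_def adj_zero_simps)

lemma sm_obj: "X \<in> A.Ob \<Longrightarrow> sm X k i \<in> Obj (adj_zero B)"
  using cob_cases[of X i] F_obj B.ObD(2)
  by (cases "cob X i") (auto simp: summand_def supp_def adj_zero_simps)

lemma sm_eq: "X \<in> A.Ob \<Longrightarrow> i \<in> supp X \<Longrightarrow> sm X k i = cob (fobj F (the (cob X i))) (k - i)"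
  by (auto simp: summand_def supp_def)

lemma lift_sum_props:
  assumes "X \<in> A.Ob"
  shows "is_direct_sum (adj_zero B) (supp X) (sm X k) (ch X k) (inc X k) (prj X k)"
    "(\<forall>i\<in>supp X. sm X k i = None) \<Longrightarrow> ch X k = None"
    "i \<in> supp X \<Longrightarrow> \<forall>j\<in>supp X. j \<noteq> i \<longrightarrow> sm X k j = None \<Longrightarrow>
        ch X k = sm X k i \<and> inc X k i = Ident (adj_zero B) (sm X k i) \<and> prj X k i = Ident (adj_zero B) (sm X k i)"
proof -
  let ?P = "\<lambda>(b, inc, prj). is_direct_sum (adj_zero B) (supp X) (sm X k) b inc prj \<and>
     ((\<forall>i\<in>supp X. sm X k i = None) \<longrightarrow> b = None) \<and>
     (\<forall>i\<in>supp X. (\<forall>j\<in>supp X. j \<noteq> i \<longrightarrow> sm X k j = None) \<longrightarrow>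
        b = sm X k i \<and> inc i = Ident (adj_zero B) (sm X k i) \<and> prj i = Ident (adj_zero B) (sm X k i))"
  have "\<exists>t. ?P t"
    using strict_direct_sum_exists[OF B.A.linear_category_axioms add A.ObD(1)[OF assms] sm_obj[OF assms]] by auto
  then have "?P (lift_sum B F X k)" unfolding lift_sum_def chosen_sum_def by (rule someI_ex)
  then show "is_direct_sum (adj_zero B) (supp X) (sm X k) (ch X k) (inc X k) (prj X k)"
    "(\<forall>i\<in>supp X. sm X k i = None) \<Longrightarrow> ch X k = None"
    "i \<in> supp X \<Longrightarrow> \<forall>j\<in>supp X. j \<noteq> i \<longrightarrow> sm X k j = None \<Longrightarrow>
        ch X k = sm X k i \<and> inc X k i = Ident (adj_zero B) (sm X k i) \<and> prj X k i = Ident (adj_zero B) (sm X k i)"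
    unfolding lift_chain_def by (auto simp: case_prod_beta)
qed

lemma ch_obj: "X \<in> A.Ob \<Longrightarrow> ch X k \<in> Obj (adj_zero B)"
  using lift_sum_props(1) by (simp add: is_direct_sum_def)

lemma inc_in: "X \<in> A.Ob \<Longrightarrow> i \<in> supp X \<Longrightarrow> inc X k i \<in> carrier (B.H (sm X k i) (ch X k))"
  and prj_in: "X \<in> A.Ob \<Longrightarrow> i \<in> supp X \<Longrightarrow> prj X k i \<in> carrier (B.H (ch X k) (sm X k i))"
  using lift_sum_props(1)[of X k] by (auto simp: is_direct_sum_def)

lemma prj_inc: "X \<in> A.Ob \<Longrightarrow> i \<in> supp X \<Longrightarrow> j \<in> supp X \<Longrightarrow>
    B.cmp (sm X k i) (ch X k) (sm X k j) (prj X k j) (inc X k i) =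
      (if i = j then Ident (adj_zero B) (sm X k i) else \<zero>\<^bsub>B.H (sm X k i) (sm X k j)\<^esub>)"
  using lift_sum_props(1)[of X k] by (auto simp: is_direct_sum_def)

section \<open>Matrices between lifted complexes\<close>

lemma me_linear:
  assumes "X \<in> A.Ob" "Y \<in> A.Ob" "i \<in> supp X" "j \<in> supp Y"
  shows "me X k i Y l j \<in> linear_maps K (B.H (sm X k i) (sm Y l j)) (B.H (ch X k) (ch Y l))"
  unfolding matrix_entry_def[abs_def]
  using assms by (intro linear_maps_comp[OF B.Z.Comp_linear_left B.Z.Comp_linear_right] sm_obj ch_obj inc_in prj_in)

lemma me_comp:
  assumes "X \<in> A.Ob" "Y \<in> A.Ob" "Z \<in> A.Ob" "i \<in> supp X" "j \<in> supp Y" "j' \<in> supp Y" "m \<in> supp Z"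
    "\<phi> \<in> carrier (B.H (sm X k i) (sm Y l j))" "\<psi> \<in> carrier (B.H (sm Y l j') (sm Z n m))"
  shows "B.cmp (ch X k) (ch Y l) (ch Z n) (me Y l j' Z n m \<psi>) (me X k i Y l j \<phi>) =
    (if j = j' then me X k i Z n m (B.cmp (sm X k i) (sm Y l j) (sm Z n m) \<psi> \<phi>) else \<zero>\<^bsub>B.H (ch X k) (ch Z n)\<^esub>)"
proof -
  note t = sm_obj[OF assms(1)] sm_obj[OF assms(2)] sm_obj[OF assms(3)] ch_obj[OF assms(1)] ch_obj[OF assms(2)]
    ch_obj[OF assms(3)]
  have "B.cmp (ch X k) (ch Y l) (ch Z n) (me Y l j' Z n m \<psi>) (me X k i Y l j \<phi>) =
    me X k i Z n m (B.cmp (sm X k i) (sm Y l j') (sm Z n m) \<psi>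
      (B.cmp (sm X k i) (sm Y l j) (sm Y l j') (B.cmp (sm Y l j) (ch Y l) (sm Y l j') (prj Y l j') (inc Y l j)) \<phi>))"
    unfolding matrix_entry_def by (intro B.Z.entry_comp t inc_in prj_in assms)
  also have "\<dots> = (if j = j' then me X k i Z n m (B.cmp (sm X k i) (sm Y l j) (sm Z n m) \<psi> \<phi>)
      else \<zero>\<^bsub>B.H (ch X k) (ch Z n)\<^esub>)"
    using linear_map_zero[OF B.Z.module_Hom B.Z.module_Hom me_linear[OF assms(1,3,4,7)]] assms t
    by (cases "j = j'") (simp_all add: prj_inc B.Z.Comp_Ident_left B.Z.Comp_zero_left B.Z.Comp_zero_right)
  finally show ?thesis .
qed

text \<open>The morphisms of lifts that arise here have entries only from the \<open>i\<close>-th to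
  the \<open>(i+d)\<close>-th summand: \<open>d\<close> is the degree for the lift of a morphism and
  0 for the differentials of the complexes \<open>F(X^i)\<close>.\<close>

definition diag :: "('o,'m) cplx \<Rightarrow> int \<Rightarrow> ('o,'m) cplx \<Rightarrow> int \<Rightarrow> int \<Rightarrow> (int \<Rightarrow> 'n) \<Rightarrow> 'n" where
  "diag X k Y l d \<phi> = finsum (B.H (ch X k) (ch Y l)) (\<lambda>i. me X k i Y l (i + d) (\<phi> i)) {i\<in>supp X. i + d \<in> supp Y}"

definition diag_data :: "('o,'m) cplx \<Rightarrow> int \<Rightarrow> ('o,'m) cplx \<Rightarrow> int \<Rightarrow> int \<Rightarrow> (int \<Rightarrow> 'n) set" where
  "diag_data X k Y l d = {\<phi>. \<forall>i. i \<in> supp X \<longrightarrow> i + d \<in> supp Y \<longrightarrow> \<phi> i \<in> carrier (B.H (sm X k i) (sm Y l (i + d)))}"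

lemma diag_terms:
  assumes "X \<in> A.Ob" "Y \<in> A.Ob" "\<phi> \<in> diag_data X k Y l d"
  shows "(\<lambda>i. me X k i Y l (i + d) (\<phi> i)) \<in> {i\<in>supp X. i + d \<in> supp Y} \<rightarrow> carrier (B.H (ch X k) (ch Y l))"
  using assms linear_mapsD(1)[OF me_linear] by (auto simp: diag_data_def)

lemma ch_module: "X \<in> A.Ob \<Longrightarrow> Y \<in> A.Ob \<Longrightarrow> module K (B.H (ch X k) (ch Y l))"
  by (intro B.Z.module_Hom ch_obj)

lemma sm_module: "X \<in> A.Ob \<Longrightarrow> Y \<in> A.Ob \<Longrightarrow> module K (B.H (sm X k i) (sm Y l j))"
  by (intro B.Z.module_Hom sm_obj)

lemma diag_closed:
  assumes "X \<in> A.Ob" "Y \<in> A.Ob" "\<phi> \<in> diag_data X k Y l d"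
  shows "diag X k Y l d \<phi> \<in> carrier (B.H (ch X k) (ch Y l))"
proof -
  interpret M: module K "B.H (ch X k) (ch Y l)" by (rule ch_module[OF assms(1,2)])
  show ?thesis unfolding diag_def by (rule M.M.finsum_closed[OF diag_terms[OF assms]])
qed

lemma diag_cong:
  assumes "X \<in> A.Ob" "Y \<in> A.Ob" "\<phi> \<in> diag_data X k Y l d"
    "\<And>i. i \<in> supp X \<Longrightarrow> i + d \<in> supp Y \<Longrightarrow> \<psi> i = \<phi> i"
  shows "diag X k Y l d \<psi> = diag X k Y l d \<phi>"
proof -
  interpret M: module K "B.H (ch X k) (ch Y l)" by (rule ch_module[OF assms(1,2)])
  show ?thesis unfolding diag_def
    by (rule M.M.finsum_cong'[OF refl diag_terms[OF assms(1-3)]]) (use assms(4) in auto)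
qed

lemma diag_signed:
  assumes "X \<in> A.Ob" "Y \<in> A.Ob" "\<phi> \<in> diag_data X k Y l d"
  shows "signed (B.H (ch X k) (ch Y l)) e (diag X k Y l d \<phi>) =
    diag X k Y l d (\<lambda>i. signed (B.H (sm X k i) (sm Y l (i + d))) e (\<phi> i))"
proof -
  note M = ch_module[OF assms(1,2)]
  interpret M: module K "B.H (ch X k) (ch Y l)" by (rule M)
  show ?thesis unfolding diag_def signed_finsum[OF M diag_terms[OF assms]]
  proof (rule M.M.finsum_cong'[OF refl])
    fix i assume i: "i \<in> {i\<in>supp X. i + d \<in> supp Y}"
    then have i': "i \<in> supp X" "i + d \<in> supp Y" "\<phi> i \<in> carrier (B.H (sm X k i) (sm Y l (i + d)))"
      using assms(3) by (auto simp: diag_data_def)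
    show "signed (B.H (ch X k) (ch Y l)) e (me X k i Y l (i + d) (\<phi> i)) =
      me X k i Y l (i + d) (signed (B.H (sm X k i) (sm Y l (i + d))) e (\<phi> i))"
      by (rule linear_map_signed[OF sm_module[OF assms(1,2)] M me_linear[OF assms(1,2) i'(1,2)] i'(3), symmetric])
  next
    show "(\<lambda>i. me X k i Y l (i + d) (signed (B.H (sm X k i) (sm Y l (i + d))) e (\<phi> i)))
      \<in> {i \<in> supp X. i + d \<in> supp Y} \<rightarrow> carrier (B.H (ch X k) (ch Y l))"
      by (intro diag_terms[OF assms(1,2)])
        (use assms(3) signed_closed[OF sm_module[OF assms(1,2)]] in \<open>simp add: diag_data_def\<close>)
  qed
qed

lemma diag_zero:
  assumes "X \<in> A.Ob" "Y \<in> A.Ob"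
    "\<And>i. i \<in> supp X \<Longrightarrow> i + d \<in> supp Y \<Longrightarrow> \<phi> i = \<zero>\<^bsub>B.H (sm X k i) (sm Y l (i + d))\<^esub>"
  shows "diag X k Y l d \<phi> = \<zero>\<^bsub>B.H (ch X k) (ch Y l)\<^esub>"
proof -
  interpret M: module K "B.H (ch X k) (ch Y l)" by (rule ch_module[OF assms(1,2)])
  show ?thesis unfolding diag_def
    using linear_map_zero[OF sm_module[OF assms(1,2)] ch_module[OF assms(1,2)] me_linear[OF assms(1,2)]] assms(3)
    by (intro M.M.finsum_all_zero) auto
qed

text \<open>Orthogonality of the summands of the middle complex leaves, for each \<open>i\<close>,
  only the path through \<open>i + d\<close>. If that summand is missing there is no path, so
  \<open>\<chi>\<close> has to be zero there.\<close>

lemma diag_comp: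
  assumes X: "X \<in> A.Ob" and Y: "Y \<in> A.Ob" and Z: "Z \<in> A.Ob"
    and \<phi>: "\<phi> \<in> diag_data X k Y l d" and \<psi>: "\<psi> \<in> diag_data Y l Z n e"
    and \<chi>: "\<And>i. \<lbrakk>i \<in> supp X; i + d \<in> supp Y; i + d + e \<in> supp Z\<rbrakk> \<Longrightarrow>
      \<chi> i = B.cmp (sm X k i) (sm Y l (i + d)) (sm Z n (i + d + e)) (\<psi> (i + d)) (\<phi> i)"
      "\<And>i. \<lbrakk>i \<in> supp X; i + d \<notin> supp Y; i + d + e \<in> supp Z\<rbrakk> \<Longrightarrow> \<chi> i = \<zero>\<^bsub>B.H (sm X k i) (sm Z n (i + d + e))\<^esub>"
    and c: "c = d + e"
  shows "B.cmp (ch X k) (ch Y l) (ch Z n) (diag Y l Z n e \<psi>) (diag X k Y l d \<phi>) = diag X k Z n c \<chi>"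
proof -
  let ?I = "{i\<in>supp X. i + d \<in> supp Y}" and ?J = "{j\<in>supp Y. j + e \<in> supp Z}"
  interpret M: module K "B.H (ch X k) (ch Z n)" by (rule ch_module[OF X Z])
  have fin: "finite ?I" "finite ?J" "finite (supp X)" using A.ObD(1)[OF X] A.ObD(1)[OF Y] by auto
  note o = ch_obj[OF X] ch_obj[OF Y] ch_obj[OF Z]
  note tm = diag_terms[OF X Y \<phi>] diag_terms[OF Y Z \<psi>]
  define T where "T i = me X k i Y l (i + d) (\<phi> i)" for i
  define U where "U j = me Y l j Z n (j + e) (\<psi> j)" for j
  have T: "T i \<in> carrier (B.H (ch X k) (ch Y l))" if "i \<in> ?I" for i using tm(1) that by (auto simp: T_def)
  have U: "U j \<in> carrier (B.H (ch Y l) (ch Z n))" if "j \<in> ?J" for j using tm(2) that by (auto simp: U_def)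
  have e': "c = d + e" "i + (d + e) = i + d + e" for i :: int using c by simp_all
  have inner: "B.cmp (ch X k) (ch Y l) (ch Z n) (finsum (B.H (ch Y l) (ch Z n)) U ?J) (T i) =
    (if i + d + e \<in> supp Z then me X k i Z n (i + c) (\<chi> i) else \<zero>\<^bsub>B.H (ch X k) (ch Z n)\<^esub>)" if i: "i \<in> ?I" for i
  proof -
    have i': "i \<in> supp X" "i + d \<in> supp Y" "\<phi> i \<in> carrier (B.H (sm X k i) (sm Y l (i + d)))"
      using i \<phi> by (auto simp: diag_data_def)
    have cm: "B.cmp (ch X k) (ch Y l) (ch Z n) (U j) (T i) =
      (if i + d = j then me X k i Z n (j + e) (B.cmp (sm X k i) (sm Y l (i + d)) (sm Z n (j + e)) (\<psi> j) (\<phi> i))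
       else \<zero>\<^bsub>B.H (ch X k) (ch Z n)\<^esub>)" if "j \<in> ?J" for j
      unfolding T_def U_def using that i' \<psi>
      by (intro me_comp[OF X Y Z]) (auto simp: diag_data_def)
    have "B.cmp (ch X k) (ch Y l) (ch Z n) (finsum (B.H (ch Y l) (ch Z n)) U ?J) (T i) =
      finsum (B.H (ch X k) (ch Z n)) (\<lambda>j. B.cmp (ch X k) (ch Y l) (ch Z n) (U j) (T i)) ?J"
      by (rule linear_map_finsum[OF ch_module[OF Y Z] ch_module[OF X Z] B.Z.Comp_linear_left[OF o T[OF i]]]) (use U in auto)
    also have "\<dots> = (if i + d + e \<in> supp Z then me X k i Z n (i + c) (\<chi> i) else \<zero>\<^bsub>B.H (ch X k) (ch Z n)\<^esub>)"
    proof (cases "i + d + e \<in> supp Z")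
      case True
      then have j: "i + d \<in> ?J" using i' by simp
      have "finsum (B.H (ch X k) (ch Z n)) (\<lambda>j. B.cmp (ch X k) (ch Y l) (ch Z n) (U j) (T i)) ?J =
        B.cmp (ch X k) (ch Y l) (ch Z n) (U (i + d)) (T i)"
        by (rule M.M.finsum_one_nonzero[OF j fin(2)]) (use cm B.Z.Comp_closed[OF o T[OF i] U[OF j]] in auto)
      then show ?thesis using True cm[OF j] \<chi>(1)[OF i'(1,2) True] by (simp add: e')
    next
      case False
      then show ?thesis using cm by (intro trans[OF M.M.finsum_all_zero]) auto
    qed
    finally show ?thesis .
  qed
  have \<chi>D: "\<chi> i \<in> carrier (B.H (sm X k i) (sm Z n (i + c)))" if "i \<in> supp X" "i + c \<in> supp Z" for i
  proof (cases "i + d \<in> supp Y")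
    case True
    then have "\<phi> i \<in> carrier (B.H (sm X k i) (sm Y l (i + d)))" "\<psi> (i + d) \<in> carrier (B.H (sm Y l (i + d)) (sm Z n (i + d + e)))"
      using that \<phi> \<psi> by (auto simp: diag_data_def e')
    then show ?thesis using that True \<chi>(1)[of i] by (auto simp: e' intro!: B.Z.Comp_closed sm_obj X Y Z)
  next
    case False
    then show ?thesis using that \<chi>(2)[of i] by (auto simp: e' intro!: B.Z.zero_in sm_obj X Z)
  qed
  then have \<chi>': "\<chi> \<in> diag_data X k Z n c" by (simp add: diag_data_def)
  have "B.cmp (ch X k) (ch Y l) (ch Z n) (diag Y l Z n e \<psi>) (diag X k Y l d \<phi>) =
    finsum (B.H (ch X k) (ch Z n)) (\<lambda>i. B.cmp (ch X k) (ch Y l) (ch Z n) (finsum (B.H (ch Y l) (ch Z n)) U ?J) (T i)) ?I"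
    unfolding diag_def T_def[symmetric] U_def[symmetric]
    by (rule linear_map_finsum[OF ch_module[OF X Y] ch_module[OF X Z] B.Z.Comp_linear_right[OF o]])
       (use T diag_closed[OF Y Z \<psi>] in \<open>auto simp: diag_def U_def\<close>)
  also have "\<dots> = finsum (B.H (ch X k) (ch Z n)) (\<lambda>i. me X k i Z n (i + c) (\<chi> i)) {i\<in>?I. i + d + e \<in> supp Z}"
    by (rule M.M.add.finprod_mono_neutral_cong_right[OF fin(1)])
       (use inner diag_terms[OF X Z \<chi>'] in \<open>auto simp: e' Pi_iff\<close>)
  also have "\<dots> = diag X k Z n c \<chi>"
    unfolding diag_def
  proof (rule M.M.add.finprod_mono_neutral_cong_left)
    fix i assume "i \<in> {i \<in> supp X. i + c \<in> supp Z} - {i\<in>?I. i + d + e \<in> supp Z}"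
    then have "i \<in> supp X" "i + c \<in> supp Z" "i + d \<notin> supp Y" by (auto simp: e')
    then show "me X k i Z n (i + c) (\<chi> i) = \<zero>\<^bsub>B.H (ch X k) (ch Z n)\<^esub>"
      using \<chi>(2)[of i] linear_map_zero[OF sm_module[OF X Z] ch_module[OF X Z] me_linear[OF X Z]] by (auto simp: e')
  qed (use fin diag_terms[OF X Z \<chi>'] in \<open>auto simp: e'\<close>)
  finally show ?thesis .
qed

abbreviation "LO \<equiv> lift_ob B F"
abbreviation "LM \<equiv> lift_mor B F"

lemma cob_LO: "cob (LO X) k = ch X k"
  by (simp add: lift_ob_def Let_def)

definition ent :: "('o,'m) cplx \<Rightarrow> ('o,'m) cplx \<Rightarrow> int \<Rightarrow> (int \<Rightarrow> 'm) \<Rightarrow> int \<Rightarrow> int \<Rightarrow> 'n" where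
  "ent X Y l v k i = FX (the (cob X i)) (the (cob Y (i + l))) (v i) (k - i)"

lemma LM_eq:
  assumes "f \<in> carrier (A.HC X Y l)"
  shows "LM f = Arr (LO X) (LO Y) l (\<lambda>k. diag X k Y (k + l) l (ent X Y l (val f) k))"
  using assms by (simp add: lift_mor_def Let_def diag_def ent_def[abs_def] chain_comp_def A.HC_iff)

lemma entry_sm:
  assumes "X \<in> A.Ob" "Y \<in> A.Ob" "i \<in> supp X" "i + l \<in> supp Y"
  shows "B.H (sm X k i) (sm Y (k + l) (i + l)) =
      B.H (cob (fobj F (the (cob X i))) (k - i)) (cob (fobj F (the (cob Y (i + l)))) (k - i))"
    "A.H (cob X i) (cob Y (i + l)) = Hom A (the (cob X i)) (the (cob Y (i + l)))"
proof -
  show "B.H (sm X k i) (sm Y (k + l) (i + l)) =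
      B.H (cob (fobj F (the (cob X i))) (k - i)) (cob (fobj F (the (cob Y (i + l)))) (k - i))"
    using sm_eq[OF assms(1,3)] sm_eq[OF assms(2,4)] by simp
  obtain a b where "cob X i = Some a" "cob Y (i + l) = Some b"
    using assms(3,4) by (auto simp: supp_def)
  then show "A.H (cob X i) (cob Y (i + l)) = Hom A (the (cob X i)) (the (cob Y (i + l)))"
    by (simp add: adj_zero_simps)
qed

lemma ent_linear:
  assumes "X \<in> A.Ob" "Y \<in> A.Ob" "i \<in> supp X" "i + l \<in> supp Y"
  shows "(\<lambda>f. ent X Y l (val f) k i) \<in> linear_maps K (A.HC X Y l) (B.H (sm X k i) (sm Y (k + l) (i + l)))"
  unfolding ent_def entry_sm(1)[OF assms]
  using linear_maps_comp[OF A.HC_val_linear[of i X Y l, unfolded entry_sm(2)[OF assms]]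
      FX_linear[OF cob_cases(2)[OF assms(1,3)] cob_cases(2)[OF assms(2,4)]]] .

lemma ent_data:
  assumes "X \<in> A.Ob" "Y \<in> A.Ob" "f \<in> carrier (A.HC X Y l)"
  shows "ent X Y l (val f) k \<in> diag_data X k Y (k + l) l"
  unfolding diag_data_def using linear_mapsD(1)[OF ent_linear[OF assms(1,2)] assms(3)] by simp

lemma LM_val_linear:
  assumes "X \<in> A.Ob" "Y \<in> A.Ob"
  shows "(\<lambda>f. diag X k Y (k + l) l (ent X Y l (val f) k)) \<in> linear_maps K (A.HC X Y l) (B.H (ch X k) (ch Y (k + l)))"
  unfolding diag_def
proof (rule linear_maps_finsum[OF A.HC_module[OF assms] ch_module[OF assms]])
  fix i assume "i \<in> {i \<in> supp X. i + l \<in> supp Y}"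
  then have i: "i \<in> supp X" "i + l \<in> supp Y" by auto
  show "(\<lambda>f. me X k i Y (k + l) (i + l) (ent X Y l (val f) k i)) \<in> linear_maps K (A.HC X Y l) (B.H (ch X k) (ch Y (k + l)))"
    by (rule linear_maps_comp[OF ent_linear[OF assms i] me_linear[OF assms i]])
qed

lemma LM_closed:
  assumes "X \<in> A.Ob" "Y \<in> A.Ob" "f \<in> carrier (A.HC X Y l)"
  shows "LM f \<in> carrier (B.HC (LO X) (LO Y) l)"
  unfolding LM_eq[OF assms(3)] B.HC_iff cob_LO
  using diag_closed[OF assms(1,2) ent_data[OF assms]] by simp

lemma LM_linear:
  assumes "X \<in> A.Ob" "Y \<in> A.Ob"
  shows "LM \<in> linear_maps K (A.HC X Y l) (B.HC (LO X) (LO Y) l)"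
proof (rule linear_mapsI)
  interpret M: module K "A.HC X Y l" by (rule A.HC_module[OF assms])
  note L = linear_mapsD[OF LM_val_linear[OF assms]]
  show "LM (x \<oplus>\<^bsub>A.HC X Y l\<^esub> y) = LM x \<oplus>\<^bsub>B.HC (LO X) (LO Y) l\<^esub> LM y"
    if "x \<in> carrier (A.HC X Y l)" "y \<in> carrier (A.HC X Y l)" for x y
    using L(2)[OF that] that by (simp add: LM_eq[OF M.a_closed[OF that]] LM_eq[OF that(1)] LM_eq[OF that(2)] B.HC_ops cob_LO)
  show "LM (c \<odot>\<^bsub>A.HC X Y l\<^esub> x) = c \<odot>\<^bsub>B.HC (LO X) (LO Y) l\<^esub> LM x"
    if "c \<in> carrier K" "x \<in> carrier (A.HC X Y l)" for c x
    using L(3)[OF that] that by (simp add: LM_eq[OF M.smult_closed[OF that]] LM_eq[OF that(2)] B.HC_ops cob_LO)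
qed (rule LM_closed[OF assms])

text \<open>Off the support of the middle complex the composite passes through \<open>None\<close>
  and is zero, and \<open>F\<close> preserves zero; elsewhere this is functoriality of
  \<open>F\<close> entry by entry.\<close>

lemma LM_gComp:
  assumes X: "X \<in> A.Ob" and Y: "Y \<in> A.Ob" and Z: "Z \<in> A.Ob"
    and f: "f \<in> carrier (A.HC X Y l)" and g: "g \<in> carrier (A.HC Y Z m)"
  shows "LM (gComp (Chb A) g f) = gComp (Chb B) (LM g) (LM f)"
proof -
  note gf = A.gComp_closed[OF X Y Z f g]
  have fg: "src f = X" "tgt f = Y" "deg f = l" "src g = Y" "tgt g = Z" "deg g = m"
    "\<And>i. val f i \<in> carrier (A.H (cob X i) (cob Y (i + l)))" "\<And>i. val g i \<in> carrier (A.H (cob Y i) (cob Z (i + m)))"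
    using f g by (auto simp: A.HC_iff)
  have e: "i + (m + l) = i + l + m" for i :: int by simp
  have v: "val (gComp (Chb A) g f) i = A.cmp (cob X i) (cob Y (i + l)) (cob Z (i + l + m)) (val g (i + l)) (val f i)" for i
    using fg by (simp add: A.gComp_eq)
  have "B.cmp (ch X k) (ch Y (k + l)) (ch Z (k + l + m)) (diag Y (k + l) Z (k + l + m) m (ent Y Z m (val g) (k + l)))
      (diag X k Y (k + l) l (ent X Y l (val f) k)) = diag X k Z (k + l + m) (m + l) (ent X Z (m + l) (val (gComp (Chb A) g f)) k)" for k
  proof (rule diag_comp[OF X Y Z ent_data[OF X Y f] ent_data[OF Y Z g]])
    fix i assume i: "i \<in> supp X" "i + l \<in> supp Y" "i + l + m \<in> supp Z"
    note x = cob_cases[OF X i(1)] and y = cob_cases[OF Y i(2)] and z = cob_cases[OF Z i(3)]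
    have H: "val f i \<in> carrier (Hom A (the (cob X i)) (the (cob Y (i + l))))"
      "val g (i + l) \<in> carrier (Hom A (the (cob Y (i + l))) (the (cob Z (i + l + m))))"
      using fg(7)[of i] fg(8)[of "i + l"] entry_sm(2)[OF X Y i(1,2)] entry_sm(2)[OF Y Z i(2,3)] by auto
    have vi: "val (gComp (Chb A) g f) i =
      Comp A (the (cob X i)) (the (cob Y (i + l))) (the (cob Z (i + l + m))) (val g (i + l)) (val f i)"
    proof -
      obtain a b c where "cob X i = Some a" "cob Y (i + l) = Some b" "cob Z (i + l + m) = Some c"
        using x(1) y(1) z(1) by blast
      then show ?thesis by (simp add: v adj_zero_simps)
    qed
    show "ent X Z (m + l) (val (gComp (Chb A) g f)) k i = B.cmp (sm X k i) (sm Y (k + l) (i + l)) (sm Z (k + l + m) (i + l + m))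
        (ent Y Z m (val g) (k + l) (i + l)) (ent X Y l (val f) k i)"
      unfolding ent_def vi e FX_comp[OF x(2) y(2) z(2) H] sm_eq[OF X i(1)] sm_eq[OF Y i(2)] sm_eq[OF Z i(3)] by simp
  next
    fix i assume i: "i \<in> supp X" "i + l \<notin> supp Y" "i + l + m \<in> supp Z"
    note x = cob_cases[OF X i(1)] and z = cob_cases[OF Z i(3)]
    have "val (gComp (Chb A) g f) i = \<zero>\<^bsub>Hom A (the (cob X i)) (the (cob Z (i + l + m)))\<^esub>"
    proof -
      obtain a c where "cob X i = Some a" "cob Z (i + l + m) = Some c" using x(1) z(1) by blast
      moreover have "cob Y (i + l) = None" using i(2) by (simp add: supp_def)
      ultimately show ?thesis by (simp add: v adj_zero_simps)
    qed
    then have "ent X Z (m + l) (val (gComp (Chb A) g f)) k i =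
      \<zero>\<^bsub>B.H (cob (fobj F (the (cob X i))) (k - i)) (cob (fobj F (the (cob Z (i + l + m)))) (k - i))\<^esub>"
      using linear_map_zero[OF A.A.module_Hom B.H_module FX_linear[OF x(2) z(2)]] x(2) z(2) F_obj
      by (simp add: ent_def e)
    then show "ent X Z (m + l) (val (gComp (Chb A) g f)) k i = \<zero>\<^bsub>B.H (sm X k i) (sm Z (k + l + m) (i + l + m))\<^esub>"
      using sm_eq[OF X i(1)] sm_eq[OF Z i(3)] by simp
  qed simp
  then show ?thesis
    unfolding LM_eq[OF gf] LM_eq[OF f] LM_eq[OF g] B.gComp_eq by (simp add: cob_LO e)
qed

section \<open>The differential of the lifted complex\<close>

definition ent2 :: "('o,'m) cplx \<Rightarrow> int \<Rightarrow> int \<Rightarrow> 'n" where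
  "ent2 X k i = signed (B.H (sm X k i) (sm X (k + 1) i)) i (cdif (fobj F (the (cob X i))) (k - i))"

text \<open>The part of the lifted differential that comes from the complexes \<open>F(X^i)\<close>;
  the other part is the lift of \<open>delta X\<close>.\<close>

definition D2 :: "('o,'m) cplx \<Rightarrow> int \<Rightarrow> 'n" where
  "D2 X k = diag X k X (k + 1) 0 (ent2 X k)"

lemma cdif_sm:
  assumes "X \<in> A.Ob" "i \<in> supp X"
  shows "cdif (fobj F (the (cob X i))) (k - i) \<in> carrier (B.H (sm X k i) (sm X (k + 1) i))"
  using B.ObD(3)[OF F_obj[OF cob_cases(2)[OF assms]], of "k - i"] sm_eq[OF assms]
  by (simp add: algebra_simps)

lemma ent2_data: "X \<in> A.Ob \<Longrightarrow> ent2 X k \<in> diag_data X k X (k + 1) 0"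
  unfolding diag_data_def ent2_def by (auto intro: signed_closed[OF sm_module] cdif_sm)

lemma cdif_LO:
  assumes X: "X \<in> A.Ob"
  shows "cdif (LO X) k = val (LM (delta X)) k \<oplus>\<^bsub>B.H (ch X k) (ch X (k + 1))\<^esub> D2 X k"
proof -
  interpret M: module K "B.H (ch X k) (ch X (k + 1))" by (rule ch_module[OF X X])
  have "finsum (B.H (ch X k) (ch X (k + 1))) (\<lambda>i. signed (B.H (ch X k) (ch X (k + 1))) i (me X k i X (k + 1) i
         (cdif (fobj F (the (cob X i))) (k - i)))) (supp X) = D2 X k"
    unfolding D2_def diag_def
  proof (rule M.M.finsum_cong')
    show "(\<lambda>i. me X k i X (k + 1) (i + 0) (ent2 X k i)) \<in> {i \<in> supp X. i + 0 \<in> supp X} \<rightarrow> carrier (B.H (ch X k) (ch X (k + 1)))"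
      by (rule diag_terms[OF X X ent2_data[OF X]])
  next
    fix i assume "i \<in> {i \<in> supp X. i + 0 \<in> supp X}"
    then have i: "i \<in> supp X" by simp
    show "signed (B.H (ch X k) (ch X (k + 1))) i (me X k i X (k + 1) i (cdif (fobj F (the (cob X i))) (k - i))) =
      me X k i X (k + 1) (i + 0) (ent2 X k i)"
      unfolding ent2_def using linear_map_signed[OF sm_module[OF X X] ch_module[OF X X] me_linear[OF X X i i] cdif_sm[OF X i]]
      by simp
  qed simp
  then show ?thesis
    by (simp add: lift_ob_def Let_def lift_mor_def delta_def)
qed

lemma D2_closed: "X \<in> A.Ob \<Longrightarrow> D2 X k \<in> carrier (B.H (ch X k) (ch X (k + 1)))"
  unfolding D2_def by (intro diag_closed ent2_data)

lemma cdif_FX: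
  assumes "X \<in> A.Ob" "Y \<in> A.Ob" "f \<in> carrier (A.HC X Y l)" "i \<in> supp X" "i + l \<in> supp Y"
  shows "B.cmp (sm X k i) (sm Y (k + l) (i + l)) (sm Y (k + l + 1) (i + l))
      (cdif (fobj F (the (cob Y (i + l)))) (k + l - (i + l))) (ent X Y l (val f) k i) =
    B.cmp (sm X k i) (sm X (k + 1) i) (sm Y (k + l + 1) (i + l)) (ent X Y l (val f) (k + 1) i)
      (cdif (fobj F (the (cob X i))) (k - i))"
proof -
  have "val f i \<in> carrier (Hom A (the (cob X i)) (the (cob Y (i + l))))"
    using assms(3) entry_sm(2)[OF assms(1,2,4,5)] unfolding A.HC_iff by metis
  from FX_chain_map[OF cob_cases(2)[OF assms(1,4)] cob_cases(2)[OF assms(2,5)] this, of "k - i"]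
  show ?thesis unfolding ent_def sm_eq[OF assms(1,4)] sm_eq[OF assms(2,5)] by (simp add: algebra_simps)
qed

text \<open>Each \<open>F(f)\<close> is a chain map, so the two composites have the same entries up
  to weights: \<open>(-1)^(i+l)\<close> if the entry has already moved to summand
  \<open>i + l\<close>, and \<open>(-1)^i\<close> if it has not.\<close>

lemma D2_LM:
  assumes X: "X \<in> A.Ob" and Y: "Y \<in> A.Ob" and f: "f \<in> carrier (A.HC X Y l)"
  shows "B.cmp (ch X k) (ch Y (k + l)) (ch Y (k + l + 1)) (D2 Y (k + l)) (val (LM f) k) =
    signed (B.H (ch X k) (ch Y (k + l + 1))) l
      (B.cmp (ch X k) (ch X (k + 1)) (ch Y (k + l + 1)) (val (LM f) (k + 1)) (D2 X k))"
proof -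
  define t where "t i = B.cmp (sm X k i) (sm X (k + 1) i) (sm Y (k + l + 1) (i + l)) (ent X Y l (val f) (k + 1) i)
      (cdif (fobj F (the (cob X i))) (k - i))" for i
  have e: "k + 1 + l = k + l + 1" by simp
  note ed = ent_data[OF X Y f, of k] ent_data[OF X Y f, of "k + 1", unfolded e]
  have ei: "ent X Y l (val f) k i \<in> carrier (B.H (sm X k i) (sm Y (k + l) (i + l)))"
    "ent X Y l (val f) (k + 1) i \<in> carrier (B.H (sm X (k + 1) i) (sm Y (k + l + 1) (i + l)))"
    if "i \<in> supp X" "i + l \<in> supp Y" for i using ed that by (auto simp: diag_data_def)
  have tc: "t i \<in> carrier (B.H (sm X k i) (sm Y (k + l + 1) (i + l)))" if "i \<in> supp X" "i + l \<in> supp Y" for i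
    unfolding t_def by (intro B.Z.Comp_closed sm_obj X Y cdif_sm that ei)
  have 1: "B.cmp (ch X k) (ch Y (k + l)) (ch Y (k + l + 1)) (D2 Y (k + l)) (val (LM f) k) =
    diag X k Y (k + l + 1) l (\<lambda>i. signed (B.H (sm X k i) (sm Y (k + l + 1) (i + l))) (i + l) (t i))"
    unfolding LM_eq[OF f] harr.sel D2_def
  proof (rule diag_comp[OF X Y Y ed(1) ent2_data[OF Y]])
    fix i assume i: "i \<in> supp X" "i + l \<in> supp Y"
    show "signed (B.H (sm X k i) (sm Y (k + l + 1) (i + l))) (i + l) (t i) =
      B.cmp (sm X k i) (sm Y (k + l) (i + l)) (sm Y (k + l + 1) (i + l + 0)) (ent2 Y (k + l) (i + l)) (ent X Y l (val f) k i)"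
      unfolding ent2_def t_def cdif_FX[OF X Y f i, symmetric] add_0_right
      by (rule linear_map_signed[OF sm_module[OF Y Y] sm_module[OF X Y]
          B.Z.Comp_linear_left[OF sm_obj[OF X] sm_obj[OF Y] sm_obj[OF Y] ei(1)[OF i]] cdif_sm[OF Y i(2)], symmetric])
  qed simp_all
  have 2: "B.cmp (ch X k) (ch X (k + 1)) (ch Y (k + l + 1)) (val (LM f) (k + 1)) (D2 X k) =
    diag X k Y (k + l + 1) l (\<lambda>i. signed (B.H (sm X k i) (sm Y (k + l + 1) (i + l))) i (t i))"
    unfolding LM_eq[OF f] harr.sel D2_def e
  proof (rule diag_comp[OF X X Y ent2_data[OF X] ed(2)])
    fix i assume i: "i \<in> supp X" "i + 0 + l \<in> supp Y"
    then have i': "i + l \<in> supp Y" by simp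
    show "signed (B.H (sm X k i) (sm Y (k + l + 1) (i + l))) i (t i) =
      B.cmp (sm X k i) (sm X (k + 1) (i + 0)) (sm Y (k + l + 1) (i + 0 + l)) (ent X Y l (val f) (k + 1) (i + 0)) (ent2 X k i)"
      unfolding ent2_def t_def add_0_right
      by (rule linear_map_signed[OF sm_module[OF X X] sm_module[OF X Y]
          B.Z.Comp_linear_right[OF sm_obj[OF X] sm_obj[OF X] sm_obj[OF Y] ei(2)[OF i(1) i']] cdif_sm[OF X i(1)], symmetric])
  qed simp_all
  have d: "(\<lambda>i. signed (B.H (sm X k i) (sm Y (k + l + 1) (i + l))) (e i) (t i)) \<in> diag_data X k Y (k + l + 1) l" for e
    using tc by (auto simp: diag_data_def intro: signed_closed[OF sm_module[OF X Y]])
  show ?thesis unfolding 1 2 diag_signed[OF X Y d]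
  proof (rule diag_cong[OF X Y])
    show "(\<lambda>i. signed (B.H (sm X k i) (sm Y (k + l + 1) (i + l))) l (signed (B.H (sm X k i) (sm Y (k + l + 1) (i + l))) i (t i)))
      \<in> diag_data X k Y (k + l + 1) l"
      using tc by (auto simp: diag_data_def intro!: signed_closed[OF sm_module[OF X Y]])
  next
    fix i assume i: "i \<in> supp X" "i + l \<in> supp Y"
    show "signed (B.H (sm X k i) (sm Y (k + l + 1) (i + l))) (i + l) (t i) =
      signed (B.H (sm X k i) (sm Y (k + l + 1) (i + l))) l (signed (B.H (sm X k i) (sm Y (k + l + 1) (i + l))) i (t i))"
      unfolding signed_signed[OF sm_module[OF X Y] tc[OF i]] by (simp add: add.commute)
  qed
qed

lemma D2_D2:
  assumes X: "X \<in> A.Ob"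
  shows "B.cmp (ch X k) (ch X (k + 1)) (ch X (k + 2)) (D2 X (k + 1)) (D2 X k) = \<zero>\<^bsub>B.H (ch X k) (ch X (k + 2))\<^esub>"
proof -
  have e: "k + 1 + 1 = k + 2" by simp
  have "B.cmp (ch X k) (ch X (k + 1)) (ch X (k + 2)) (D2 X (k + 1)) (D2 X k) =
    diag X k X (k + 2) 0 (\<lambda>i. \<zero>\<^bsub>B.H (sm X k i) (sm X (k + 2) (i + 0))\<^esub>)"
    unfolding D2_def e
  proof (rule diag_comp[OF X X X ent2_data[OF X] ent2_data[OF X, of "k + 1", unfolded e]])
    fix i assume i: "i \<in> supp X"
    note c = cdif_sm[OF X i, of k] cdif_sm[OF X i, of "k + 1", unfolded e]
    note c' = signed_closed[OF sm_module[OF X X] c(1)]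
    have z: "B.cmp (sm X k i) (sm X (k + 1) i) (sm X (k + 2) i) (cdif (fobj F (the (cob X i))) (k + 1 - i))
        (cdif (fobj F (the (cob X i))) (k - i)) = \<zero>\<^bsub>B.H (sm X k i) (sm X (k + 2) i)\<^esub>"
      using F_obj[OF cob_cases(2)[OF X i]] unfolding B.Ob_iff sm_eq[OF X i]
      by (auto simp: algebra_simps dest!: spec[of _ "k - i"])
    have "B.cmp (sm X k i) (sm X (k + 1) i) (sm X (k + 2) i) (ent2 X (k + 1) i) (ent2 X k i) = \<zero>\<^bsub>B.H (sm X k i) (sm X (k + 2) i)\<^esub>"
      unfolding ent2_def e
        linear_map_signed[OF sm_module[OF X X] sm_module[OF X X] B.Z.Comp_linear_left[OF sm_obj[OF X] sm_obj[OF X] sm_obj[OF X] c'] c(2)]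
        linear_map_signed[OF sm_module[OF X X] sm_module[OF X X] B.Z.Comp_linear_right[OF sm_obj[OF X] sm_obj[OF X] sm_obj[OF X] c(2)] c(1)]
        z signed_zero[OF sm_module[OF X X]] ..
    then show "\<zero>\<^bsub>B.H (sm X k i) (sm X (k + 2) (i + 0))\<^esub> =
      B.cmp (sm X k i) (sm X (k + 1) (i + 0)) (sm X (k + 2) (i + 0 + 0)) (ent2 X (k + 1) (i + 0)) (ent2 X k i)" by simp
  qed simp_all
  also have "\<dots> = \<zero>\<^bsub>B.H (ch X k) (ch X (k + 2))\<^esub>" by (rule diag_zero[OF X X]) simp
  finally show ?thesis .
qed

lemma LM_zero: "X \<in> A.Ob \<Longrightarrow> Y \<in> A.Ob \<Longrightarrow> val (LM \<zero>\<^bsub>A.HC X Y l\<^esub>) k = \<zero>\<^bsub>B.H (ch X k) (ch Y (k + l))\<^esub>"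
proof -
  assume o: "X \<in> A.Ob" "Y \<in> A.Ob"
  interpret M: module K "A.HC X Y l" by (rule A.HC_module[OF o])
  have "diag X k Y (k + l) l (ent X Y l (val \<zero>\<^bsub>A.HC X Y l\<^esub>) k) = \<zero>\<^bsub>B.H (ch X k) (ch Y (k + l))\<^esub>"
    by (rule linear_map_zero[OF A.HC_module[OF o] ch_module[OF o] LM_val_linear[OF o]])
  then show ?thesis unfolding LM_eq[OF M.M.zero_closed] by simp
qed

text \<open>The square of the differential vanishes because the lift of \<open>delta X\<close> and
  \<open>D2\<close> both square to zero and the mixed terms cancel. Boundedness holds because, by
  the clause of \<open>chosen_sum\<close> for zero summands, a chain object is nonzero only if one
  of its finitely many summands is.\<close>

lemma LO_Ob:
  assumes X: "X \<in> A.Ob"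
  shows "LO X \<in> B.Ob"
proof -
  have "supp (LO X) \<subseteq> (\<Union>i\<in>supp X. (\<lambda>j. j + i) ` supp (fobj F (the (cob X i))))"
  proof
    fix k assume "k \<in> supp (LO X)"
    then have "ch X k \<noteq> None" by (simp add: supp_def cob_LO)
    then have "\<not> (\<forall>i\<in>supp X. sm X k i = None)" using lift_sum_props(2)[OF X, of k] by argo
    then obtain i where i: "i \<in> supp X" "sm X k i \<noteq> None" unfolding Ball_def by metis
    then have "k - i \<in> supp (fobj F (the (cob X i)))" using sm_eq[OF X i(1)] by (simp add: supp_def)
    then show "k \<in> (\<Union>i\<in>supp X. (\<lambda>j. j + i) ` supp (fobj F (the (cob X i))))"
      using i(1) by (intro UN_I[of i] image_eqI[of _ _ "k - i"]) simp_all
  qed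
  then have fin: "finite (supp (LO X))"
    by (rule finite_subset) (intro finite_UN_I A.ObD(1)[OF X] finite_imageI B.ObD(1) F_obj cob_cases(2)[OF X])
  note d = A.delta_closed[OF X]
  have a: "val (LM (delta X)) k \<in> carrier (B.H (ch X k) (ch X (k + 1)))" for k
    using LM_closed[OF X X d] by (simp add: B.HC_iff cob_LO)
  have cd: "cdif (LO X) k \<in> carrier (B.H (ch X k) (ch X (k + 1)))" for k
  proof -
    interpret M: module K "B.H (ch X k) (ch X (k + 1))" by (rule ch_module[OF X X])
    show ?thesis unfolding cdif_LO[OF X] using a D2_closed[OF X] by simp
  qed
  have sq: "B.cmp (ch X k) (ch X (k + 1)) (ch X (k + 2)) (cdif (LO X) (k + 1)) (cdif (LO X) k) = \<zero>\<^bsub>B.H (ch X k) (ch X (k + 2))\<^esub>" for k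
  proof -
    have e: "k + 1 + 1 = k + 2" by simp
    interpret M: module K "B.H (ch X k) (ch X (k + 2))" by (rule ch_module[OF X X])
    note o = ch_obj[OF X, of k] ch_obj[OF X, of "k + 1"] ch_obj[OF X, of "k + 2"]
    note a1 = a[of "k + 1", unfolded e] and D1 = D2_closed[OF X, of "k + 1", unfolded e]
    note L = linear_mapsD(2)[OF B.Z.Comp_linear_left[OF o cd] a1 D1]
    note R1 = linear_mapsD(2)[OF B.Z.Comp_linear_right[OF o a1] a[of k] D2_closed[OF X]]
    note R2 = linear_mapsD(2)[OF B.Z.Comp_linear_right[OF o D1] a[of k] D2_closed[OF X]]
    let ?c = "B.cmp (ch X k) (ch X (k + 1)) (ch X (k + 2))"
    have aa: "?c (val (LM (delta X)) (k + 1)) (val (LM (delta X)) k) = \<zero>\<^bsub>B.H (ch X k) (ch X (k + 2))\<^esub>"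
    proof -
      have "val (gComp (Chb B) (LM (delta X)) (LM (delta X))) k = \<zero>\<^bsub>B.H (ch X k) (ch X (k + 2))\<^esub>"
        unfolding LM_gComp[OF X X X d d, symmetric] A.delta_sq[OF X] LM_zero[OF X X] ..
      then show ?thesis unfolding LM_eq[OF d] by (simp add: B.gComp_eq cob_LO add.commute[of 2 k])
    qed
    \<comment> \<open>\<open>delta X\<close> has degree one, so graded commutation with
      \<open>D2\<close> is anticommutation.\<close>
    have da: "?c (D2 X (k + 1)) (val (LM (delta X)) k) = \<ominus>\<^bsub>B.H (ch X k) (ch X (k + 2))\<^esub> ?c (val (LM (delta X)) (k + 1)) (D2 X k)"
      using D2_LM[OF X X d, of k] unfolding e by (simp add: signed_def)
    have "?c (val (LM (delta X)) (k + 1)) (D2 X k) \<in> carrier (B.H (ch X k) (ch X (k + 2)))"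
      by (intro B.Z.Comp_closed o a1 D2_closed X)
    then show ?thesis
      unfolding cdif_LO[OF X, of "k + 1", unfolded e] L
      unfolding cdif_LO[OF X, of k] R1 R2 aa da D2_D2[OF X] by (simp add: M.M.r_neg)
  qed
  show ?thesis unfolding B.Ob_iff cob_LO using fin ch_obj[OF X] cd sq by blast
qed

text \<open>By graded commutation the contributions of \<open>D2\<close> to the commutator with the
  lifted differential cancel, leaving the lift of the commutator with \<open>delta\<close>.\<close>

lemma LM_dif:
  assumes X: "X \<in> A.Ob" and Y: "Y \<in> A.Ob" and f: "f \<in> carrier (A.HC X Y l)"
  shows "LM (dif (Chb A) f) = dif (Chb B) (LM f)"
proof -
  let ?H = "B.HC (LO X) (LO Y) (l + 1)"
  interpret M: module K ?H by (rule B.HC_module[OF LO_Ob[OF X] LO_Ob[OF Y]])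
  note MA = A.HC_module[OF X Y, of "l + 1"]
  have e: "1 + l = l + 1" by simp
  note oX = LO_Ob[OF X] and oY = LO_Ob[OF Y] and dX = A.delta_closed[OF X] and dY = A.delta_closed[OF Y]
  note Lf = LM_closed[OF X Y f] and LdX = LM_closed[OF X X dX] and LdY = LM_closed[OF Y Y dY]
  define DD where "DD Z = Arr (LO Z) (LO Z) 1 (D2 Z)" for Z
  have DD: "DD Z \<in> carrier (B.HC (LO Z) (LO Z) 1)" if "Z \<in> A.Ob" for Z
    using D2_closed[OF that] by (simp add: B.HC_iff DD_def cob_LO)
  have dl: "delta (LO Z) = LM (delta Z) \<oplus>\<^bsub>B.HC (LO Z) (LO Z) 1\<^esub> DD Z" if "Z \<in> A.Ob" for Z
    using cdif_LO[OF that] by (simp add: delta_def[of "LO Z"] B.HC_ops DD_def cob_LO fun_eq_iff)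
  have c: "gComp (Chb B) (DD Y) (LM f) = signed ?H l (gComp (Chb B) (LM f) (DD X))"
  proof (rule B.HC_eqI)
    show cl: "gComp (Chb B) (DD Y) (LM f) \<in> carrier ?H"
      using B.gComp_closed[OF oX oY oY Lf DD[OF Y]] unfolding e .
    have cr: "gComp (Chb B) (LM f) (DD X) \<in> carrier ?H" by (rule B.gComp_closed[OF oX oX oY DD[OF X] Lf])
    then show "signed ?H l (gComp (Chb B) (LM f) (DD X)) \<in> carrier ?H" by (rule signed_closed[OF M.module_axioms])
    fix k
    have "val (signed ?H l (gComp (Chb B) (LM f) (DD X))) k =
      signed (B.H (cob (LO X) k) (cob (LO Y) (k + (l + 1)))) l (val (gComp (Chb B) (LM f) (DD X)) k)"
      by (rule linear_map_signed[OF M.module_axioms B.H_module[OF oX oY] B.HC_val_linear cr])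
    then show "val (gComp (Chb B) (DD Y) (LM f)) k = val (signed ?H l (gComp (Chb B) (LM f) (DD X))) k"
      using D2_LM[OF X Y f, of k] Lf by (simp add: B.gComp_eq DD_def cob_LO B.HC_iff algebra_simps)
  qed
  define p where "p = gComp (Chb B) (LM (delta Y)) (LM f)"
  define q where "q = gComp (Chb B) (LM f) (LM (delta X))"
  define r where "r = gComp (Chb B) (LM f) (DD X)"
  have p: "p \<in> carrier ?H" unfolding p_def using B.gComp_closed[OF oX oY oY Lf LdY] unfolding e .
  have q: "q \<in> carrier ?H" unfolding q_def by (rule B.gComp_closed[OF oX oX oY LdX Lf])
  have r: "r \<in> carrier ?H" unfolding r_def by (rule B.gComp_closed[OF oX oX oY DD[OF X] Lf])
  note sl = signed_closed[OF M.module_axioms, of _ l]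
  have 1: "LM (dif (Chb A) f) = p \<ominus>\<^bsub>?H\<^esub> signed ?H l q"
  proof -
    have a: "gComp (Chb A) (delta Y) f \<in> carrier (A.HC X Y (l + 1))"
      using A.gComp_closed[OF X Y Y f dY] unfolding e .
    note b = A.gComp_closed[OF X X Y dX f]
    show ?thesis
      unfolding A.dif_eq[OF X Y f] linear_map_minus[OF MA M.module_axioms LM_linear[OF X Y] a signed_closed[OF MA b]]
        linear_map_signed[OF MA M.module_axioms LM_linear[OF X Y] b] LM_gComp[OF X Y Y f dY] LM_gComp[OF X X Y dX f]
        p_def q_def ..
  qed
  have 2: "gComp (Chb B) (delta (LO Y)) (LM f) = p \<oplus>\<^bsub>?H\<^esub> signed ?H l r"
    unfolding dl[OF Y] linear_mapsD(2)[OF B.gComp_lin_left[OF oX oY oY Lf] LdY DD[OF Y]] p_def r_def c e ..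
  have 3: "gComp (Chb B) (LM f) (delta (LO X)) = q \<oplus>\<^bsub>?H\<^esub> r"
    unfolding dl[OF X] linear_mapsD(2)[OF B.gComp_lin_right[OF oX oX oY Lf] LdX DD[OF X]] q_def r_def ..
  have "dif (Chb B) (LM f) = (p \<oplus>\<^bsub>?H\<^esub> signed ?H l r) \<ominus>\<^bsub>?H\<^esub> (signed ?H l q \<oplus>\<^bsub>?H\<^esub> signed ?H l r)"
    unfolding B.dif_eq[OF oX oY Lf] 2 3 signed_add[OF M.module_axioms q r] ..
  also have "\<dots> = p \<ominus>\<^bsub>?H\<^esub> signed ?H l q"
  proof -
    let ?s = "signed ?H l r" and ?t = "signed ?H l q"
    have "(p \<oplus>\<^bsub>?H\<^esub> ?s) \<ominus>\<^bsub>?H\<^esub> (?t \<oplus>\<^bsub>?H\<^esub> ?s) = (p \<oplus>\<^bsub>?H\<^esub> \<ominus>\<^bsub>?H\<^esub> ?t) \<oplus>\<^bsub>?H\<^esub> (?s \<oplus>\<^bsub>?H\<^esub> \<ominus>\<^bsub>?H\<^esub> ?s)"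
      using p sl[OF q] sl[OF r] by (simp add: M.M.minus_eq M.M.minus_add M.M.a_ac del: M.M.r_neg)
    then show ?thesis using p sl[OF q] sl[OF r] by (simp add: M.M.minus_eq M.M.r_neg)
  qed
  finally show ?thesis unfolding 1 by simp
qed

text \<open>Equality rather than isomorphism: with a single summand \<open>chosen_sum\<close>
  returns that summand with identities, and the weight of its differential is
  \<open>(-1)^0\<close>.\<close>

lemma LO_emb:
  assumes y: "y \<in> Obj A" and E: "emb_ob y \<in> A.Ob"
  shows "LO (emb_ob y) = fobj F y"
    "i = 0 \<Longrightarrow> inc (emb_ob y) k i = Ident (adj_zero B) (cob (fobj F y) k)"
    "i = 0 \<Longrightarrow> prj (emb_ob y) k i = Ident (adj_zero B) (cob (fobj F y) k)"
    "ch (emb_ob y) k = cob (fobj F y) k"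
proof -
  have s: "supp (emb_ob y :: ('o,'m) cplx) = {0}" by (auto simp: supp_def emb_ob_def)
  have sm: "sm (emb_ob y) k 0 = cob (fobj F y) k" for k by (simp add: summand_def emb_ob_def)
  have P: "ch (emb_ob y) k = cob (fobj F y) k" "inc (emb_ob y) k 0 = Ident (adj_zero B) (cob (fobj F y) k)"
    "prj (emb_ob y) k 0 = Ident (adj_zero B) (cob (fobj F y) k)" for k
    using lift_sum_props(3)[OF E, of 0 k] s sm by auto
  show "i = 0 \<Longrightarrow> inc (emb_ob y) k i = Ident (adj_zero B) (cob (fobj F y) k)"
    "i = 0 \<Longrightarrow> prj (emb_ob y) k i = Ident (adj_zero B) (cob (fobj F y) k)"
    "ch (emb_ob y) k = cob (fobj F y) k" using P by auto
  have "cdif (LO (emb_ob y)) k = cdif (fobj F y) k" for k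
  proof -
    note o = B.ObD(2)[OF F_obj[OF y]] and c = B.ObD(3)[OF F_obj[OF y], of k]
    interpret M: module K "B.H (cob (fobj F y) k) (cob (fobj F y) (k + 1))" by (rule B.H_module[OF F_obj[OF y] F_obj[OF y]])
    have "me (emb_ob y) k 0 (emb_ob y) (k + 1) 0 (cdif (fobj F y) k) = cdif (fobj F y) k"
      unfolding matrix_entry_def P sm using o c by (simp add: B.Z.Comp_Ident_left B.Z.Comp_Ident_right)
    moreover have e: "{i \<in> supp (emb_ob y :: ('o,'m) cplx). i + 1 \<in> supp (emb_ob y :: ('o,'m) cplx)} = {}"
      using s by auto
    moreover have "cob (emb_ob y :: ('o,'m) cplx) 0 = Some y" by (simp add: emb_ob_def)
    ultimately show ?thesis using c unfolding lift_ob_def Let_def cplx.sel e by (simp add: s P Pi_def)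
  qed
  then show "LO (emb_ob y) = fobj F y" by (intro cplx.expand) (simp add: cob_LO P fun_eq_iff)
qed

end

section \<open>Complexes concentrated in degree zero\<close>

context cplx_cat
begin

sublocale D: deg0_cat K A
  by (rule deg0_cat.intro) (rule A.linear_category_axioms)

lemma supp_emb: "supp (emb_ob y :: ('o,'m) cplx) = {0}"
  by (auto simp: supp_def emb_ob_def)

lemma cob_emb: "cob (emb_ob y) i = (if i = 0 then Some y else None)"
  by (simp add: emb_ob_def)

lemma emb_Ob: "y \<in> Obj A \<Longrightarrow> emb_ob y \<in> Ob"
  unfolding Ob_iff supp_emb by (auto simp: emb_ob_def adj_zero_simps)

lemma H_emb: "H (cob (emb_ob y :: ('o,'m) cplx) i) (cob (emb_ob y' :: ('o,'m) cplx) j) =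
    (if i = 0 \<and> j = 0 then Hom A y y' else zero_module)"
  by (simp add: cob_emb adj_zero_simps)

text \<open>Inverse to \<open>emb_mor\<close> on Hom modules. In nonzero degree a morphism between
  such complexes has only \<open>undefined\<close> components, while \<open>dg_of A\<close> stores
  the zero of the Hom module, so that value is supplied explicitly.\<close>

definition unemb :: "(('o,'m) cplx, int \<Rightarrow> 'm) harr \<Rightarrow> ('o,'m) harr" where
  "unemb f = (let x = the (cob (src f) 0); y = the (cob (tgt f) 0) in
     Arr x y (deg f) (if deg f = 0 then val f 0 else \<zero>\<^bsub>Hom A x y\<^esub>))"

lemma HC_emb_iff: "f \<in> carrier (HC (emb_ob y) (emb_ob y') k) \<longleftrightarrow>
    src f = emb_ob y \<and> tgt f = emb_ob y' \<and> deg f = k \<and>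
    (\<forall>i. if i = 0 \<and> k = 0 then val f i \<in> carrier (Hom A y y') else val f i = undefined)"
  unfolding HC_iff H_emb by (auto split: if_splits)

lemma unemb_eq: "f \<in> carrier (HC (emb_ob y) (emb_ob y') k) \<Longrightarrow>
    unemb f = Arr y y' k (if k = 0 then val f 0 else \<zero>\<^bsub>Hom A y y'\<^esub>)"
  by (simp add: HC_emb_iff unemb_def cob_emb Let_def)

lemma unemb_closed:
  "f \<in> carrier (HC (emb_ob y) (emb_ob y') k) \<Longrightarrow> unemb f \<in> carrier (gHom (dg_of A) y y' k)"
  using unemb_eq[of f y y' k] by (auto simp: HC_emb_iff D.gHom_iff)

lemma unemb_linear:
  assumes "y \<in> Obj A" "y' \<in> Obj A"
  shows "unemb \<in> linear_maps K (HC (emb_ob y) (emb_ob y') k) (gHom (dg_of A) y y' k)"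
proof (rule linear_mapsI)
  interpret M: module K "HC (emb_ob y) (emb_ob y') k" by (intro HC_module emb_Ob assms)
  interpret N: module K "Hom A y y'" by (rule A.module_Hom[OF assms])
  fix f g assume f: "f \<in> carrier (HC (emb_ob y) (emb_ob y') k)" and g: "g \<in> carrier (HC (emb_ob y) (emb_ob y') k)"
  show "unemb (f \<oplus>\<^bsub>HC (emb_ob y) (emb_ob y') k\<^esub> g) = unemb f \<oplus>\<^bsub>gHom (dg_of A) y y' k\<^esub> unemb g"
    unfolding unemb_eq[OF M.a_closed[OF f g]] unemb_eq[OF f] unemb_eq[OF g]
    by (simp add: D.gHom_ops HC_ops H_emb)
next
  interpret M: module K "HC (emb_ob y) (emb_ob y') k" by (intro HC_module emb_Ob assms)
  interpret N: module K "Hom A y y'" by (rule A.module_Hom[OF assms])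
  fix c f assume c: "c \<in> carrier K" and f: "f \<in> carrier (HC (emb_ob y) (emb_ob y') k)"
  show "unemb (c \<odot>\<^bsub>HC (emb_ob y) (emb_ob y') k\<^esub> f) = c \<odot>\<^bsub>gHom (dg_of A) y y' k\<^esub> unemb f"
    unfolding unemb_eq[OF M.smult_closed[OF c f]] unemb_eq[OF f] using c
    by (simp add: D.gHom_ops HC_ops H_emb)
qed (rule unemb_closed)

lemma emb_mor_closed:
  "f \<in> carrier (gHom (dg_of A) y y' k) \<Longrightarrow> emb_mor f \<in> carrier (HC (emb_ob y) (emb_ob y') k)"
  by (auto simp: D.gHom_iff HC_emb_iff emb_mor_def)

lemma unemb_emb: "f \<in> carrier (gHom (dg_of A) y y' k) \<Longrightarrow> unemb (emb_mor f) = f"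
  using unemb_eq[OF emb_mor_closed, of f y y' k]
  by (intro harr.expand) (auto simp: D.gHom_iff emb_mor_def)

text \<open>In nonzero degree every component starts or ends at a zero chain object. Nontrivial
  middle entries of a relative symbol are thus confined to degree zero.\<close>

lemma emb_zero:
  assumes "y \<in> Obj A" "y' \<in> Obj A" "f \<in> carrier (HC (emb_ob y) (emb_ob y') k)" "k \<noteq> 0"
  shows "f = \<zero>\<^bsub>HC (emb_ob y) (emb_ob y') k\<^esub>"
proof -
  interpret M: module K "HC (emb_ob y) (emb_ob y') k" by (intro HC_module emb_Ob assms)
  show ?thesis
  proof (rule HC_eqI[OF assms(3) M.M.zero_closed])
    show "val f i = val \<zero>\<^bsub>HC (emb_ob y) (emb_ob y') k\<^esub> i" for i
      using assms(3,4) M.M.zero_closed by (simp add: HC_emb_iff)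
  qed
qed

lemma unemb_gComp:
  assumes o: "y \<in> Obj A" "y' \<in> Obj A" "y'' \<in> Obj A" and f: "f \<in> carrier (HC (emb_ob y) (emb_ob y') k)"
    and g: "g \<in> carrier (HC (emb_ob y') (emb_ob y'') l)"
  shows "unemb (gComp (Chb A) g f) = gComp (dg_of A) (unemb g) (unemb f)"
proof -
  have fg: "src f = emb_ob y" "tgt f = emb_ob y'" "deg f = k" "src g = emb_ob y'" "tgt g = emb_ob y''" "deg g = l"
    using f g by (auto simp: HC_emb_iff)
  note gf = gComp_closed[OF emb_Ob[OF o(1)] emb_Ob[OF o(2)] emb_Ob[OF o(3)] f g]
  have v: "val (unemb f) \<in> carrier (Hom A y y')" "val (unemb g) \<in> carrier (Hom A y' y'')"
    using D.val_in[OF o(1,2) unemb_closed[OF f]] D.val_in[OF o(2,3) unemb_closed[OF g]] .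
  show ?thesis
  proof (cases "k = 0 \<and> l = 0")
    case True
    then show ?thesis unfolding unemb_eq[OF gf] unemb_eq[OF f] unemb_eq[OF g]
      using fg by (simp add: gComp_eq D.gComp_eq cob_emb adj_zero_simps)
  next
    case False
    then have "Comp A y y' y'' (val (unemb g)) (val (unemb f)) = \<zero>\<^bsub>Hom A y y''\<^esub>"
      using v o unemb_eq[OF f] unemb_eq[OF g] by (auto simp: A.Comp_zero_left A.Comp_zero_right)
    then have r: "gComp (dg_of A) (unemb g) (unemb f) = Arr y y'' (l + k) \<zero>\<^bsub>Hom A y y''\<^esub>"
      unfolding D.gComp_eq by (simp add: unemb_eq[OF f] unemb_eq[OF g])
    have "val (gComp (Chb A) g f) 0 = \<zero>\<^bsub>Hom A y y''\<^esub>" if "l + k = 0"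
      using False fg that by (simp add: gComp_eq cob_emb adj_zero_simps)
    then show ?thesis unfolding r unemb_eq[OF gf] by simp
  qed
qed

sublocale R: rel_bar K "Chb A" "emb_ob ` Obj A"
  by unfold_locales (auto intro: emb_Ob)

sublocale Bd: rel_bar K "dg_of A" "Obj A"
  by unfold_locales (simp add: dg_of_def)

lemma Ob_dg_of: "dgOb (dg_of A) = Obj A"
  by (simp add: dg_of_def)

end

context lifting
begin

text \<open>The lift extends \<open>F\<close> strictly, which lets an entry over \<open>A\<close> be
  moved between the lifted functor and the argument of \<open>\<tau>\<close>.\<close>

lemma LM_emb:
  assumes o: "y \<in> Obj A" "y' \<in> Obj A" and f: "f \<in> carrier (A.HC (emb_ob y) (emb_ob y') k)"
  shows "LM f = fmor F (A.unemb f)"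
proof -
  note e = A.emb_Ob[OF o(1)] A.emb_Ob[OF o(2)]
  note u = A.unemb_eq[OF f]
  note LE = LO_emb[OF o(1) e(1)] LO_emb[OF o(2) e(2)]
  have c: "LM f \<in> carrier (B.HC (fobj F y) (fobj F y') k)" using LM_closed[OF e f] unfolding LE .
  have c': "fmor F (A.unemb f) \<in> carrier (B.HC (fobj F y) (fobj F y') k)"
    by (rule linear_mapsD(1)[OF F_lin[OF o] A.unemb_closed[OF f]])
  show ?thesis
  proof (cases "k = 0")
    case False
    have "LM f = \<zero>\<^bsub>B.HC (fobj F y) (fobj F y') k\<^esub>"
      using linear_map_zero[OF A.HC_module[OF e] B.HC_module[OF LO_Ob LO_Ob] LM_linear[OF e], OF e, of k]
      unfolding LE by (subst A.emb_zero[OF o f False])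
    moreover have "A.unemb f = \<zero>\<^bsub>gHom (dg_of A) y y' k\<^esub>" using u False by (simp add: A.D.gHom_ops)
    then have "fmor F (A.unemb f) = \<zero>\<^bsub>B.HC (fobj F y) (fobj F y') k\<^esub>"
      using linear_map_zero[OF A.D.gHom_module[OF o] B.HC_module[OF F_obj[OF o(1)] F_obj[OF o(2)]] F_lin[OF o]] by simp
    ultimately show ?thesis by simp
  next
    case True
    have val: "val f 0 \<in> carrier (Hom A y y')" using f True unfolding A.HC_emb_iff by (auto dest: spec[of _ 0])
    have "val (LM f) p = val (fmor F (A.unemb f)) p" for p
    proof -
      note x = linear_mapsD(1)[OF FX_linear[OF o] val, of p]
      note ob = B.ObD(2)[OF F_obj[OF o(1)], of p] B.ObD(2)[OF F_obj[OF o(2)], of p]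
      interpret M: module K "B.H (cob (fobj F y) p) (cob (fobj F y') p)" by (rule B.H_module[OF F_obj[OF o(1)] F_obj[OF o(2)]])
      have sm: "sm (emb_ob y) p 0 = cob (fobj F y) p" "sm (emb_ob y') p 0 = cob (fobj F y') p"
        by (simp_all add: summand_def emb_ob_def)
      have "me (emb_ob y) p 0 (emb_ob y') p 0 (FX y y' (val f 0) p) = FX y y' (val f 0) p"
        unfolding matrix_entry_def LE sm LE(2)[OF refl] LE(3)[OF refl] LE(6)[OF refl] using x ob
        by (simp add: B.Z.Comp_Ident_left B.Z.Comp_Ident_right)
      moreover have "{i \<in> {0}. i + 0 \<in> {0}} = {0 :: int}" by auto
      ultimately show ?thesis unfolding LM_eq[OF f]
        using x True by (simp add: diag_def A.supp_emb LE ent_def A.cob_emb u Pi_def)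
    qed
    then show ?thesis by (rule B.HC_eqI[OF c c'])
  qed
qed

end

section \<open>Extending a natural transformation to the relative bar complex\<close>

lemma (in rel_bar) multilinear_comp:
  assumes "multilinear X X' n P \<phi>" "\<psi> \<in> linear_maps K P P'"
  shows "multilinear X X' n P' (\<lambda>fs. \<psi> (\<phi> fs))"
  by (rule multilinearI)
     (rule linear_mapsD(1)[OF assms(2) multilinear_closed[OF assms(1)]],
      assumption, rule linear_maps_comp[OF multilinear_linear[OF assms(1)] assms(2)])

lemma length_ge_2_split:
  assumes "2 \<le> length fs" obtains f mid g where "fs = f # mid @ [g]"
proof -
  obtain f t where "fs = f # t" "t \<noteq> []" using assms by (cases fs; cases "tl fs") simp_all
  then show ?thesis using that by (cases t rule: rev_cases) simp_all
qed

lemma successively_src: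
  assumes "successively (\<lambda>f g. src f = tgt g \<and> src f \<in> S) (a # t)" "t \<noteq> []"
  shows "src a \<in> S"
proof -
  obtain b u where t: "t = b # u" using assms(2) by (cases t) simp_all
  show ?thesis
    by (rule assms(1)[unfolded t successively.simps, THEN conjunct1, THEN conjunct2])
qed

context cplx_cat
begin

text \<open>Objects of \<open>A\<close> are recovered one by one along the chain, starting at the
  source of \<open>f0\<close>. The end pieces \<open>g0\<close> and \<open>gl\<close> stay arbitrary
  so that identities can be put there later.\<close>

lemma chain_unemb:
  assumes "successively (\<lambda>f g. src f = tgt g \<and> src f \<in> emb_ob ` Obj A) (f0 # mid @ [fl])"
    "\<forall>f\<in>set mid. dg.arr f" "src f0 = emb_ob y0" "y0 \<in> Obj A"
  shows "\<exists>yr\<in>Obj A. tgt fl = emb_ob yr \<and> (\<forall>f\<in>set mid. D.dg.arr (unemb f)) \<and>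
    (\<forall>g0 gl. src g0 = y0 \<longrightarrow> tgt gl = yr \<longrightarrow>
      successively (\<lambda>f g. src f = tgt g \<and> src f \<in> Obj A) (g0 # map unemb mid @ [gl]))"
  using assms
proof (induction mid arbitrary: f0 y0)
  case Nil
  then show ?case by (intro bexI[of _ y0]) auto
next
  case (Cons a mid)
  note p1 = Cons.prems(1)[unfolded append_Cons successively.simps]
  have a: "dg.arr a" "tgt a = emb_ob y0"
    using Cons.prems(2) p1[THEN conjunct1, THEN conjunct1] Cons.prems(3) by simp_all
  note s = p1[THEN conjunct2]
  have "src a \<in> emb_ob ` Obj A" by (rule successively_src[OF s]) simp
  then obtain y1 where y1: "y1 \<in> Obj A" "src a = emb_ob y1" by (elim imageE)
  have m: "\<forall>f\<in>set mid. dg.arr f" using Cons.prems(2) by simp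
  obtain yr where yr: "yr \<in> Obj A" "tgt fl = emb_ob yr \<and> (\<forall>f\<in>set mid. D.dg.arr (unemb f)) \<and>
    (\<forall>g0 gl. src g0 = y1 \<longrightarrow> tgt gl = yr \<longrightarrow>
      successively (\<lambda>f g. src f = tgt g \<and> src f \<in> Obj A) (g0 # map unemb mid @ [gl]))"
    using Cons.IH[OF s m y1(2,1)] by (elim bexE)
  note yr2 = yr(2)[THEN conjunct1] yr(2)[THEN conjunct2, THEN conjunct1]
  note yr3 = yr(2)[THEN conjunct2, THEN conjunct2, rule_format]
  have "a \<in> carrier (HC (emb_ob y1) (emb_ob y0) (deg a))" using a y1 by (simp add: dg.arr_def)
  note ua = unemb_closed[OF this]
  have u: "D.dg.arr (unemb a)" "src (unemb a) = y1" "tgt (unemb a) = y0"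
    using ua D.dg.arrI[OF _ _ ua] y1(1) Cons.prems(4) by (simp_all add: Ob_dg_of D.gHom_iff)
  show ?case
  proof (intro bexI[of _ yr] conjI allI impI)
    show "\<forall>f\<in>set (a # mid). D.dg.arr (unemb f)" using yr2(2) u(1) by simp
    show "successively (\<lambda>f g. src f = tgt g \<and> src f \<in> Obj A) (g0 # map unemb (a # mid) @ [gl])"
      if "src g0 = y0" "tgt gl = yr" for g0 gl
      using yr3[OF u(2) that(2)] that u(3) Cons.prems(4) by simp
  qed (rule yr(1) yr2(1))+
qed

text \<open>The normal form in which relative symbols are treated: outer entries that may leave
  \<open>A\<close>, and a middle part that becomes a symbol over \<open>A\<close> when flanked by
  identities.\<close>

lemma rel_sym_split:
  assumes "fs \<in> R.Sym X X' n"
  obtains f0 mid fl y0 yr where "fs = f0 # mid @ [fl]" "y0 \<in> Obj A" "yr \<in> Obj A" "X \<in> Ob" "X' \<in> Ob"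
    "f0 \<in> carrier (HC (emb_ob y0) X (deg f0))" "fl \<in> carrier (HC X' (emb_ob yr) (deg fl))"
    "idt (dg_of A) y0 # map unemb mid @ [idt (dg_of A) yr] \<in> Bd.Sym y0 yr (n - deg f0 - deg fl)"
proof -
  note S = assms[unfolded R.Sym_iff]
  note S2 = S[THEN conjunct2] note S3 = S2[THEN conjunct2] note S4 = S3[THEN conjunct2] note S5 = S4[THEN conjunct2]
  obtain f0 mid fl where fs: "fs = f0 # mid @ [fl]" using length_ge_2_split[OF S[THEN conjunct1]] .
  have arr: "dg.arr f0" "dg.arr fl" "\<forall>f\<in>set mid. dg.arr f" using S2[THEN conjunct1] fs by auto
  note succ = S3[THEN conjunct1, unfolded fs]
  have X: "tgt f0 = X" "src fl = X'" using S4[THEN conjunct1] S5[THEN conjunct1] fs by auto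
  have "src f0 \<in> emb_ob ` Obj A" by (rule successively_src[OF succ]) simp
  then obtain y0 where y0: "y0 \<in> Obj A" "src f0 = emb_ob y0" by (elim imageE)
  obtain yr where yr1: "yr \<in> Obj A" and yr2: "tgt fl = emb_ob yr \<and> (\<forall>f\<in>set mid. D.dg.arr (unemb f)) \<and>
    (\<forall>g0 gl. src g0 = y0 \<longrightarrow> tgt gl = yr \<longrightarrow>
      successively (\<lambda>f g. src f = tgt g \<and> src f \<in> Obj A) (g0 # map unemb mid @ [gl]))"
    using chain_unemb[OF succ arr(3) y0(2,1)] by (elim bexE)
  note yr = yr1 yr2[THEN conjunct1] yr2[THEN conjunct2, THEN conjunct1] yr2[THEN conjunct2, THEN conjunct2, rule_format]
  note i = D.dg.arr_idt[unfolded Ob_dg_of]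
  have dg: "deg (unemb f) = deg f" for f by (simp add: unemb_def Let_def)
  have deg: "(\<Sum>f\<leftarrow>map unemb mid. deg f) = (\<Sum>f\<leftarrow>mid. deg f)" by (induction mid) (simp_all add: dg)
  have n: "(\<Sum>f\<leftarrow>f0 # mid @ [fl]. deg f) - (int (length (f0 # mid @ [fl])) - 2) = n"
    using S5[THEN conjunct2] fs by simp
  have "idt (dg_of A) y0 # map unemb mid @ [idt (dg_of A) yr] \<in> Bd.Sym y0 yr (n - deg f0 - deg fl)"
    unfolding Bd.Sym_iff
  proof (intro conjI)
    show "successively (\<lambda>f g. src f = tgt g \<and> src f \<in> Obj A) (idt (dg_of A) y0 # map unemb mid @ [idt (dg_of A) yr])"
      by (rule yr(4)) (simp_all add: i y0 yr)
    show "sum_list (map deg (idt (dg_of A) y0 # map unemb mid @ [idt (dg_of A) yr])) -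
      (int (length (idt (dg_of A) y0 # map unemb mid @ [idt (dg_of A) yr])) - 2) = n - deg f0 - deg fl"
      using n deg i(4)[OF y0(1)] i(4)[OF yr(1)] by simp
  qed (use yr(3) i y0(1) yr(1) in auto)
  moreover have "X \<in> Ob" "X' \<in> Ob" "f0 \<in> carrier (HC (emb_ob y0) X (deg f0))" "fl \<in> carrier (HC X' (emb_ob yr) (deg fl))"
    using arr(1,2) X y0(2) yr(2) by (auto simp: dg.arr_def)
  ultimately show ?thesis using that[OF fs y0(1) yr(1)] by blast
qed

end

section \<open>The extension of a natural transformation on symbols\<close>

locale nat_lift = LF: lifting K A B F + LG: lifting K A B G
  for K :: "'k ring" and A :: "('k,'o,'m) lincat" and B :: "('k,'p,'n) lincat"
    and F G :: "('o,'m,('p,'n) cplx,int \<Rightarrow> 'n) dgfun" +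
  fixes \<tau> :: "'o \<Rightarrow> 'o \<Rightarrow> int \<Rightarrow> (('o,'m) harr list \<Rightarrow> 'k) set \<Rightarrow> (('p,'n) cplx,int \<Rightarrow> 'n) harr"
  assumes \<tau>b: "bimodule_map K (dg_of A) (rel_Bar K (dg_of A) (Obj A)) (functor_bimodule (Chb B) F G) 0 \<tau>"
    and \<tau>c: "closed_map (dg_of A) (rel_Bar K (dg_of A) (Obj A)) (functor_bimodule (Chb B) F G) 0 \<tau>"
begin

abbreviation "ObA \<equiv> dgOb (Chb A)"
abbreviation "HA \<equiv> gHom (Chb A)"
abbreviation "HB \<equiv> gHom (Chb B)"
abbreviation "cA \<equiv> gComp (Chb A)"
abbreviation "cB \<equiv> gComp (Chb B)"
abbreviation "id0 \<equiv> idt (dg_of A)"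
abbreviation "RSym \<equiv> bar_symbols (Chb A) (emb_ob ` Obj A)"
abbreviation "DSym \<equiv> bar_symbols (dg_of A) (Obj A)"
abbreviation "MB \<equiv> functor_bimodule (Chb B) (lift B F) (lift B G)"
abbreviation "HM X X' n \<equiv> HB (LG.LO X') (LF.LO X) n"
abbreviation "ue \<equiv> LF.A.unemb"

lemma MB_simps: "bmod MB X X' n = HM X X' n" "bdif MB X X' n = dif (Chb B)"
  "lact MB f X' n m = cB (LF.LM f) m" "ract MB X n m g = cB m (LG.LM g)"
  by (simp_all add: functor_bimodule_def lift_def)

definition T :: "'o \<Rightarrow> 'o \<Rightarrow> int \<Rightarrow> ('o,'m) harr list \<Rightarrow> (('p,'n) cplx,int \<Rightarrow> 'n) harr" where
  "T y y' n fs = \<tau> y y' n (bar_elem K (dg_of A) (Obj A) y y' n fs)"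

lemma bmod_D: "bmod (rel_Bar K (dg_of A) (Obj A)) = bar_module K (dg_of A) (Obj A)"
  by (simp add: rel_Bar_def)

lemma \<tau>_lin: "y \<in> Obj A \<Longrightarrow> y' \<in> Obj A \<Longrightarrow>
    \<tau> y y' n \<in> linear_maps K (bar_module K (dg_of A) (Obj A) y y' n) (HB (fobj G y') (fobj F y) n)"
  using bimodule_map0D(1)[OF \<tau>b, of y y' n, unfolded LF.A.Ob_dg_of bmod_D] by (simp add: functor_bimodule_def)

lemma T_multilinear: "y \<in> Obj A \<Longrightarrow> y' \<in> Obj A \<Longrightarrow>
    LF.A.Bd.multilinear y y' n (HB (fobj G y') (fobj F y) n) (T y y' n)"
  unfolding T_def[abs_def]
  by (rule LF.A.Bd.multilinear_comp[OF LF.A.Bd.multilinear_el \<tau>_lin])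

lemma HB_module: "y \<in> Obj A \<Longrightarrow> y' \<in> Obj A \<Longrightarrow> module K (HB (fobj G y') (fobj F y) n)"
  by (intro LF.B.HC_module LF.F_obj LG.F_obj)

lemma HM_module: "X \<in> ObA \<Longrightarrow> X' \<in> ObA \<Longrightarrow> module K (HM X X' n)"
  by (intro LF.B.HC_module LF.LO_Ob LG.LO_Ob)

lemma F_closed: "x \<in> Obj A \<Longrightarrow> y \<in> Obj A \<Longrightarrow> f \<in> carrier (gHom (dg_of A) x y k) \<Longrightarrow>
    fmor F f \<in> carrier (HB (fobj F x) (fobj F y) k)"
  and G_closed: "x \<in> Obj A \<Longrightarrow> y \<in> Obj A \<Longrightarrow> f \<in> carrier (gHom (dg_of A) x y k) \<Longrightarrow>
    fmor G f \<in> carrier (HB (fobj G x) (fobj G y) k)"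
  by (rule linear_mapsD(1)[OF LF.F_lin] linear_mapsD(1)[OF LG.F_lin]; assumption)+

text \<open>The outer entries act on the symbol flanked by identities, and \<open>\<tau>\<close>
  respects the action. The sign of the left action is brought to the other side by applying it a
  second time.\<close>

lemma T_act:
  assumes o: "y \<in> Obj A" "y' \<in> Obj A" "y0 \<in> Obj A" "yr \<in> Obj A"
    and f: "f \<in> carrier (gHom (dg_of A) y0 y k)" and g: "g \<in> carrier (gHom (dg_of A) y' yr l)"
    and W: "id0 y0 # mid @ [id0 yr] \<in> DSym y0 yr m"
  shows "T y y' (k + m + l) (f # mid @ [g]) = signed (HB (fobj G y') (fobj F y) (k + m + l)) (int (length mid) * k)
    (cB (fmor F f) (cB (T y0 yr m (id0 y0 # mid @ [id0 yr])) (fmor G g)))"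
proof -
  interpret M: module K "HB (fobj G y') (fobj F y) (k + m + l)" by (rule HB_module[OF o(1,2)])
  let ?W = "id0 y0 # mid @ [id0 yr]" and ?B = "rel_Bar K (dg_of A) (Obj A)"
  let ?el = "bar_elem K (dg_of A) (Obj A)"
  let ?e = "int (length mid) * k"
  note od = o[folded LF.A.Ob_dg_of]
  note lp = LF.A.Bd.lact_props[OF f od(1)] and rp = LF.A.Bd.ract_props[OF g od(2)]
  have fi: "gComp (dg_of A) f (id0 y0) = f" by (rule LF.A.D.dg.gComp_idt_right[OF od(3,1) f])
  have gi: "gComp (dg_of A) (id0 yr) g = g" by (rule LF.A.D.dg.gComp_idt_left[OF od(2,4) g])
  have 1: "lact ?B f yr m (?el y0 yr m ?W) =
      signed (bar_module K (dg_of A) (Obj A) y yr (k + m)) ?e (?el y yr (k + m) (f # mid @ [id0 yr]))"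
    using lp(2)[OF W] fi by simp
  have W1: "f # mid @ [id0 yr] \<in> DSym y yr (k + m)" using LF.A.Bd.Sym_left[OF W f od(1)] fi by simp
  have W2: "f # mid @ [g] \<in> DSym y y' (k + m + l)" using LF.A.Bd.Sym_right[OF W1 g od(2)] gi by simp
  have 2: "ract ?B y (k + m) (lact ?B f yr m (?el y0 yr m ?W)) g =
      signed (bar_module K (dg_of A) (Obj A) y y' (k + m + l)) ?e (?el y y' (k + m + l) (f # mid @ [g]))"
    unfolding 1 linear_map_signed[OF LF.A.Bd.BM_module LF.A.Bd.BM_module rp(1) LF.A.Bd.el_closed[OF W1]]
    using rp(2)[OF W1] gi by simp
  have 3: "\<tau> y y' (k + m + l) (ract ?B y (k + m) (lact ?B f yr m (?el y0 yr m ?W)) g) =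
      signed (HB (fobj G y') (fobj F y) (k + m + l)) ?e (T y y' (k + m + l) (f # mid @ [g]))"
    unfolding 2 linear_map_signed[OF LF.A.Bd.BM_module HB_module[OF o(1,2)] \<tau>_lin[OF o(1,2)] LF.A.Bd.el_closed[OF W2]]
    by (simp add: T_def)
  have 4: "\<tau> y y' (k + m + l) (ract ?B y (k + m) (lact ?B f yr m (?el y0 yr m ?W)) g) =
      cB (cB (fmor F f) (T y0 yr m ?W)) (fmor G g)"
    using bimodule_map0D(2)[OF \<tau>b od(3,4,1,2) f _ g, of "?el y0 yr m ?W" m, unfolded bmod_D] LF.A.Bd.el_closed[OF W]
    by (simp add: functor_bimodule_def T_def)
  have Tc: "T y0 yr m ?W \<in> carrier (HB (fobj G yr) (fobj F y0) m)"
    by (rule LF.A.Bd.multilinear_closed[OF T_multilinear[OF o(3,4)] W])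
  have 5: "cB (cB (fmor F f) (T y0 yr m ?W)) (fmor G g) = cB (fmor F f) (cB (T y0 yr m ?W) (fmor G g))"
    by (rule LF.B.gComp_ass[OF LG.F_obj[OF o(2)] LG.F_obj[OF o(4)] LF.F_obj[OF o(3)] LF.F_obj[OF o(1)]
        G_closed[OF o(2,4) g] Tc F_closed[OF o(3,1) f]])
  have Tc2: "T y y' (k + m + l) (f # mid @ [g]) \<in> carrier (HB (fobj G y') (fobj F y) (k + m + l))"
    by (rule LF.A.Bd.multilinear_closed[OF T_multilinear[OF o(1,2)] W2])
  have "signed (HB (fobj G y') (fobj F y) (k + m + l)) ?e (signed (HB (fobj G y') (fobj F y) (k + m + l)) ?e
      (T y y' (k + m + l) (f # mid @ [g]))) = T y y' (k + m + l) (f # mid @ [g])"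
    unfolding signed_signed[OF M.module_axioms Tc2] by (simp add: signed_def)
  then show ?thesis unfolding 3[symmetric] 4 5 by simp
qed

text \<open>The formula for \<open>tau'\<close> without its sign. The objects of \<open>A\<close> at
  the two joints are read off as degree zero chain objects, and \<open>n - deg f - deg g\<close> is
  the degree of the middle part.\<close>

definition core :: "int \<Rightarrow> (('o,'m) cplx,int \<Rightarrow> 'm) harr list \<Rightarrow> (('p,'n) cplx,int \<Rightarrow> 'n) harr" where
  "core n fs = (let f = hd fs; g = last fs; y = the (cob (src f) 0); y' = the (cob (tgt g) 0) in
     cB (LF.LM f) (cB (T y y' (n - deg f - deg g) (id0 y # map ue (butlast (tl fs)) @ [id0 y'])) (LG.LM g)))"

definition Phi :: "('o,'m) cplx \<Rightarrow> ('o,'m) cplx \<Rightarrow> int \<Rightarrow> (('o,'m) cplx,int \<Rightarrow> 'm) harr list \<Rightarrow> (('p,'n) cplx,int \<Rightarrow> 'n) harr" where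
  "Phi X X' n fs = signed (HM X X' n) (int (length fs - 2) * deg (hd fs)) (core n fs)"

lemma core_eq:
  assumes "src f = emb_ob y0" "tgt g = emb_ob yr"
  shows "core n (f # mid @ [g]) =
     cB (LF.LM f) (cB (T y0 yr (n - deg f - deg g) (id0 y0 # map ue mid @ [id0 yr])) (LG.LM g))"
  using assms by (simp add: core_def Let_def emb_ob_def butlast_append)

lemma LMF_closed: "y \<in> Obj A \<Longrightarrow> X \<in> ObA \<Longrightarrow> f \<in> carrier (HA (emb_ob y) X k) \<Longrightarrow>
    LF.LM f \<in> carrier (HB (fobj F y) (LF.LO X) k)"
  using LF.LM_closed[OF LF.A.emb_Ob] LF.LO_emb(1)[OF _ LF.A.emb_Ob] by metis

lemma LMG_closed: "y \<in> Obj A \<Longrightarrow> X \<in> ObA \<Longrightarrow> f \<in> carrier (HA X (emb_ob y) k) \<Longrightarrow>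
    LG.LM f \<in> carrier (HB (LG.LO X) (fobj G y) k)"
  using LG.LM_closed[OF _ LF.A.emb_Ob] LG.LO_emb(1)[OF _ LF.A.emb_Ob] by metis

lemma core_closed_aux:
  assumes o: "y0 \<in> Obj A" "yr \<in> Obj A" "X \<in> ObA" "X' \<in> ObA"
    and f: "f \<in> carrier (HA (emb_ob y0) X k)" and t: "t \<in> carrier (HB (fobj G yr) (fobj F y0) m)"
    and g: "g \<in> carrier (HA X' (emb_ob yr) l)"
  shows "cB t (LG.LM g) \<in> carrier (HB (LG.LO X') (fobj F y0) (m + l))"
    "cB (LF.LM f) (cB t (LG.LM g)) \<in> carrier (HM X X' (k + m + l))"
proof -
  show 1: "cB t (LG.LM g) \<in> carrier (HB (LG.LO X') (fobj F y0) (m + l))"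
    by (rule LF.B.gComp_closed[OF LG.LO_Ob[OF o(4)] LG.F_obj[OF o(2)] LF.F_obj[OF o(1)] LMG_closed[OF o(2,4) g] t])
  show "cB (LF.LM f) (cB t (LG.LM g)) \<in> carrier (HM X X' (k + m + l))"
    using LF.B.gComp_closed[OF LG.LO_Ob[OF o(4)] LF.F_obj[OF o(1)] LF.LO_Ob[OF o(3)] 1 LMF_closed[OF o(1,3) f]]
    by (simp add: add.assoc)
qed

lemma core_linear:
  assumes o: "y0 \<in> Obj A" "yr \<in> Obj A" "X \<in> ObA" "X' \<in> ObA"
  shows "f \<in> carrier (HA (emb_ob y0) X k) \<Longrightarrow> g \<in> carrier (HA X' (emb_ob yr) l) \<Longrightarrow>
      (\<lambda>t. cB (LF.LM f) (cB t (LG.LM g))) \<in> linear_maps K (HB (fobj G yr) (fobj F y0) m) (HM X X' (k + m + l))"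
    and "t \<in> carrier (HB (fobj G yr) (fobj F y0) m) \<Longrightarrow> g \<in> carrier (HA X' (emb_ob yr) l) \<Longrightarrow>
      (\<lambda>f. cB (LF.LM f) (cB t (LG.LM g))) \<in> linear_maps K (HA (emb_ob y0) X k) (HM X X' (k + m + l))"
    and "t \<in> carrier (HB (fobj G yr) (fobj F y0) m) \<Longrightarrow> f \<in> carrier (HA (emb_ob y0) X k) \<Longrightarrow>
      (\<lambda>g. cB (LF.LM f) (cB t (LG.LM g))) \<in> linear_maps K (HA X' (emb_ob yr) l) (HM X X' (k + m + l))"
proof -
  note ob = LG.LO_Ob[OF o(4)] LG.F_obj[OF o(2)] LF.F_obj[OF o(1)] LF.LO_Ob[OF o(3)]
  have e: "k + (m + l) = k + m + l" by simp
  note eF = LF.LM_linear[OF LF.A.emb_Ob[OF o(1)] o(3), unfolded LF.LO_emb(1)[OF o(1) LF.A.emb_Ob[OF o(1)]]]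
  note eG = LG.LM_linear[OF o(4) LF.A.emb_Ob[OF o(2)], unfolded LG.LO_emb(1)[OF o(2) LF.A.emb_Ob[OF o(2)]]]
  show "(\<lambda>t. cB (LF.LM f) (cB t (LG.LM g))) \<in> linear_maps K (HB (fobj G yr) (fobj F y0) m) (HM X X' (k + m + l))"
    if f: "f \<in> carrier (HA (emb_ob y0) X k)" and g: "g \<in> carrier (HA X' (emb_ob yr) l)"
    using linear_maps_comp[OF LF.B.gComp_lin_left[OF ob(1-3) LMG_closed[OF o(2,4) g]]
        LF.B.gComp_lin_right[OF ob(1,3,4) LMF_closed[OF o(1,3) f]], of m] unfolding e .
  show "(\<lambda>f. cB (LF.LM f) (cB t (LG.LM g))) \<in> linear_maps K (HA (emb_ob y0) X k) (HM X X' (k + m + l))"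
    if t: "t \<in> carrier (HB (fobj G yr) (fobj F y0) m)" and g: "g \<in> carrier (HA X' (emb_ob yr) l)"
    using linear_maps_comp[OF eF LF.B.gComp_lin_left[OF ob(1,3,4)
          LF.B.gComp_closed[OF ob(1-3) LMG_closed[OF o(2,4) g] t]], of k] unfolding e .
  show "(\<lambda>g. cB (LF.LM f) (cB t (LG.LM g))) \<in> linear_maps K (HA X' (emb_ob yr) l) (HM X X' (k + m + l))"
    if t: "t \<in> carrier (HB (fobj G yr) (fobj F y0) m)" and f: "f \<in> carrier (HA (emb_ob y0) X k)"
    using linear_maps_comp[OF linear_maps_comp[OF eG LF.B.gComp_lin_right[OF ob(1-3) t]]
        LF.B.gComp_lin_right[OF ob(1,3,4) LMF_closed[OF o(1,3) f]], of l] unfolding e .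
qed

lemma T_closed: "y \<in> Obj A \<Longrightarrow> y' \<in> Obj A \<Longrightarrow> fs \<in> DSym y y' m \<Longrightarrow> T y y' m fs \<in> carrier (HB (fobj G y') (fobj F y) m)"
  by (rule LF.A.Bd.multilinear_closed[OF T_multilinear])

text \<open>The varied entry is the first, the last or a middle one; a middle entry reaches
  \<open>\<tau>\<close> through the linear map \<open>unemb\<close>.\<close>

lemma core_multilinear: "LF.A.R.multilinear X X' n (HM X X' n) (core n)"
proof (rule LF.A.R.multilinearI)
  fix fs assume "fs \<in> RSym X X' n"
  then obtain f0 mid fl y0 yr where s: "fs = f0 # mid @ [fl]" "y0 \<in> Obj A" "yr \<in> Obj A" "X \<in> ObA" "X' \<in> ObA"
    "f0 \<in> carrier (HA (emb_ob y0) X (deg f0))" "fl \<in> carrier (HA X' (emb_ob yr) (deg fl))"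
    "id0 y0 # map ue mid @ [id0 yr] \<in> DSym y0 yr (n - deg f0 - deg fl)" by (rule LF.A.rel_sym_split)
  have e: "src f0 = emb_ob y0" "tgt fl = emb_ob yr" using s(6,7) by (auto simp: LF.A.HC_iff)
  show "core n fs \<in> carrier (HM X X' n)"
    unfolding s(1) core_eq[OF e] using core_closed_aux(2)[OF s(2-6) T_closed[OF s(2,3,8)] s(7)] by simp
next
  fix us vs Y Z k f
  assume f: "f \<in> carrier (HA Y Z k)" "us @ f # vs \<in> RSym X X' n" "Y \<in> ObA" "Z \<in> ObA" "module K (HA Y Z k)"
    "\<And>g. g \<in> carrier (HA Y Z k) \<Longrightarrow> us @ g # vs \<in> RSym X X' n"
  obtain f0 mid fl y0 yr where s: "us @ f # vs = f0 # mid @ [fl]" "y0 \<in> Obj A" "yr \<in> Obj A" "X \<in> ObA" "X' \<in> ObA"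
    "f0 \<in> carrier (HA (emb_ob y0) X (deg f0))" "fl \<in> carrier (HA X' (emb_ob yr) (deg fl))"
    "id0 y0 # map ue mid @ [id0 yr] \<in> DSym y0 yr (n - deg f0 - deg fl)" using f(2) by (rule LF.A.rel_sym_split)
  have e: "src f0 = emb_ob y0" "tgt fl = emb_ob yr" using s(6,7) by (auto simp: LF.A.HC_iff)
  let ?W = "id0 y0 # map ue mid @ [id0 yr]"
  let ?m = "n - deg f0 - deg fl"
  note t = T_closed[OF s(2,3,8)]
  have d: "src g = Y" "tgt g = Z" "deg g = k" if "g \<in> carrier (HA Y Z k)" for g using that by (auto simp: LF.A.HC_iff)
  consider (first) "us = []" "f = f0" "vs = mid @ [fl]" | (last) "us = f0 # mid" "f = fl" "vs = []"
    | (mid) us' vs' where "us = f0 # us'" "vs = vs' @ [fl]" "mid = us' @ f # vs'"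
  proof (cases us)
    case Nil
    then show ?thesis using s(1) first by simp
  next
    case (Cons u us')
    then show ?thesis using s(1) mid last by (cases vs rule: rev_cases) auto
  qed
  then show "(\<lambda>g. core n (us @ g # vs)) \<in> linear_maps K (HA Y Z k) (HM X X' n)"
  proof cases
    case first
    then have YZ: "Y = emb_ob y0" "Z = X" "k = deg f0" using d[OF f(1)] s(6) by (auto simp: LF.A.HC_iff)
    have "(\<lambda>g. cB (LF.LM g) (cB (T y0 yr ?m ?W) (LG.LM fl))) \<in> linear_maps K (HA Y Z k) (HM X X' n)"
      using core_linear(2)[OF s(2-5) t s(7), of k] by (simp add: YZ)
    then show ?thesis
      by (rule linear_maps_cong[OF _ f(5)]) (use first d e YZ in \<open>simp add: core_eq[where ?y0.0=y0 and yr=yr]\<close>)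
  next
    case last
    then have YZ: "Y = X'" "Z = emb_ob yr" "k = deg fl" using d[OF f(1)] s(7) by (auto simp: LF.A.HC_iff)
    have "(\<lambda>g. cB (LF.LM f0) (cB (T y0 yr ?m ?W) (LG.LM g))) \<in> linear_maps K (HA Y Z k) (HM X X' n)"
      using core_linear(3)[OF s(2-5) t s(6), of k] by (simp add: YZ)
    then show ?thesis
      by (rule linear_maps_cong[OF _ f(5)]) (use last d e YZ in \<open>simp add: core_eq[where ?y0.0=y0 and yr=yr]\<close>)
  next
    case mid
    have "src f \<in> emb_ob ` Obj A \<and> tgt f \<in> emb_ob ` Obj A"
    proof -
      have "successively (\<lambda>f g. src f = tgt g \<and> src f \<in> emb_ob ` Obj A) ((f0 # us') @ f # (vs' @ [fl]))"
        using f(2) unfolding LF.A.R.Sym_iff mid by simp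
      note a = this[unfolded successively_append_iff]
      have l: "src (List.last (f0 # us')) = tgt f \<and> src (List.last (f0 # us')) \<in> emb_ob ` Obj A"
        using a[THEN conjunct2, THEN conjunct2, unfolded list.sel] by blast
      have "successively (\<lambda>f g. src f = tgt g \<and> src f \<in> emb_ob ` Obj A) (f # (vs' @ [fl]))"
        using a by simp
      then have "src f \<in> emb_ob ` Obj A" by (rule successively_src) simp
      then show ?thesis using l[THEN conjunct2, unfolded l[THEN conjunct1]] by (rule conjI)
    qed
    then obtain y y' where YZ: "y \<in> Obj A" "y' \<in> Obj A" "Y = emb_ob y" "Z = emb_ob y'" using d[OF f(1)] by auto
    have W: "(id0 y0 # map ue us') @ ue f # (map ue vs' @ [id0 yr]) \<in> DSym y0 yr ?m" using s(8) mid(3) by simp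
    have uf: "ue f \<in> carrier (gHom (dg_of A) y y' k)" using f(1) unfolding YZ by (rule LF.A.unemb_closed)
    have 1: "(\<lambda>g. T y0 yr ?m ((id0 y0 # map ue us') @ g # (map ue vs' @ [id0 yr])))
        \<in> linear_maps K (gHom (dg_of A) y y' k) (HB (fobj G yr) (fobj F y0) ?m)"
      by (rule LF.A.Bd.multilinear_linear[OF T_multilinear[OF s(2,3)] W uf])
    have "(\<lambda>g. cB (LF.LM f0) (cB (T y0 yr ?m ((id0 y0 # map ue us') @ ue g # (map ue vs' @ [id0 yr]))) (LG.LM fl)))
        \<in> linear_maps K (HA Y Z k) (HM X X' n)"
      using linear_maps_comp[OF linear_maps_comp[OF LF.A.unemb_linear[OF YZ(1,2)] 1] core_linear(1)[OF s(2-7)]]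
      unfolding YZ by simp
    then show ?thesis
    proof (rule linear_maps_cong[OF _ f(5)])
      fix g
      have "us @ g # vs = f0 # (us' @ g # vs') @ [fl]" using mid by simp
      then show "core n (us @ g # vs) =
        cB (LF.LM f0) (cB (T y0 yr ?m ((id0 y0 # map ue us') @ ue g # (map ue vs' @ [id0 yr]))) (LG.LM fl))"
        using core_eq[OF e, of n "us' @ g # vs'"] by simp
    qed
  qed
qed

lemma Phi_multilinear: "X \<in> ObA \<Longrightarrow> X' \<in> ObA \<Longrightarrow> LF.A.R.multilinear X X' n (HM X X' n) (Phi X X' n)"
  unfolding Phi_def[abs_def]
proof (rule LF.A.R.multilinear_signed[OF core_multilinear HM_module], assumption, assumption)
  fix fs gs :: "(('o,'m) cplx,int \<Rightarrow> 'm) harr list" assume s: "shape fs = shape gs"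
  show "int (length fs - 2) * deg (hd fs) = int (length gs - 2) * deg (hd gs)"
  proof (cases fs)
    case Nil
    then show ?thesis using shape_length[OF s] by simp
  next
    case (Cons a t)
    then show ?thesis using shape_length[OF s] shape_nth(3)[OF s, of 0] by (cases gs) simp_all
  qed
qed

end

lemma (in rel_bar) Sym_adj:
  assumes "us @ f # g # vs \<in> Sym X X' n"
  shows "src f = tgt g" "arr f" "arr g" "f \<in> carrier (gHom C (src f) (tgt f) (deg f))"
    "g \<in> carrier (gHom C (src g) (tgt g) (deg g))"
proof -
  note S = assms[unfolded Sym_iff, THEN conjunct2]
  show a: "arr f" "arr g" using S[THEN conjunct1] by simp_all
  then show "f \<in> carrier (gHom C (src f) (tgt f) (deg f))" "g \<in> carrier (gHom C (src g) (tgt g) (deg g))"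
    by (simp_all add: arr_def)
  show "src f = tgt g"
    using S[THEN conjunct2, THEN conjunct1] by (simp add: successively_append_iff)
qed

lemma (in rel_bar) Sym_src:
  assumes "us @ f # vs \<in> Sym X X' n" "vs \<noteq> []"
  shows "src f \<in> S"
proof -
  note S = assms(1)[unfolded Sym_iff, THEN conjunct2, THEN conjunct2, THEN conjunct1, unfolded successively_append_iff]
  show ?thesis by (rule successively_src[OF S[THEN conjunct2, THEN conjunct1] assms(2)])
qed

lemma (in rel_bar) Sym_inner:
  assumes "us @ f # vs \<in> Sym X X' n" "us \<noteq> []" "vs \<noteq> []"
  shows "src f \<in> S" "tgt f \<in> S"
proof -
  show "src f \<in> S" by (rule Sym_src[OF assms(1,3)])
  obtain us0 u where us: "us = us0 @ [u]" using assms(2) by (cases us rule: rev_cases) simp_all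
  have 1: "us0 @ u # f # vs \<in> Sym X X' n" using assms(1) us by simp
  have "src u \<in> S" by (rule Sym_src[OF 1]) simp
  then show "tgt f \<in> S" unfolding Sym_adj(1)[OF 1] .
qed

lemma (in abelian_monoid) finsum_ends:
  assumes "f \<in> {0..r + 1} \<rightarrow> carrier G" "\<And>i. 0 < i \<Longrightarrow> i \<le> (r :: nat) \<Longrightarrow> f i = \<zero>"
  shows "finsum G f {0..r + 1} = f 0 \<oplus> f (r + 1)"
proof -
  have "finsum G f {0..r + 1} = finsum G f {0, r + 1}"
    using assms by (intro add.finprod_mono_neutral_cong_right) (auto simp: Pi_def)
  also have "\<dots> = f 0 \<oplus> f (r + 1)" using assms(1) by (simp add: Pi_def)
  finally show ?thesis .
qed

section \<open>Compatibility with the actions and the differential\<close>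

context nat_lift
begin

lemma Phi_eq:
  assumes "src f = emb_ob y0" "tgt g = emb_ob yr"
  shows "Phi X X' n (f # mid @ [g]) = signed (HM X X' n) (int (length mid) * deg f)
     (cB (LF.LM f) (cB (T y0 yr (n - deg f - deg g) (id0 y0 # map ue mid @ [id0 yr])) (LG.LM g)))"
  using core_eq[OF assms] by (simp add: Phi_def)

text \<open>With \<open>r\<close> middle entries, the exponent \<open>r(j + |f_0|)\<close> of the
  new symbol and the exponent \<open>rj\<close> of the left action add up to \<open>r|f_0|\<close>
  modulo two.\<close>

lemma Phi_left:
  assumes X1: "X1 \<in> ObA" and f: "f \<in> carrier (HA X X1 j)" and fs: "fs \<in> RSym X X' n"
  shows "signed (HM X1 X' (j + n)) (int (length fs - 2) * j) (Phi X1 X' (j + n) (cA f (hd fs) # tl fs)) =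
    cB (LF.LM f) (Phi X X' n fs)"
proof -
  obtain f0 mid fl y0 yr where s: "fs = f0 # mid @ [fl]" "y0 \<in> Obj A" "yr \<in> Obj A" "X \<in> ObA" "X' \<in> ObA"
    "f0 \<in> carrier (HA (emb_ob y0) X (deg f0))" "fl \<in> carrier (HA X' (emb_ob yr) (deg fl))"
    "id0 y0 # map ue mid @ [id0 yr] \<in> DSym y0 yr (n - deg f0 - deg fl)" using fs by (rule LF.A.rel_sym_split)
  have e: "src f0 = emb_ob y0" "tgt fl = emb_ob yr" using s(6,7) by (auto simp: LF.A.HC_iff)
  have ff: "src (cA f f0) = emb_ob y0" "deg (cA f f0) = j + deg f0" using f e by (auto simp: LF.A.gComp_eq LF.A.HC_iff)
  let ?t = "T y0 yr (n - deg f0 - deg fl) (id0 y0 # map ue mid @ [id0 yr])"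
  note t = T_closed[OF s(2,3,8)]
  let ?c = "cB (LF.LM f0) (cB ?t (LG.LM fl))"
  have c: "?c \<in> carrier (HM X X' n)" using core_closed_aux(2)[OF s(2-6) t s(7)] by simp
  note ct = core_closed_aux(1)[OF s(2-6) t s(7)]
  note Lf = LF.LM_closed[OF s(4) X1 f]
  note ob = LG.LO_Ob[OF s(5)] LF.F_obj[OF s(2)] LF.LO_Ob[OF s(4)] LF.LO_Ob[OF X1]
  have 1: "cB (LF.LM (cA f f0)) (cB ?t (LG.LM fl)) = cB (LF.LM f) ?c"
    unfolding LF.LM_gComp[OF LF.A.emb_Ob[OF s(2)] s(4) X1 s(6) f]
    by (rule LF.B.gComp_ass[OF ob ct LMF_closed[OF s(2,4,6)] Lf])
  have c1: "cB (LF.LM f) ?c \<in> carrier (HM X1 X' (j + n))" by (rule LF.B.gComp_closed[OF ob(1,3,4) c Lf])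
  have idx: "j + n - (j + deg f0) - deg fl = n - deg f0 - deg fl" by simp
  have "signed (HM X1 X' (j + n)) (int (length fs - 2) * j) (Phi X1 X' (j + n) (cA f (hd fs) # tl fs)) =
    signed (HM X1 X' (j + n)) (int (length mid) * j + int (length mid) * (j + deg f0)) (cB (LF.LM f) ?c)"
    using signed_signed[OF HM_module[OF X1 s(5)] c1]
    by (simp add: s(1) Phi_eq[OF ff(1) e(2)] ff(2) idx 1)
  also have "\<dots> = signed (HM X1 X' (j + n)) (int (length mid) * deg f0) (cB (LF.LM f) ?c)"
    by (rule signed_cong) (simp add: algebra_simps)
  also have "\<dots> = cB (LF.LM f) (Phi X X' n fs)"
    unfolding s(1) Phi_eq[OF e]
    by (rule linear_map_signed[OF HM_module[OF s(4,5)] HM_module[OF X1 s(5)] LF.B.gComp_lin_right[OF ob(1,3,4) Lf] c, symmetric])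
  finally show ?thesis .
qed

lemma Phi_right:
  assumes Y': "Y' \<in> ObA" and g: "g \<in> carrier (HA Y' X' m)" and fs: "fs \<in> RSym X X' n"
  shows "Phi X Y' (n + m) (butlast fs @ [cA (last fs) g]) = cB (Phi X X' n fs) (LG.LM g)"
proof -
  obtain f0 mid fl y0 yr where s: "fs = f0 # mid @ [fl]" "y0 \<in> Obj A" "yr \<in> Obj A" "X \<in> ObA" "X' \<in> ObA"
    "f0 \<in> carrier (HA (emb_ob y0) X (deg f0))" "fl \<in> carrier (HA X' (emb_ob yr) (deg fl))"
    "id0 y0 # map ue mid @ [id0 yr] \<in> DSym y0 yr (n - deg f0 - deg fl)" using fs by (rule LF.A.rel_sym_split)
  have e: "src f0 = emb_ob y0" "tgt fl = emb_ob yr" using s(6,7) by (auto simp: LF.A.HC_iff)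
  have ff: "tgt (cA fl g) = emb_ob yr" "deg (cA fl g) = deg fl + m" using g e by (auto simp: LF.A.gComp_eq LF.A.HC_iff)
  let ?t = "T y0 yr (n - deg f0 - deg fl) (id0 y0 # map ue mid @ [id0 yr])"
  note t = T_closed[OF s(2,3,8)]
  let ?c = "cB (LF.LM f0) (cB ?t (LG.LM fl))"
  have c: "?c \<in> carrier (HM X X' n)" using core_closed_aux(2)[OF s(2-6) t s(7)] by simp
  note ct = core_closed_aux(1)[OF s(2-6) t s(7)]
  note Lg = LG.LM_closed[OF Y' s(5) g]
  note ob = LG.LO_Ob[OF Y'] LG.LO_Ob[OF s(5)] LG.F_obj[OF s(3)] LF.F_obj[OF s(2)] LF.LO_Ob[OF s(4)]
  have 1: "cB (LF.LM f0) (cB ?t (LG.LM (cA fl g))) = cB ?c (LG.LM g)"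
    unfolding LG.LM_gComp[OF Y' s(5) LF.A.emb_Ob[OF s(3)] g s(7)]
      LF.B.gComp_ass[OF ob(1,2,4,5) Lg ct LMF_closed[OF s(2,4,6)]]
      LF.B.gComp_ass[OF ob(1-4) Lg LMG_closed[OF s(3,5,7)] t] ..
  have idx: "n + m - deg f0 - (deg fl + m) = n - deg f0 - deg fl" by simp
  have "Phi X Y' (n + m) (butlast fs @ [cA (last fs) g]) =
    signed (HM X Y' (n + m)) (int (length mid) * deg f0) (cB ?c (LG.LM g))"
    by (simp add: s(1) butlast_append Phi_eq[OF e(1) ff(1)] ff(2) idx 1)
  also have "\<dots> = cB (Phi X X' n fs) (LG.LM g)"
    unfolding s(1) Phi_eq[OF e]
    by (rule linear_map_signed[OF HM_module[OF s(4,5)] HM_module[OF s(4) Y'] LF.B.gComp_lin_left[OF ob(1,2,5) Lg] c, symmetric])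
  finally show ?thesis .
qed

text \<open>All morphisms of \<open>dg_of A\<close> have zero differential, so of the bar
  differential only the merges remain.\<close>

lemma dif_T:
  assumes o: "y \<in> Obj A" "y' \<in> Obj A" and W: "W \<in> DSym y y' m"
  shows "dif (Chb B) (T y y' m W) = finsum (HB (fobj G y') (fobj F y) (m + 1))
    (\<lambda>i. signed (HB (fobj G y') (fobj F y) (m + 1)) (int i) (T y y' (m + 1) (LF.A.D.dg.merge i W)))
    {i. 0 < length W - 2 \<and> i \<le> length W - 2}"
proof -
  let ?H = "HB (fobj G y') (fobj F y) (m + 1)"
  interpret H: module K ?H by (rule HB_module[OF o])
  note ml = T_multilinear[OF o, of "m + 1"]
  have "dif (Chb B) (T y y' m W) = \<tau> y y' (m + 1) (bdif (rel_Bar K (dg_of A) (Obj A)) y y' m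
      (bar_elem K (dg_of A) (Obj A) y y' m W))"
    using \<tau>c[unfolded closed_map_def bmod_D LF.A.Ob_dg_of, rule_format, OF o LF.A.Bd.el_closed[OF W]]
    by (simp add: functor_bimodule_def T_def)
  also have "\<dots> = LF.A.Bd.bar_dif_ext ?H (T y y' (m + 1)) W"
    unfolding LF.A.Bd.bdif_el[OF W]
    by (rule LF.A.Bd.linear_bar_dif_ext[OF LF.A.Bd.BM_module HB_module[OF o] \<tau>_lin[OF o] LF.A.Bd.multilinear_el W])
       (simp add: T_def)
  also have "\<dots> = finsum ?H (\<lambda>i. signed ?H (int i) (T y y' (m + 1) (LF.A.D.dg.merge i W)))
    {i. 0 < length W - 2 \<and> i \<le> length W - 2}"
  proof -
    have "T y y' (m + 1) (W[i := dif (dg_of A) (W ! i)]) = \<zero>\<^bsub>?H\<^esub>" if i: "i < length W" for i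
    proof -
      have "LF.A.D.dg.arr (W ! i)" using W i unfolding LF.A.Bd.Sym_iff by simp
      then have ob: "src (W ! i) \<in> dgOb (dg_of A)" "tgt (W ! i) \<in> dgOb (dg_of A)" by (simp_all add: LF.A.D.dg.arr_def)
      have z: "dif (dg_of A) (W ! i) = \<zero>\<^bsub>gHom (dg_of A) (src (W ! i)) (tgt (W ! i)) (deg (W ! i) + 1)\<^esub>"
        unfolding LF.A.D.gHom_ops by (simp add: dg_of_def)
      show ?thesis
        using LF.A.Bd.Sym_dif[OF W i]
        unfolding upd_conv_take_nth_drop[OF i] z
        by (rule LF.A.Bd.multilinear_zero[OF ml H.module_axioms _ ob])
    qed
    then have "finsum ?H (\<lambda>i. signed ?H (e i) (T y y' (m + 1) (W[i := dif (dg_of A) (W ! i)]))) {0..length W - 2 + 1} = \<zero>\<^bsub>?H\<^esub>" for e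
      using W[unfolded LF.A.Bd.Sym_iff, THEN conjunct1]
      by (intro H.M.finsum_all_zero) (simp add: signed_zero[OF H.module_axioms])
    moreover have "finsum ?H (\<lambda>i. signed ?H (int i) (T y y' (m + 1) (LF.A.D.dg.merge i W)))
        {i. 0 < length W - 2 \<and> i \<le> length W - 2} \<in> carrier ?H"
      by (rule H.M.finsum_closed[OF LF.A.Bd.bar_dif_terms_closed(2)[OF ml H.module_axioms W]])
    ultimately show ?thesis unfolding LF.A.Bd.bar_dif_ext_def by simp
  qed
  finally show ?thesis .
qed

lemma idt_T: 
  assumes o: "y \<in> Obj A" "y' \<in> Obj A" and t: "t \<in> carrier (HB (fobj G y') (fobj F y) m)"
  shows "cB (fmor F (id0 y)) t = t" "cB t (fmor G (id0 y')) = t"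
  unfolding LF.F_idt[OF o(1)] LG.F_idt[OF o(2)]
  by (rule LF.B.dg.gComp_idt_left[OF LG.F_obj[OF o(2)] LF.F_obj[OF o(1)] t]
      LF.B.dg.gComp_idt_right[OF LG.F_obj[OF o(2)] LF.F_obj[OF o(1)] t])+

text \<open>Merging two entries of a symbol corresponds to merging two entries of its middle part, flanked by
  identities; at the two ends this uses that \<open>\<tau>\<close> is a bimodule map.\<close>

lemma core_merge:
  assumes fs: "f0 # mid @ [fl] \<in> RSym X X' n" and e: "src f0 = emb_ob y0" "tgt fl = emb_ob yr"
    and o: "y0 \<in> Obj A" "yr \<in> Obj A" and X: "X \<in> ObA" "X' \<in> ObA"
    and f0: "f0 \<in> carrier (HA (emb_ob y0) X (deg f0))" and fl: "fl \<in> carrier (HA X' (emb_ob yr) (deg fl))"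
    and d0: "\<forall>f\<in>set mid. deg f = 0" and i: "i \<le> length mid" "mid \<noteq> []"
  shows "core (n + 1) (LF.A.dg.merge i (f0 # mid @ [fl])) = cB (LF.LM f0)
      (cB (T y0 yr (n - deg f0 - deg fl + 1) (LF.A.D.dg.merge i (id0 y0 # map ue mid @ [id0 yr]))) (LG.LM fl)) \<and>
    deg (hd (LF.A.dg.merge i (f0 # mid @ [fl]))) = deg f0"
proof -
  let ?m = "n - deg f0 - deg fl + 1"
  note Ls = LMF_closed[OF o(1) X(1) f0] LMG_closed[OF o(2) X(2) fl]
  note ob = LG.LO_Ob[OF X(2)] LG.F_obj[OF o(2)] LF.F_obj[OF o(1)] LF.LO_Ob[OF X(1)]
  have ms: "LF.A.dg.merge i (f0 # mid @ [fl]) \<in> RSym X X' (n + 1)"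
    using i by (intro LF.A.R.Sym_merge'[OF fs]) (cases mid; simp)+
  consider (first) "i = 0" | (last) "i = length mid" "i \<noteq> 0" | (mid) j where "i = Suc j" "j + 1 < length mid"
    using i by (cases i) fastforce+
  then show ?thesis
  proof cases
    case first
    obtain a mid' where mid: "mid = a # mid'" using i(2) by (cases mid) simp_all
    have fs': "[] @ f0 # a # (mid' @ [fl]) \<in> RSym X X' n" using fs mid by simp
    note adj = LF.A.R.Sym_adj[OF fs']
    have fs2: "[f0] @ a # (mid' @ [fl]) \<in> RSym X X' n" using fs mid by simp
    have "src a \<in> emb_ob ` Obj A" by (rule LF.A.R.Sym_src[OF fs2]) simp
    then obtain y1 where y1: "y1 \<in> Obj A" "src a = emb_ob y1" by (elim imageE)
    have a: "a \<in> carrier (HA (emb_ob y1) (emb_ob y0) 0)"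
      using adj(5) y1(2) adj(1) e(1) d0 mid by simp
    note ua = LF.A.unemb_closed[OF a]
    have da: "deg a = 0" "src (cA f0 a) = emb_ob y1" "deg (cA f0 a) = deg f0"
      using a y1(2) by (auto simp: LF.A.HC_iff LF.A.gComp_eq)
    have mg: "LF.A.dg.merge i (f0 # mid @ [fl]) = cA f0 a # mid' @ [fl]"
      using first mid by (simp add: LF.A.dg.merge_0)
    have mgW: "LF.A.D.dg.merge i (id0 y0 # map ue mid @ [id0 yr]) = ue a # map ue mid' @ [id0 yr]"
      using first mid LF.A.D.dg.gComp_idt_left[OF _ _ ua] y1(1) o by (simp add: LF.A.D.dg.merge_0 LF.A.Ob_dg_of)
    obtain f0' midx fl' y0' yr' where s: "cA f0 a # mid' @ [fl] = f0' # midx @ [fl']" "y0' \<in> Obj A" "yr' \<in> Obj A"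
      "f0' \<in> carrier (HA (emb_ob y0') X (deg f0'))" "fl' \<in> carrier (HA X' (emb_ob yr') (deg fl'))"
      "id0 y0' # map ue midx @ [id0 yr'] \<in> DSym y0' yr' (n + 1 - deg f0' - deg fl')"
      using ms unfolding mg by (rule LF.A.rel_sym_split)
    have eq: "f0' = cA f0 a" "midx = mid'" "fl' = fl" using s(1) by simp_all
    have "emb_ob y0' = (emb_ob y1 :: ('o,'m) cplx)" "emb_ob yr' = (emb_ob yr :: ('o,'m) cplx)"
      using s(4,5) da(2) e(2) unfolding eq LF.A.HC_iff by auto
    then have yy: "y0' = y1" "yr' = yr" by (auto simp: emb_ob_def fun_eq_iff dest!: spec[of _ 0])
    have W1: "id0 y1 # map ue mid' @ [id0 yr] \<in> DSym y1 yr ?m"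
      using s(6) unfolding eq yy da(3) by (simp add: algebra_simps)
    let ?t = "T y1 yr ?m (id0 y1 # map ue mid' @ [id0 yr])"
    have t: "?t \<in> carrier (HB (fobj G yr) (fobj F y1) ?m)" by (rule T_closed[OF y1(1) o(2) W1])
    \<comment> \<open>The sign in \<open>T_act\<close> is trivial since \<open>a\<close> has degree
      zero; \<open>F(a)\<close> comes out of \<open>\<tau>\<close> and is absorbed into the lift of
      the composite of \<open>f0\<close> and \<open>a\<close>.\<close>
    have Ta: "T y0 yr ?m (ue a # map ue mid' @ [id0 yr]) = cB (fmor F (ue a)) ?t"
      using T_act[OF o y1(1) o(2) ua _ W1, of "id0 yr" 0] LF.A.D.dg.idt_closed[of yr] o(2)
      by (simp add: LF.A.Ob_dg_of idt_T(2)[OF y1(1) o(2) t])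
    note Fa = F_closed[OF y1(1) o(1) ua]
    have "core (n + 1) (cA f0 a # mid' @ [fl]) = cB (LF.LM (cA f0 a)) (cB ?t (LG.LM fl))"
      unfolding core_eq[OF da(2) e(2)] da(3) by (simp add: algebra_simps)
    also have "\<dots> = cB (cB (LF.LM f0) (fmor F (ue a))) (cB ?t (LG.LM fl))"
      unfolding LF.LM_gComp[OF LF.A.emb_Ob[OF y1(1)] LF.A.emb_Ob[OF o(1)] X(1) a f0] LF.LM_emb[OF y1(1) o(1) a] ..
    also have "\<dots> = cB (LF.LM f0) (cB (cB (fmor F (ue a)) ?t) (LG.LM fl))"
      unfolding LF.B.gComp_ass[OF ob(1) LF.F_obj[OF y1(1)] ob(3,4) core_closed_aux(1)[OF y1(1) o(2) X LF.A.gComp_closed[OF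
          LF.A.emb_Ob[OF y1(1)] LF.A.emb_Ob[OF o(1)] X(1) a f0] t fl] Fa Ls(1)]
        LF.B.gComp_ass[OF ob(1,2) LF.F_obj[OF y1(1)] ob(3) Ls(2) t Fa] ..
    finally show ?thesis unfolding mg mgW Ta using da(3) by simp
  next
    case last
    obtain a mid' where mid: "mid = mid' @ [a]" using i(2) by (cases mid rule: rev_cases) simp_all
    have fs': "(f0 # mid') @ a # fl # [] \<in> RSym X X' n" using fs mid by simp
    note adj = LF.A.R.Sym_adj[OF fs']
    have "tgt a \<in> emb_ob ` Obj A" by (rule LF.A.R.Sym_inner(2)[OF fs']) simp_all
    then obtain y1 where y1: "y1 \<in> Obj A" "tgt a = emb_ob y1" by (elim imageE)
    have a: "a \<in> carrier (HA (emb_ob yr) (emb_ob y1) 0)"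
      using adj(4) y1(2) adj(1) e(2) d0 mid by simp
    note ua = LF.A.unemb_closed[OF a]
    have da: "deg a = 0" "tgt (cA a fl) = emb_ob y1" "deg (cA a fl) = deg fl"
      using a y1(2) by (auto simp: LF.A.HC_iff LF.A.gComp_eq)
    have mg: "LF.A.dg.merge i (f0 # mid @ [fl]) = f0 # mid' @ [cA a fl]"
      using LF.A.dg.merge_append[of "f0 # mid'" i a fl "[]"] last mid by simp
    have mgW: "LF.A.D.dg.merge i (id0 y0 # map ue mid @ [id0 yr]) = id0 y0 # map ue mid' @ [ue a]"
      using LF.A.D.dg.merge_append[of "id0 y0 # map ue mid'" i "ue a" "id0 yr" "[]"] last mid
        LF.A.D.dg.gComp_idt_right[OF _ _ ua] y1(1) o by (simp add: LF.A.Ob_dg_of)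
    obtain f0' midx fl' y0' yr' where s: "f0 # mid' @ [cA a fl] = f0' # midx @ [fl']" "y0' \<in> Obj A" "yr' \<in> Obj A"
      "f0' \<in> carrier (HA (emb_ob y0') X (deg f0'))" "fl' \<in> carrier (HA X' (emb_ob yr') (deg fl'))"
      "id0 y0' # map ue midx @ [id0 yr'] \<in> DSym y0' yr' (n + 1 - deg f0' - deg fl')"
      using ms unfolding mg by (rule LF.A.rel_sym_split)
    have eq: "f0' = f0" "midx = mid'" "fl' = cA a fl" using s(1) by simp_all
    have "emb_ob y0' = (emb_ob y0 :: ('o,'m) cplx)" "emb_ob yr' = (emb_ob y1 :: ('o,'m) cplx)"
      using s(4,5) da(2) e(1) unfolding eq LF.A.HC_iff by auto
    then have yy: "y0' = y0" "yr' = y1" by (auto simp: emb_ob_def fun_eq_iff dest!: spec[of _ 0])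
    have W1: "id0 y0 # map ue mid' @ [id0 y1] \<in> DSym y0 y1 ?m"
      using s(6) unfolding eq yy da(3) by (simp add: algebra_simps)
    let ?t = "T y0 y1 ?m (id0 y0 # map ue mid' @ [id0 y1])"
    have t: "?t \<in> carrier (HB (fobj G y1) (fobj F y0) ?m)" by (rule T_closed[OF o(1) y1(1) W1])
    note Ga = G_closed[OF o(2) y1(1) ua]
    have tG: "cB ?t (fmor G (ue a)) \<in> carrier (HB (fobj G yr) (fobj F y0) (?m + 0))"
      by (rule LF.B.gComp_closed[OF ob(2) LG.F_obj[OF y1(1)] ob(3) Ga t])
    have Ta: "T y0 yr ?m (id0 y0 # map ue mid' @ [ue a]) = cB ?t (fmor G (ue a))"
      using T_act[OF o o(1) y1(1) _ ua W1, of "id0 y0" 0] LF.A.D.dg.idt_closed[of y0] o(1)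
      by (simp add: LF.A.Ob_dg_of idt_T(1)[OF o tG])
    have "core (n + 1) (f0 # mid' @ [cA a fl]) = cB (LF.LM f0) (cB ?t (LG.LM (cA a fl)))"
      unfolding core_eq[OF e(1) da(2)] da(3) by (simp add: algebra_simps)
    also have "\<dots> = cB (LF.LM f0) (cB ?t (cB (fmor G (ue a)) (LG.LM fl)))"
      unfolding LG.LM_gComp[OF X(2) LF.A.emb_Ob[OF o(2)] LF.A.emb_Ob[OF y1(1)] fl a] LG.LM_emb[OF o(2) y1(1) a] ..
    also have "\<dots> = cB (LF.LM f0) (cB (cB ?t (fmor G (ue a))) (LG.LM fl))"
      unfolding LF.B.gComp_ass[OF ob(1,2) LG.F_obj[OF y1(1)] ob(3) Ls(2) Ga t] ..
    finally show ?thesis unfolding mg mgW Ta by simp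
  next
    case (mid j)
    obtain us a b vs where m: "mid = us @ a # b # vs" "length us = j" using LF.A.dg.split_pair[OF mid(2)] .
    have fs': "(f0 # us) @ a # b # (vs @ [fl]) \<in> RSym X X' n" using fs m by simp
    have fs2: "(f0 # us @ [a]) @ b # (vs @ [fl]) \<in> RSym X X' n" using fs m by simp
    note adj = LF.A.R.Sym_adj[OF fs']
    have "src a \<in> emb_ob ` Obj A" "tgt a \<in> emb_ob ` Obj A" using LF.A.R.Sym_inner[OF fs'] by simp_all
    then obtain y2 y1 where y1: "y1 \<in> Obj A" "src a = emb_ob y1" "y2 \<in> Obj A" "tgt a = emb_ob y2" by (elim imageE)
    have "src b \<in> emb_ob ` Obj A" using LF.A.R.Sym_inner[OF fs2] by simp
    then obtain y3 where y3: "y3 \<in> Obj A" "src b = emb_ob y3" by (elim imageE)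
    have ab: "a \<in> carrier (HA (emb_ob y1) (emb_ob y2) (deg a))" "b \<in> carrier (HA (emb_ob y3) (emb_ob y1) (deg b))"
      using adj(4,5) y1(2,4) y3(2) adj(1) by simp_all
    have mg: "LF.A.dg.merge i (f0 # mid @ [fl]) = f0 # (us @ cA a b # vs) @ [fl]"
      using LF.A.dg.merge_append[of "f0 # us" i a b "vs @ [fl]"] mid(1) m by simp
    have mgW: "LF.A.D.dg.merge i (id0 y0 # map ue mid @ [id0 yr]) = id0 y0 # map ue (us @ cA a b # vs) @ [id0 yr]"
      using LF.A.D.dg.merge_append[of "id0 y0 # map ue us" i "ue a" "ue b" "map ue vs @ [id0 yr]"] mid(1) m
        LF.A.unemb_gComp[OF y3(1) y1(1,3) ab(2,1)] by simp
    show ?thesis unfolding mg mgW core_eq[OF e] by (simp add: algebra_simps)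
  qed
qed

text \<open>The Leibniz rule for the threefold composite gives a term for each outer entry and,
  through \<open>dif_T\<close>, the merges. If a middle entry has nonzero degree it is zero, and
  then both sides vanish.\<close>

lemma Phi_dif:
  assumes fs: "fs \<in> RSym X X' n"
  shows "dif (Chb B) (Phi X X' n fs) = LF.A.R.bar_dif_ext (HM X X' (n + 1)) (Phi X X' (n + 1)) fs"
proof -
  obtain f0 mid fl y0 yr where s: "fs = f0 # mid @ [fl]" "y0 \<in> Obj A" "yr \<in> Obj A" "X \<in> ObA" "X' \<in> ObA"
    "f0 \<in> carrier (HA (emb_ob y0) X (deg f0))" "fl \<in> carrier (HA X' (emb_ob yr) (deg fl))"
    "id0 y0 # map ue mid @ [id0 yr] \<in> DSym y0 yr (n - deg f0 - deg fl)" using fs by (rule LF.A.rel_sym_split)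
  have e: "src f0 = emb_ob y0" "tgt fl = emb_ob yr" using s(6,7) by (auto simp: LF.A.HC_iff)
  let ?H = "HM X X' (n + 1)"
  interpret H: module K ?H by (rule HM_module[OF s(4,5)])
  note H0 = HM_module[OF s(4,5), of n]
  note ml = Phi_multilinear[OF s(4,5)]
  note dl = LF.B.dg.dif_linear[OF LG.LO_Ob[OF s(5)] LF.LO_Ob[OF s(4)], of n]
  have inner: "\<exists>y y'. y \<in> Obj A \<and> y' \<in> Obj A \<and> f \<in> carrier (HA (emb_ob y) (emb_ob y') (deg f))"
    if "us @ f # vs \<in> RSym X X' n'" "us \<noteq> []" "vs \<noteq> []" for f us vs n'
  proof -
    have "f \<in> carrier (HA (src f) (tgt f) (deg f))"
      using that(1) unfolding LF.A.R.Sym_iff LF.A.dg.arr_def by simp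
    with LF.A.R.Sym_inner[OF that] show ?thesis by (elim imageE) auto
  qed
  show ?thesis
  proof (cases "\<forall>f\<in>set mid. deg f = 0")
    case False
    then obtain f us vs where f: "deg f \<noteq> 0" "mid = us @ f # vs" by (metis split_list)
    have s1: "(f0 # us) @ f # (vs @ [fl]) \<in> RSym X X' n" using fs s(1) f(2) by simp
    obtain y y' where y: "y \<in> Obj A" "y' \<in> Obj A" "f \<in> carrier (HA (emb_ob y) (emb_ob y') (deg f))"
      using inner[OF s1] by auto
    note z = LF.A.emb_zero[OF y f(1)]
    have fz: "fs = (f0 # us) @ \<zero>\<^bsub>HA (emb_ob y) (emb_ob y') (deg f)\<^esub> # (vs @ [fl])" using s(1) f(2) z by simp
    note oy = LF.A.emb_Ob[OF y(1)] LF.A.emb_Ob[OF y(2)]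
    have "Phi X X' n fs = \<zero>\<^bsub>HM X X' n\<^esub>"
      unfolding fz using fs[unfolded fz] by (rule LF.A.R.multilinear_zero[OF ml H0 _ oy])
    moreover have "LF.A.R.bar_dif_ext ?H (Phi X X' (n + 1)) fs = \<zero>\<^bsub>?H\<^esub>"
      unfolding fz using fs[unfolded fz]
      by (rule LF.A.R.multilinear_zero[OF LF.A.R.multilinear_bar_dif[OF ml H.module_axioms] H.module_axioms _ oy])
    ultimately show ?thesis using linear_map_zero[OF H0 H.module_axioms dl] by simp
  next
    case True
    let ?r = "length mid" and ?k = "deg f0" and ?l = "deg fl"
    let ?W = "id0 y0 # map ue mid @ [id0 yr]"
    define m where "m = n - ?k - ?l"
    have sum0: "sum_list (map deg mid) = 0" using True by (induction mid) simp_all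
    \<comment> \<open>A middle part whose entries have degree zero has degree minus its length,
      which makes the sign \<open>(-1)^m\<close> from the Leibniz rule equal to
      \<open>(-1)^r\<close>.\<close>
    have m: "m = - int ?r" using fs sum0 unfolding LF.A.R.Sym_iff s(1) m_def by simp
    note W = s(8)[folded m_def]
    note fs' = fs[unfolded s(1)]
    let ?t = "T y0 yr m ?W"
    note t = T_closed[OF s(2,3) W]
    note ob = LG.LO_Ob[OF s(5)] LG.F_obj[OF s(3)] LF.F_obj[OF s(2)] LF.LO_Ob[OF s(4)]
    note Lf = LMF_closed[OF s(2,4,6)] and Lg = LMG_closed[OF s(3,5,7)]
    let ?c = "cB (LF.LM f0) (cB ?t (LG.LM fl))"
    have nn: "?k + m + ?l = n" "?k + (m + ?l) = n" "?k + (m + 1) + ?l = n + 1" "(?k + 1) + m + ?l = n + 1" "?k + m + (?l + 1) = n + 1"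
      by (simp_all add: m_def)
    have c: "?c \<in> carrier (HM X X' n)" using core_closed_aux(2)[OF s(2-6) t s(7)] unfolding nn .
    note ct = core_closed_aux(1)[OF s(2-6) t s(7)]
    have df0: "dif (Chb A) f0 \<in> carrier (HA (emb_ob y0) X (?k + 1))"
      by (rule linear_mapsD(1)[OF LF.A.dg.dif_linear[OF LF.A.emb_Ob[OF s(2)] s(4)] s(6)])
    have dfl: "dif (Chb A) fl \<in> carrier (HA X' (emb_ob yr) (?l + 1))"
      by (rule linear_mapsD(1)[OF LF.A.dg.dif_linear[OF s(5) LF.A.emb_Ob[OF s(3)]] s(7)])
    have dLf: "dif (Chb B) (LF.LM f0) = LF.LM (dif (Chb A) f0)" by (rule LF.LM_dif[OF LF.A.emb_Ob[OF s(2)] s(4,6), symmetric])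
    have dLg: "dif (Chb B) (LG.LM fl) = LG.LM (dif (Chb A) fl)" by (rule LG.LM_dif[OF s(5) LF.A.emb_Ob[OF s(3)] s(7), symmetric])
    let ?I = "{i. 0 < ?r \<and> i \<le> ?r}"
    define Tm where "Tm i = T y0 yr (m + 1) (LF.A.D.dg.merge i ?W)" for i
    let ?Ht = "HB (fobj G yr) (fobj F y0) (m + 1)"
    note Htm = HB_module[OF s(2,3), of "m + 1"]
    have Tm: "Tm i \<in> carrier ?Ht" if "i \<in> ?I" for i
      unfolding Tm_def using that by (intro T_closed[OF s(2,3)] LF.A.Bd.Sym_merge'[OF W]) auto
    have dt: "dif (Chb B) ?t = finsum ?Ht (\<lambda>i. signed ?Ht (int i) (Tm i)) ?I"
      using dif_T[OF s(2,3) W] by (simp add: Tm_def)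
    have Tms: "(\<lambda>i. signed ?Ht (int i) (Tm i)) \<in> ?I \<rightarrow> carrier ?Ht"
      using Tm signed_closed[OF Htm] by blast
    have dtc: "dif (Chb B) ?t \<in> carrier ?Ht"
      by (rule linear_mapsD(1)[OF LF.B.dg.dif_linear[OF ob(2,3)] t])
    note L1 = core_linear(1)[OF s(2-7), of "m + 1", unfolded nn]
    define a where "a = cB (LF.LM (dif (Chb A) f0)) (cB ?t (LG.LM fl))"
    define b where "b i = cB (LF.LM f0) (cB (Tm i) (LG.LM fl))" for i
    define d where "d = cB (LF.LM f0) (cB ?t (LG.LM (dif (Chb A) fl)))"
    have a: "a \<in> carrier ?H" unfolding a_def using core_closed_aux(2)[OF s(2-5) df0 t s(7)] unfolding nn .
    have b: "b i \<in> carrier ?H" if "i \<in> ?I" for i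
      unfolding b_def using linear_mapsD(1)[OF L1 Tm[OF that]] .
    have d: "d \<in> carrier ?H" unfolding d_def using core_closed_aux(2)[OF s(2-6) t dfl] unfolding nn .
    have bsum: "cB (LF.LM f0) (cB (dif (Chb B) ?t) (LG.LM fl)) = finsum ?H (\<lambda>i. signed ?H (int i) (b i)) ?I"
      unfolding dt linear_map_finsum[OF Htm H.module_axioms L1 Tms]
      unfolding b_def using Tm linear_map_signed[OF Htm H.module_axioms L1] signed_closed[OF H.module_axioms] linear_mapsD(1)[OF L1]
      by (intro H.M.finsum_cong') auto
    have bs: "(\<lambda>i. signed ?H e (b i)) \<in> ?I \<rightarrow> carrier ?H" "(\<lambda>i. signed ?H (int i) (b i)) \<in> ?I \<rightarrow> carrier ?H" for e
      using b signed_closed[OF H.module_axioms] by blast+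
    note S = H.M.finsum_closed[OF bs(2)]
    have dc: "dif (Chb B) ?c = a \<oplus>\<^bsub>?H\<^esub> signed ?H ?k (finsum ?H (\<lambda>i. signed ?H (int i) (b i)) ?I \<oplus>\<^bsub>?H\<^esub> signed ?H m d)"
    proof -
      have e1: "m + ?l + 1 = m + 1 + ?l" "?k + (m + 1 + ?l) = n + 1" "?k + (m + ?l) + 1 = n + 1" by (simp_all add: nn m_def)
      let ?H2 = "HB (LG.LO X') (fobj F y0) (m + 1 + ?l)"
      have H2m: "module K ?H2" by (rule LF.B.HC_module[OF ob(1,3)])
      have p: "cB (dif (Chb B) ?t) (LG.LM fl) \<in> carrier ?H2" by (rule LF.B.gComp_closed[OF ob(1-3) Lg dtc])
      have q: "cB ?t (LG.LM (dif (Chb A) fl)) \<in> carrier ?H2"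
        using core_closed_aux(1)[OF s(2-6) t dfl] by (simp add: algebra_simps)
      note LL = LF.B.gComp_lin_right[OF ob(1,3,4) Lf, of "m + 1 + ?l", unfolded e1]
      have "dif (Chb B) ?c = cB (dif (Chb B) (LF.LM f0)) (cB ?t (LG.LM fl)) \<oplus>\<^bsub>?H\<^esub>
        signed ?H ?k (cB (LF.LM f0) (dif (Chb B) (cB ?t (LG.LM fl))))"
        using LF.B.dg.dif_gComp[OF ob(1,3,4) ct Lf] unfolding nn .
      also have "dif (Chb B) (cB ?t (LG.LM fl)) = cB (dif (Chb B) ?t) (LG.LM fl) \<oplus>\<^bsub>?H2\<^esub>
        signed ?H2 m (cB ?t (LG.LM (dif (Chb A) fl)))"
        using LF.B.dg.dif_gComp[OF ob(1-3) Lg t] unfolding e1 dLg .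
      also have "cB (LF.LM f0) (cB (dif (Chb B) ?t) (LG.LM fl) \<oplus>\<^bsub>?H2\<^esub> signed ?H2 m (cB ?t (LG.LM (dif (Chb A) fl)))) =
        finsum ?H (\<lambda>i. signed ?H (int i) (b i)) ?I \<oplus>\<^bsub>?H\<^esub> signed ?H m d"
        unfolding linear_mapsD(2)[OF LL p signed_closed[OF H2m q]] linear_map_signed[OF H2m H.module_axioms LL q] bsum d_def ..
      finally show ?thesis unfolding dLf a_def .
    qed
    let ?e = "int ?r * ?k"
    have lhs: "dif (Chb B) (Phi X X' n fs) = signed ?H ?e a \<oplus>\<^bsub>?H\<^esub>
      (finsum ?H (\<lambda>i. signed ?H (?e + ?k + int i) (b i)) ?I \<oplus>\<^bsub>?H\<^esub> signed ?H (?e + ?k + m) d)"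
    proof -
      have "dif (Chb B) (Phi X X' n fs) = signed ?H ?e (dif (Chb B) ?c)"
        unfolding s(1) Phi_eq[OF e] m_def[symmetric] by (rule linear_map_signed[OF H0 H.module_axioms dl c])
      also have "\<dots> = signed ?H ?e a \<oplus>\<^bsub>?H\<^esub>
        (signed ?H (?e + ?k) (finsum ?H (\<lambda>i. signed ?H (int i) (b i)) ?I) \<oplus>\<^bsub>?H\<^esub> signed ?H (?e + ?k + m) d)"
        unfolding dc using a S d
        by (simp add: signed_add[OF H.module_axioms] signed_signed[OF H.module_axioms] signed_closed[OF H.module_axioms] add.assoc)
      also have "signed ?H (?e + ?k) (finsum ?H (\<lambda>i. signed ?H (int i) (b i)) ?I) =
        finsum ?H (\<lambda>i. signed ?H (?e + ?k + int i) (b i)) ?I"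
        unfolding signed_finsum[OF H.module_axioms bs(2)]
        using b by (intro H.M.finsum_cong') (auto simp: signed_signed[OF H.module_axioms] intro: signed_closed[OF H.module_axioms])
      finally show ?thesis .
    qed
    have ln: "length fs - 2 = ?r" using s(1) by simp
    have merges: "Phi X X' (n + 1) (LF.A.dg.merge i fs) = signed ?H (int (?r - 1) * ?k) (b i)" if i: "i \<in> ?I" for i
    proof -
      have mne: "mid \<noteq> []" "i \<le> length mid" using i by auto
      note cm = core_merge[OF fs' e s(2-7) True mne(2,1), folded m_def]
      have "length (LF.A.dg.merge i (f0 # mid @ [fl])) - 2 = ?r - 1"
        using i by (simp add: LF.A.dg.merge_def) arith
      then show ?thesis unfolding Phi_def s(1) using cm by (simp add: b_def Tm_def)
    qed
    have in1: "fs[0 := dif (Chb A) (fs ! 0)] = dif (Chb A) f0 # mid @ [fl]" using s(1) by simp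
    have in2: "fs[?r + 1 := dif (Chb A) (fs ! (?r + 1))] = f0 # mid @ [dif (Chb A) fl]"
      using s(1) by (simp add: nth_append list_update_append)
    have ed: "src (dif (Chb A) f0) = emb_ob y0" "deg (dif (Chb A) f0) = ?k + 1" "tgt (dif (Chb A) fl) = emb_ob yr"
      "deg (dif (Chb A) fl) = ?l + 1" using df0 dfl by (auto simp: LF.A.HC_iff)
    have i3: "n + 1 - (?k + 1) - ?l = m" "n + 1 - ?k - (?l + 1) = m" by (simp_all add: m_def)
    have P1: "Phi X X' (n + 1) (fs[0 := dif (Chb A) (fs ! 0)]) = signed ?H (int ?r * (?k + 1)) a"
      unfolding in1 Phi_eq[OF ed(1) e(2)] ed(2) i3 a_def ..
    have P2: "Phi X X' (n + 1) (fs[?r + 1 := dif (Chb A) (fs ! (?r + 1))]) = signed ?H ?e d"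
      unfolding in2 Phi_eq[OF e(1) ed(3)] ed(4) i3 d_def ..
    have sd: "(\<Sum>j<?r + 1. deg (fs ! j)) = ?k"
    proof -
      have "(\<Sum>j<?r. deg ((mid @ [fl]) ! j)) = 0" using True by (intro sum.neutral) (simp add: nth_append)
      then show ?thesis unfolding s(1) by (simp add: lessThan_Suc_eq_insert_0 sum.reindex zero_notin_Suc_image del: sum.lessThan_Suc)
    qed
    let ?f = "\<lambda>i. signed ?H (int ?r + (\<Sum>j<i. deg (fs ! j))) (Phi X X' (n + 1) (fs[i := dif (Chb A) (fs ! i)]))"
    have fc: "?f \<in> {0..?r + 1} \<rightarrow> carrier ?H"
      using LF.A.R.bar_dif_terms_closed(1)[OF ml H.module_axioms fs] unfolding ln .
    \<comment> \<open>Differentials of middle entries are maps of degree one between objects of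
      \<open>A\<close>, hence zero.\<close>
    have fz: "?f i = \<zero>\<^bsub>?H\<^esub>" if i: "0 < i" "i \<le> ?r" for i
    proof -
      have il: "i < length fs" using i s(1) by simp
      have s1: "take i fs @ fs ! i # drop (Suc i) fs \<in> RSym X X' n" using fs by (simp only: id_take_nth_drop[OF il, symmetric])
      have ne: "take i fs \<noteq> []" "drop (Suc i) fs \<noteq> []" using i s(1) by auto
      obtain y y' where y: "y \<in> Obj A" "y' \<in> Obj A" "fs ! i \<in> carrier (HA (emb_ob y) (emb_ob y') (deg (fs ! i)))"
        using inner[OF s1 ne] by auto
      have "fs ! i \<in> set mid" using i s(1) by (cases i) (auto simp: nth_append)
      then have "deg (fs ! i) = 0" using True by blast
      then have y3: "fs ! i \<in> carrier (HA (emb_ob y) (emb_ob y') 0)" using y(3) by simp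
      note oy = LF.A.emb_Ob[OF y(1)] LF.A.emb_Ob[OF y(2)]
      have "dif (Chb A) (fs ! i) \<in> carrier (HA (emb_ob y) (emb_ob y') (0 + 1))"
        by (rule linear_mapsD(1)[OF LF.A.dg.dif_linear[OF oy] y3])
      then have z: "dif (Chb A) (fs ! i) = \<zero>\<^bsub>HA (emb_ob y) (emb_ob y') (0 + 1)\<^esub>"
        by (rule LF.A.emb_zero[OF y(1,2)]) simp
      have "Phi X X' (n + 1) (fs[i := dif (Chb A) (fs ! i)]) = \<zero>\<^bsub>?H\<^esub>"
        using LF.A.R.Sym_dif[OF fs il] unfolding upd_conv_take_nth_drop[OF il] z
        by (rule LF.A.R.multilinear_zero[OF ml H.module_axioms _ oy])
      then show ?thesis by (simp add: signed_zero[OF H.module_axioms])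
    qed
    have g: "finsum ?H (\<lambda>i. signed ?H (int i) (Phi X X' (n + 1) (LF.A.dg.merge i fs))) ?I =
      finsum ?H (\<lambda>i. signed ?H (?e + ?k + int i) (b i)) ?I"
    proof (rule H.M.finsum_cong'[OF refl])
      fix i assume i: "i \<in> ?I"
      then have "0 < ?r" by simp
      then have r1: "int (?r - 1) = int ?r - 1" by arith
      have "signed ?H (int i) (Phi X X' (n + 1) (LF.A.dg.merge i fs)) = signed ?H (int i + int (?r - 1) * ?k) (b i)"
        unfolding merges[OF i] by (rule signed_signed[OF H.module_axioms b[OF i]])
      also have "\<dots> = signed ?H (?e + ?k + int i) (b i)"
      proof (rule signed_cong)
        \<comment> \<open>The merged symbol carries \<open>(-1)^((r-1)k)\<close> and the Leibniz
          rule yields \<open>(-1)^(rk+k)\<close>; the exponents differ by \<open>2k\<close>.\<close>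
        have "int i + int (?r - 1) * ?k - (?e + ?k + int i) = 2 * (- ?k)" unfolding r1 by (simp add: algebra_simps)
        then show "even (int i + int (?r - 1) * ?k - (?e + ?k + int i))" by (simp only: dvd_triv_left)
      qed
      finally show "signed ?H (int i) (Phi X X' (n + 1) (LF.A.dg.merge i fs)) = signed ?H (?e + ?k + int i) (b i)" .
    qed (use b signed_closed[OF H.module_axioms] in blast)
    have gc: "finsum ?H (\<lambda>i. signed ?H (?e + ?k + int i) (b i)) ?I \<in> carrier ?H"
      using b signed_closed[OF H.module_axioms] by (intro H.M.finsum_closed) blast
    have f0': "?f 0 = signed ?H ?e a"
      unfolding P1 using signed_signed[OF H.module_axioms a] by (simp) (rule signed_cong, simp add: algebra_simps)
    have f1': "?f (?r + 1) = signed ?H (?e + ?k + m) d"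
      unfolding P2 sd signed_signed[OF H.module_axioms d] by (rule signed_cong) (simp add: m algebra_simps)
    have E: "finsum ?H ?f {0..?r + 1} = signed ?H ?e a \<oplus>\<^bsub>?H\<^esub> signed ?H (?e + ?k + m) d"
      unfolding f0'[symmetric] f1'[symmetric] by (rule H.M.finsum_ends[OF fc fz])
    have "LF.A.R.bar_dif_ext ?H (Phi X X' (n + 1)) fs = (signed ?H ?e a \<oplus>\<^bsub>?H\<^esub> signed ?H (?e + ?k + m) d) \<oplus>\<^bsub>?H\<^esub>
      finsum ?H (\<lambda>i. signed ?H (?e + ?k + int i) (b i)) ?I"
      unfolding LF.A.R.bar_dif_ext_def ln g E ..
    then show ?thesis unfolding lhs using gc a d signed_closed[OF H.module_axioms] by (simp add: H.M.a_ac)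
  qed
qed

definition tau' :: "('o,'m) cplx \<Rightarrow> ('o,'m) cplx \<Rightarrow> int \<Rightarrow>
    ((('o,'m) cplx,int \<Rightarrow> 'm) harr list \<Rightarrow> 'k) set \<Rightarrow> (('p,'n) cplx,int \<Rightarrow> 'n) harr" where
  "tau' X X' n = lin_ext K (bmod MB X X' n) (Phi X X' n)"

lemma lin_MB: "lin_bimodule K (Chb A) MB"
  by (rule lin_bimodule_functor_bimodule[OF LF.B.dg.dg_category_axioms])
     (simp_all add: lift_def LF.LO_Ob LG.LO_Ob LF.LM_closed LG.LM_closed)

lemma tau'_bimodule_map: "bimodule_map K (Chb A) (rel_Bar K (Chb A) (emb_ob ` Obj A)) MB 0 tau'"
  unfolding tau'_def[abs_def]
  by (rule LF.A.R.bimodule_map_lin_ext[OF lin_MB]) (simp_all only: MB_simps Phi_multilinear Phi_left Phi_right)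

lemma tau'_closed: "closed_map (Chb A) (rel_Bar K (Chb A) (emb_ob ` Obj A)) MB 0 tau'"
  unfolding tau'_def[abs_def]
  by (rule LF.A.R.closed_map_lin_ext[OF lin_MB]) (simp_all only: MB_simps Phi_multilinear Phi_dif)

lemma tau'_el:
  assumes "X \<in> ObA" "X' \<in> ObA" "fs \<in> RSym X X' n"
  shows "tau' X X' n (bar_elem K (Chb A) (emb_ob ` Obj A) X X' n fs) = Phi X X' n fs"
  unfolding tau'_def MB_simps
  by (rule LF.A.R.lin_ext_el[OF HM_module[OF assms(1,2)] Phi_multilinear[OF assms(1,2)] assms(3)])

end

section \<open>Inserting differentials: the sign identity\<close>

text \<open>The counterpart of \<open>signed\<close> in a type of class \<open>ab_group_add\<close>,
  where sums carry no membership conditions.\<close>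

definition sgm :: "int \<Rightarrow> 'v::ab_group_add \<Rightarrow> 'v" where
  "sgm e v = (if even e then v else - v)"

lemma sgm_simps:
  "sgm e (a + b) = sgm e a + sgm e b" "sgm e (a - b) = sgm e a - sgm e b" "sgm e (- a) = - sgm e a"
  "sgm e 0 = 0" "sgm e (sgm e' a) = sgm (e + e') a" "sgm 0 a = a"
  by (auto simp: sgm_def)

lemma sgm_sum: "sgm e (sum f I) = (\<Sum>i\<in>I. sgm e (f i))"
  by (simp add: sgm_def sum_negf)

lemma sgm_cong: "even (e - e') \<Longrightarrow> sgm e v = sgm e' v"
  by (auto simp: sgm_def)

lemma sgm_neg: "odd (e - e') \<Longrightarrow> sgm e v = - sgm e' v"
  by (auto simp: sgm_def)

lemma choose_2_Suc: "int (Suc n + 1 choose 2) = int (n + 1 choose 2) + int n + 1"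
  by (simp add: numeral_2_eq_2)

text \<open>\<open>m\<close> is composition and \<open>D x\<close> is the differential of the source
  of \<open>x\<close>, the letter that may be inserted after \<open>x\<close>. A composite has the
  source of its right factor, whence \<open>D (m x y) = D y\<close>. That the differential squares
  to zero is not a law for letters; it enters as a hypothesis on the evaluation
  \<open>c\<close>.\<close>

locale words =
  fixes m :: "'w \<Rightarrow> 'w \<Rightarrow> 'w" and D :: "'w \<Rightarrow> 'w" and dg :: "'w \<Rightarrow> int"
  assumes dg_m: "dg (m x y) = dg x + dg y" and D_m: "D (m x y) = D y"
    and dg_D: "dg (D x) = 1" and D_D: "D (D x) = D x"
begin

definition mrg :: "nat \<Rightarrow> 'w list \<Rightarrow> 'w list" where
  "mrg i w = take i w @ [m (w ! i) (w ! (i + 1))] @ drop (i + 2) w"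

lemma mrg_simps: "mrg 0 (x # y # t) = m x y # t" "mrg (Suc i) (x # w) = x # mrg i w"
  by (simp_all add: mrg_def)

lemma length_mrg: "i + 1 < length w \<Longrightarrow> length (mrg i w) = length w - 1"
  by (simp add: mrg_def)

text \<open>The signed sum over insertions in \<open>\<Xi>\<close>, with every block shorter than
  \<open>B\<close> and with \<open>c\<close> as a continuation that evaluates the finished word. The
  exponent is split at the first letter: \<open>length w - length (y # t)\<close> counts the
  differentials inserted later, and the mixed terms of the binomial coefficient and of the degree
  sum are charged to the continuation.\<close>

fun X :: "nat \<Rightarrow> ('w list \<Rightarrow> 'v::ab_group_add) \<Rightarrow> 'w list \<Rightarrow> 'v" where
  "X B c [] = 0"
| "X B c [x] = c [x]"
| "X B c (x # y # t) = (\<Sum>n<B. sgm (int (n + 1 choose 2) + (int (length (y # t)) - 1) * int n + dg x * int n)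
     (X B (\<lambda>w. sgm ((int n + dg x) * (int (length w) - int (length (y # t)))) (c (x # replicate n (D x) @ w))) (y # t)))"

lemma X_Cons: "g \<noteq> [] \<Longrightarrow> X B c (x # g) =
    (\<Sum>n<B. sgm (int (n + 1 choose 2) + (int (length g) - 1) * int n + dg x * int n)
     (X B (\<lambda>w. sgm ((int n + dg x) * (int (length w) - int (length g))) (c (x # replicate n (D x) @ w))) g))"
  by (cases g) simp_all

lemma X_cong: "(\<And>w. w \<noteq> [] \<Longrightarrow> c w = c' w) \<Longrightarrow> X B c f = X B c' f"
proof (induction f arbitrary: c c' rule: induct_list012)
  case (3 x y t)
  show ?case by (simp only: X.simps) (intro sum.cong refl arg_cong[of _ _ "sgm _"] 3(2), simp add: 3(3))
qed simp_all

lemma X_add: "X B (\<lambda>w. c w + c' w) f = X B c f + X B c' f"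
  by (induction f arbitrary: c c' rule: induct_list012) (simp_all add: sgm_simps sum.distrib)

lemma X_sgm:
  fixes c :: "'w list \<Rightarrow> 'v::ab_group_add"
  shows "X B (\<lambda>w. sgm e (c w)) f = sgm e (X B c f)"
proof (induction f arbitrary: c rule: induct_list012)
  case (3 x y t)
  have *: "X B (\<lambda>w. sgm (a' w) (sgm e (c w))) (y # t) = sgm e (X B (\<lambda>w. sgm (a' w) (c w)) (y # t))"
    for a' and c :: "'w list \<Rightarrow> 'v"
    using 3(2)[of "\<lambda>w. sgm (a' w) (c w)"] by (simp add: sgm_simps add.commute)
  show ?case unfolding X.simps * sgm_sum unfolding sgm_simps by (simp only: add_ac)
qed (simp_all add: sgm_simps)

lemma X_zero: "X B (\<lambda>w. 0) f = 0"
  by (induction f rule: induct_list012) (simp_all add: sgm_simps)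

text \<open>Composing \<open>z\<close> onto the first letter keeps the inserted differentials and
  changes the exponent by \<open>|z|\<close> times their number, which is the excess length of the
  word.\<close>

lemma X_head:
  "X B c (m z y # t) = X B (\<lambda>w. sgm (dg z * (int (length w) - int (length (y # t)))) (c (m z (hd w) # tl w))) (y # t)"
proof (cases t)
  case Nil
  then show ?thesis by (simp add: sgm_simps)
next
  case (Cons y2 t2)
  let ?g = "y2 # t2"
  have e: "sgm (int (n + 1 choose 2) + (int (length ?g) - 1) * int n + dg (m z y) * int n)
     (X B (\<lambda>w. sgm ((int n + dg (m z y)) * (int (length w) - int (length ?g))) (c (m z y # replicate n (D (m z y)) @ w))) ?g) =
    sgm (int (n + 1 choose 2) + (int (length ?g) - 1) * int n + dg y * int n)
     (X B (\<lambda>w. sgm ((int n + dg y) * (int (length w) - int (length ?g)))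
       (sgm (dg z * (int (length (y # replicate n (D y) @ w)) - int (length (y # ?g))))
          (c (m z (hd (y # replicate n (D y) @ w)) # tl (y # replicate n (D y) @ w))))) ?g)" for n
  proof -
    have P: "X B (\<lambda>w. sgm ((int n + dg y) * (int (length w) - int (length ?g)))
       (sgm (dg z * (int (length (y # replicate n (D y) @ w)) - int (length (y # ?g))))
          (c (m z (hd (y # replicate n (D y) @ w)) # tl (y # replicate n (D y) @ w))))) ?g =
      X B (\<lambda>w. sgm (dg z * int n) (sgm ((int n + dg (m z y)) * (int (length w) - int (length ?g)))
        (c (m z y # replicate n (D (m z y)) @ w)))) ?g"
      by (rule X_cong) (simp add: sgm_simps D_m dg_m algebra_simps)
    show ?thesis unfolding P X_sgm unfolding sgm_simps(5) dg_m by (rule sgm_cong) (simp add: algebra_simps)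
  qed
  show ?thesis unfolding Cons X_Cons[OF list.simps(3)] e ..
qed

text \<open>The merge part of the bar differential, written as an operation on evaluations of
  words.\<close>

definition mu :: "('w list \<Rightarrow> 'v::ab_group_add) \<Rightarrow> 'w list \<Rightarrow> 'v" where
  "mu c w = (\<Sum>p<length w - 1. sgm (int p) (c (mrg p w)))"

lemma mu_Cons:
  fixes c :: "'w list \<Rightarrow> 'v::ab_group_add"
  shows "w \<noteq> [] \<Longrightarrow> mu c (x # w) = c (m x (hd w) # tl w) - mu (\<lambda>u. c (x # u)) w"
proof -
  assume "w \<noteq> []"
  then obtain y t where w: "w = y # t" by (cases w) auto
  have s: "sgm (int (Suc p)) v = - sgm (int p) v" for p and v :: 'v by (simp add: sgm_def)
  show ?thesis unfolding mu_def w
    by (simp add: sum.lessThan_Suc_shift mrg_simps sgm_simps(6) s sum_negf del: sum.lessThan_Suc of_nat_Suc)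
qed

text \<open>Merges inside the block compose two differentials and vanish; the last differential
  meets the head of \<open>w\<close>, and the remaining merges lie in \<open>w\<close>.\<close>

lemma mu_replicate:
  assumes "\<And>us vs. c (us @ m (D x) (D x) # vs) = 0" "w \<noteq> []"
  shows "mu c (replicate (Suc n) (D x) @ w) = sgm (int n) (c (replicate n (D x) @ m (D x) (hd w) # tl w)) +
    sgm (int (Suc n)) (mu (\<lambda>u. c (replicate (Suc n) (D x) @ u)) w)"
  using assms(1)
proof (induction n arbitrary: c)
  case 0
  then show ?case using mu_Cons[OF assms(2), of c "D x"] by (simp add: sgm_def)
next
  case (Suc n)
  have 1: "mu c (replicate (Suc (Suc n)) (D x) @ w) = - mu (\<lambda>u. c (D x # u)) (replicate (Suc n) (D x) @ w)"
    using mu_Cons[of "replicate (Suc n) (D x) @ w" c "D x"] Suc.prems[of "[]"] by simp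
  have 2: "mu (\<lambda>u. c (D x # u)) (replicate (Suc n) (D x) @ w) =
    sgm (int n) (c (D x # replicate n (D x) @ m (D x) (hd w) # tl w)) +
    sgm (int (Suc n)) (mu (\<lambda>u. c (D x # replicate (Suc n) (D x) @ u)) w)"
    by (rule Suc.IH) (metis Suc.prems append_Cons)
  show ?case unfolding 1 2 by (simp add: sgm_def)
qed

lemma mu_block:
  assumes "\<And>us vs. c (us @ m (D x) (D x) # vs) = 0" "w \<noteq> []"
  shows "mu c (x # replicate (Suc n) (D x) @ w) = c (m x (D x) # replicate n (D x) @ w) +
    sgm (int (Suc n)) (c (x # replicate n (D x) @ m (D x) (hd w) # tl w)) +
    sgm (int (Suc n) + 1) (mu (\<lambda>u. c (x # replicate (Suc n) (D x) @ u)) w)"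
proof -
  have "mu (\<lambda>u. c (x # u)) (replicate (Suc n) (D x) @ w) = sgm (int n) (c (x # replicate n (D x) @ m (D x) (hd w) # tl w)) +
    sgm (int (Suc n)) (mu (\<lambda>u. c (x # replicate (Suc n) (D x) @ u)) w)"
    by (rule mu_replicate[OF _ assms(2)]) (metis assms(1) append_Cons)
  then show ?thesis
    using mu_Cons[of "replicate (Suc n) (D x) @ w" c x] by (simp add: sgm_def)
qed

text \<open>A merge shortens the word by one, so a length dependent sign passes through
  \<open>mu\<close> with its offset shifted by one.\<close>

lemma mu_sgm_length:
  "mu (\<lambda>w. sgm (k * (int (length w) - l)) (c w)) w = sgm (k * (int (length w) - l - 1)) (mu c w)"
  unfolding mu_def sgm_sum
proof (intro sum.cong refl)
  fix p assume p: "p \<in> {..<length w - 1}"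
  then have l: "int (length (mrg p w)) = int (length w) - 1" using length_mrg[of p w] by auto
  show "sgm (int p) (sgm (k * (int (length (mrg p w)) - l)) (c (mrg p w))) =
    sgm (k * (int (length w) - l - 1)) (sgm (int p) (c (mrg p w)))"
    unfolding l sgm_simps by (rule sgm_cong) (simp add: algebra_simps)
qed

text \<open>The first letter \<open>x\<close> is followed by \<open>n\<close> differentials. Merges
  of \<open>x\<close> with its successor are collected in \<open>\<alpha>\<close>, merges of the
  last differential with the next letter in \<open>\<beta>\<close>, and the rest is left to the
  induction hypothesis. For positive \<open>n\<close> these terms are those of
  \<open>x\<delta>\<close> and of \<open>\<delta>y\<close> with a block shorter by one; for
  \<open>n = 0\<close> the merge of \<open>x\<close> and \<open>y\<close> remains. The bound
  \<open>Suc b\<close> lets \<open>n\<close> reach the vanishing length \<open>b\<close>, so that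
  lowering \<open>n\<close> by one loses nothing.\<close>

theorem X_mu:
  assumes "f \<noteq> []" "\<And>us vs z. c (us @ m (D z) (D z) # vs) = 0"
    "\<And>us vs z. c (us @ replicate b (D z) @ vs) = 0"
  shows "X (Suc b) (mu c) f = (\<Sum>i<length f - 1.
      sgm (int (length f - 1) + (\<Sum>j\<le>i. dg (f ! j))) (X (Suc b) c (f[i := m (f ! i) (D (f ! i))])) -
      sgm (int (length f - 1) + (\<Sum>j\<le>i. dg (f ! j))) (X (Suc b) c (f[Suc i := m (D (f ! i)) (f ! Suc i)])) +
      sgm (int i) (X (Suc b) c (mrg i f)))"
  using assms
proof (induction f arbitrary: c rule: induct_list012)
  case (2 x)
  then show ?case by (simp add: mu_def)
next
  case (3 x y t)
  let ?B = "Suc b"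
  define g where "g = y # t"
  have g: "g \<noteq> []" "length g = Suc (length t)" by (simp_all add: g_def)
  define k where "k = dg x"
  define l where "l = int (length g)"
  \<comment> \<open>The exponent that the recursion of \<open>X\<close> attaches to \<open>n\<close>
    differentials after \<open>x\<close>; \<open>cn n\<close> is the continuation then left for
    \<open>g\<close>.\<close>
  define E where "E n = int (n + 1 choose 2) + (l - 1) * int n + k * int n" for n
  define cn where "cn n w = sgm ((int n + k) * (int (length w) - l)) (c (x # replicate n (D x) @ w))" for n w
  define \<alpha> where "\<alpha> n w = sgm ((int n + k) * (int (length w) - l))
    (if n = 0 then c (m x (hd w) # tl w) else c (m x (D x) # replicate (n - 1) (D x) @ w))" for n w
  define \<beta> where "\<beta> n w = sgm ((int n + k) * (int (length w) - l))
    (if n = 0 then 0 else sgm (int n) (c (x # replicate (n - 1) (D x) @ m (D x) (hd w) # tl w)))" for n w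
  have ES: "E (Suc n) = E n + int n + l + k" for n
    unfolding E_def choose_2_Suc by (simp add: algebra_simps)
  have XC: "X ?B c (x # h) = (\<Sum>n<?B. sgm (E n) (X ?B (cn n) h))" if "length h = length g" for h
    using that g by (subst X_Cons) (auto simp: E_def cn_def[abs_def] l_def k_def)
  have step: "X ?B (\<lambda>w. sgm ((int n + k) * (int (length w) - l)) (mu c (x # replicate n (D x) @ w))) g =
    X ?B (\<alpha> n) g + X ?B (\<beta> n) g + sgm (k + 1) (X ?B (mu (cn n)) g)" for n
  proof -
    have "X ?B (\<lambda>w. sgm ((int n + k) * (int (length w) - l)) (mu c (x # replicate n (D x) @ w))) g =
      X ?B (\<lambda>w. (\<alpha> n w + \<beta> n w) + sgm (k + 1) (mu (cn n) w)) g"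
    proof (rule X_cong)
      fix w :: "'w list" assume w: "w \<noteq> []"
      have c1: "mu (cn n) w = sgm ((int n + k) * (int (length w) - l - 1)) (mu (\<lambda>u. c (x # replicate n (D x) @ u)) w)"
        unfolding cn_def[abs_def] by (rule mu_sgm_length)
      have c2: "sgm (k + 1) (mu (cn n) w) = sgm ((int n + k) * (int (length w) - l))
        (sgm (int n + 1) (mu (\<lambda>u. c (x # replicate n (D x) @ u)) w))"
        unfolding c1 sgm_simps by (rule sgm_cong) (simp add: algebra_simps)
      have c3: "mu c (x # replicate n (D x) @ w) =
        (if n = 0 then c (m x (hd w) # tl w) else c (m x (D x) # replicate (n - 1) (D x) @ w)) +
        (if n = 0 then 0 else sgm (int n) (c (x # replicate (n - 1) (D x) @ m (D x) (hd w) # tl w))) +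
        sgm (int n + 1) (mu (\<lambda>u. c (x # replicate n (D x) @ u)) w)"
      proof (cases n)
        case 0
        then show ?thesis using mu_Cons[OF w, of c x] by (simp add: sgm_def)
      next
        case (Suc n')
        then show ?thesis using mu_block[of c x w n', OF _ w] 3(4) by simp
      qed
      show "sgm ((int n + k) * (int (length w) - l)) (mu c (x # replicate n (D x) @ w)) =
        (\<alpha> n w + \<beta> n w) + sgm (k + 1) (mu (cn n) w)"
        unfolding c2 c3 \<alpha>_def \<beta>_def by (simp only: sgm_simps(1))
    qed
    then show ?thesis by (simp add: X_add X_sgm)
  qed
  have A: "(\<Sum>n<?B. sgm (E n) (X ?B (\<alpha> n) g)) = X ?B c (m x y # t) + sgm (l + k) (X ?B c (m x (D x) # g))"
  proof -
    have a0: "X ?B (\<alpha> 0) g = X ?B c (m x y # t)"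
      unfolding X_head g_def[symmetric] \<alpha>_def[abs_def] by (simp add: k_def l_def)
    \<comment> \<open>The letter \<open>x\<delta>\<close> has degree \<open>k + 1\<close>, so
      \<open>n\<close> differentials after it are weighted in the continuation like
      \<open>n + 1\<close> differentials after \<open>x\<close>.\<close>
    have "X ?B c (m x (D x) # g) = (\<Sum>n<?B. sgm (E n + int n)
      (X ?B (\<lambda>w. sgm ((int n + (k + 1)) * (int (length w) - l)) (c (m x (D x) # replicate n (D x) @ w))) g))"
      unfolding X_Cons[OF g(1)] by (intro sum.cong refl) (simp add: E_def k_def l_def dg_m dg_D D_m D_D algebra_simps)
    also have "\<dots> = (\<Sum>n<b. sgm (E n + int n)
      (X ?B (\<lambda>w. sgm ((int n + (k + 1)) * (int (length w) - l)) (c (m x (D x) # replicate n (D x) @ w))) g))"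
    proof -
      \<comment> \<open>The summand \<open>n = b\<close> contains a full block and vanishes.\<close>
      have "c (m x (D x) # replicate b (D x) @ w) = 0" for w using 3(5)[of "[m x (D x)]"] by simp
      then show ?thesis by (simp add: sgm_simps X_zero)
    qed
    finally have a1: "sgm (l + k) (X ?B c (m x (D x) # g)) = (\<Sum>n<b. sgm (l + k) (sgm (E n + int n)
      (X ?B (\<lambda>w. sgm ((int n + (k + 1)) * (int (length w) - l)) (c (m x (D x) # replicate n (D x) @ w))) g)))"
      by (simp add: sgm_sum)
    have "(\<Sum>n<?B. sgm (E n) (X ?B (\<alpha> n) g)) = sgm (E 0) (X ?B (\<alpha> 0) g) + (\<Sum>n<b. sgm (E (Suc n)) (X ?B (\<alpha> (Suc n)) g))"
      by (rule sum.lessThan_Suc_shift)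
    moreover have "sgm (E (Suc n)) (X ?B (\<alpha> (Suc n)) g) = sgm (l + k) (sgm (E n + int n)
      (X ?B (\<lambda>w. sgm ((int n + (k + 1)) * (int (length w) - l)) (c (m x (D x) # replicate n (D x) @ w))) g))" for n
      unfolding ES \<alpha>_def[abs_def] sgm_simps by (simp add: algebra_simps)
    moreover have "E 0 = 0" by (simp add: E_def numeral_2_eq_2)
    ultimately show ?thesis unfolding a1 by (simp only: a0 sgm_simps(6))
  qed
  have Bt: "(\<Sum>n<?B. sgm (E n) (X ?B (\<beta> n) g)) = - sgm (l + k) (X ?B c (x # m (D x) y # t))"
  proof -
    \<comment> \<open>Composing the degree one letter \<open>D x\<close> onto \<open>y\<close> turns
      the weight \<open>n + k\<close> into \<open>n + k + 1\<close>, the one that belongs to a block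
      longer by one.\<close>
    have Xc: "X ?B (cn n) (m (D x) y # t) =
      X ?B (\<lambda>w. sgm ((int n + k + 1) * (int (length w) - l)) (c (x # replicate n (D x) @ m (D x) (hd w) # tl w))) g" for n
      unfolding X_head g_def[symmetric]
    proof (rule X_cong)
      fix w :: "'w list" assume "w \<noteq> []"
      then have "length (m (D x) (hd w) # tl w) = length w" by simp
      then show "sgm (dg (D x) * (int (length w) - int (length g))) (cn n (m (D x) (hd w) # tl w)) =
        sgm ((int n + k + 1) * (int (length w) - l)) (c (x # replicate n (D x) @ m (D x) (hd w) # tl w))"
        unfolding cn_def dg_D sgm_simps by (simp only: l_def[symmetric]) (simp add: algebra_simps)
    qed
    have "X ?B c (x # m (D x) y # t) = (\<Sum>n<?B. sgm (E n) (X ?B (cn n) (m (D x) y # t)))"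
      by (rule XC) (simp add: g_def)
    also have "\<dots> = (\<Sum>n<b. sgm (E n) (X ?B (cn n) (m (D x) y # t)))"
    proof -
      have "c (x # replicate b (D x) @ w) = 0" for w using 3(5)[of "[x]"] by simp
      then show ?thesis by (simp add: cn_def[abs_def] sgm_simps X_zero)
    qed
    finally have b1: "- sgm (l + k) (X ?B c (x # m (D x) y # t)) = (\<Sum>n<b. - sgm (l + k) (sgm (E n)
      (X ?B (\<lambda>w. sgm ((int n + k + 1) * (int (length w) - l)) (c (x # replicate n (D x) @ m (D x) (hd w) # tl w))) g)))"
      unfolding Xc by (simp add: sgm_sum sum_negf)
    have "X ?B (\<beta> 0) g = 0" unfolding \<beta>_def[abs_def] by (simp add: sgm_simps X_zero)
    then have "(\<Sum>n<?B. sgm (E n) (X ?B (\<beta> n) g)) = (\<Sum>n<b. sgm (E (Suc n)) (X ?B (\<beta> (Suc n)) g))"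
      unfolding sum.lessThan_Suc_shift by (simp add: sgm_simps)
    also have "\<dots> = (\<Sum>n<b. - sgm (l + k) (sgm (E n)
      (X ?B (\<lambda>w. sgm ((int n + k + 1) * (int (length w) - l)) (c (x # replicate n (D x) @ m (D x) (hd w) # tl w))) g)))"
    proof (rule sum.cong[OF refl])
      fix n
      have b2: "X ?B (\<beta> (Suc n)) g = sgm (int n + 1)
        (X ?B (\<lambda>w. sgm ((int n + k + 1) * (int (length w) - l)) (c (x # replicate n (D x) @ m (D x) (hd w) # tl w))) g)"
        unfolding X_sgm[symmetric] \<beta>_def[abs_def] by (simp add: sgm_simps algebra_simps)
      show "sgm (E (Suc n)) (X ?B (\<beta> (Suc n)) g) = - sgm (l + k) (sgm (E n)
        (X ?B (\<lambda>w. sgm ((int n + k + 1) * (int (length w) - l)) (c (x # replicate n (D x) @ m (D x) (hd w) # tl w))) g))"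
        unfolding b2 ES sgm_simps(5) by (rule sgm_neg) simp
    qed
    finally show ?thesis unfolding b1 .
  qed
  have IH: "X ?B (mu (cn n)) g = (\<Sum>i<length t.
      sgm (int (length t) + (\<Sum>j\<le>i. dg (g ! j))) (X ?B (cn n) (g[i := m (g ! i) (D (g ! i))])) -
      sgm (int (length t) + (\<Sum>j\<le>i. dg (g ! j))) (X ?B (cn n) (g[Suc i := m (D (g ! i)) (g ! Suc i)])) +
      sgm (int i) (X ?B (cn n) (mrg i g)))" for n
  proof -
    have z1: "cn n (us @ m (D z) (D z) # vs) = 0" for us vs z
      using 3(4)[of "x # replicate n (D x) @ us"] by (simp add: cn_def sgm_simps)
    have z2: "cn n (us @ replicate b (D z) @ vs) = 0" for us vs z
      using 3(5)[of "x # replicate n (D x) @ us"] by (simp add: cn_def sgm_simps)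
    show ?thesis using 3(2)[of "cn n", OF _ z1 z2] unfolding g_def[symmetric] using g by simp
  qed
  \<comment> \<open>\<open>mrg i g\<close> is one letter shorter than \<open>g\<close>, which lowers
    the exponent by \<open>n\<close> and shifts the offset in the continuation by
    \<open>n + k\<close>; an extra \<open>k\<close> is left.\<close>
  have mr: "X ?B c (x # mrg i g) = (\<Sum>n<?B. sgm (E n + k) (X ?B (cn n) (mrg i g)))" if i: "i < length t" for i
  proof -
    have lm: "int (length (mrg i g)) = l - 1" using length_mrg[of i g] i g by (simp add: l_def)
    have ne: "mrg i g \<noteq> []" using lm i g by (auto simp: l_def)
    show ?thesis unfolding X_Cons[OF ne] lm
    proof (rule sum.cong[OF refl])
      fix n
      have "X ?B (\<lambda>w. sgm ((int n + dg x) * (int (length w) - (l - 1))) (c (x # replicate n (D x) @ w))) (mrg i g) =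
        sgm (int n + k) (X ?B (cn n) (mrg i g))"
        unfolding X_sgm[symmetric] cn_def[abs_def] k_def by (simp add: sgm_simps algebra_simps)
      then show "sgm (int (n + 1 choose 2) + (l - 1 - 1) * int n + dg x * int n)
         (X ?B (\<lambda>w. sgm ((int n + dg x) * (int (length w) - (l - 1))) (c (x # replicate n (D x) @ w))) (mrg i g)) =
        sgm (E n + k) (X ?B (cn n) (mrg i g))"
        by (simp only: sgm_simps) (rule sgm_cong, simp add: E_def k_def algebra_simps)
    qed
  qed
  have Ct: "(\<Sum>n<?B. sgm (E n) (sgm (k + 1) (X ?B (mu (cn n)) g))) = (\<Sum>i<length t.
      sgm (l + k + (\<Sum>j\<le>i. dg (g ! j))) (X ?B c (x # g[i := m (g ! i) (D (g ! i))])) -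
      sgm (l + k + (\<Sum>j\<le>i. dg (g ! j))) (X ?B c (x # g[Suc i := m (D (g ! i)) (g ! Suc i)])) +
      sgm (int (Suc i)) (X ?B c (x # mrg i g)))"
  proof -
    define K where "K i = (\<Sum>j\<le>i. dg (g ! j))" for i
    have lt: "int (length t) = l - 1" using g by (simp add: l_def)
    have "(\<Sum>n<?B. sgm (E n) (sgm (k + 1) (X ?B (mu (cn n)) g))) = (\<Sum>n<?B. \<Sum>i<length t.
      sgm (l + k + K i + E n) (X ?B (cn n) (g[i := m (g ! i) (D (g ! i))])) -
      sgm (l + k + K i + E n) (X ?B (cn n) (g[Suc i := m (D (g ! i)) (g ! Suc i)])) +
      sgm (int (Suc i) + (E n + k)) (X ?B (cn n) (mrg i g)))"
      unfolding IH sgm_sum sgm_simps K_def[symmetric] lt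
      by (intro sum.cong refl arg_cong2[where f="(+)"] arg_cong2[where f="(-)"] sgm_cong) (simp_all add: algebra_simps)
    also have "\<dots> = (\<Sum>i<length t. \<Sum>n<?B.
      sgm (l + k + K i + E n) (X ?B (cn n) (g[i := m (g ! i) (D (g ! i))])) -
      sgm (l + k + K i + E n) (X ?B (cn n) (g[Suc i := m (D (g ! i)) (g ! Suc i)])) +
      sgm (int (Suc i) + (E n + k)) (X ?B (cn n) (mrg i g)))"
      by (rule sum.swap)
    also have "\<dots> = (\<Sum>i<length t.
      sgm (l + k + K i) (X ?B c (x # g[i := m (g ! i) (D (g ! i))])) -
      sgm (l + k + K i) (X ?B c (x # g[Suc i := m (D (g ! i)) (g ! Suc i)])) +
      sgm (int (Suc i)) (X ?B c (x # mrg i g)))"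
    proof (rule sum.cong[OF refl])
      fix i assume "i \<in> {..<length t}"
      then have i: "i < length t" by simp
      show "(\<Sum>n<?B.
        sgm (l + k + K i + E n) (X ?B (cn n) (g[i := m (g ! i) (D (g ! i))])) -
        sgm (l + k + K i + E n) (X ?B (cn n) (g[Suc i := m (D (g ! i)) (g ! Suc i)])) +
        sgm (int (Suc i) + (E n + k)) (X ?B (cn n) (mrg i g))) =
        sgm (l + k + K i) (X ?B c (x # g[i := m (g ! i) (D (g ! i))])) -
        sgm (l + k + K i) (X ?B c (x # g[Suc i := m (D (g ! i)) (g ! Suc i)])) +
        sgm (int (Suc i)) (X ?B c (x # mrg i g))"
        unfolding mr[OF i] XC[OF length_list_update] sgm_sum sgm_simps
        by (simp only: sum.distrib sum_subtractf)
    qed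
    finally show ?thesis unfolding K_def .
  qed
  have K: "(\<Sum>j\<le>Suc i. dg ((x # g) ! j)) = k + (\<Sum>j\<le>i. dg (g ! j))" for i
    by (simp add: sum.atMost_Suc_shift k_def del: sum.atMost_Suc)
  have "X ?B (mu c) (x # g) = (\<Sum>n<?B. sgm (E n) (X ?B (\<alpha> n) g + X ?B (\<beta> n) g + sgm (k + 1) (X ?B (mu (cn n)) g)))"
    unfolding X_Cons[OF g(1)] step[symmetric] by (simp add: E_def k_def l_def)
  also have "\<dots> = X ?B c (m x y # t) + sgm (l + k) (X ?B c (m x (D x) # g)) - sgm (l + k) (X ?B c (x # m (D x) y # t)) +
    (\<Sum>n<?B. sgm (E n) (sgm (k + 1) (X ?B (mu (cn n)) g)))"
    unfolding sgm_simps(1) sum.distrib A Bt by simp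
  finally have lhs: "X ?B (mu c) (x # g) = X ?B c (m x y # t) + sgm (l + k) (X ?B c (m x (D x) # g)) -
    sgm (l + k) (X ?B c (x # m (D x) y # t)) + (\<Sum>n<?B. sgm (E n) (sgm (k + 1) (X ?B (mu (cn n)) g)))" .
  define R where "R i = sgm (l + (\<Sum>j\<le>i. dg ((x # g) ! j))) (X ?B c ((x # g)[i := m ((x # g) ! i) (D ((x # g) ! i))])) -
      sgm (l + (\<Sum>j\<le>i. dg ((x # g) ! j))) (X ?B c ((x # g)[Suc i := m (D ((x # g) ! i)) ((x # g) ! Suc i)])) +
      sgm (int i) (X ?B c (mrg i (x # g)))" for i
  have u: "(x # g)[Suc i := v] = x # g[i := v]" "(x # g)[0 := v] = v # g" "(x # g)[Suc 0 := v] = x # v # t"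
    "(x # g) ! Suc i = g ! i" "(x # g) ! 0 = x" "g ! 0 = y" for i v
    by (simp_all add: g_def)
  have R0: "R 0 = sgm (l + k) (X ?B c (m x (D x) # g)) - sgm (l + k) (X ?B c (x # m (D x) y # t)) + X ?B c (m x y # t)"
  proof -
    have "(\<Sum>j\<le>0. dg ((x # g) ! j)) = k" "mrg 0 (x # g) = m x y # t" "g[0 := v] = v # t" for v
      by (simp_all add: k_def g_def mrg_simps)
    then show ?thesis unfolding R_def u by (simp only: of_nat_0 sgm_simps(6))
  qed
  have RS: "R (Suc i) = sgm (l + k + (\<Sum>j\<le>i. dg (g ! j))) (X ?B c (x # g[i := m (g ! i) (D (g ! i))])) -
      sgm (l + k + (\<Sum>j\<le>i. dg (g ! j))) (X ?B c (x # g[Suc i := m (D (g ! i)) (g ! Suc i)])) +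
      sgm (int (Suc i)) (X ?B c (x # mrg i g))" for i
    unfolding R_def K u mrg_simps by (simp only: add.assoc)
  have "X ?B (mu c) (x # g) = (\<Sum>i<Suc (length t). R i)"
    unfolding lhs Ct unfolding sum.lessThan_Suc_shift R0 RS by simp
  moreover have "int (length (x # g) - 1) = l" "length (x # g) - 1 = Suc (length t)" using g by (simp_all add: l_def)
  ultimately show ?case unfolding g_def[symmetric] R_def by (simp only:)
qed simp

section \<open>Block lengths and the sign in closed form\<close>

fun ins :: "'w list \<Rightarrow> nat list \<Rightarrow> 'w list" where
  "ins (x # y # t) (n # ns) = x # replicate n (D x) @ ins (y # t) ns"
| "ins f ns = f"

text \<open>The exponent of \<open>\<Xi>\<close> unfolded along the first letter, to match the
  recursion of \<open>X\<close>; \<open>esgn_eq\<close> recovers the closed form.\<close>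

fun esgn :: "'w list \<Rightarrow> nat list \<Rightarrow> int" where
  "esgn (x # y # t) (n # ns) = int (n + 1 choose 2) + (int (length (y # t)) - 1) * int n + dg x * int n +
     (int n + dg x) * int (sum_list ns) + esgn (y # t) ns"
| "esgn f ns = 0"

lemma length_ins: "length ns = length f - 1 \<Longrightarrow> length (ins f ns) = length f + sum_list ns"
  by (induction f ns rule: ins.induct) auto

text \<open>Unrolls the recursion into a single sum over lists of block lengths, the shape in which
  \<open>Xi\<close> is defined.\<close>

lemma X_expand:
  "f \<noteq> [] \<Longrightarrow> X B c f = (\<Sum>ns | set ns \<subseteq> {..<B} \<and> length ns = length f - 1. sgm (esgn f ns) (c (ins f ns)))"
proof (induction f arbitrary: c rule: induct_list012)
  case (2 x)
  have "{ns. set ns \<subseteq> {..<B} \<and> length ns = length [x] - 1} = {[]}" by auto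
  then show ?case by (simp add: sgm_simps)
next
  case (3 x y t)
  let ?g = "y # t"
  let ?L = "{ns. set ns \<subseteq> {..<B} \<and> length ns = length ?g - 1}"
  have e: "{ns. set ns \<subseteq> {..<B} \<and> length ns = length (x # y # t) - 1} = (\<lambda>(ns, n). n # ns) ` (?L \<times> {..<B})"
    using lists_length_Suc_eq[of "{..<B}" "length t"] by simp
  have "(\<Sum>ns | set ns \<subseteq> {..<B} \<and> length ns = length (x # y # t) - 1. sgm (esgn (x # y # t) ns) (c (ins (x # y # t) ns))) =
    (\<Sum>(ns, n)\<in>?L \<times> {..<B}. sgm (esgn (x # y # t) (n # ns)) (c (ins (x # y # t) (n # ns))))"
    unfolding e by (subst sum.reindex) (auto simp: inj_on_def case_prod_beta)
  also have "\<dots> = (\<Sum>n<B. \<Sum>ns\<in>?L. sgm (esgn (x # y # t) (n # ns)) (c (ins (x # y # t) (n # ns))))"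
    unfolding sum.cartesian_product[symmetric] by (rule sum.swap)
  also have "\<dots> = X B c (x # y # t)"
    unfolding X.simps(3) 3(2)[OF list.simps(3)] sgm_sum
    by (intro sum.cong refl) (simp add: length_ins sgm_simps algebra_simps)
  finally show ?case ..
qed simp

end

section \<open>Cutting symbols into their components\<close>

context cplx_cat
begin

sublocale wd: words "gComp (Chb A)" "\<lambda>f. delta (src f)" deg
  by unfold_locales (simp_all add: gComp_eq delta_def)

sublocale Bf: rel_bar K "Chb A" "dgOb (Chb A)"
  by unfold_locales simp

lemma mrg_merge: "wd.mrg i w = dg.merge i w"
  by (simp add: wd.mrg_def dg.merge_def)

lemma supp_obj: "X \<in> Ob \<Longrightarrow> a \<in> supp X \<Longrightarrow> cob X a = Some (the (cob X a)) \<and> the (cob X a) \<in> Obj A"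
  using ObD(2)[of X a] by (auto simp: supp_def adj_zero_simps)

abbreviation "yob X a \<equiv> the (cob X a)"

lemma incl_closed: "X \<in> Ob \<Longrightarrow> a \<in> supp X \<Longrightarrow> incl A X a \<in> carrier (HC (emb_ob (yob X a)) X a)"
proof -
  assume X: "X \<in> Ob" "a \<in> supp X"
  then obtain y where y: "cob X a = Some y" "y \<in> Obj A" using supp_obj by blast
  have "val (incl A X a) i \<in> carrier (H (cob (emb_ob y :: ('o,'m) cplx) i) (cob X (i + a)))" for i
    using y A.Ident_in by (simp add: incl_def cob_emb adj_zero_simps)
  then show ?thesis using y(1) unfolding HC_iff by (simp add: incl_def)
qed

lemma proj_closed: "X \<in> Ob \<Longrightarrow> a \<in> supp X \<Longrightarrow> proj A X a \<in> carrier (HC X (emb_ob (yob X a)) (- a))"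
proof -
  assume X: "X \<in> Ob" "a \<in> supp X"
  then obtain y where y: "cob X a = Some y" "y \<in> Obj A" using supp_obj by blast
  have "val (proj A X a) i \<in> carrier (H (cob X i) (cob (emb_ob y :: ('o,'m) cplx) (i + - a)))" for i
    using y A.Ident_in by (simp add: proj_def cob_emb adj_zero_simps)
  then show ?thesis using y(1) unfolding HC_iff by (simp add: proj_def)
qed

text \<open>In component \<open>i\<close> only \<open>a = i + k\<close> contributes. Indices outside
  the support belong to zero chain objects, so the finite sum over the support already gives the
  identity.\<close>

lemma incl_proj_sum:
  assumes X: "X \<in> Ob" and Y: "Y \<in> Ob" and g: "g \<in> carrier (HC Y X k)"
  shows "finsum (HC Y X k) (\<lambda>a. gComp (Chb A) (incl A X a) (gComp (Chb A) (proj A X a) g)) (supp X) = g"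
proof -
  interpret M: module K "HC Y X k" by (rule HC_module[OF Y X])
  let ?p = "\<lambda>a. gComp (Chb A) (incl A X a) (gComp (Chb A) (proj A X a) g)"
  have p: "?p a \<in> carrier (HC Y X k)" if a: "a \<in> supp X" for a
  proof -
    have E: "emb_ob (yob X a) \<in> Ob" using emb_Ob supp_obj[OF X a] by blast
    have "?p a \<in> carrier (HC Y X (a + (- a + k)))"
      by (rule gComp_closed[OF Y E X gComp_closed[OF Y X E g proj_closed[OF X a]] incl_closed[OF X a]])
    then show ?thesis by simp
  qed
  have pp: "?p \<in> supp X \<rightarrow> carrier (HC Y X k)" using p by blast
  have gd: "src g = Y" "tgt g = X" "deg g = k" "\<And>i. val g i \<in> carrier (H (cob Y i) (cob X (i + k)))"
    using g by (auto simp: HC_iff)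
  show ?thesis
  proof (rule HC_eqI[OF M.M.finsum_closed[OF pp] g])
    fix i
    interpret N: module K "H (cob Y i) (cob X (i + k))" by (rule H_module[OF Y X])
    have v: "val (?p a) i = (if a = i + k then val g i else \<zero>\<^bsub>H (cob Y i) (cob X (i + k))\<^esub>)" if a: "a \<in> supp X" for a
    proof -
      obtain y where y: "cob X a = Some y" "y \<in> Obj A" using supp_obj[OF X a] by blast
      show ?thesis
      proof (cases "a = i + k")
        case True
        then have "val g i \<in> carrier (H (cob Y i) (Some y))" using gd(4)[of i] y by simp
        moreover have "cob Y i \<in> Obj (adj_zero A)" "Some y \<in> Obj (adj_zero A)" using ObD(2)[OF Y] y by (auto simp: adj_zero_simps)
        ultimately have "cmp (cob Y i) (Some y) (Some y) (Ident A y) (val g i) = val g i"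
          using Z.Comp_Ident_left[of "cob Y i" "Some y"] by (simp add: adj_zero_simps)
        then show ?thesis using True y gd by (simp add: gComp_eq incl_def proj_def cob_emb)
      next
        case False
        then have "i + k - a \<noteq> 0" by simp
        moreover have "cmp (cob Y i) None (cob X (i + k)) u w = \<zero>\<^bsub>H (cob Y i) (cob X (i + k))\<^esub>" for u w
          by (cases "cob Y i"; cases "cob X (i + k)") (simp_all add: adj_zero_simps)
        ultimately show ?thesis using False y gd by (simp add: gComp_eq incl_def proj_def cob_emb)
      qed
    qed
    have "val (finsum (HC Y X k) ?p (supp X)) i = finsum (H (cob Y i) (cob X (i + k))) (\<lambda>a. val (?p a) i) (supp X)"
      by (rule linear_map_finsum[OF M.module_axioms N.module_axioms HC_val_linear pp])
    also have "\<dots> = val g i"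
    proof (cases "i + k \<in> supp X")
      case True
      then show ?thesis using N.M.finsum_one_nonzero[OF True ObD(1)[OF X], of "\<lambda>a. val (?p a) i"] v gd(4) by simp
    next
      case False
      then have "finsum (H (cob Y i) (cob X (i + k))) (\<lambda>a. val (?p a) i) (supp X) = \<zero>\<^bsub>H (cob Y i) (cob X (i + k))\<^esub>"
        using v by (intro N.M.finsum_all_zero) auto
      moreover have "val g i = \<zero>\<^bsub>H (cob Y i) (cob X (i + k))\<^esub>"
        using gd(4)[of i] False by (simp add: supp_def adj_zero_simps)
      ultimately show ?thesis by simp
    qed
    finally show "val (finsum (HC Y X k) ?p (supp X)) i = val g i" .
  qed
qed

text \<open>The index vectors that avoid zero chain objects, that is, the second components in
  \<open>Xi_index\<close> for a fixed word.\<close>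

definition idx :: "(('o,'m) cplx,int \<Rightarrow> 'm) harr list \<Rightarrow> int list set" where
  "idx h = {as. length as = length h - 1 \<and> (\<forall>t<length as. as ! t \<in> supp (src (h ! t)))}"

definition cutE :: "(('o,'m) cplx,int \<Rightarrow> 'm) harr list \<Rightarrow> int list \<Rightarrow> nat \<Rightarrow> (('o,'m) cplx,int \<Rightarrow> 'm) harr" where
  "cutE gs as t = (
     let h = (if t < length gs - 1 then gComp (Chb A) (gs ! t) (incl A (src (gs ! t)) (as ! t)) else gs ! t)
     in if 0 < t then gComp (Chb A) (proj A (src (gs ! (t - 1))) (as ! (t - 1))) h else h)"

lemma cut_cutE: "cut A gs as = map (cutE gs as) [0..<length gs]"
  unfolding cut_def cutE_def[abs_def] ..

lemma Bf_nth:
  assumes "h \<in> Bf.Sym X X' n"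
  shows "t < length h \<Longrightarrow> dg.arr (h ! t)" "t < length h \<Longrightarrow> h ! t \<in> carrier (HC (src (h ! t)) (tgt (h ! t)) (deg (h ! t)))"
    "Suc t < length h \<Longrightarrow> src (h ! t) = tgt (h ! Suc t)" "t < length h \<Longrightarrow> src (h ! t) \<in> Ob" "t < length h \<Longrightarrow> tgt (h ! t) \<in> Ob"
    "2 \<le> length h" "tgt (h ! 0) = X" "src (h ! (length h - 1)) = X'"
    "(\<Sum>t<length h. deg (h ! t)) = n + int (length h) - 2"
proof -
  note S = assms[unfolded Bf.Sym_iff]
  note S2 = S[THEN conjunct2] note S3 = S2[THEN conjunct2] note S4 = S3[THEN conjunct2] note S5 = S4[THEN conjunct2]
  show a: "dg.arr (h ! t)" if "t < length h" for t using S2[THEN conjunct1] that by simp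
  show "h ! t \<in> carrier (HC (src (h ! t)) (tgt (h ! t)) (deg (h ! t)))" "src (h ! t) \<in> Ob" "tgt (h ! t) \<in> Ob"
    if "t < length h" using a[OF that] by (simp_all add: dg.arr_def)
  show "src (h ! t) = tgt (h ! Suc t)" if "Suc t < length h"
    using successively_nth[OF S3[THEN conjunct1] that] by (rule conjunct1)
  show l: "2 \<le> length h" by (rule S[THEN conjunct1])
  then have "h \<noteq> []" by auto
  then show "tgt (h ! 0) = X" "src (h ! (length h - 1)) = X'"
    using S4[THEN conjunct1] S5[THEN conjunct1] by (simp_all add: hd_conv_nth last_conv_nth)
  show "(\<Sum>t<length h. deg (h ! t)) = n + int (length h) - 2"
    using S5[THEN conjunct2] by (simp add: sum_list_sum_nth atLeast0LessThan)
qed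

lemma cutE_closed:
  assumes h: "h \<in> Bf.Sym X X' n" and as: "as \<in> idx h" and t: "t < length h"
  shows "cutE h as t \<in> carrier (HC (if t < length h - 1 then emb_ob (yob (src (h ! t)) (as ! t)) else X')
    (if 0 < t then emb_ob (yob (src (h ! (t - 1))) (as ! (t - 1))) else X)
    (deg (h ! t) + (if t < length h - 1 then as ! t else 0) - (if 0 < t then as ! (t - 1) else 0)))"
proof -
  note B = Bf_nth[OF h]
  have ai: "as ! s \<in> supp (src (h ! s))" if "s < length h - 1" for s using as that by (auto simp: idx_def)
  have E: "emb_ob (yob (src (h ! s)) (as ! s)) \<in> Ob" if "s < length h - 1" for s
    using emb_Ob supp_obj[OF B(4) ai[OF that]] that by simp
  define g where "g = (if t < length h - 1 then gComp (Chb A) (h ! t) (incl A (src (h ! t)) (as ! t)) else h ! t)"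
  define S where "S = (if t < length h - 1 then emb_ob (yob (src (h ! t)) (as ! t)) else X')"
  define k where "k = deg (h ! t) + (if t < length h - 1 then as ! t else 0)"
  have S: "S \<in> Ob" using E B(4)[of "length h - 1"] B(6,8) by (auto simp: S_def)
  have g: "g \<in> carrier (HC S (tgt (h ! t)) k)"
  proof (cases "t < length h - 1")
    case True
    then show ?thesis
      using gComp_closed[OF E[OF True] B(4)[OF t] B(5)[OF t] incl_closed[OF B(4)[OF t] ai[OF True]] B(2)[OF t]]
      by (simp add: g_def S_def k_def)
  next
    case False
    then have "t = length h - 1" using t by simp
    then show ?thesis using B(2)[OF t] B(8) by (simp add: g_def S_def k_def)
  qed
  have c: "cutE h as t = (if 0 < t then gComp (Chb A) (proj A (src (h ! (t - 1))) (as ! (t - 1))) g else g)"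
    by (simp only: cutE_def Let_def g_def)
  show ?thesis
  proof (cases "0 < t")
    case True
    have s: "t - 1 < length h - 1" "Suc (t - 1) = t" using t True by auto
    have tg: "tgt (h ! t) = src (h ! (t - 1))" using B(3)[of "t - 1"] s t by simp
    have o: "src (h ! (t - 1)) \<in> Ob" using B(4)[of "t - 1"] s by simp
    have "gComp (Chb A) (proj A (src (h ! (t - 1))) (as ! (t - 1))) g \<in>
      carrier (HC S (emb_ob (yob (src (h ! (t - 1))) (as ! (t - 1)))) (- (as ! (t - 1)) + k))"
      by (rule gComp_closed[OF S o E[OF s(1)] g[unfolded tg] proj_closed[OF o ai[OF s(1)]]])
    then show ?thesis unfolding c S_def[symmetric] k_def[symmetric] if_P[OF True] by (simp only: uminus_add_conv_diff)
  next
    case False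
    then have "t = 0" by simp
    then show ?thesis using g B(7) unfolding c S_def[symmetric] k_def[symmetric] by (simp only: if_False less_irrefl diff_0_right)
  qed
qed

lemma cut_Sym:
  assumes h: "h \<in> Bf.Sym X X' n" and as: "as \<in> idx h"
  shows "cut A h as \<in> R.Sym X X' n"
proof -
  note B = Bf_nth[OF h]
  note E = cutE_closed[OF h as]
  have ai: "as ! s \<in> supp (src (h ! s))" if "s < length h - 1" for s using as that by (auto simp: idx_def)
  have yo: "yob (src (h ! s)) (as ! s) \<in> Obj A" if "s < length h - 1" for s
    using supp_obj[OF B(4) ai[OF that]] that by simp
  have d: "src (cutE h as t) = (if t < length h - 1 then emb_ob (yob (src (h ! t)) (as ! t)) else X')"
    "tgt (cutE h as t) = (if 0 < t then emb_ob (yob (src (h ! (t - 1))) (as ! (t - 1))) else X)"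
    "deg (cutE h as t) = deg (h ! t) + (if t < length h - 1 then as ! t else 0) - (if 0 < t then as ! (t - 1) else 0)"
    if "t < length h" for t using E[OF that] unfolding HC_iff by simp_all
  have XO: "X \<in> Ob" "X' \<in> Ob" by (rule Bf.Sym_obj[OF h])+
  have arr: "dg.arr (cutE h as t)" if "t < length h" for t
    by (rule dg.arrI[OF _ _ E[OF that]]) (use XO emb_Ob yo that in auto)
  \<comment> \<open>Each index is added at the entry that receives the inclusion and subtracted at
    the next one, which receives the projection.\<close>
  have sm: "(\<Sum>t<length h. deg (cutE h as t)) = (\<Sum>t<length h. deg (h ! t))"
  proof -
    obtain L where L: "length h = Suc L" using B(6) by (cases "length h") auto
    have "(\<Sum>t<L. if t < L then as ! t else 0) = (\<Sum>t<L. as ! t)" by (rule sum.cong) auto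
    then have "(\<Sum>t<Suc L. if t < L then as ! t else 0) = (\<Sum>t<L. as ! t)" by simp
    moreover have "(\<Sum>t<Suc L. if 0 < t then as ! (t - 1) else 0) = (\<Sum>t<L. as ! t)"
      unfolding sum.lessThan_Suc_shift by simp
    moreover have "(\<Sum>t<length h. deg (cutE h as t)) = (\<Sum>t<Suc L. deg (h ! t) + (if t < L then as ! t else 0) -
        (if 0 < t then as ! (t - 1) else 0))" using d(3) L by (intro sum.cong) auto
    ultimately show ?thesis unfolding L by (simp only: sum.distrib sum_subtractf)
  qed
  have ne: "[0..<length h] \<noteq> []" using B(6) by (cases h) simp_all
  show ?thesis unfolding R.Sym_iff cut_cutE
  proof (intro conjI)
    show "2 \<le> length (map (cutE h as) [0..<length h])" using B(6) by simp
    show "\<forall>f\<in>set (map (cutE h as) [0..<length h]). dg.arr f" using arr by simp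
    show "successively (\<lambda>f g. src f = tgt g \<and> src f \<in> emb_ob ` Obj A) (map (cutE h as) [0..<length h])"
      unfolding successively_conv_nth
    proof (intro allI impI)
      fix i assume "Suc i < length (map (cutE h as) [0..<length h])"
      then have i: "i < length h" "Suc i < length h" "i < length h - 1" by simp_all
      show "src (map (cutE h as) [0..<length h] ! i) = tgt (map (cutE h as) [0..<length h] ! Suc i) \<and>
        src (map (cutE h as) [0..<length h] ! i) \<in> emb_ob ` Obj A"
        using d(1)[OF i(1)] d(2)[OF i(2)] i yo[OF i(3)] by simp
    qed
    have l: "0 < length h" using B(6) by linarith
    show "tgt (hd (map (cutE h as) [0..<length h])) = X"
      using d(2)[OF l] ne by (simp add: hd_map)
    show "src (last (map (cutE h as) [0..<length h])) = X'"
      using d(1)[of "length h - 1"] ne l by (simp add: last_map)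
    show "sum_list (map deg (map (cutE h as) [0..<length h])) - (int (length (map (cutE h as) [0..<length h])) - 2) = n"
      using sm B(9) by (simp add: sum_list_sum_nth atLeast0LessThan)
  qed
qed

text \<open>The cut of an entry \<open>g\<close> standing between \<open>us\<close> and
  \<open>vs\<close>, with its source \<open>Y\<close> passed separately: the inclusion then does not
  depend on \<open>g\<close>, and the expression is linear in it.\<close>

definition cutL :: "(('o,'m) cplx,int \<Rightarrow> 'm) harr list \<Rightarrow> ('o,'m) cplx \<Rightarrow> (('o,'m) cplx,int \<Rightarrow> 'm) harr list \<Rightarrow>
    int list \<Rightarrow> (('o,'m) cplx,int \<Rightarrow> 'm) harr \<Rightarrow> (('o,'m) cplx,int \<Rightarrow> 'm) harr" where
  "cutL us Y vs as g = (
     let h = (if vs \<noteq> [] then gComp (Chb A) g (incl A Y (as ! length us)) else g)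
     in if us \<noteq> [] then gComp (Chb A) (proj A (src (last us)) (as ! (length us - 1))) h else h)"

lemma cutE_slot: "vs = [] \<or> src g = Y \<Longrightarrow> cutE (us @ g # vs) as (length us) = cutL us Y vs as g"
proof -
  assume "vs = [] \<or> src g = Y"
  moreover have "(us @ g # vs) ! (length us - 1) = last us" if "us \<noteq> []"
    using that by (simp add: nth_append last_conv_nth)
  ultimately show ?thesis by (auto simp: cutE_def cutL_def Let_def nth_append)
qed

lemma cut_slot:
  assumes "vs = [] \<or> src g = Y"
  shows "cut A (us @ g # vs) as = map (cutE (us @ g # vs) as) [0..<length us] @ cutL us Y vs as g #
    map (cutE (us @ g # vs) as) [Suc (length us)..<length us + Suc (length vs)]"
proof -
  have "[0..<length (us @ g # vs)] = [0..<length us] @ length us # [Suc (length us)..<length us + Suc (length vs)]"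
    using upt_add_eq_append[of 0 "length us" "Suc (length vs)"] upt_conv_Cons[of "length us" "length us + Suc (length vs)"]
    by (simp del: upt_Suc)
  then show ?thesis unfolding cut_cutE using cutE_slot[OF assms, of us as] by (simp del: upt_Suc)
qed

lemma cutE_other:
  assumes "vs = [] \<or> src g = src f" "t \<noteq> length us"
  shows "cutE (us @ g # vs) as t = cutE (us @ f # vs) as t \<or> (vs = [] \<and> length us < t)"
proof -
  have 1: "(us @ g # vs) ! t = (us @ f # vs) ! t" using assms(2) by (simp add: nth_append nth_Cons')
  have 2: "src ((us @ g # vs) ! (t - 1)) = src ((us @ f # vs) ! (t - 1)) \<or> (vs = [] \<and> length us < t)"
    using assms by (auto simp: nth_append nth_Cons')
  show ?thesis using 2 unfolding cutE_def Let_def 1 by auto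
qed

lemma cut_slot2:
  assumes "vs = [] \<or> src g = src f"
  shows "\<exists>P Q. cut A (us @ f # vs) as = P @ cutL us (src f) vs as f # Q \<and> cut A (us @ g # vs) as = P @ cutL us (src f) vs as g # Q
    \<and> length P = length us \<and> length Q = length vs"
proof (intro exI conjI)
  show "cut A (us @ f # vs) as = map (cutE (us @ f # vs) as) [0..<length us] @ cutL us (src f) vs as f #
    map (cutE (us @ f # vs) as) [Suc (length us)..<length us + Suc (length vs)]"
    by (rule cut_slot) simp
  have eq: "cutE (us @ g # vs) as t = cutE (us @ f # vs) as t" if "t \<noteq> length us" "t < length us + Suc (length vs)" for t
    using cutE_other[OF assms that(1), of as] that(2) by auto
  have m: "map (cutE (us @ g # vs) as) [0..<length us] = map (cutE (us @ f # vs) as) [0..<length us]"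
    "map (cutE (us @ g # vs) as) [Suc (length us)..<length us + Suc (length vs)] =
     map (cutE (us @ f # vs) as) [Suc (length us)..<length us + Suc (length vs)]"
    by (rule map_cong[OF refl eq]; simp del: upt_Suc)+
  show "cut A (us @ g # vs) as = map (cutE (us @ f # vs) as) [0..<length us] @ cutL us (src f) vs as g #
    map (cutE (us @ f # vs) as) [Suc (length us)..<length us + Suc (length vs)]"
    using cut_slot[OF assms, of us as] m by (simp del: upt_Suc)
qed (simp_all del: upt_Suc)

lemma cut_left:
  assumes h: "f # t \<in> Bf.Sym X X' n" and as: "as \<in> idx (f # t)" and g: "g \<in> carrier (HC X X1 j)" "X1 \<in> Ob"
  shows "cut A (gComp (Chb A) g f # t) as = gComp (Chb A) g (hd (cut A (f # t) as)) # tl (cut A (f # t) as)"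
proof -
  note B = Bf_nth[OF h]
  have t: "t \<noteq> []" using B(6) by auto
  have s: "src (gComp (Chb A) g f) = src f" by (simp add: gComp_eq)
  obtain P Q where PQ: "cut A ([] @ f # t) as = P @ cutL [] (src f) t as f # Q"
    "cut A ([] @ gComp (Chb A) g f # t) as = P @ cutL [] (src f) t as (gComp (Chb A) g f) # Q" "length P = length []"
    using cut_slot2[of t "gComp (Chb A) g f" f "[]" as] s by auto
  have f: "f \<in> carrier (HC (src f) X (deg f))" "src f \<in> Ob" "X \<in> Ob" using B(2)[of 0] B(4)[of 0] B(5)[of 0] B(7) by auto
  have a: "as ! 0 \<in> supp (src f)"
  proof -
    have "\<forall>s<length t. as ! s \<in> supp (src ((f # t) ! s))" "0 < length t" using as t by (simp_all add: idx_def)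
    then show ?thesis by (metis nth_Cons_0)
  qed
  have "cutL [] (src f) t as (gComp (Chb A) g f) = gComp (Chb A) g (cutL [] (src f) t as f)"
    using t gComp_ass[OF _ f(2,3) g(2) incl_closed[OF f(2) a] f(1) g(1)] emb_Ob supp_obj[OF f(2) a]
    by (simp add: cutL_def)
  then show ?thesis using PQ by simp
qed

lemma cut_right:
  assumes h: "h \<in> Bf.Sym X X' n" and as: "as \<in> idx h" and g: "g \<in> carrier (HC Y' X' m)" "Y' \<in> Ob"
  shows "cut A (butlast h @ [gComp (Chb A) (last h) g]) as = butlast (cut A h as) @ [gComp (Chb A) (last (cut A h as)) g]"
proof -
  note B = Bf_nth[OF h]
  obtain u z where hz: "h = u @ [z]" "u \<noteq> []" using B(6) by (cases h rule: rev_cases; cases "butlast h") simp_all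
  obtain P Q where PQ: "cut A (u @ z # []) as = P @ cutL u (src z) [] as z # Q"
    "cut A (u @ gComp (Chb A) z g # []) as = P @ cutL u (src z) [] as (gComp (Chb A) z g) # Q" "length Q = length []"
    using cut_slot2[of "[]" "gComp (Chb A) z g" z u as] by auto
  let ?l = "length u - 1"
  have l: "Suc ?l = length u" using hz(2) by simp
  have z: "z \<in> carrier (HC X' (tgt z) (deg z))" "X' \<in> Ob" "tgt z \<in> Ob"
    using B(2)[of "length u"] B(4)[of "length u"] B(5)[of "length u"] B(8) hz by (auto simp: nth_append)
  have lu: "h ! ?l = last u" using hz by (simp add: nth_append last_conv_nth)
  have q: "src (last u) = tgt z" "src (last u) \<in> Ob" using B(3)[of ?l] B(4)[of ?l] l hz lu by (auto simp: nth_append)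
  have a: "as ! ?l \<in> supp (src (last u))"
  proof -
    have "\<forall>t<length u. as ! t \<in> supp (src (h ! t))" using as hz(1) by (simp add: idx_def)
    then have "as ! ?l \<in> supp (src (h ! ?l))" using l by (metis lessI)
    then show ?thesis by (simp only: lu)
  qed
  have E: "emb_ob (yob (tgt z) (as ! ?l)) \<in> Ob" using supp_obj[OF q(2) a] q(1) emb_Ob by simp
  have "cutL u (src z) [] as (gComp (Chb A) z g) = gComp (Chb A) (cutL u (src z) [] as z) g"
    using hz(2) gComp_ass[OF g(2) z(2,3) E g(1) z(1)] proj_closed[OF q(2) a] q(1) by (simp add: cutL_def)
  then show ?thesis using PQ hz by (simp add: butlast_append)
qed

lemma cutL_linear:
  assumes h: "us @ f # vs \<in> Bf.Sym X X' n" and as: "as \<in> idx (us @ f # vs)" and f: "f \<in> carrier (HC Y Z k)"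
  shows "\<exists>Y' Z' k'. cutL us (src f) vs as \<in> linear_maps K (HC Y Z k) (HC Y' Z' k')"
proof -
  note B = Bf_nth[OF h]
  note o = Bf.Sym_slot_obj[OF h f]
  have sf: "src f = Y" "tgt f = Z" using f by (auto simp: HC_iff)
  have ai: "as ! s \<in> supp (src ((us @ f # vs) ! s))" if "s < length us + length vs" for s using as that by (auto simp: idx_def)
  have 1: "\<exists>Y' k'. Y' \<in> Ob \<and> (\<lambda>g. if vs \<noteq> [] then gComp (Chb A) g (incl A (src f) (as ! length us)) else g) \<in> linear_maps K (HC Y Z k) (HC Y' Z k')"
  proof (cases "vs = []")
    case True
    then show ?thesis using linear_maps_id o(1) by auto
  next
    case False
    have a: "as ! length us \<in> supp Y" using ai[of "length us"] False sf by simp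
    have E: "emb_ob (yob Y (as ! length us)) \<in> Ob" using supp_obj[OF o(1) a] emb_Ob by simp
    show ?thesis using False sf gComp_lin_left[OF E o(1,2) incl_closed[OF o(1) a], of k] E by auto
  qed
  then obtain Y' k' where Y': "Y' \<in> Ob" "(\<lambda>g. if vs \<noteq> [] then gComp (Chb A) g (incl A (src f) (as ! length us)) else g)
    \<in> linear_maps K (HC Y Z k) (HC Y' Z k')" by blast
  show ?thesis
  proof (cases "us = []")
    case True
    have "cutL us (src f) vs as = (\<lambda>g. if vs \<noteq> [] then gComp (Chb A) g (incl A (src f) (as ! length us)) else g)"
      using True by (simp add: cutL_def fun_eq_iff)
    then show ?thesis using Y'(2) by metis
  next
    case False
    let ?l = "length us - 1"
    have l: "Suc ?l = length us" using False by simp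
    have lu: "(us @ f # vs) ! ?l = last us" using False by (simp add: nth_append last_conv_nth)
    have q: "src (last us) = Z" using B(3)[of ?l] l lu sf by (simp add: nth_append)
    have a: "as ! ?l \<in> supp Z" using ai[of ?l] l lu q by simp
    have E: "emb_ob (yob Z (as ! ?l)) \<in> Ob" using supp_obj[OF o(2) a] emb_Ob by simp
    have "cutL us (src f) vs as = (\<lambda>g. gComp (Chb A) (proj A Z (as ! ?l))
        (if vs \<noteq> [] then gComp (Chb A) g (incl A (src f) (as ! length us)) else g))"
      using False q by (simp add: cutL_def fun_eq_iff)
    then show ?thesis
      using linear_maps_comp[OF Y'(2) gComp_lin_right[OF Y'(1) o(2) E proj_closed[OF o(2) a]]] by metis
  qed
qed

lemma idx_shape: "shape g = shape h \<Longrightarrow> idx g = idx h"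
  unfolding idx_def using shape_length[of g h] shape_nth(1)[of g h] by auto

lemma finite_idx:
  assumes h: "h \<in> Bf.Sym X X' n"
  shows "finite (idx h)"
proof -
  have "idx h \<subseteq> {as. set as \<subseteq> (\<Union>f\<in>set h. supp (src f)) \<and> length as = length h - 1}"
  proof (intro subsetI CollectI conjI)
    fix as assume as: "as \<in> idx h"
    then show l: "length as = length h - 1" by (simp add: idx_def)
    fix x assume "x \<in> set as"
    then obtain t where t: "t < length as" "x = as ! t" by (auto simp: in_set_conv_nth)
    then have "h ! t \<in> set h" "x \<in> supp (src (h ! t))" using as l by (auto simp: idx_def)
    then show "x \<in> (\<Union>f\<in>set h. supp (src f))" by (rule UN_I)
  qed
  moreover have "finite (\<Union>f\<in>set h. supp (src f))"
    using Bf_nth(4)[OF h] ObD(1) by (auto simp: in_set_conv_nth)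
  ultimately show ?thesis by (rule finite_subset[OF _ finite_lists_length_eq])
qed

text \<open>Only the entry of the cut in the same position depends on the varied entry, and it does
  so linearly through \<open>cutL\<close>.\<close>

lemma slot_cut:
  assumes "R.multilinear X X' n P \<phi>" "us @ f # vs \<in> Bf.Sym X X' n" "f \<in> carrier (HC Y Z k)" "as \<in> idx (us @ f # vs)"
  shows "(\<lambda>g. \<phi> (cut A (us @ g # vs) as)) \<in> linear_maps K (HC Y Z k) P"
proof -
  obtain Y' Z' k' where L: "cutL us (src f) vs as \<in> linear_maps K (HC Y Z k) (HC Y' Z' k')"
    using cutL_linear[OF assms(2,4,3)] by blast
  let ?P = "map (cutE (us @ f # vs) as) [0..<length us]"
  let ?Q = "map (cutE (us @ f # vs) as) [Suc (length us)..<length us + Suc (length vs)]"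
  have c: "cut A (us @ f # vs) as = ?P @ cutL us (src f) vs as f # ?Q" by (rule cut_slot) simp
  have s: "?P @ cutL us (src f) vs as f # ?Q \<in> R.Sym X X' n" using cut_Sym[OF assms(2,4)] unfolding c .
  show ?thesis
  proof (rule R.multilinear_slot[OF assms(1) L assms(3) s Bf.Sym_slot_obj(3)[OF assms(2,3)]])
    fix g assume g: "g \<in> carrier (HC Y Z k)"
    have sg: "src g = src f" using g assms(3) by (simp add: HC_iff)
    obtain P Q where PQ: "cut A (us @ f # vs) as = P @ cutL us (src f) vs as f # Q"
      "cut A (us @ g # vs) as = P @ cutL us (src f) vs as g # Q" "length P = length us"
      using cut_slot2[of vs g f us as] sg by auto
    have "P = ?P \<and> Q = ?Q" using PQ(1,3) unfolding c by (simp add: append_eq_append_conv)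
    then show "cut A (us @ g # vs) as = ?P @ cutL us (src f) vs as g # ?Q" using PQ(2) by simp
  qed
qed

text \<open>The inner sum of \<open>\<Xi>\<close>, over index vectors, for a word whose
  differentials are already inserted. Isolating it keeps the properties of cutting apart from the
  signs of insertion.\<close>

definition Cut :: "('o,'m) cplx \<Rightarrow> ('o,'m) cplx \<Rightarrow> int \<Rightarrow> (('o,'m) cplx,int \<Rightarrow> 'm) harr list \<Rightarrow>
    ((('o,'m) cplx,int \<Rightarrow> 'm) harr list \<Rightarrow> 'k) set" where
  "Cut X X' n h = finsum (R.BM X X' n) (\<lambda>as. R.el X X' n (cut A h as)) (idx h)"

lemma el_cut_closed: "h \<in> Bf.Sym X X' n \<Longrightarrow> (\<lambda>as. R.el X X' n (cut A h as)) \<in> idx h \<rightarrow> carrier (R.BM X X' n)"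
  using cut_Sym R.el_closed by blast

lemma Cut_closed: "h \<in> Bf.Sym X X' n \<Longrightarrow> Cut X X' n h \<in> carrier (R.BM X X' n)"
proof -
  interpret M: module K "R.BM X X' n" by (rule R.BM_module)
  show "h \<in> Bf.Sym X X' n \<Longrightarrow> Cut X X' n h \<in> carrier (R.BM X X' n)"
    unfolding Cut_def by (intro M.M.finsum_closed el_cut_closed)
qed

lemma Cut_multilinear: "Bf.multilinear X X' n (R.BM X X' n) (Cut X X' n)"
proof (rule Bf.multilinearI)
  fix us vs Y Z k f
  assume f: "f \<in> carrier (HC Y Z k)" "us @ f # vs \<in> Bf.Sym X X' n" "module K (HC Y Z k)"
    "\<And>g. g \<in> carrier (HC Y Z k) \<Longrightarrow> shape (us @ g # vs) = shape (us @ f # vs)"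
  show "(\<lambda>g. Cut X X' n (us @ g # vs)) \<in> linear_maps K (HC Y Z k) (R.BM X X' n)"
    by (rule linear_maps_cong[OF linear_maps_finsum[OF f(3) R.BM_module] f(3)])
       (rule slot_cut[OF R.multilinear_el f(2,1)], assumption, simp add: Cut_def idx_shape[OF f(4)])
qed (rule Cut_closed)

section \<open>Merging neighbouring entries of a cut symbol\<close>

lemma cutL_merge:
  assumes h: "us @ f # g # vs \<in> Bf.Sym X X' n" and l: "length as1 = length us" and as: "as1 @ a # as2 \<in> idx (us @ f # g # vs)"
  shows "gComp (Chb A) (cutL us (src f) (g # vs) (as1 @ a # as2) f) (cutL (us @ [f]) (src g) vs (as1 @ a # as2) g) =
    cutL us (src g) vs (as1 @ as2) (gComp (Chb A) f (gComp (Chb A) (incl A (src f) a) (gComp (Chb A) (proj A (src f) a) g)))"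
proof -
  let ?h = "us @ f # g # vs" let ?as = "as1 @ a # as2"
  note B = Bf_nth[OF h]
  have ai: "?as ! s \<in> supp (src (?h ! s))" if "s < length us + 1 + length vs" for s using as that by (auto simp: idx_def)
  have la: "length as2 = length vs" using as l by (simp add: idx_def)
  have fO: "src f \<in> Ob" "tgt f \<in> Ob" and f: "dg.arr f" using B(4)[of "length us"] B(5)[of "length us"] B(1)[of "length us"]
    by (simp_all add: nth_append)
  have gO: "src g \<in> Ob" "tgt g \<in> Ob" and g: "dg.arr g" "src f = tgt g"
    using B(4)[of "Suc (length us)"] B(5)[of "Suc (length us)"] B(1)[of "Suc (length us)"] B(3)[of "length us"]
    by (simp_all add: nth_append)
  have a: "a \<in> supp (src f)" using ai[of "length us"] l by (simp add: nth_append)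
  have arI: "dg.arr (incl A Y b)" "dg.arr (proj A Y b)" if "Y \<in> Ob" "b \<in> supp Y" for Y b
    using dg.arrI[OF _ that(1) incl_closed[OF that]] dg.arrI[OF that(1) _ proj_closed[OF that]] emb_Ob supp_obj[OF that] by blast+
  have st: "src (incl A Y b) = emb_ob (yob Y b)" "tgt (incl A Y b) = Y" "src (proj A Y b) = Y" "tgt (proj A Y b) = emb_ob (yob Y b)" for Y b
    by (simp_all add: incl_def proj_def)
  note ag = dg.arr_gComp(1-3) dg.arr_assoc
  have core: "gComp (Chb A) (gComp (Chb A) f (incl A (src f) a)) (gComp (Chb A) (proj A (src f) a) g') =
    gComp (Chb A) f (gComp (Chb A) (incl A (src f) a) (gComp (Chb A) (proj A (src f) a) g'))"
    if "dg.arr g'" "tgt g' = src f" for g'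
    using f arI[OF fO(1) a] that by (simp add: ag st)
  define s where "s = gComp (Chb A) (incl A (src f) a) (gComp (Chb A) (proj A (src f) a) g)"
  have s: "dg.arr s" "src s = src g" "tgt s = src f" using arI[OF fO(1) a] g by (simp_all add: s_def ag st)
  define G where "G = gComp (Chb A) f s"
  have G: "dg.arr G" "src G = src g" "tgt G = tgt f" using s f by (simp_all add: G_def ag)
  have i1: "?as ! length us = a" using l by (simp add: nth_append)
  have i2: "?as ! Suc (length us) = as2 ! 0" "(as1 @ as2) ! length us = as2 ! 0" using l by (simp_all add: nth_append)
  have i3: "?as ! (length us - 1) = as1 ! (length us - 1)" "(as1 @ as2) ! (length us - 1) = as1 ! (length us - 1)"
    if "us \<noteq> []" using l that by (simp_all add: nth_append)
  define q where "q x = (if vs \<noteq> [] then gComp (Chb A) x (incl A (src g) (as2 ! 0)) else x)" for x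
  have vi: "as2 ! 0 \<in> supp (src g)" if "vs \<noteq> []" using ai[of "Suc (length us)"] that i2 by (simp add: nth_append)
  have q1: "dg.arr (q x) \<and> tgt (q x) = tgt x" if "dg.arr x" "src x = src g" for x
    using that arI(1)[OF gO(1) vi] by (simp add: q_def ag st)
  have q2: "q (gComp (Chb A) y x) = gComp (Chb A) y (q x)" if "dg.arr x" "src x = src g" "dg.arr y" "src y = tgt x" for x y
    using that arI(1)[OF gO(1) vi] by (simp add: q_def ag st)
  have c: "gComp (Chb A) (gComp (Chb A) f (incl A (src f) a)) (gComp (Chb A) (proj A (src f) a) (q g)) = q G"
  proof -
    have "q G = gComp (Chb A) f (q s)" unfolding G_def by (rule q2[OF s(1,2) f s(3)[symmetric]])
    also have "q s = gComp (Chb A) (incl A (src f) a) (gComp (Chb A) (proj A (src f) a) (q g))"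
      unfolding s_def using arI[OF fO(1) a] g by (simp add: q2 ag st)
    finally show ?thesis using core[of "q g"] q1[OF g(1) refl] g(2) by simp
  qed
  have e2: "cutL (us @ [f]) (src g) vs ?as g = gComp (Chb A) (proj A (src f) a) (q g)"
    using i1 i2 by (simp add: cutL_def q_def Let_def)
  have e3: "cutL us (src g) vs (as1 @ as2) G = (if us \<noteq> [] then gComp (Chb A) (proj A (src (last us)) (as1 ! (length us - 1))) (q G) else q G)"
    by (cases "us = []") (use i2 i3 in \<open>simp_all add: cutL_def q_def Let_def\<close>)
  have e1: "cutL us (src f) (g # vs) ?as f = (if us \<noteq> [] then gComp (Chb A) (proj A (src (last us)) (as1 ! (length us - 1)))
     (gComp (Chb A) f (incl A (src f) a)) else gComp (Chb A) f (incl A (src f) a))"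
    using i1 i3 by (simp add: cutL_def Let_def)
  show ?thesis unfolding s_def[symmetric] G_def[symmetric] e1 e2 e3
  proof (cases "us = []")
    case False
    let ?l = "length us - 1"
    have l1: "Suc ?l = length us" using False by simp
    have lu: "?h ! ?l = last us" using False by (simp add: nth_append last_conv_nth)
    have u: "src (last us) = tgt f" using B(3)[of ?l] l1 lu by (simp add: nth_append)
    have a1: "as1 ! ?l \<in> supp (tgt f)" using ai[of ?l] l1 lu u i3(1)[OF False] by simp
    have "gComp (Chb A) (gComp (Chb A) (proj A (tgt f) (as1 ! ?l)) (gComp (Chb A) f (incl A (src f) a)))
        (gComp (Chb A) (proj A (src f) a) (q g)) =
      gComp (Chb A) (proj A (tgt f) (as1 ! ?l)) (gComp (Chb A) (gComp (Chb A) f (incl A (src f) a))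
        (gComp (Chb A) (proj A (src f) a) (q g)))"
      using f arI[OF fO(1) a] arI[OF fO(2) a1] q1[OF g(1) refl] g(2) by (intro dg.arr_assoc) (simp_all add: dg.arr_gComp(1-3) st)
    then show "gComp (Chb A) (if us \<noteq> [] then gComp (Chb A) (proj A (src (last us)) (as1 ! (length us - 1)))
       (gComp (Chb A) f (incl A (src f) a)) else gComp (Chb A) f (incl A (src f) a)) (gComp (Chb A) (proj A (src f) a) (q g)) =
      (if us \<noteq> [] then gComp (Chb A) (proj A (src (last us)) (as1 ! (length us - 1))) (q G) else q G)"
      using False c u by simp
  qed (use c in simp)
qed

text \<open>Joining the two entries brings the inclusion and the projection at the common index
  \<open>a\<close> together; \<open>a\<close> leaves the index vector and survives only in this
  factor between \<open>f\<close> and \<open>g\<close>.\<close>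

lemma cut_merge:
  assumes h: "us @ f # g # vs \<in> Bf.Sym X X' n" and l: "length as1 = length us" and as: "as1 @ a # as2 \<in> idx (us @ f # g # vs)"
  shows "dg.merge (length us) (cut A (us @ f # g # vs) (as1 @ a # as2)) =
    cut A (us @ gComp (Chb A) f (gComp (Chb A) (incl A (src f) a) (gComp (Chb A) (proj A (src f) a) g)) # vs) (as1 @ as2)"
proof -
  define G where "G = gComp (Chb A) f (gComp (Chb A) (incl A (src f) a) (gComp (Chb A) (proj A (src f) a) g))"
  let ?h = "us @ f # g # vs" let ?as = "as1 @ a # as2" let ?h' = "us @ G # vs" let ?as' = "as1 @ as2"
  have la: "length as2 = length vs" using as l by (simp add: idx_def)
  have sG: "src G = src g" by (simp add: G_def gComp_eq)
  let ?i = "length us"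
  have pre: "cutE ?h ?as t = cutE ?h' ?as' t" if t: "t < ?i" for t
  proof -
    have "?h ! t = ?h' ! t" "?h ! (t - 1) = ?h' ! (t - 1)" "?as ! t = ?as' ! t" "?as ! (t - 1) = ?as' ! (t - 1)"
      using t less_imp_diff_less[OF t, of 1] l by (simp_all add: nth_append)
    note e = this
    show ?thesis unfolding cutE_def e using t by simp
  qed
  have post: "cutE ?h ?as (Suc (Suc (?i + k))) = cutE ?h' ?as' (Suc (?i + k))" if k: "k < length vs" for k
  proof -
    have "?h ! Suc (Suc (?i + k)) = vs ! k" "?h' ! Suc (?i + k) = vs ! k"
      "src (?h ! Suc (?i + k)) = src (?h' ! (?i + k))"
      "?as ! Suc (Suc (?i + k)) = ?as' ! Suc (?i + k)" "?as ! Suc (?i + k) = ?as' ! (?i + k)"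
      using l sG by (simp_all add: nth_append nth_Cons')
    then show ?thesis by (simp add: cutE_def)
  qed
  have c2: "cutE ?h ?as (Suc ?i) = cutL (us @ [f]) (src g) vs ?as g"
    using cutE_slot[of vs g "src g" "us @ [f]" ?as] by simp
  have c1: "cutE ?h ?as ?i = cutL us (src f) (g # vs) ?as f" by (rule cutE_slot) simp
  have c3: "cutE ?h' ?as' ?i = cutL us (src g) vs ?as' G" by (rule cutE_slot) (simp add: sG)
  have u: "[0..<length ?h] = [0..<?i] @ ?i # Suc ?i # map (\<lambda>k. Suc (Suc (?i + k))) [0..<length vs]"
    by (rule nth_equalityI) (auto simp: nth_append nth_Cons' simp del: upt_Suc)
  have u': "[0..<length ?h'] = [0..<?i] @ ?i # map (\<lambda>k. Suc (?i + k)) [0..<length vs]"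
    by (rule nth_equalityI) (auto simp: nth_append nth_Cons' simp del: upt_Suc)
  have e: "map (cutE ?h ?as) [0..<?i] = map (cutE ?h' ?as') [0..<?i]"
    "map (\<lambda>k. cutE ?h ?as (Suc (Suc (?i + k)))) [0..<length vs] = map (\<lambda>k. cutE ?h' ?as' (Suc (?i + k))) [0..<length vs]"
    using pre post by (intro map_cong refl; simp)+
  have L: "cut A ?h ?as = map (cutE ?h' ?as') [0..<?i] @ cutL us (src f) (g # vs) ?as f # cutL (us @ [f]) (src g) vs ?as g #
    map (\<lambda>k. cutE ?h' ?as' (Suc (?i + k))) [0..<length vs]"
    unfolding cut_cutE u by (simp add: e c1 c2 comp_def)
  have R: "cut A ?h' ?as' = map (cutE ?h' ?as') [0..<?i] @ cutL us (src g) vs ?as' G #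
    map (\<lambda>k. cutE ?h' ?as' (Suc (?i + k))) [0..<length vs]"
    unfolding cut_cutE u' by (simp add: c3 comp_def)
  show ?thesis unfolding G_def[symmetric] L R
    by (subst dg.merge_append) (simp_all add: cutL_merge[OF h l as] G_def)
qed

text \<open>Summing over the index between the two merged entries recovers the identity between them.\<close>

lemma sum_merge_cut:
  assumes P: "module K P" and ml: "R.multilinear X X' (n + 1) P \<phi>"
    and h: "us @ f # g # vs \<in> Bf.Sym X X' n" and ne: "us \<noteq> [] \<or> vs \<noteq> []"
  shows "finsum P (\<lambda>as. \<phi> (dg.merge (length us) (cut A (us @ f # g # vs) as))) (idx (us @ f # g # vs)) =
    finsum P (\<lambda>as. \<phi> (cut A (us @ gComp (Chb A) f g # vs) as)) (idx (us @ gComp (Chb A) f g # vs))"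
proof -
  interpret P: module K P by (rule P)
  let ?h = "us @ f # g # vs" let ?h' = "us @ gComp (Chb A) f g # vs" let ?i = "length us"
  note B = Bf_nth[OF h]
  have h': "?h' \<in> Bf.Sym X X' (n + 1)" by (rule Bf.Sym_merge[OF h ne])
  have fO: "src f \<in> Ob" "tgt f \<in> Ob" and f: "f \<in> carrier (HC (src f) (tgt f) (deg f))"
    using B(4)[of ?i] B(5)[of ?i] B(2)[of ?i] by (simp_all add: nth_append)
  have gO: "src g \<in> Ob" and fg: "src f = tgt g" and g: "g \<in> carrier (HC (src g) (src f) (deg g))"
    using B(4)[of "Suc ?i"] B(3)[of ?i] B(2)[of "Suc ?i"] by (simp_all add: nth_append)
  let ?s = "\<lambda>a. gComp (Chb A) (incl A (src f) a) (gComp (Chb A) (proj A (src f) a) g)"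
  have s: "?s a \<in> carrier (HC (src g) (src f) (deg g))" if a: "a \<in> supp (src f)" for a
  proof -
    have E: "emb_ob (yob (src f) a) \<in> Ob" using emb_Ob supp_obj[OF fO(1) a] by blast
    have "?s a \<in> carrier (HC (src g) (src f) (a + (- a + deg g)))"
      by (rule gComp_closed[OF gO E fO(1) gComp_closed[OF gO fO(1) E g proj_closed[OF fO(1) a]] incl_closed[OF fO(1) a]])
    then show ?thesis by simp
  qed
  let ?T = "\<lambda>as. (\<lambda>x. \<phi> (cut A (us @ gComp (Chb A) f x # vs) as))"
  have T: "?T as \<in> linear_maps K (HC (src g) (src f) (deg g)) P" if "as \<in> idx ?h'" for as
    using linear_maps_comp[OF gComp_lin_right[OF gO fO f] slot_cut[OF ml h' gComp_closed[OF gO fO g f] that]] .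
  let ?J = "\<lambda>(as, a). take ?i as @ a # drop ?i as"
  \<comment> \<open>An index vector of the long word is one of the merged word together with an
    index at the joint.\<close>
  have I: "idx ?h = ?J ` (idx ?h' \<times> supp (src f))"
  proof (intro equalityI subsetI)
    fix as assume as: "as \<in> idx ?h"
    have len: "length as = Suc (?i + length vs)" using as by (simp add: idx_def)
    have nn: "as ! t \<in> supp (src (?h ! t))" if "t < Suc (?i + length vs)" for t using as that by (simp add: idx_def)
    have "take ?i as @ drop (Suc ?i) as \<in> idx ?h'" unfolding idx_def
    proof (intro CollectI conjI allI impI)
      show "length (take ?i as @ drop (Suc ?i) as) = length ?h' - 1" using len by simp
      fix t assume "t < length (take ?i as @ drop (Suc ?i) as)"
      then have t: "t < ?i + length vs" using len by simp
      show "(take ?i as @ drop (Suc ?i) as) ! t \<in> supp (src (?h' ! t))"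
      proof (cases "t < ?i")
        case True
        then show ?thesis using nn[of t] len by (simp add: nth_append)
      next
        case False
        then obtain k where k: "t = ?i + k" using le_Suc_ex by (metis linorder_not_less)
        then show ?thesis using nn[of "Suc t"] len t by (cases k) (simp_all add: nth_append gComp_eq)
      qed
    qed
    moreover have "as ! ?i \<in> supp (src f)" using nn[of ?i] by (simp add: nth_append)
    moreover have "as = ?J (take ?i as @ drop (Suc ?i) as, as ! ?i)" using len by (simp add: id_take_nth_drop)
    ultimately show "as \<in> ?J ` (idx ?h' \<times> supp (src f))" by (intro image_eqI[where x="(take ?i as @ drop (Suc ?i) as, as ! ?i)"]) auto
  next
    fix x assume "x \<in> ?J ` (idx ?h' \<times> supp (src f))"
    then obtain as a where x: "x = take ?i as @ a # drop ?i as" and as: "as \<in> idx ?h'" and a: "a \<in> supp (src f)" by auto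
    have len: "length as = ?i + length vs" using as by (simp add: idx_def)
    have nn: "as ! t \<in> supp (src (?h' ! t))" if "t < ?i + length vs" for t using as that by (simp add: idx_def)
    show "x \<in> idx ?h" unfolding idx_def x
    proof (intro CollectI conjI allI impI)
      show "length (take ?i as @ a # drop ?i as) = length ?h - 1" using len by simp
      fix t assume "t < length (take ?i as @ a # drop ?i as)"
      then have t: "t < Suc (?i + length vs)" using len by simp
      consider "t < ?i" | "t = ?i" | k where "t = Suc (?i + k)"
        by (metis less_iff_Suc_add linorder_neqE_nat)
      then show "(take ?i as @ a # drop ?i as) ! t \<in> supp (src (?h ! t))"
      proof cases
        case 1
        then show ?thesis using nn[of t] len by (simp add: nth_append)
      next
        case 2
        then show ?thesis using a len by (simp add: nth_append)
      next
        case 3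
        then show ?thesis using nn[of "?i + k"] len t by (cases k) (simp_all add: nth_append gComp_eq)
      qed
    qed
  qed
  have inj: "inj_on ?J (idx ?h' \<times> supp (src f))"
  proof (rule inj_onI, clarify)
    fix as a bs b assume "as \<in> idx ?h'" "bs \<in> idx ?h'" and e: "take ?i as @ a # drop ?i as = take ?i bs @ b # drop ?i bs"
    then have "length (take ?i as) = length (take ?i bs)" by (simp add: idx_def)
    with e have "take ?i as = take ?i bs" "a = b" "drop ?i as = drop ?i bs" by simp_all
    then show "as = bs \<and> a = b" by (metis append_take_drop_id)
  qed
  have m: "dg.merge ?i (cut A ?h (take ?i as @ a # drop ?i as)) = cut A (us @ gComp (Chb A) f (?s a) # vs) as"
    if "as \<in> idx ?h'" "a \<in> supp (src f)" for as a
  proof -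
    have l: "length (take ?i as) = ?i" using that(1) by (simp add: idx_def)
    have "?J (as, a) \<in> idx ?h" unfolding I by (rule imageI) (use that in simp)
    then have "take ?i as @ a # drop ?i as \<in> idx ?h" by simp
    from cut_merge[OF h l this] show ?thesis by simp
  qed
  have Tc: "?T as (?s a) \<in> carrier P" if "as \<in> idx ?h'" "a \<in> supp (src f)" for as a
    by (rule linear_mapsD(1)[OF T[OF that(1)] s[OF that(2)]])
  have fin: "finite (idx ?h')" "finite (supp (src f))" by (rule finite_idx[OF h'], rule ObD(1)[OF fO(1)])
  have "finsum P (\<lambda>as. \<phi> (dg.merge ?i (cut A ?h as))) (idx ?h) =
    finsum P (\<lambda>x. \<phi> (dg.merge ?i (cut A ?h (?J x)))) (idx ?h' \<times> supp (src f))"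
    unfolding I by (rule P.M.finsum_reindex[OF _ inj]) (use m Tc in auto)
  also have "\<dots> = finsum P (\<lambda>x. ?T (fst x) (?s (snd x))) (idx ?h' \<times> supp (src f))"
    by (rule P.M.finsum_cong') (use m Tc in auto)
  also have "\<dots> = finsum P (\<lambda>as. finsum P (\<lambda>a. ?T as (?s a)) (supp (src f))) (idx ?h')"
    using P.M.finsum_Sigma[of "idx ?h'" "\<lambda>_. supp (src f)" "\<lambda>x. ?T (fst x) (?s (snd x))"] fin Tc by simp
  also have "\<dots> = finsum P (\<lambda>as. ?T as g) (idx ?h')"
  proof (rule P.M.finsum_cong'[OF refl])
    show "(\<lambda>as. ?T as g) \<in> idx ?h' \<rightarrow> carrier P" using linear_mapsD(1)[OF T g] by blast
    fix as assume as: "as \<in> idx ?h'"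
    have "finsum P (\<lambda>a. ?T as (?s a)) (supp (src f)) = ?T as (finsum (HC (src g) (src f) (deg g)) ?s (supp (src f)))"
      by (rule linear_map_finsum[OF HC_module[OF gO fO(1)] P T[OF as], symmetric]) (use s in blast)
    then show "finsum P (\<lambda>a. ?T as (?s a)) (supp (src f)) = ?T as g"
      by (simp add: incl_proj_sum[OF fO(1) gO g])
  qed
  finally show ?thesis .
qed

text \<open>A complex in degree zero has zero differential, so one half of the commutator drops
  out.\<close>

lemma delta_emb:
  assumes y: "y \<in> Obj A" and X: "X \<in> Ob"
  shows "f \<in> carrier (HC (emb_ob y) X k) \<Longrightarrow> dif (Chb A) f = gComp (Chb A) (delta X) f"
    and "f \<in> carrier (HC X (emb_ob y) k) \<Longrightarrow> dif (Chb A) f = signed (HC X (emb_ob y) (k + 1)) (k + 1) (gComp (Chb A) f (delta X))"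
proof -
  let ?E = "emb_ob y :: ('o,'m) cplx"
  have E: "?E \<in> Ob" by (rule emb_Ob[OF y])
  have z: "delta ?E = \<zero>\<^bsub>HC ?E ?E 1\<^esub>" by (rule emb_zero[OF y y delta_closed[OF E]]) simp
  show "dif (Chb A) f = gComp (Chb A) (delta X) f" if f: "f \<in> carrier (HC ?E X k)"
  proof -
    interpret M: module K "HC ?E X (k + 1)" by (rule HC_module[OF E X])
    have "gComp (Chb A) f (delta ?E) = \<zero>\<^bsub>HC ?E X (k + 1)\<^esub>"
      unfolding z by (rule linear_map_zero[OF HC_module[OF E E] M.module_axioms gComp_lin_right[OF E E X f]])
    moreover have "gComp (Chb A) (delta X) f \<in> carrier (HC ?E X (k + 1))"
      using gComp_closed[OF E X X f delta_closed[OF X]] by (simp add: add.commute)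
    ultimately show ?thesis
      using dif_eq[OF E X f] signed_zero[OF M.module_axioms] by (simp add: M.M.minus_eq)
  qed
  show "dif (Chb A) f = signed (HC X ?E (k + 1)) (k + 1) (gComp (Chb A) f (delta X))" if f: "f \<in> carrier (HC X ?E k)"
  proof -
    interpret M: module K "HC X ?E (k + 1)" by (rule HC_module[OF X E])
    have "gComp (Chb A) (delta ?E) f = \<zero>\<^bsub>HC X ?E (1 + k)\<^esub>"
      unfolding z by (rule linear_map_zero[OF HC_module[OF E E] HC_module[OF X E] gComp_lin_left[OF X E E f]])
    then have 0: "gComp (Chb A) (delta ?E) f = \<zero>\<^bsub>HC X ?E (k + 1)\<^esub>" by (simp add: add.commute)
    have c: "gComp (Chb A) f (delta X) \<in> carrier (HC X ?E (k + 1))"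
      by (rule gComp_closed[OF X X E delta_closed[OF X] f])
    show ?thesis unfolding dif_eq[OF X E f] 0 using c by (simp add: signed_def M.M.minus_eq)
  qed
qed

lemma R_nth:
  assumes "w \<in> R.Sym X X' n"
  shows "t < length w \<Longrightarrow> dg.arr (w ! t)"
    "Suc t < length w \<Longrightarrow> src (w ! t) = tgt (w ! Suc t) \<and> (\<exists>y\<in>Obj A. src (w ! t) = emb_ob y)"
    "2 \<le> length w" "tgt (w ! 0) = X" "src (w ! (length w - 1)) = X'"
    "(\<Sum>t<length w. deg (w ! t)) = n + int (length w) - 2"
proof -
  note S = assms[unfolded R.Sym_iff]
  note S2 = S[THEN conjunct2] note S3 = S2[THEN conjunct2] note S4 = S3[THEN conjunct2] note S5 = S4[THEN conjunct2]
  show "dg.arr (w ! t)" if "t < length w" for t using S2[THEN conjunct1] that by simp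
  show "src (w ! t) = tgt (w ! Suc t) \<and> (\<exists>y\<in>Obj A. src (w ! t) = emb_ob y)" if "Suc t < length w"
    using successively_nth[OF S3[THEN conjunct1] that] unfolding image_iff .
  show l: "2 \<le> length w" by (rule S[THEN conjunct1])
  then have "w \<noteq> []" by auto
  then show "tgt (w ! 0) = X" "src (w ! (length w - 1)) = X'"
    using S4[THEN conjunct1] S5[THEN conjunct1] by (simp_all add: hd_conv_nth last_conv_nth)
  show "(\<Sum>t<length w. deg (w ! t)) = n + int (length w) - 2"
    using S5[THEN conjunct2] by (simp add: sum_list_sum_nth atLeast0LessThan)
qed

text \<open>The complexes concentrated in degree \<open>0\<close> have zero differential, so only the outer entries
  contribute to the internal differential.\<close>

lemma rel_bar_dif:
  assumes P: "module K P" and ml: "R.multilinear X X' (n + 1) P \<phi>" and w: "w \<in> R.Sym X X' n"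
  shows "R.bar_dif_ext P \<phi> w = signed P (int (length w - 2)) (\<phi> (gComp (Chb A) (delta X) (hd w) # tl w)) \<oplus>\<^bsub>P\<^esub>
    (signed P (n + 1) (\<phi> (butlast w @ [gComp (Chb A) (last w) (delta X')])) \<oplus>\<^bsub>P\<^esub>
     finsum P (\<lambda>i. signed P (int i) (\<phi> (dg.merge i w))) {i. 0 < length w - 2 \<and> i \<le> length w - 2})"
proof -
  interpret P: module K P by (rule P)
  note B = R_nth[OF w]
  have XO: "X \<in> Ob" "X' \<in> Ob" by (rule R.Sym_obj[OF w])+
  define s where "s = length w - 2"
  have ls: "length w = s + 2" using B(3) by (simp add: s_def)
  have ne: "w \<noteq> []" using ls by auto
  let ?T = "\<lambda>i. signed P (int s + (\<Sum>j<i. deg (w ! j))) (\<phi> (w[i := dif (Chb A) (w ! i)]))"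
  have Tc: "?T \<in> {0..s + 1} \<rightarrow> carrier P"
    using R.bar_dif_terms_closed(1)[OF ml P w, of "\<lambda>i. int s + (\<Sum>j<i. deg (w ! j))"] by (simp add: s_def)
  have mid: "?T i = \<zero>\<^bsub>P\<^esub>" if i: "0 < i" "i \<le> s" for i
  proof -
    obtain y where y: "y \<in> Obj A" "src (w ! i) = emb_ob y" using B(2)[of i] i ls by auto
    obtain y' where y': "y' \<in> Obj A" "tgt (w ! i) = emb_ob y'" using B(2)[of "i - 1"] i ls by auto
    have c: "w ! i \<in> carrier (HC (emb_ob y) (emb_ob y') (deg (w ! i)))" using B(1)[of i] i ls y y' by (simp add: dg.arr_def)
    note E = emb_Ob[OF y(1)] emb_Ob[OF y'(1)]
    note dl = dg.dif_linear[OF E, of "deg (w ! i)"]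
    have z: "dif (Chb A) (w ! i) = \<zero>\<^bsub>HC (emb_ob y) (emb_ob y') (deg (w ! i) + 1)\<^esub>"
    proof (cases "deg (w ! i) = 0")
      case True
      show ?thesis by (rule emb_zero[OF y(1) y'(1) linear_mapsD(1)[OF dl c]]) (use True in simp)
    next
      case False
      show ?thesis using linear_map_zero[OF HC_module[OF E] HC_module[OF E] dl] emb_zero[OF y(1) y'(1) c False] by simp
    qed
    have il: "i < length w" using i ls by simp
    have u: "w[i := dif (Chb A) (w ! i)] = take i w @ \<zero>\<^bsub>HC (emb_ob y) (emb_ob y') (deg (w ! i) + 1)\<^esub> # drop (Suc i) w"
      unfolding z by (rule upd_conv_take_nth_drop[OF il])
    have "\<phi> (w[i := dif (Chb A) (w ! i)]) = \<zero>\<^bsub>P\<^esub>" unfolding u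
      by (rule R.multilinear_zero[OF ml P _ E]) (use R.Sym_dif[OF w il] in \<open>simp only: u\<close>)
    then show ?thesis by (simp add: signed_zero[OF P])
  qed
  have first: "?T 0 = signed P (int s) (\<phi> (gComp (Chb A) (delta X) (hd w) # tl w))"
  proof -
    obtain y where y: "y \<in> Obj A" "src (w ! 0) = emb_ob y" using B(2)[of 0] ls by auto
    have c: "w ! 0 \<in> carrier (HC (emb_ob y) X (deg (w ! 0)))" using B(1)[of 0] ls y B(4) by (simp add: dg.arr_def)
    have "w[0 := x] = x # tl w" for x using ne by (cases w) simp_all
    then show ?thesis using delta_emb(1)[OF y(1) XO(1) c] by (simp add: hd_conv_nth[OF ne])
  qed
  have last: "?T (s + 1) = signed P (n + 1) (\<phi> (butlast w @ [gComp (Chb A) (last w) (delta X')]))"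
  proof -
    have l1: "length w - 1 = s + 1" using ls by simp
    have lw: "w ! (s + 1) = last w" using last_conv_nth[OF ne] l1 by simp
    obtain y where y: "y \<in> Obj A" "tgt (last w) = emb_ob y" using B(2)[of s] ls lw by auto
    let ?k = "deg (last w)"
    have c: "last w \<in> carrier (HC X' (emb_ob y) ?k)" using B(1)[of "s + 1"] ls y B(5) l1 lw by (simp add: dg.arr_def)
    have E: "emb_ob y \<in> Ob" by (rule emb_Ob[OF y(1)])
    have lb: "length (butlast w) = s + 1" using ls by simp
    have u: "w[s + 1 := x] = butlast w @ [x]" for x
      by (metis append_butlast_last_id[OF ne] lb list_update_length)
    have g: "gComp (Chb A) (last w) (delta X') \<in> carrier (HC X' (emb_ob y) (?k + 1))"
      by (rule gComp_closed[OF XO(2) XO(2) E delta_closed[OF XO(2)] c])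
    have m: "butlast w @ [gComp (Chb A) (last w) (delta X')] \<in> R.Sym X X' (n + 1)"
      by (rule R.Sym_right[OF w delta_closed[OF XO(2)] XO(2)])
    have "\<phi> (butlast w @ [signed (HC X' (emb_ob y) (?k + 1)) (?k + 1) (gComp (Chb A) (last w) (delta X'))]) =
      signed P (?k + 1) (\<phi> (butlast w @ [gComp (Chb A) (last w) (delta X')]))"
      by (rule linear_map_signed[OF HC_module[OF XO(2) E] P R.multilinear_linear[OF ml m g] g])
    then have "?T (s + 1) = signed P (int s + (\<Sum>j<s + 1. deg (w ! j))) (signed P (?k + 1) (\<phi> (butlast w @ [gComp (Chb A) (last w) (delta X')])))"
      unfolding u lw delta_emb(2)[OF y(1) XO(2) c] by simp
    also have "\<dots> = signed P (n + 1) (\<phi> (butlast w @ [gComp (Chb A) (last w) (delta X')]))"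
    proof -
      \<comment> \<open>All degrees add up to \<open>n + s\<close>; with the shift sign
        \<open>s\<close> and the sign from the commutator the exponent is \<open>n + 1\<close>
        modulo two.\<close>
      have "(\<Sum>j<s + 1. deg (w ! j)) + ?k = n + int s" using B(6) ls lw by simp
      then have e: "int s + (\<Sum>j<s + 1. deg (w ! j)) + (?k + 1) = n + 1 + 2 * int s" by simp
      show ?thesis unfolding signed_signed[OF P R.multilinear_closed[OF ml m]] e by (rule signed_cong) simp
    qed
    finally show ?thesis .
  qed
  have fc: "?T 0 \<in> carrier P" "?T (s + 1) \<in> carrier P"
    by (rule funcset_mem[OF Tc, of 0], simp, rule funcset_mem[OF Tc, of "s + 1"], simp)
  have mc: "finsum P (\<lambda>i. signed P (int i) (\<phi> (dg.merge i w))) {i. 0 < s \<and> i \<le> s} \<in> carrier P"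
    by (rule P.M.finsum_closed) (use R.bar_dif_terms_closed(2)[OF ml P w, of int] in \<open>simp add: s_def\<close>)
  have "R.bar_dif_ext P \<phi> w = finsum P ?T {0..s + 1} \<oplus>\<^bsub>P\<^esub> finsum P (\<lambda>i. signed P (int i) (\<phi> (dg.merge i w))) {i. 0 < s \<and> i \<le> s}"
    by (simp only: R.bar_dif_ext_def s_def)
  also have "finsum P ?T {0..s + 1} = ?T 0 \<oplus>\<^bsub>P\<^esub> ?T (s + 1)" by (rule P.M.finsum_ends[OF Tc mid])
  finally show ?thesis unfolding s_def[symmetric] first[symmetric] last[symmetric]
    using P.M.a_assoc[OF fc mc] by simp
qed

section \<open>Sums of cuts under the actions and the differential\<close>

abbreviation "RB \<equiv> rel_Bar K (Chb A) (emb_ob ` Obj A)"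

lemma idx_src: "map src g = map src h \<Longrightarrow> idx g = idx h"
proof -
  assume e: "map src g = map src h"
  then have l: "length g = length h" by (rule map_eq_imp_length_eq)
  have "src (g ! t) = src (h ! t)" if "t < length g" for t using arg_cong[OF e, of "\<lambda>x. x ! t"] that l by simp
  then show ?thesis using l unfolding idx_def by auto
qed

lemma Bf_Cons:
  assumes "h \<in> Bf.Sym X X' n"
  obtains f t where "h = f # t" "t \<noteq> []"
  using Bf_nth(6)[OF assms] that by (cases h; cases "tl h") auto

lemma length_cut: "length (cut A h as) = length h"
  by (simp add: cut_cutE)

lemma Cut_left:
  assumes h: "h \<in> Bf.Sym X X' n" and g: "g \<in> carrier (HC X X1 j)" "X1 \<in> Ob"
  shows "finsum (R.BM X1 X' (j + n)) (\<lambda>as. R.el X1 X' (j + n) (gComp (Chb A) g (hd (cut A h as)) # tl (cut A h as))) (idx h) =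
    Cut X1 X' (j + n) (gComp (Chb A) g (hd h) # tl h)"
proof -
  interpret P: module K "R.BM X1 X' (j + n)" by (rule R.BM_module)
  obtain f t where ht: "h = f # t" "t \<noteq> []" using Bf_Cons[OF h] .
  have i: "idx (gComp (Chb A) g f # t) = idx (f # t)" by (rule idx_src) (simp add: gComp_eq)
  show ?thesis unfolding Cut_def ht list.sel i
    by (rule P.M.finsum_cong'[OF refl])
      (use cut_left[OF h[unfolded ht(1)] _ g] el_cut_closed[OF Bf.Sym_left[OF h g]] in \<open>auto simp: ht i\<close>)
qed

lemma Cut_right:
  assumes h: "h \<in> Bf.Sym X X' n" and g: "g \<in> carrier (HC Y' X' m)" "Y' \<in> Ob"
  shows "finsum (R.BM X Y' (n + m)) (\<lambda>as. R.el X Y' (n + m) (butlast (cut A h as) @ [gComp (Chb A) (last (cut A h as)) g])) (idx h) =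
    Cut X Y' (n + m) (butlast h @ [gComp (Chb A) (last h) g])"
proof -
  interpret P: module K "R.BM X Y' (n + m)" by (rule R.BM_module)
  have l: "length (butlast h @ [gComp (Chb A) (last h) g]) = length h" using Bf_nth(6)[OF h] by simp
  have i: "idx (butlast h @ [gComp (Chb A) (last h) g]) = idx h"
  proof -
    have "(butlast h @ [gComp (Chb A) (last h) g]) ! t = h ! t" if "t < length h - 1" for t
      using that by (simp add: nth_append nth_butlast)
    then show ?thesis unfolding idx_def l by auto
  qed
  show ?thesis unfolding Cut_def i
    by (rule P.M.finsum_cong'[OF refl])
      (use cut_right[OF h _ g] el_cut_closed[OF Bf.Sym_right[OF h g]] in \<open>auto simp: i\<close>)
qed

text \<open>On cut words the internal differential reaches only the outer entries, where it is
  composition with \<open>delta\<close> and commutes with cutting; the merges are summed by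
  \<open>sum_merge_cut\<close>.\<close>

lemma bdif_Cut:
  assumes h: "h \<in> Bf.Sym X X' n"
  shows "bdif RB X X' n (Cut X X' n h) =
    signed (R.BM X X' (n + 1)) (int (length h - 2)) (Cut X X' (n + 1) (gComp (Chb A) (delta X) (hd h) # tl h)) \<oplus>\<^bsub>R.BM X X' (n + 1)\<^esub>
    (signed (R.BM X X' (n + 1)) (n + 1) (Cut X X' (n + 1) (butlast h @ [gComp (Chb A) (last h) (delta X')])) \<oplus>\<^bsub>R.BM X X' (n + 1)\<^esub>
     finsum (R.BM X X' (n + 1)) (\<lambda>i. signed (R.BM X X' (n + 1)) (int i) (Cut X X' (n + 1) (dg.merge i h)))
       {i. 0 < length h - 2 \<and> i \<le> length h - 2})"
proof -
  let ?P = "R.BM X X' (n + 1)" and ?el = "R.el X X' (n + 1)"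
  let ?I = "{i. 0 < length h - 2 \<and> i \<le> length h - 2}"
  have P: "module K ?P" by (rule R.BM_module)
  interpret P: module K ?P by (rule P)
  have XO: "X \<in> Ob" "X' \<in> Ob" by (rule Bf.Sym_obj[OF h])+
  note c = cut_Sym[OF h]
  define a where "a as = ?el (gComp (Chb A) (delta X) (hd (cut A h as)) # tl (cut A h as))" for as
  define b where "b as = ?el (butlast (cut A h as) @ [gComp (Chb A) (last (cut A h as)) (delta X')])" for as
  define d where "d i as = ?el (dg.merge i (cut A h as))" for i as
  have ac: "a as \<in> carrier ?P" if "as \<in> idx h" for as
    unfolding a_def using R.el_closed[OF R.Sym_left[OF c[OF that] delta_closed[OF XO(1)] XO(1)]] by (simp add: add.commute)
  have bc: "b as \<in> carrier ?P" if "as \<in> idx h" for as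
    unfolding b_def by (rule R.el_closed[OF R.Sym_right[OF c[OF that] delta_closed[OF XO(2)] XO(2)]])
  have dc: "d i as \<in> carrier ?P" if "i \<in> ?I" "as \<in> idx h" for i as
    unfolding d_def by (rule R.el_closed[OF R.Sym_merge'[OF c[OF that(2)]]]) (use that(1) in \<open>auto simp: length_cut\<close>)
  let ?s = "signed ?P"
  note sc = signed_closed[OF P]
  have fI: "finite ?I" by (rule finite_subset[of _ "{..length h - 2}"]) auto
  have Dc: "finsum ?P (\<lambda>i. ?s (int i) (d i as)) ?I \<in> carrier ?P" if "as \<in> idx h" for as
    by (rule P.M.finsum_closed) (use dc that sc in blast)
  have 1: "bdif RB X X' n (R.el X X' n (cut A h as)) = ?s (int (length h - 2)) (a as) \<oplus>\<^bsub>?P\<^esub>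
    (?s (n + 1) (b as) \<oplus>\<^bsub>?P\<^esub> finsum ?P (\<lambda>i. ?s (int i) (d i as)) ?I)" if "as \<in> idx h" for as
    unfolding R.bdif_el[OF c[OF that]] rel_bar_dif[OF P R.multilinear_el c[OF that]] length_cut a_def b_def d_def ..
  have "bdif RB X X' n (Cut X X' n h) = finsum ?P (\<lambda>as. bdif RB X X' n (R.el X X' n (cut A h as))) (idx h)"
    unfolding Cut_def by (rule linear_map_finsum[OF R.BM_module P R.bdif_linear el_cut_closed[OF h]])
  also have "\<dots> = finsum ?P (\<lambda>as. ?s (int (length h - 2)) (a as) \<oplus>\<^bsub>?P\<^esub>
    (?s (n + 1) (b as) \<oplus>\<^bsub>?P\<^esub> finsum ?P (\<lambda>i. ?s (int i) (d i as)) ?I)) (idx h)"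
    by (rule P.M.finsum_cong'[OF refl _ 1]) (use ac bc Dc sc in \<open>auto intro!: P.M.a_closed\<close>)
  also have "\<dots> = finsum ?P (\<lambda>as. ?s (int (length h - 2)) (a as)) (idx h) \<oplus>\<^bsub>?P\<^esub>
    (finsum ?P (\<lambda>as. ?s (n + 1) (b as)) (idx h) \<oplus>\<^bsub>?P\<^esub> finsum ?P (\<lambda>as. finsum ?P (\<lambda>i. ?s (int i) (d i as)) ?I) (idx h))"
    using ac bc Dc sc by (subst P.M.finsum_addf, simp, simp add: Pi_def, subst P.M.finsum_addf, simp, simp, simp)
  also have "finsum ?P (\<lambda>as. ?s (int (length h - 2)) (a as)) (idx h) = ?s (int (length h - 2)) (finsum ?P a (idx h))"
    by (rule signed_finsum[OF P, symmetric]) (use ac in blast)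
  also have "finsum ?P a (idx h) = Cut X X' (n + 1) (gComp (Chb A) (delta X) (hd h) # tl h)"
    unfolding a_def using Cut_left[OF h delta_closed[OF XO(1)] XO(1)] by (simp add: add.commute)
  also have "finsum ?P (\<lambda>as. ?s (n + 1) (b as)) (idx h) = ?s (n + 1) (finsum ?P b (idx h))"
    by (rule signed_finsum[OF P, symmetric]) (use bc in blast)
  also have "finsum ?P b (idx h) = Cut X X' (n + 1) (butlast h @ [gComp (Chb A) (last h) (delta X')])"
    unfolding b_def by (rule Cut_right[OF h delta_closed[OF XO(2)] XO(2)])
  also have "finsum ?P (\<lambda>as. finsum ?P (\<lambda>i. ?s (int i) (d i as)) ?I) (idx h) =
    finsum ?P (\<lambda>i. finsum ?P (\<lambda>as. ?s (int i) (d i as)) (idx h)) ?I"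
    by (rule P.M.finsum_swap[OF finite_idx[OF h] fI]) (use dc sc in blast)
  also have "\<dots> = finsum ?P (\<lambda>i. ?s (int i) (Cut X X' (n + 1) (dg.merge i h))) ?I"
  proof (rule P.M.finsum_cong'[OF refl])
    have m: "dg.merge i h \<in> Bf.Sym X X' (n + 1)" if "i \<in> ?I" for i
      by (rule Bf.Sym_merge'[OF h]) (use that in auto)
    show "(\<lambda>i. ?s (int i) (Cut X X' (n + 1) (dg.merge i h))) \<in> ?I \<rightarrow> carrier ?P"
      by (intro Pi_I sc Cut_closed m)
    fix i assume i: "i \<in> ?I"
    have "i + 1 < length h" "2 < length h" using i by auto
    then obtain us f g vs where e: "h = us @ f # g # vs" "length us = i" by (metis dg.split_pair)
    have ne: "us \<noteq> [] \<or> vs \<noteq> []" using \<open>2 < length h\<close> e by auto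
    have "finsum ?P (\<lambda>as. ?s (int i) (d i as)) (idx h) = ?s (int i) (finsum ?P (d i) (idx h))"
      by (rule signed_finsum[OF P, symmetric]) (use dc[OF i] in blast)
    also have "finsum ?P (d i) (idx h) = Cut X X' (n + 1) (dg.merge i h)"
      using sum_merge_cut[OF P R.multilinear_el h[unfolded e(1)] ne]
      unfolding d_def e(2)[symmetric] unfolding e(1) Cut_def by (simp add: dg.merge_append)
    finally show "finsum ?P (\<lambda>as. ?s (int i) (d i as)) (idx h) = ?s (int i) (Cut X X' (n + 1) (dg.merge i h))" .
  qed
  finally show ?thesis .
qed

lemma lact_Cut:
  assumes h: "h \<in> Bf.Sym X X' n" and f: "f \<in> carrier (HC X X1 j)" "X1 \<in> Ob"
  shows "lact RB f X' n (Cut X X' n h) =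
    signed (R.BM X1 X' (j + n)) (int (length h - 2) * j) (Cut X1 X' (j + n) (gComp (Chb A) f (hd h) # tl h))"
proof -
  let ?P = "R.BM X1 X' (j + n)"
  interpret P: module K ?P by (rule R.BM_module)
  let ?a = "\<lambda>as. R.el X1 X' (j + n) (gComp (Chb A) f (hd (cut A h as)) # tl (cut A h as))"
  have ac: "?a \<in> idx h \<rightarrow> carrier ?P" using R.el_closed[OF R.Sym_left[OF cut_Sym[OF h] f]] by blast
  have "lact RB f X' n (Cut X X' n h) = finsum ?P (\<lambda>as. lact RB f X' n (R.el X X' n (cut A h as))) (idx h)"
    unfolding Cut_def by (rule linear_map_finsum[OF R.BM_module R.BM_module R.lact_props(1)[OF f] el_cut_closed[OF h]])
  also have "\<dots> = finsum ?P (\<lambda>as. signed ?P (int (length h - 2) * j) (?a as)) (idx h)"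
  proof (rule P.M.finsum_cong'[OF refl])
    show "(\<lambda>as. signed ?P (int (length h - 2) * j) (?a as)) \<in> idx h \<rightarrow> carrier ?P"
      using ac signed_closed[OF P.module_axioms] by blast
    fix as assume as: "as \<in> idx h"
    show "lact RB f X' n (R.el X X' n (cut A h as)) = signed ?P (int (length h - 2) * j) (?a as)"
      unfolding R.lact_props(2)[OF f cut_Sym[OF h as]] length_cut ..
  qed
  also have "\<dots> = signed ?P (int (length h - 2) * j) (finsum ?P ?a (idx h))"
    by (rule signed_finsum[OF P.module_axioms ac, symmetric])
  finally show ?thesis unfolding Cut_left[OF h f] .
qed

lemma ract_Cut:
  assumes h: "h \<in> Bf.Sym X X' n" and g: "g \<in> carrier (HC Y' X' m)" "Y' \<in> Ob"
  shows "ract RB X n (Cut X X' n h) g = Cut X Y' (n + m) (butlast h @ [gComp (Chb A) (last h) g])"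
proof -
  let ?P = "R.BM X Y' (n + m)"
  interpret P: module K ?P by (rule R.BM_module)
  have "ract RB X n (Cut X X' n h) g = finsum ?P (\<lambda>as. ract RB X n (R.el X X' n (cut A h as)) g) (idx h)"
    unfolding Cut_def by (rule linear_map_finsum[OF R.BM_module R.BM_module R.ract_props(1)[OF g] el_cut_closed[OF h]])
  also have "\<dots> = finsum ?P (\<lambda>as. R.el X Y' (n + m) (butlast (cut A h as) @ [gComp (Chb A) (last (cut A h as)) g])) (idx h)"
    by (rule P.M.finsum_cong'[OF refl])
      (use R.ract_props(2)[OF g cut_Sym[OF h]] R.el_closed[OF R.Sym_right[OF cut_Sym[OF h] g]] in auto)
  finally show ?thesis unfolding Cut_right[OF h g] .
qed

lemma Cut_delta_sq:
  assumes h: "us @ gComp (Chb A) (delta Y) (delta Y) # vs \<in> Bf.Sym X X' n"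
  shows "Cut X X' n (us @ gComp (Chb A) (delta Y) (delta Y) # vs) = \<zero>\<^bsub>R.BM X X' n\<^esub>"
proof -
  have Y: "Y \<in> Ob" using Bf_nth(4)[OF h, of "length us"] by (simp add: nth_append gComp_eq delta_def)
  show ?thesis unfolding delta_sq[OF Y]
    by (rule Bf.multilinear_zero[OF Cut_multilinear R.BM_module h[unfolded delta_sq[OF Y]] Y Y])
qed

text \<open>In a long block \<open>\<delta>|\<dots>|\<delta>\<close> some entry \<open>\<pi>\<^sup>a\<delta>\<sigma>\<^sup>b\<close> has nonzero degree, for otherwise the
  degrees of its chain objects would decrease by one in each step.\<close>

lemma el_cut_replicate:
  assumes h: "us @ replicate b (delta Y) @ vs \<in> Bf.Sym X X' n" and b: "card (supp Y) + 1 < b"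
    and as: "as \<in> idx (us @ replicate b (delta Y) @ vs)"
  shows "R.el X X' n (cut A (us @ replicate b (delta Y) @ vs) as) = \<zero>\<^bsub>R.BM X X' n\<^esub>"
proof -
  let ?h = "us @ replicate b (delta Y) @ vs" and ?i = "length us"
  note B = Bf_nth[OF h]
  have lh: "length ?h = ?i + b + length vs" by simp
  have hn: "?h ! (?i + k) = delta Y" if "k < b" for k using that by (simp add: nth_append)
  have ai: "as ! t \<in> supp (src (?h ! t))" if "t < length ?h - 1" for t using as that by (simp add: idx_def)
  have Y: "Y \<in> Ob" using B(4)[of ?i] hn[of 0] b lh by (simp add: delta_def)
  \<comment> \<open>The first and the last differential are left out, as they may be cut on one side
    only.\<close>
  have ex: "\<exists>k. 0 < k \<and> k < b - 1 \<and> 1 + as ! (?i + k) - as ! (?i + k - 1) \<noteq> 0"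
  proof (rule ccontr)
    assume n: "\<not> ?thesis"
    have e: "as ! (?i + k) = as ! ?i - int k" if "k < b - 1" for k
      using that
    proof (induction k)
      case (Suc k)
      have "1 + as ! (?i + Suc k) - as ! (?i + Suc k - 1) = 0" using n Suc.prems by blast
      then show ?case using Suc by simp
    qed simp
    \<comment> \<open>The indices after all but the last differential would be \<open>b - 1\<close>
      distinct elements of \<open>supp Y\<close>, against the bound on \<open>b\<close>.\<close>
    have "inj_on (\<lambda>k. as ! (?i + k)) {..<b - 1}" using e by (intro inj_onI) simp
    moreover have "(\<lambda>k. as ! (?i + k)) ` {..<b - 1} \<subseteq> supp Y"
    proof
      fix x assume "x \<in> (\<lambda>k. as ! (?i + k)) ` {..<b - 1}"
      then obtain k where k: "k < b - 1" "x = as ! (?i + k)" by auto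
      then show "x \<in> supp Y" using ai[of "?i + k"] hn[of k] lh by (simp add: delta_def)
    qed
    ultimately have "card {..<b - 1} \<le> card (supp Y)" by (rule card_inj_on_le[OF _ _ ObD(1)[OF Y]])
    then show False using b by simp
  qed
  then obtain k where k: "0 < k" "k < b - 1" "1 + as ! (?i + k) - as ! (?i + k - 1) \<noteq> 0" by blast
  let ?t = "?i + k"
  have t: "?t < length ?h" "?t < length ?h - 1" "0 < ?t" "?t - 1 < length ?h - 1" "?t - 1 < length ?h" using k lh by auto
  have o: "yob (src (?h ! s)) (as ! s) \<in> Obj A" if "s < length ?h - 1" for s
    using supp_obj[OF B(4) ai[OF that]] that by simp
  let ?y = "yob (src (?h ! ?t)) (as ! ?t)" and ?y' = "yob (src (?h ! (?t - 1))) (as ! (?t - 1))"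
  let ?c = "cutE ?h as ?t" and ?k = "1 + as ! ?t - as ! (?t - 1)"
  have dk: "deg (?h ! ?t) = 1" using hn[of k] k by (simp add: delta_def)
  have c: "?c \<in> carrier (HC (emb_ob ?y) (emb_ob ?y') ?k)"
    using cutE_closed[OF h as t(1)] unfolding if_P[OF t(2)] if_P[OF t(3)] dk .
  have z: "?c = \<zero>\<^bsub>HC (emb_ob ?y) (emb_ob ?y') ?k\<^esub>" by (rule emb_zero[OF o[OF t(2)] o[OF t(4)] c k(3)])
  have e: "cut A ?h as = take ?t (cut A ?h as) @ ?c # drop (Suc ?t) (cut A ?h as)"
    using id_take_nth_drop[of ?t "cut A ?h as"] t(1) unfolding length_cut by (simp add: cut_cutE del: length_append)
  have m: "take ?t (cut A ?h as) @ \<zero>\<^bsub>HC (emb_ob ?y) (emb_ob ?y') ?k\<^esub> # drop (Suc ?t) (cut A ?h as) \<in> R.Sym X X' n"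
    unfolding z[symmetric] e[symmetric] by (rule cut_Sym[OF h as])
  have "R.el X X' n (take ?t (cut A ?h as) @ \<zero>\<^bsub>HC (emb_ob ?y) (emb_ob ?y') ?k\<^esub> # drop (Suc ?t) (cut A ?h as)) = \<zero>\<^bsub>R.BM X X' n\<^esub>"
    by (rule R.multilinear_zero[OF R.multilinear_el R.BM_module m emb_Ob[OF o[OF t(2)]] emb_Ob[OF o[OF t(4)]]])
  then show ?thesis unfolding z[symmetric] e[symmetric] .
qed

lemma Cut_replicate:
  assumes "us @ replicate b (delta Y) @ vs \<in> Bf.Sym X X' n" "card (supp Y) + 1 < b"
  shows "Cut X X' n (us @ replicate b (delta Y) @ vs) = \<zero>\<^bsub>R.BM X X' n\<^esub>"
proof -
  interpret P: module K "R.BM X X' n" by (rule R.BM_module)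
  show ?thesis unfolding Cut_def by (rule P.M.finsum_all_zero) (rule el_cut_replicate[OF assms])
qed

end

section \<open>Formal integer combinations in a module\<close>

text \<open>The homomorphism from the free abelian group on words determined by \<open>g\<close>. It
  carries identities proved in a type of class \<open>ab_group_add\<close> into the module.\<close>

definition lin_comb :: "('k,'x) module \<Rightarrow> ('w \<Rightarrow> 'x) \<Rightarrow> ('w \<Rightarrow>\<^sub>0 int) \<Rightarrow> 'x" where
  "lin_comb M g p = finsum M (\<lambda>w. add_pow M (Poly_Mapping.lookup p w) (g w)) (Poly_Mapping.keys p)"

context
  fixes K :: "'k ring" and M :: "('k,'x) module" and g :: "'w \<Rightarrow> 'x"
  assumes M: "module K M" and g: "\<And>w. g w \<in> carrier M"
begin

interpretation M: module K M by (rule M)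

lemma add_pow_0: "add_pow M (0::int) x = \<zero>\<^bsub>M\<^esub>"
  by (simp add: add_pow_def)

lemma lin_comb_superset:
  assumes "finite S" "Poly_Mapping.keys p \<subseteq> S"
  shows "lin_comb M g p = finsum M (\<lambda>w. add_pow M (Poly_Mapping.lookup p w) (g w)) S"
  unfolding lin_comb_def
  by (rule M.M.add.finprod_mono_neutral_cong_left[OF assms])
    (use g in \<open>auto simp: in_keys_iff add_pow_0\<close>)

lemma lin_comb_closed: "lin_comb M g p \<in> carrier M"
  unfolding lin_comb_def by (intro M.M.finsum_closed Pi_I M.M.add.int_pow_closed g)

lemma lin_comb_zero: "lin_comb M g 0 = \<zero>\<^bsub>M\<^esub>"
  by (simp add: lin_comb_def)

lemma lin_comb_single: "lin_comb M g (Poly_Mapping.single w 1) = g w"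
  using g by (simp add: lin_comb_def M.M.add.int_pow_1)

lemma lin_comb_add: "lin_comb M g (p + q) = lin_comb M g p \<oplus>\<^bsub>M\<^esub> lin_comb M g q"
proof -
  let ?S = "Poly_Mapping.keys p \<union> Poly_Mapping.keys q"
  have S: "finite ?S" by simp
  have c: "(\<lambda>w. add_pow M (Poly_Mapping.lookup r w) (g w)) \<in> ?S \<rightarrow> carrier M" for r :: "'w \<Rightarrow>\<^sub>0 int"
    by (intro Pi_I M.M.add.int_pow_closed g)
  have "lin_comb M g (p + q) = finsum M (\<lambda>w. add_pow M (Poly_Mapping.lookup (p + q) w) (g w)) ?S"
    by (rule lin_comb_superset[OF S Poly_Mapping.keys_add])
  also have "\<dots> = finsum M (\<lambda>w. add_pow M (Poly_Mapping.lookup p w) (g w) \<oplus>\<^bsub>M\<^esub> add_pow M (Poly_Mapping.lookup q w) (g w)) ?S"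
    by (simp only: Poly_Mapping.lookup_add M.M.add.int_pow_mult[OF g])
  also have "\<dots> = lin_comb M g p \<oplus>\<^bsub>M\<^esub> lin_comb M g q"
    unfolding M.M.finsum_addf[OF c c] using lin_comb_superset[OF S, of p] lin_comb_superset[OF S, of q] by simp
  finally show ?thesis .
qed

lemma lin_comb_sgm: "lin_comb M g (sgm e p) = signed M e (lin_comb M g p)"
proof -
  have "lin_comb M g (- p) \<oplus>\<^bsub>M\<^esub> lin_comb M g p = \<zero>\<^bsub>M\<^esub>"
    unfolding lin_comb_add[symmetric] by (simp add: lin_comb_zero)
  then have "lin_comb M g (- p) = \<ominus>\<^bsub>M\<^esub> lin_comb M g p"
    by (metis M.M.minus_equality lin_comb_closed)
  then show ?thesis by (simp add: sgm_def signed_def)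
qed

lemma lin_comb_sum: "finite I \<Longrightarrow> lin_comb M g (sum f I) = finsum M (\<lambda>i. lin_comb M g (f i)) I"
  by (induction I rule: finite_induct) (simp_all add: lin_comb_zero lin_comb_add lin_comb_closed)

end

section \<open>The map \<open>\<Xi>\<close>\<close>

context words
begin

text \<open>No sign arises: nothing is inserted after the last letter, and its degree does not enter
  the exponent.\<close>

lemma X_last: "f \<noteq> [] \<Longrightarrow> X B (\<lambda>w. c (butlast w @ [m (last w) z])) f = X B c (butlast f @ [m (last f) z])"
proof (induction f arbitrary: c rule: induct_list012)
  case (3 x y t)
  let ?g = "y # t" and ?g' = "butlast (y # t) @ [m (last (y # t)) z]"
  have g': "?g' \<noteq> []" "length ?g' = length ?g" by simp_all
  have e: "butlast (x # y # t) @ [m (last (x # y # t)) z] = x # ?g'" by simp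
  show ?case unfolding e X_Cons[OF g'(1)] X.simps(3) g'(2)
  proof (intro sum.cong refl arg_cong[of _ _ "sgm _"])
    fix n
    have "X B (\<lambda>w. sgm ((int n + dg x) * (int (length w) - int (length ?g)))
        (c (butlast (x # replicate n (D x) @ w) @ [m (last (x # replicate n (D x) @ w)) z]))) ?g =
      X B (\<lambda>w. (\<lambda>v. sgm ((int n + dg x) * (int (length v) - int (length ?g))) (c (x # replicate n (D x) @ v)))
        (butlast w @ [m (last w) z])) ?g"
      by (rule X_cong) (simp add: butlast_append)
    also have "\<dots> = X B (\<lambda>v. sgm ((int n + dg x) * (int (length v) - int (length ?g))) (c (x # replicate n (D x) @ v))) ?g'"
      by (rule 3(2)) simp
    finally show "X B (\<lambda>w. sgm ((int n + dg x) * (int (length w) - int (length ?g)))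
        (c (butlast (x # replicate n (D x) @ w) @ [m (last (x # replicate n (D x) @ w)) z]))) ?g =
      X B (\<lambda>w. sgm ((int n + dg x) * (int (length w) - int (length ?g))) (c (x # replicate n (D x) @ w))) ?g'" .
  qed
qed simp_all

text \<open>The inserted letters depend on an entry only through \<open>D\<close>, that is, through
  its source; entries from one Hom module therefore produce words that differ in one slot.\<close>

lemma ins_slot:
  assumes "length ns = length us + length vs" "\<And>x y. x \<in> G \<Longrightarrow> y \<in> G \<Longrightarrow> D x = D y"
  shows "\<exists>us' vs'. \<forall>x\<in>G. ins (us @ x # vs) ns = us' @ x # vs'"
  using assms(1)
proof (induction us arbitrary: ns)
  case Nil
  show ?case
  proof (cases vs)
    case Nil
    then show ?thesis by (intro exI[of _ "[]"]) simp
  next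
    case (Cons y t)
    then obtain n ms where ns: "ns = n # ms" using Nil.prems by (cases ns) auto
    show ?thesis
    proof (cases "G = {}")
      case False
      then obtain x where x: "x \<in> G" by blast
      have "\<forall>z\<in>G. ins ([] @ z # vs) ns = [] @ z # replicate n (D x) @ ins (y # t) ms"
      proof
        fix z assume "z \<in> G"
        then show "ins ([] @ z # vs) ns = [] @ z # replicate n (D x) @ ins (y # t) ms"
          using assms(2)[OF _ x, of z] by (simp add: Cons ns)
      qed
      then show ?thesis by (intro exI)
    qed simp
  qed
next
  case (Cons u us)
  then obtain n ms where ns: "ns = n # ms" "length ms = length us + length vs" by (cases ns) auto
  obtain us' vs' where IH: "\<forall>x\<in>G. ins (us @ x # vs) ms = us' @ x # vs'" using Cons.IH[OF ns(2)] by blast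
  have "ins (u # us @ x # vs) (n # ms) = u # replicate n (D u) @ ins (us @ x # vs) ms" for x
    by (cases us) simp_all
  then have "\<forall>x\<in>G. ins ((u # us) @ x # vs) ns = (u # replicate n (D u) @ us') @ x # vs'" using IH ns(1) by simp
  then show ?case by blast
qed

lemma ins_block:
  "length ns = length f - 1 \<Longrightarrow> u < length ns \<Longrightarrow> \<exists>us vs. ins f ns = us @ replicate (ns ! u) (D (f ! u)) @ vs"
proof (induction f ns arbitrary: u rule: ins.induct)
  case (1 x y t n ns)
  show ?case
  proof (cases u)
    case 0
    then have "ins (x # y # t) (n # ns) = [x] @ replicate ((n # ns) ! u) (D ((x # y # t) ! u)) @ ins (y # t) ns" by simp
    then show ?thesis by blast
  next
    case (Suc k)
    then obtain us vs where "ins (y # t) ns = us @ replicate (ns ! k) (D ((y # t) ! k)) @ vs" using 1 by force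
    then have "ins (x # y # t) (n # ns) = (x # replicate n (D x) @ us) @ replicate ((n # ns) ! u) (D ((x # y # t) ! u)) @ vs"
      using Suc by simp
    then show ?thesis by blast
  qed
qed simp_all

text \<open>The product of \<open>n\<close> and \<open>k\<close> is the mixed term that the
  recursion of \<open>X\<close> charges to the continuation.\<close>

lemma choose_add: "int (n + k + 1 choose 2) = int (n + 1 choose 2) + int (k + 1 choose 2) + int n * int k"
proof (induction n)
  case (Suc n)
  have "int (Suc n + k + 1 choose 2) = int (n + k + 1 choose 2) + int (n + k) + 1"
    using choose_2_Suc[of "n + k"] by simp
  then show ?case using Suc choose_2_Suc[of n] by (simp add: algebra_simps)
qed (simp add: numeral_2_eq_2)

lemma esgn_eq:
  "f \<noteq> [] \<Longrightarrow> length ns = length f - 1 \<Longrightarrow> esgn f ns = int (sum_list ns + 1 choose 2) +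
    (\<Sum>u<length f - 1. int (length f - 2 - u) * int (ns ! u)) +
    (\<Sum>u<length f - 1. \<Sum>v\<in>{u..<length f - 1}. dg (f ! u) * int (ns ! v))"
proof (induction f ns rule: ins.induct)
  case (1 x y t n ns)
  let ?L = "length (y # t)"
  have l: "length ns = length t" using 1(3) by simp
  have a: "(\<Sum>u<?L. int (length (x # y # t) - 2 - u) * int ((n # ns) ! u)) =
    (int ?L - 1) * int n + (\<Sum>u<?L - 1. int (?L - 2 - u) * int (ns ! u))"
    by (simp add: sum.lessThan_Suc_shift del: sum.lessThan_Suc)
  have b: "(\<Sum>v\<in>{0..<?L}. dg x * int ((n # ns) ! v)) = dg x * int n + dg x * int (sum_list ns)"
    using l by (simp add: sum.atLeast0_lessThan_Suc_shift sum_list_sum_nth sum_distrib_left del: sum.op_ivl_Suc)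
  have c: "(\<Sum>u<?L. \<Sum>v\<in>{u..<?L}. dg ((x # y # t) ! u) * int ((n # ns) ! v)) =
    dg x * int n + dg x * int (sum_list ns) + (\<Sum>u<?L - 1. \<Sum>v\<in>{u..<?L - 1}. dg ((y # t) ! u) * int (ns ! v))"
  proof -
    have s: "(\<Sum>v\<in>{Suc u..<Suc k}. h v) = (\<Sum>v\<in>{u..<k}. h (Suc v))" for u k and h :: "nat \<Rightarrow> int"
      by (rule sum.shift_bounds_Suc_ivl)
    have "(\<Sum>u<?L. \<Sum>v\<in>{u..<?L}. dg ((x # y # t) ! u) * int ((n # ns) ! v)) =
      (\<Sum>v\<in>{0..<?L}. dg x * int ((n # ns) ! v)) +
      (\<Sum>u<length t. \<Sum>v\<in>{Suc u..<Suc (length t)}. dg ((y # t) ! u) * int ((n # ns) ! v))"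
      by (simp only: list.size(4) add_0_right add_Suc_right sum.lessThan_Suc_shift nth_Cons_0 nth_Cons_Suc One_nat_def)
    then show ?thesis unfolding b s by simp
  qed
  have IH: "esgn (y # t) ns = int (sum_list ns + 1 choose 2) + (\<Sum>u<?L - 1. int (?L - 2 - u) * int (ns ! u)) +
    (\<Sum>u<?L - 1. \<Sum>v\<in>{u..<?L - 1}. dg ((y # t) ! u) * int (ns ! v))"
    using 1(1) l by simp
  have L: "length (x # y # t) - 1 = ?L" "sum_list (n # ns) = n + sum_list ns" by simp_all
  show ?case unfolding esgn.simps L a c IH choose_add by (simp only: distrib_right ring_distribs add_ac)
qed simp_all

end

context cplx_cat
begin

lemma insert_deltas_eq:
  "fs \<noteq> [] \<Longrightarrow> length ns = length fs - 1 \<Longrightarrow> insert_deltas fs ns = wd.ins fs ns"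
proof (induction fs ns rule: wd.ins.induct)
  case (1 x y t n ns)
  have u: "[0..<length (x # y # t) - 1] = 0 # map Suc [0..<length (y # t) - 1]"
    by (simp add: upt_conv_Cons map_Suc_upt del: upt_Suc)
  have "insert_deltas (x # y # t) (n # ns) = x # replicate n (delta (src x)) @ insert_deltas (y # t) ns"
    unfolding insert_deltas_def u by (simp add: comp_def del: upt_Suc)
  then show ?case using 1 by simp
qed (auto simp: insert_deltas_def length_Suc_conv le_Suc_eq)

lemma Xi_sign_eq:
  assumes "2 \<le> length fs" "length ns = length fs - 1"
  shows "Xi_sign fs ns = wd.esgn fs ns"
proof -
  have r: "{u..length fs - 2} = {u..<length fs - 1}" for u
    using assms(1) by auto
  have ne: "fs \<noteq> []" using assms(1) by auto
  show ?thesis unfolding wd.esgn_eq[OF ne assms(2)] Xi_sign_def Let_def r atLeast0LessThan ..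
qed

text \<open>Each inserted differential has degree one and takes up one place, so degree minus
  length, and with it the bar degree, is unchanged.\<close>

lemma ins_props:
  assumes "f \<noteq> []" "length ns = length f - 1" "\<forall>x\<in>set f. dg.arr x" "successively (\<lambda>f g. src f = tgt g \<and> src f \<in> Ob) f"
  shows "wd.ins f ns \<noteq> [] \<and> (\<forall>x\<in>set (wd.ins f ns). dg.arr x) \<and> successively (\<lambda>f g. src f = tgt g \<and> src f \<in> Ob) (wd.ins f ns) \<and>
    tgt (hd (wd.ins f ns)) = tgt (hd f) \<and> src (last (wd.ins f ns)) = src (last f) \<and>
    sum_list (map deg (wd.ins f ns)) - int (length (wd.ins f ns)) = sum_list (map deg f) - int (length f) \<and>
    src ` set (wd.ins f ns) \<subseteq> src ` set f"
  using assms
proof (induction f ns rule: wd.ins.induct)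
  case (1 x y t n ns)
  let ?w = "wd.ins (y # t) ns"
  have IH: "?w \<noteq> []" "\<forall>x\<in>set ?w. dg.arr x" "successively (\<lambda>f g. src f = tgt g \<and> src f \<in> Ob) ?w"
    "tgt (hd ?w) = tgt y" "src (last ?w) = src (last (y # t))"
    "sum_list (map deg ?w) - int (length ?w) = sum_list (map deg (y # t)) - int (length (y # t))"
    "src ` set ?w \<subseteq> src ` set (y # t)"
    using 1 by simp_all
  have x: "dg.arr x" "src x = tgt y" "src x \<in> Ob" using 1(4,5) by auto
  have d: "dg.arr (delta (src x))" using dg.arrI[OF x(3) x(3) delta_closed[OF x(3)]] .
  have ds: "src (delta Y) = Y" "tgt (delta Y) = Y" "deg (delta Y) = 1" for Y :: "('o,'m) cplx" by (simp_all add: delta_def)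
  have s: "src z = src x \<Longrightarrow> successively (\<lambda>f g. src f = tgt g \<and> src f \<in> Ob) (z # replicate k (delta (src x)) @ ?w)" for z k
  proof (induction k arbitrary: z)
    case 0
    then show ?case using IH(1,3,4) x by (cases ?w) simp_all
  next
    case (Suc k)
    then show ?case using x(3) Suc.IH[of "delta (src x)"] by (simp add: ds)
  qed
  have sm: "sum_list (map deg (replicate k (delta Y))) = int k" for k and Y :: "('o,'m) cplx" by (induction k) (simp_all add: ds)
  have r: "src ` set (replicate n (delta (src x))) \<subseteq> {src x}" by (auto simp: ds)
  show ?case using IH s[OF refl, of n] x d r
    by (simp add: sm) (auto simp: ds sum_list_replicate)
qed simp_all

lemma ins_Sym:
  assumes fs: "fs \<in> Bf.Sym X X' n" and l: "length ns = length fs - 1"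
  shows "wd.ins fs ns \<in> Bf.Sym X X' n" "src ` set (wd.ins fs ns) \<subseteq> src ` set fs" "2 \<le> length (wd.ins fs ns)"
proof -
  note S = fs[unfolded Bf.Sym_iff]
  note S2 = S[THEN conjunct2] note S3 = S2[THEN conjunct2] note S4 = S3[THEN conjunct2] note S5 = S4[THEN conjunct2]
  have l2: "2 \<le> length fs" by (rule S[THEN conjunct1])
  then have ne: "fs \<noteq> []" by auto
  note p = ins_props[OF ne l S2[THEN conjunct1] S3[THEN conjunct1]]
  note p2 = p[THEN conjunct2] note p3 = p2[THEN conjunct2] note p4 = p3[THEN conjunct2]
  note p5 = p4[THEN conjunct2] note p6 = p5[THEN conjunct2]
  show le: "2 \<le> length (wd.ins fs ns)" using wd.length_ins[OF l] l2 by simp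
  show "src ` set (wd.ins fs ns) \<subseteq> src ` set fs" by (rule p6[THEN conjunct2])
  show "wd.ins fs ns \<in> Bf.Sym X X' n" unfolding Bf.Sym_iff
  proof (intro conjI le)
    show "\<forall>f\<in>set (wd.ins fs ns). dg.arr f" "successively (\<lambda>f g. src f = tgt g \<and> src f \<in> Ob) (wd.ins fs ns)"
      by (rule p2[THEN conjunct1], rule p3[THEN conjunct1])
    have "tgt (hd (wd.ins fs ns)) = tgt (hd fs)" "src (last (wd.ins fs ns)) = src (last fs)"
      by (rule p4[THEN conjunct1], rule p5[THEN conjunct1])
    then show "tgt (hd (wd.ins fs ns)) = X" "src (last (wd.ins fs ns)) = X'"
      using S4[THEN conjunct1] S5[THEN conjunct1] by simp_all
    have "sum_list (map deg (wd.ins fs ns)) - int (length (wd.ins fs ns)) = sum_list (map deg fs) - int (length fs)" by (rule p6[THEN conjunct1])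
    then show "sum_list (map deg (wd.ins fs ns)) - (int (length (wd.ins fs ns)) - 2) = n" using S5[THEN conjunct2] by simp
  qed
qed

definition Xi_el :: "('o,'m) cplx \<Rightarrow> ('o,'m) cplx \<Rightarrow> int \<Rightarrow> (('o,'m) cplx,int \<Rightarrow> 'm) harr list \<Rightarrow>
    ((('o,'m) cplx,int \<Rightarrow> 'm) harr list \<Rightarrow> 'k) set" where
  "Xi_el X X' n fs = fin_supp_sum (R.BM X X' n) (\<lambda>(ns, as). signed (R.BM X X' n) (Xi_sign fs ns)
     (R.el X X' n (cut A (insert_deltas fs ns) as))) (Xi_index fs)"

lemma Xi_eq: "Xi K A X X' n = lin_ext K (R.BM X X' n) (Xi_el X X' n)"
  by (simp add: Xi_def Xi_el_def[abs_def] rel_Bar_Chb_def rel_Bar_def Let_def)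

definition NS :: "nat \<Rightarrow> nat \<Rightarrow> nat list set" where
  "NS B l = {ns. set ns \<subseteq> {..<B} \<and> length ns = l - 1}"

lemma finite_NS: "finite (NS B l)"
  unfolding NS_def by (rule finite_lists_length_eq) simp

text \<open>A block of length at least \<open>B\<close> contributes only zero cuts by
  \<open>el_cut_replicate\<close>, so the unbounded index set shrinks to a finite one. The value is
  the same for every admissible \<open>B\<close>, which allows one bound for several
  symbols.\<close>

lemma Xi_el_eq:
  assumes fs: "fs \<in> Bf.Sym X X' n" and B: "\<And>Y. Y \<in> src ` set fs \<Longrightarrow> card (supp Y) + 1 < B"
  shows "Xi_el X X' n fs = finsum (R.BM X X' n) (\<lambda>ns. signed (R.BM X X' n) (wd.esgn fs ns) (Cut X X' n (wd.ins fs ns))) (NS B (length fs))"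
proof -
  let ?P = "R.BM X X' n"
  interpret P: module K ?P by (rule R.BM_module)
  have l2: "2 \<le> length fs" by (rule Bf_nth(6)[OF fs])
  then have ne: "fs \<noteq> []" by auto
  let ?N = "NS B (length fs)"
  define tt where "tt = (\<lambda>(ns, as). signed ?P (Xi_sign fs ns) (R.el X X' n (cut A (insert_deltas fs ns) as)))"
  define uu where "uu x = signed ?P (wd.esgn fs (fst x)) (R.el X X' n (cut A (wd.ins fs (fst x)) (snd x)))" for x
  have I: "x \<in> Xi_index fs \<longleftrightarrow> length (fst x) = length fs - 1 \<and> snd x \<in> idx (wd.ins fs (fst x))" for x
    using insert_deltas_eq[OF ne, of "fst x"] by (cases x) (auto simp: Xi_index_def idx_def)
  have tu: "tt x = uu x" if "x \<in> Xi_index fs" for x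
    using that insert_deltas_eq[OF ne, of "fst x"] Xi_sign_eq[OF l2, of "fst x"] unfolding I by (cases x) (simp add: tt_def uu_def)
  have S: "Sigma ?N (\<lambda>ns. idx (wd.ins fs ns)) \<subseteq> Xi_index fs" unfolding NS_def by (auto simp: I)
  have z: "tt x = \<zero>\<^bsub>?P\<^esub>" if x: "x \<in> Xi_index fs" "x \<notin> Sigma ?N (\<lambda>ns. idx (wd.ins fs ns))" for x
  proof -
    obtain ns as where xe: "x = (ns, as)" by (cases x)
    have l: "length ns = length fs - 1" and as: "as \<in> idx (wd.ins fs ns)" using x(1) unfolding I xe by simp_all
    have "ns \<notin> ?N" using x(2) as unfolding xe by blast
    then have "\<not> set ns \<subseteq> {..<B}" using l unfolding NS_def by blast
    then obtain u where u: "u < length ns" "B \<le> ns ! u" by (force simp: in_set_conv_nth)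
    obtain us vs where e: "wd.ins fs ns = us @ replicate (ns ! u) (delta (src (fs ! u))) @ vs"
      using wd.ins_block[OF l u(1)] by blast
    have "fs ! u \<in> set fs" using u(1) l by simp
    then have b: "card (supp (src (fs ! u))) + 1 < ns ! u" using B[OF imageI] u(2) by (meson less_le_trans)
    have "R.el X X' n (cut A (wd.ins fs ns) as) = \<zero>\<^bsub>?P\<^esub>"
      unfolding e by (rule el_cut_replicate[OF ins_Sym(1)[OF fs l, unfolded e] b as[unfolded e]])
    then show ?thesis unfolding tu[OF x(1)] unfolding xe uu_def by (simp add: signed_zero[OF P.module_axioms])
  qed
  have uc: "uu x \<in> carrier ?P" if "x \<in> Sigma ?N (\<lambda>ns. idx (wd.ins fs ns))" for x
  proof -
    have l: "length (fst x) = length fs - 1" and as: "snd x \<in> idx (wd.ins fs (fst x))" using that by (auto simp: NS_def)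
    show ?thesis unfolding uu_def
      by (rule signed_closed[OF P.module_axioms funcset_mem[OF el_cut_closed[OF ins_Sym(1)[OF fs l]] as]])
  qed
  have fin: "finite (idx (wd.ins fs ns))" if "ns \<in> ?N" for ns
    using that finite_idx[OF ins_Sym(1)[OF fs]] unfolding NS_def by blast
  have sub: "{x \<in> Xi_index fs. tt x \<noteq> \<zero>\<^bsub>?P\<^esub>} \<subseteq> Sigma ?N (\<lambda>ns. idx (wd.ins fs ns))" using z by blast
  have "Xi_el X X' n fs = finsum ?P tt {x \<in> Xi_index fs. tt x \<noteq> \<zero>\<^bsub>?P\<^esub>}"
    by (simp add: Xi_el_def fin_supp_sum_def tt_def)
  also have "\<dots> = finsum ?P uu (Sigma ?N (\<lambda>ns. idx (wd.ins fs ns)))"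
  proof (rule P.M.add.finprod_mono_neutral_cong_left)
    show "finite (Sigma ?N (\<lambda>ns. idx (wd.ins fs ns)))" by (intro finite_SigmaI finite_NS fin)
    show "uu i = \<zero>\<^bsub>?P\<^esub>" if "i \<in> Sigma ?N (\<lambda>ns. idx (wd.ins fs ns)) - {x \<in> Xi_index fs. tt x \<noteq> \<zero>\<^bsub>?P\<^esub>}" for i
    proof -
      have i: "i \<in> Xi_index fs" by (rule subsetD[OF S DiffD1[OF that]])
      have "tt i = \<zero>\<^bsub>?P\<^esub>"
      proof (rule ccontr)
        assume "tt i \<noteq> \<zero>\<^bsub>?P\<^esub>"
        with i have "i \<in> {x \<in> Xi_index fs. tt x \<noteq> \<zero>\<^bsub>?P\<^esub>}" by (intro CollectI conjI)
        then show False by (rule DiffD2[OF that])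
      qed
      then show ?thesis using tu[OF i] by simp
    qed
    show "{x \<in> Xi_index fs. tt x \<noteq> \<zero>\<^bsub>?P\<^esub>} \<subseteq> Sigma ?N (\<lambda>ns. idx (wd.ins fs ns))" by (rule sub)
    show "tt x = uu x" if "x \<in> {x \<in> Xi_index fs. tt x \<noteq> \<zero>\<^bsub>?P\<^esub>}" for x by (rule tu) (use that in \<open>elim CollectE conjE\<close>)
    show "uu \<in> Sigma ?N (\<lambda>ns. idx (wd.ins fs ns)) \<rightarrow> carrier ?P" by (intro Pi_I uc)
  qed
  also have "\<dots> = finsum ?P (\<lambda>ns. finsum ?P (\<lambda>as. uu (ns, as)) (idx (wd.ins fs ns))) ?N"
    by (rule P.M.finsum_Sigma[OF finite_NS fin]) (assumption, rule uc, rule SigmaI)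
  also have "\<dots> = finsum ?P (\<lambda>ns. signed ?P (wd.esgn fs ns) (Cut X X' n (wd.ins fs ns))) ?N"
  proof (rule P.M.finsum_cong'[OF refl])
    have l: "length ns = length fs - 1" if "ns \<in> ?N" for ns using that by (simp add: NS_def)
    show "(\<lambda>ns. signed ?P (wd.esgn fs ns) (Cut X X' n (wd.ins fs ns))) \<in> ?N \<rightarrow> carrier ?P"
      using signed_closed[OF P.module_axioms Cut_closed[OF ins_Sym(1)[OF fs l]]] by blast
    fix ns assume ns: "ns \<in> ?N"
    show "finsum ?P (\<lambda>as. uu (ns, as)) (idx (wd.ins fs ns)) = signed ?P (wd.esgn fs ns) (Cut X X' n (wd.ins fs ns))"
      unfolding Cut_def uu_def fst_conv snd_conv
      by (rule signed_finsum[OF P.module_axioms el_cut_closed[OF ins_Sym(1)[OF fs l[OF ns]]], symmetric])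
  qed
  finally show ?thesis .
qed

lemma esgn_shape: 
  assumes "shape f = shape g" "f \<noteq> []" "length ns = length f - 1"
  shows "wd.esgn f ns = wd.esgn g ns"
proof -
  have l: "length f = length g" by (rule shape_length[OF assms(1)])
  then have g: "g \<noteq> []" "length ns = length g - 1" using assms by auto
  have "deg (f ! u) = deg (g ! u)" if "u < length g - 1" for u using shape_nth(3)[OF assms(1), of u] that l by simp
  then show ?thesis unfolding wd.esgn_eq[OF assms(2,3)] wd.esgn_eq[OF g] l by simp
qed

lemma Xi_el_multilinear: "Bf.multilinear X X' n (R.BM X X' n) (Xi_el X X' n)"
proof (rule Bf.multilinearI)
  let ?P = "R.BM X X' n"
  interpret P: module K ?P by (rule R.BM_module)
  \<comment> \<open>A bound that depends on the set of sources only, hence is the same for all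
    fillings of a slot.\<close>
  define Bd where "Bd fs = Suc (\<Sum>Y\<in>src ` set fs. card (supp Y) + 2)" for fs :: "(('o,'m) cplx,int \<Rightarrow> 'm) harr list"
  have Bd: "card (supp Y) + 1 < Bd fs" if "Y \<in> src ` set fs" for Y fs
  proof -
    have "card (supp Y) + 2 \<le> (\<Sum>Y\<in>src ` set fs. card (supp Y) + 2)" by (rule member_le_sum[OF that]) simp_all
    then show ?thesis by (simp add: Bd_def)
  qed
  show "Xi_el X X' n fs \<in> carrier ?P" if fs: "fs \<in> Bf.Sym X X' n" for fs
  proof -
    have e: "Xi_el X X' n fs = finsum ?P (\<lambda>ns. signed ?P (wd.esgn fs ns) (Cut X X' n (wd.ins fs ns))) (NS (Bd fs) (length fs))"
      by (rule Xi_el_eq[OF fs]) (rule Bd)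
    show ?thesis unfolding e
    proof (intro P.M.finsum_closed Pi_I signed_closed[OF P.module_axioms] Cut_closed ins_Sym(1)[OF fs])
      fix ns assume "ns \<in> NS (Bd fs) (length fs)"
      then show "length ns = length fs - 1" by (simp add: NS_def)
    qed
  qed
  fix us vs Y Z k f
  assume f: "f \<in> carrier (HC Y Z k)" "us @ f # vs \<in> Bf.Sym X X' n" "module K (HC Y Z k)"
    and r: "\<And>g. g \<in> carrier (HC Y Z k) \<Longrightarrow> us @ g # vs \<in> Bf.Sym X X' n"
    and sh: "\<And>g. g \<in> carrier (HC Y Z k) \<Longrightarrow> shape (us @ g # vs) = shape (us @ f # vs)"
  let ?fs = "us @ f # vs"
  have sg: "src g = Y" if "g \<in> carrier (HC Y Z k)" for g using that by (simp add: HC_iff)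
  show "(\<lambda>g. Xi_el X X' n (us @ g # vs)) \<in> linear_maps K (HC Y Z k) ?P"
  proof (rule linear_maps_cong[OF linear_maps_finsum[OF f(3) P.module_axioms] f(3)])
    fix g assume g: "g \<in> carrier (HC Y Z k)"
    have "src ` set (us @ g # vs) = src ` set ?fs" using sg[OF g] sg[OF f(1)] by simp
    then have b: "card (supp Y) + 1 < Bd ?fs" if "Y \<in> src ` set (us @ g # vs)" for Y using Bd that by simp
    have lg: "length (us @ g # vs) = length ?fs" by simp
    show "Xi_el X X' n (us @ g # vs) = finsum ?P (\<lambda>ns. signed ?P (wd.esgn (us @ g # vs) ns) (Cut X X' n (wd.ins (us @ g # vs) ns))) (NS (Bd ?fs) (length ?fs))"
      unfolding lg[symmetric] by (rule Xi_el_eq[OF r[OF g] b])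
  next
    fix ns assume "ns \<in> NS (Bd ?fs) (length ?fs)"
    then have l: "length ns = length us + length vs" by (simp add: NS_def)
    have "\<exists>us' vs'. \<forall>x\<in>carrier (HC Y Z k). wd.ins (us @ x # vs) ns = us' @ x # vs'"
      by (rule wd.ins_slot[OF l]) (simp add: sg)
    then obtain us' vs' where i: "\<And>x. x \<in> carrier (HC Y Z k) \<Longrightarrow> wd.ins (us @ x # vs) ns = us' @ x # vs'" by blast
    have S: "us' @ f # vs' \<in> Bf.Sym X X' n" using ins_Sym(1)[OF f(2), of ns] i[OF f(1)] l by simp
    show "(\<lambda>g. signed ?P (wd.esgn (us @ g # vs) ns) (Cut X X' n (wd.ins (us @ g # vs) ns))) \<in> linear_maps K (HC Y Z k) ?P"
    proof (rule linear_maps_cong[OF linear_maps_signed[OF P.module_axioms Bf.multilinear_linear[OF Cut_multilinear S f(1)]] f(3)])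
      fix x assume x: "x \<in> carrier (HC Y Z k)"
      have "wd.esgn (us @ x # vs) ns = wd.esgn ?fs ns"
        by (rule esgn_shape[OF sh[OF x]]) (simp_all add: l)
      then show "signed ?P (wd.esgn (us @ x # vs) ns) (Cut X X' n (wd.ins (us @ x # vs) ns)) =
        signed ?P (wd.esgn ?fs ns) (Cut X X' n (us' @ x # vs'))"
        by (simp only: i[OF x])
    qed
  qed
qed

end

section \<open>Formal sums of words evaluated in the relative bar module\<close>

locale Xi_symbol = cplx_cat K A for K :: "'k ring" and A :: "('k,'o,'m) lincat" +
  fixes X X' n fs and E :: "('o,'m) cplx set"
  assumes fs: "fs \<in> Bf.Sym X X' n" and finite_E: "finite E"
begin

text \<open>The sources that letters may have in words derived from \<open>fs\<close>. The extra set
  \<open>E\<close> makes room for the new source created by the right action.\<close>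

definition \<Omega> :: "('o,'m) cplx set" where "\<Omega> = src ` set fs \<union> E"
definition b :: nat where "b = (\<Sum>Y\<in>\<Omega>. card (supp Y) + 2)"

lemma card_b: "Y \<in> \<Omega> \<Longrightarrow> card (supp Y) + 1 < b"
proof -
  assume Y: "Y \<in> \<Omega>"
  have "finite \<Omega>" by (simp add: \<Omega>_def finite_E)
  then have "card (supp Y) + 2 \<le> b" unfolding b_def using member_le_sum[OF Y, of "\<lambda>Y. card (supp Y) + 2"] by simp
  then show ?thesis by simp
qed

text \<open>Words that are not symbols, or that have a source outside \<open>\<Omega>\<close>, are
  sent to zero: \<open>lin_comb\<close> asks for a value in the carrier for every word, and the
  block bound \<open>b\<close> is computed from the sources in \<open>\<Omega>\<close>.\<close>

definition CW where
  "CW Z Z' k w = (if w \<in> Bf.Sym Z Z' k \<and> src ` set w \<subseteq> \<Omega> then Cut Z Z' k w else \<zero>\<^bsub>R.BM Z Z' k\<^esub>)"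

text \<open>A basis word is replaced by zero as soon as its value vanishes. The hypotheses of
  \<open>X_mu\<close> on squares and long blocks then hold in the free abelian group itself, and the
  evaluation is unaffected.\<close>

definition cw :: "('o,'m) cplx \<Rightarrow> ('o,'m) cplx \<Rightarrow> int \<Rightarrow> (('o,'m) cplx,int \<Rightarrow> 'm) harr list \<Rightarrow>
    ((('o,'m) cplx,int \<Rightarrow> 'm) harr list \<Rightarrow>\<^sub>0 int)" where
  "cw Z Z' k w = (if CW Z Z' k w = \<zero>\<^bsub>R.BM Z Z' k\<^esub> then 0 else Poly_Mapping.single w 1)"

abbreviation "lc Z Z' k \<equiv> lin_comb (R.BM Z Z' k) (CW Z Z' k)"

lemma CW_closed: "CW Z Z' k w \<in> carrier (R.BM Z Z' k)"
proof -
  interpret P: module K "R.BM Z Z' k" by (rule R.BM_module)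
  show ?thesis unfolding CW_def using Cut_closed by simp
qed

lemma lc_add: "lc Z Z' k (p + q) = lc Z Z' k p \<oplus>\<^bsub>R.BM Z Z' k\<^esub> lc Z Z' k q"
  by (rule lin_comb_add[OF R.BM_module CW_closed])

lemma lc_sgm: "lc Z Z' k (sgm e p) = signed (R.BM Z Z' k) e (lc Z Z' k p)"
  by (rule lin_comb_sgm[OF R.BM_module CW_closed])

lemma lc_sum: "finite I \<Longrightarrow> lc Z Z' k (sum f I) = finsum (R.BM Z Z' k) (\<lambda>i. lc Z Z' k (f i)) I"
  by (rule lin_comb_sum[OF R.BM_module CW_closed])

lemma lc_zero: "lc Z Z' k 0 = \<zero>\<^bsub>R.BM Z Z' k\<^esub>"
  by (rule lin_comb_zero[OF R.BM_module CW_closed])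

lemma lc_closed: "lc Z Z' k p \<in> carrier (R.BM Z Z' k)"
  by (rule lin_comb_closed[OF R.BM_module CW_closed])

lemma lc_single: "lc Z Z' k (Poly_Mapping.single w 1) = CW Z Z' k w"
  by (rule lin_comb_single[OF R.BM_module CW_closed])

lemma lc_cw: "lc Z Z' k (cw Z Z' k w) = CW Z Z' k w"
  by (simp add: cw_def lc_zero lc_single)

lemma cw_delta_sq: "cw Z Z' k (us @ gComp (Chb A) (delta (src z)) (delta (src z)) # vs) = 0"
  unfolding cw_def CW_def using Cut_delta_sq by simp

lemma cw_replicate: "cw Z Z' k (us @ replicate b (delta (src z)) @ vs) = 0"
proof -
  let ?w = "us @ replicate b (delta (src z)) @ vs"
  have "Cut Z Z' k ?w = \<zero>\<^bsub>R.BM Z Z' k\<^esub>" if w: "?w \<in> Bf.Sym Z Z' k" "src ` set ?w \<subseteq> \<Omega>"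
  proof (rule Cut_replicate[OF w(1) card_b])
    have "fs \<noteq> []" using Bf_nth(6)[OF fs] by auto
    then obtain Y where "Y \<in> \<Omega>" unfolding \<Omega>_def by (cases fs) auto
    then have "0 < b" using card_b by fastforce
    then have "src (delta (src z)) \<in> src ` set ?w" by (intro imageI) simp
    then show "src z \<in> \<Omega>" using w(2) by (auto simp: delta_def)
  qed
  then show ?thesis unfolding cw_def CW_def by simp
qed

lemma CW_ins:
  assumes "f \<in> Bf.Sym Z Z' k" "src ` set f \<subseteq> \<Omega>" "length ns = length f - 1"
  shows "CW Z Z' k (wd.ins f ns) = Cut Z Z' k (wd.ins f ns)"
proof -
  have "src ` set (wd.ins f ns) \<subseteq> \<Omega>" by (rule order_trans[OF ins_Sym(2)[OF assms(1,3)] assms(2)])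
  then show ?thesis using ins_Sym(1)[OF assms(1,3)] by (simp add: CW_def)
qed

lemma lc_X:
  assumes "f \<noteq> []"
  shows "lc Z Z' k (wd.X B c f) = finsum (R.BM Z Z' k) (\<lambda>ns. signed (R.BM Z Z' k) (wd.esgn f ns) (lc Z Z' k (c (wd.ins f ns)))) (NS B (length f))"
  unfolding wd.X_expand[OF assms] NS_def[symmetric] lc_sum[OF finite_NS] lc_sgm ..

lemma Xi_el_lc:
  assumes f: "f \<in> Bf.Sym Z Z' k" "src ` set f \<subseteq> \<Omega>"
  shows "Xi_el Z Z' k f = lc Z Z' k (wd.X (Suc b) (cw Z Z' k) f)"
proof -
  let ?P = "R.BM Z Z' k"
  interpret P: module K ?P by (rule R.BM_module)
  have ne: "f \<noteq> []" using Bf_nth(6)[OF f(1)] by auto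
  have B: "card (supp Y) + 1 < Suc b" if "Y \<in> src ` set f" for Y
    by (rule less_SucI[OF card_b[OF subsetD[OF f(2) that]]])
  have e: "Xi_el Z Z' k f = finsum ?P (\<lambda>ns. signed ?P (wd.esgn f ns) (Cut Z Z' k (wd.ins f ns))) (NS (Suc b) (length f))"
    by (rule Xi_el_eq[OF f(1)]) (rule B)
  show ?thesis unfolding lc_X[OF ne] lc_cw e
  proof (rule P.M.finsum_cong'[OF refl])
    show "(\<lambda>ns. signed ?P (wd.esgn f ns) (CW Z Z' k (wd.ins f ns))) \<in> NS (Suc b) (length f) \<rightarrow> carrier ?P"
      by (intro Pi_I signed_closed[OF P.module_axioms] CW_closed)
    fix ns assume "ns \<in> NS (Suc b) (length f)"
    then have "length ns = length f - 1" by (simp add: NS_def)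
    then show "signed ?P (wd.esgn f ns) (Cut Z Z' k (wd.ins f ns)) = signed ?P (wd.esgn f ns) (CW Z Z' k (wd.ins f ns))"
      by (simp only: CW_ins[OF f])
  qed
qed

lemma sub_\<Omega>: "src ` set fs \<subseteq> \<Omega>"
  by (simp add: \<Omega>_def)

text \<open>A linear operation known on the sum of cuts of each word passes to \<open>Xi_el\<close>
  by a change of continuation in \<open>X\<close>; the remaining combinatorics concerns
  continuations only.\<close>

lemma transfer:
  assumes L: "L \<in> linear_maps K (R.BM X X' n) (R.BM Z Z' k)"
    and c: "\<And>w. w \<in> Bf.Sym X X' n \<Longrightarrow> src ` set w \<subseteq> \<Omega> \<Longrightarrow> L (Cut X X' n w) = lc Z Z' k (c w)"
  shows "L (Xi_el X X' n fs) = lc Z Z' k (wd.X (Suc b) c fs)"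
proof -
  let ?P = "R.BM X X' n" and ?Q = "R.BM Z Z' k"
  interpret P: module K ?P by (rule R.BM_module)
  interpret Q: module K ?Q by (rule R.BM_module)
  have ne: "fs \<noteq> []" using Bf_nth(6)[OF fs] by auto
  have cl: "(\<lambda>ns. signed ?P (wd.esgn fs ns) (CW X X' n (wd.ins fs ns))) \<in> NS (Suc b) (length fs) \<rightarrow> carrier ?P"
    by (intro Pi_I signed_closed[OF P.module_axioms] CW_closed)
  have "L (Xi_el X X' n fs) = finsum ?Q (\<lambda>ns. L (signed ?P (wd.esgn fs ns) (CW X X' n (wd.ins fs ns)))) (NS (Suc b) (length fs))"
    unfolding Xi_el_lc[OF fs sub_\<Omega>] lc_X[OF ne] lc_cw
    by (rule linear_map_finsum[OF P.module_axioms Q.module_axioms L cl])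
  also have "\<dots> = lc Z Z' k (wd.X (Suc b) c fs)" unfolding lc_X[OF ne]
  proof (rule Q.M.finsum_cong'[OF refl])
    show "(\<lambda>ns. signed ?Q (wd.esgn fs ns) (lc Z Z' k (c (wd.ins fs ns)))) \<in> NS (Suc b) (length fs) \<rightarrow> carrier ?Q"
      by (intro Pi_I signed_closed[OF Q.module_axioms] lc_closed)
    fix ns assume "ns \<in> NS (Suc b) (length fs)"
    then have l: "length ns = length fs - 1" by (simp add: NS_def)
    have "src ` set (wd.ins fs ns) \<subseteq> \<Omega>" by (rule order_trans[OF ins_Sym(2)[OF fs l] sub_\<Omega>])
    then have "L (CW X X' n (wd.ins fs ns)) = lc Z Z' k (c (wd.ins fs ns))"
      unfolding CW_ins[OF fs sub_\<Omega> l] by (rule c[OF ins_Sym(1)[OF fs l]])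
    then show "L (signed ?P (wd.esgn fs ns) (CW X X' n (wd.ins fs ns))) = signed ?Q (wd.esgn fs ns) (lc Z Z' k (c (wd.ins fs ns)))"
      by (simp only: linear_map_signed[OF P.module_axioms Q.module_axioms L CW_closed])
  qed
  finally show ?thesis .
qed

lemma CW_Cut: "w \<in> Bf.Sym Z Z' k \<Longrightarrow> src ` set w \<subseteq> \<Omega> \<Longrightarrow> lc Z Z' k (cw Z Z' k w) = Cut Z Z' k w"
  unfolding lc_cw by (simp add: CW_def)

lemma left_src: 
  assumes "w \<in> Bf.Sym X X' n" "src ` set w \<subseteq> \<Omega>"
  shows "src ` set (gComp (Chb A) f (hd w) # tl w) \<subseteq> \<Omega>"
proof -
  obtain a t where "w = a # t" using Bf_Cons[OF assms(1)] .
  then show ?thesis using assms(2) by (simp add: gComp_eq)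
qed

lemma last_src: "w \<in> Bf.Sym X X' n \<Longrightarrow> last w \<in> set w \<and> src (last w) = X'"
proof -
  assume w: "w \<in> Bf.Sym X X' n"
  then have "w \<noteq> []" using Bf_nth(6)[OF w] by auto
  then show ?thesis using Bf_nth(8)[OF w] by (simp add: last_conv_nth)
qed

lemma cw_short: "length w < 2 \<Longrightarrow> cw Z Z' k w = 0"
  using Bf_nth(6)[of w Z Z' k] by (auto simp: cw_def CW_def)

text \<open>This is \<open>X_head\<close> with the sign in the form used by the left action. The
  truncated subtraction in \<open>length w - 2\<close> does no harm, since words of fewer than two
  letters are evaluated to zero.\<close>

lemma X_head_cw:
  assumes "deg f = j"
  shows "wd.X B (\<lambda>w. sgm (int (length w - 2) * j) (cw Z Z' k (gComp (Chb A) f (hd w) # tl w))) fs =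
    sgm (int (length fs - 2) * j) (wd.X B (cw Z Z' k) (gComp (Chb A) f (hd fs) # tl fs))"
proof -
  obtain y t where yt: "fs = y # t" "t \<noteq> []" using Bf_Cons[OF fs] .
  let ?c = "cw Z Z' k"
  have "sgm (int (length (y # t) - 2) * j) (wd.X B ?c (gComp (Chb A) f y # t)) =
    wd.X B (\<lambda>w. sgm (int (length (y # t) - 2) * j)
      (sgm (deg f * (int (length w) - int (length (y # t)))) (?c (gComp (Chb A) f (hd w) # tl w)))) (y # t)"
    by (subst wd.X_head) (rule wd.X_sgm[symmetric])
  also have "\<dots> = wd.X B (\<lambda>w. sgm (int (length w - 2) * j) (?c (gComp (Chb A) f (hd w) # tl w))) (y # t)"
  proof (rule wd.X_cong)
    fix w :: "(('o,'m) cplx,int \<Rightarrow> 'm) harr list"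
    show "sgm (int (length (y # t) - 2) * j) (sgm (deg f * (int (length w) - int (length (y # t)))) (?c (gComp (Chb A) f (hd w) # tl w))) =
      sgm (int (length w - 2) * j) (?c (gComp (Chb A) f (hd w) # tl w))"
    proof (cases "2 \<le> length w")
      case True
      have e: "int (length w - 2) = int (length w) - 2" "int (length (y # t) - 2) = int (length (y # t)) - 2"
        using True yt(2) by (cases t; simp)+
      show ?thesis unfolding sgm_simps assms e by (rule sgm_cong) (simp add: algebra_simps)
    next
      case False
      then have "length (gComp (Chb A) f (hd w) # tl w) < 2" by simp
      then have "?c (gComp (Chb A) f (hd w) # tl w) = 0" by (rule cw_short)
      then show ?thesis by (simp add: sgm_simps)
    qed
  qed
  finally show ?thesis unfolding yt(1) list.sel by (rule sym)
qed

lemma Xi_left: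
  assumes f: "f \<in> carrier (HC X Z j)" "Z \<in> Ob"
  shows "signed (R.BM Z X' (j + n)) (int (length fs - 2) * j) (Xi_el Z X' (j + n) (gComp (Chb A) f (hd fs) # tl fs)) =
    lact RB f X' n (Xi_el X X' n fs)"
proof -
  have df: "deg f = j" using f(1) by (simp add: HC_iff)
  have "lact RB f X' n (Xi_el X X' n fs) = lc Z X' (j + n) (wd.X (Suc b)
      (\<lambda>w. sgm (int (length w - 2) * j) (cw Z X' (j + n) (gComp (Chb A) f (hd w) # tl w))) fs)"
  proof (rule transfer[OF R.lact_props(1)[OF f]])
    fix w assume w: "w \<in> Bf.Sym X X' n" "src ` set w \<subseteq> \<Omega>"
    show "lact RB f X' n (Cut X X' n w) = lc Z X' (j + n) (sgm (int (length w - 2) * j) (cw Z X' (j + n) (gComp (Chb A) f (hd w) # tl w)))"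
      unfolding lact_Cut[OF w(1) f] lc_sgm CW_Cut[OF Bf.Sym_left[OF w(1) f] left_src[OF w]] ..
  qed
  then show ?thesis
    unfolding X_head_cw[OF df] lc_sgm Xi_el_lc[OF Bf.Sym_left[OF fs f] left_src[OF fs sub_\<Omega>]] by (rule sym)
qed

lemma right_src:
  "w \<in> Bf.Sym X X' n \<Longrightarrow> src ` set w \<subseteq> \<Omega> \<Longrightarrow> src g \<in> \<Omega> \<Longrightarrow> src ` set (butlast w @ [gComp (Chb A) (last w) g]) \<subseteq> \<Omega>"
  by (auto simp: gComp_eq dest: in_set_butlastD)

lemma Xi_right:
  assumes g: "g \<in> carrier (HC Z X' m)" "Z \<in> Ob" and Z: "Z \<in> \<Omega>"
  shows "Xi_el X Z (n + m) (butlast fs @ [gComp (Chb A) (last fs) g]) = ract RB X n (Xi_el X X' n fs) g"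
proof -
  have sg: "src g \<in> \<Omega>" using g(1) Z by (simp add: HC_iff)
  have ne: "fs \<noteq> []" using Bf_nth(6)[OF fs] by auto
  have "ract RB X n (Xi_el X X' n fs) g = lc X Z (n + m) (wd.X (Suc b)
      (\<lambda>w. cw X Z (n + m) (butlast w @ [gComp (Chb A) (last w) g])) fs)"
  proof (rule transfer[OF R.ract_props(1)[OF g]])
    fix w assume w: "w \<in> Bf.Sym X X' n" "src ` set w \<subseteq> \<Omega>"
    show "ract RB X n (Cut X X' n w) g = lc X Z (n + m) (cw X Z (n + m) (butlast w @ [gComp (Chb A) (last w) g]))"
      unfolding ract_Cut[OF w(1) g] CW_Cut[OF Bf.Sym_right[OF w(1) g] right_src[OF w sg]] ..
  qed
  then show ?thesis
    unfolding wd.X_last[OF ne] Xi_el_lc[OF Bf.Sym_right[OF fs g] right_src[OF fs sub_\<Omega> sg]] by (rule sym)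
qed

text \<open>The two index sets differ for words of length two, where the first sum has a merge and
  the bar differential has none; the merged word is then too short and gives zero.\<close>

lemma lc_mrg:
  assumes w: "w \<in> Bf.Sym X X' n" "src ` set w \<subseteq> \<Omega>" and short: "\<And>u. length u < 2 \<Longrightarrow> \<psi> u = 0"
    and \<psi>: "\<And>u. u \<in> Bf.Sym X X' (n + 1) \<Longrightarrow> src ` set u \<subseteq> \<Omega> \<Longrightarrow> lc X X' (n + 1) (\<psi> u) = \<Phi> u"
  shows "lc X X' (n + 1) (\<Sum>p<length w - 1. sgm (int p) (\<psi> (wd.mrg p w))) =
    finsum (R.BM X X' (n + 1)) (\<lambda>i. signed (R.BM X X' (n + 1)) (int i) (\<Phi> (dg.merge i w))) {i. 0 < length w - 2 \<and> i \<le> length w - 2}"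
proof -
  let ?P = "R.BM X X' (n + 1)"
  interpret P: module K ?P by (rule R.BM_module)
  have l2: "2 \<le> length w" by (rule Bf_nth(6)[OF w(1)])
  show ?thesis
  proof (cases "length w = 2")
    case True
    have "\<psi> (wd.mrg 0 w) = 0" by (rule short) (simp add: wd.length_mrg True)
    then have "(\<Sum>p<length w - 1. sgm (int p) (\<psi> (wd.mrg p w))) = 0" using True by (simp add: sgm_simps)
    moreover have "{i. 0 < length w - 2 \<and> i \<le> length w - 2} = {}" using True by auto
    ultimately show ?thesis by (simp only: lc_zero P.M.finsum_empty)
  next
    case False
    then have I: "{i. 0 < length w - 2 \<and> i \<le> length w - 2} = {..<length w - 1}" using l2 by auto
    have m: "lc X X' (n + 1) (\<psi> (dg.merge i w)) = \<Phi> (dg.merge i w)" if i: "i < length w - 1" for i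
    proof -
      have i': "i + 1 < length w" "2 < length w" using i False l2 by auto
      have S: "dg.merge i w \<in> Bf.Sym X X' (n + 1)" by (rule Bf.Sym_merge'[OF w(1) i'])
      obtain us f g vs where e: "w = us @ f # g # vs" "length us = i" by (metis dg.split_pair i'(1))
      have "src ` set (dg.merge i w) \<subseteq> \<Omega>" using w(2) unfolding e(1) dg.merge_append[OF e(2)] by (auto simp: gComp_eq)
      then show ?thesis by (rule \<psi>[OF S])
    qed
    show ?thesis unfolding I lc_sum[OF finite_lessThan] lc_sgm mrg_merge
    proof (rule P.M.finsum_cong'[OF refl])
      have "\<Phi> (dg.merge i w) \<in> carrier ?P" if "i < length w - 1" for i
        using m[OF that] lc_closed[of X X' "n + 1" "\<psi> (dg.merge i w)"] by simp
      then show "(\<lambda>i. signed ?P (int i) (\<Phi> (dg.merge i w))) \<in> {..<length w - 1} \<rightarrow> carrier ?P"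
        by (intro Pi_I signed_closed[OF P.module_axioms]) simp
      show "signed ?P (int i) (lc X X' (n + 1) (\<psi> (dg.merge i w))) = signed ?P (int i) (\<Phi> (dg.merge i w))"
        if "i \<in> {..<length w - 1}" for i using m that by simp
    qed
  qed
qed

text \<open>The differential of the entry is its graded commutator with \<open>delta\<close>, and
  \<open>Xi_el\<close> is linear in the slot. Both new symbols have the sources of the old one, so
  the same bound \<open>b\<close> covers them.\<close>

lemma Xi_dif:
  assumes i: "i < length fs"
  shows "Xi_el X X' (n + 1) (fs[i := dif (Chb A) (fs ! i)]) = lc X X' (n + 1)
    (wd.X (Suc b) (cw X X' (n + 1)) (fs[i := gComp (Chb A) (delta (tgt (fs ! i))) (fs ! i)]) +
     sgm (deg (fs ! i) + 1) (wd.X (Suc b) (cw X X' (n + 1)) (fs[i := gComp (Chb A) (fs ! i) (delta (src (fs ! i)))])))"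
proof -
  let ?P = "R.BM X X' (n + 1)"
  interpret P: module K ?P by (rule R.BM_module)
  let ?f = "fs ! i" let ?Y = "src ?f" and ?Z = "tgt ?f" and ?k = "deg ?f"
  let ?us = "take i fs" and ?vs = "drop (Suc i) fs"
  note B = Bf_nth[OF fs]
  have o: "?Y \<in> Ob" "?Z \<in> Ob" and f: "?f \<in> carrier (HC ?Y ?Z ?k)" using B(2,4,5) i by blast+
  interpret M: module K "HC ?Y ?Z (?k + 1)" by (rule HC_module[OF o])
  have u: "fs[i := x] = ?us @ x # ?vs" for x by (rule upd_conv_take_nth_drop[OF i])
  have a: "gComp (Chb A) (delta ?Z) ?f \<in> carrier (HC ?Y ?Z (?k + 1))"
    using gComp_closed[OF o(1,2,2) f delta_closed[OF o(2)]] by (simp add: add.commute)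
  have c: "gComp (Chb A) ?f (delta ?Y) \<in> carrier (HC ?Y ?Z (?k + 1))"
    by (rule gComp_closed[OF o(1,1,2) delta_closed[OF o(1)] f])
  have dS: "?us @ dif (Chb A) ?f # ?vs \<in> Bf.Sym X X' (n + 1)" using Bf.Sym_dif[OF fs i] unfolding u .
  have df: "dif (Chb A) ?f \<in> carrier (HC ?Y ?Z (?k + 1))" by (rule linear_mapsD(1)[OF dg.dif_linear[OF o] f])
  note lin = Bf.multilinear_linear[OF Xi_el_multilinear dS df]
  have S: "?us @ x # ?vs \<in> Bf.Sym X X' (n + 1)" if "x \<in> carrier (HC ?Y ?Z (?k + 1))" for x
    by (rule Bf.Sym_replace[OF dS df that])
  have src: "src ` set (?us @ x # ?vs) \<subseteq> \<Omega>" if "x \<in> carrier (HC ?Y ?Z (?k + 1))" for x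
  proof -
    have "src x = ?Y" using that by (simp add: HC_iff)
    moreover have "set ?us \<subseteq> set fs" "set ?vs \<subseteq> set fs" "?f \<in> set fs" using i by (auto dest: in_set_takeD in_set_dropD)
    ultimately show ?thesis unfolding \<Omega>_def by auto
  qed
  have X: "Xi_el X X' (n + 1) (?us @ x # ?vs) = lc X X' (n + 1) (wd.X (Suc b) (cw X X' (n + 1)) (?us @ x # ?vs))"
    if "x \<in> carrier (HC ?Y ?Z (?k + 1))" for x by (rule Xi_el_lc[OF S[OF that] src[OF that]])
  have cc: "Xi_el X X' (n + 1) (?us @ gComp (Chb A) ?f (delta ?Y) # ?vs) \<in> carrier ?P" by (rule linear_mapsD(1)[OF lin c])
  have "Xi_el X X' (n + 1) (?us @ dif (Chb A) ?f # ?vs) = Xi_el X X' (n + 1) (?us @ gComp (Chb A) (delta ?Z) ?f # ?vs) \<ominus>\<^bsub>?P\<^esub>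
    signed ?P ?k (Xi_el X X' (n + 1) (?us @ gComp (Chb A) ?f (delta ?Y) # ?vs))"
    unfolding dif_eq[OF o f] linear_map_minus[OF M.module_axioms P.module_axioms lin a signed_closed[OF M.module_axioms c]]
      linear_map_signed[OF M.module_axioms P.module_axioms lin c] ..
  also have "\<dots> = Xi_el X X' (n + 1) (?us @ gComp (Chb A) (delta ?Z) ?f # ?vs) \<oplus>\<^bsub>?P\<^esub>
    signed ?P (?k + 1) (Xi_el X X' (n + 1) (?us @ gComp (Chb A) ?f (delta ?Y) # ?vs))"
    using cc by (simp add: signed_def a_minus_def)
  finally show ?thesis unfolding u lc_add lc_sgm X[OF a] X[OF c] .
qed

text \<open>\<open>D i\<close> belongs to \<open>\<delta>f_i\<close> and \<open>L i\<close> to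
  \<open>f_i\<delta>\<close>. By \<open>X_mu\<close> the merges of the cut words yield
  \<open>L i\<close> for every entry but the last and \<open>D i\<close> for every entry but the
  first; the two missing terms are the outer differentials in \<open>bdif_Cut\<close>. Together they
  form the internal differential of all entries.\<close>

lemma Xi_closed:
  "bdif RB X X' n (Xi_el X X' n fs) = Bf.bar_dif_ext (R.BM X X' (n + 1)) (Xi_el X X' (n + 1)) fs"
proof -
  let ?P = "R.BM X X' (n + 1)" and ?l = "lc X X' (n + 1)" and ?X = "wd.X (Suc b) (cw X X' (n + 1))"
  interpret P: module K ?P by (rule R.BM_module)
  note B = Bf_nth[OF fs]
  have XO: "X \<in> Ob" "X' \<in> Ob" by (rule Bf.Sym_obj[OF fs])+
  define r where "r = length fs - 2"
  have lr: "length fs = r + 2" using B(6) by (simp add: r_def)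
  have ne: "fs \<noteq> []" using lr by auto
  define S where "S i = (\<Sum>j<i. deg (fs ! j))" for i
  define L where "L i = ?X (fs[i := gComp (Chb A) (fs ! i) (delta (src (fs ! i)))])" for i
  define D where "D i = ?X (fs[i := gComp (Chb A) (delta (tgt (fs ! i))) (fs ! i)])" for i
  define m where "m i = sgm (int i) (?X (wd.mrg i fs))" for i
  have X'\<Omega>: "X' \<in> \<Omega>" using last_src[OF fs] by (auto simp: \<Omega>_def)
  have dX: "deg (delta X) = 1" "src (delta X') = X'" by (simp_all add: delta_def)
  let ?c = "\<lambda>w. sgm (int (length w - 2) * 1) (cw X X' (n + 1) (gComp (Chb A) (delta X) (hd w) # tl w)) +
    (sgm (n + 1) (cw X X' (n + 1) (butlast w @ [gComp (Chb A) (last w) (delta X')])) + wd.mu (cw X X' (n + 1)) w)"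
  have 1: "bdif RB X X' n (Xi_el X X' n fs) = ?l (wd.X (Suc b) ?c fs)"
  proof (rule transfer[OF R.bdif_linear])
    fix w assume w: "w \<in> Bf.Sym X X' n" "src ` set w \<subseteq> \<Omega>"
    have a: "?l (cw X X' (n + 1) (gComp (Chb A) (delta X) (hd w) # tl w)) = Cut X X' (n + 1) (gComp (Chb A) (delta X) (hd w) # tl w)"
      by (rule CW_Cut[OF _ left_src[OF w]]) (use Bf.Sym_left[OF w(1) delta_closed[OF XO(1)] XO(1)] in \<open>simp add: add.commute\<close>)
    have d: "?l (cw X X' (n + 1) (butlast w @ [gComp (Chb A) (last w) (delta X')])) = Cut X X' (n + 1) (butlast w @ [gComp (Chb A) (last w) (delta X')])"
      by (rule CW_Cut[OF Bf.Sym_right[OF w(1) delta_closed[OF XO(2)] XO(2)] right_src[OF w]]) (simp only: dX X'\<Omega>)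
    have e: "?l (wd.mu (cw X X' (n + 1)) w) = finsum ?P (\<lambda>i. signed ?P (int i) (Cut X X' (n + 1) (dg.merge i w))) {i. 0 < length w - 2 \<and> i \<le> length w - 2}"
      unfolding wd.mu_def by (rule lc_mrg[OF w cw_short CW_Cut])
    show "bdif RB X X' n (Cut X X' n w) = ?l (?c w)"
      unfolding bdif_Cut[OF w(1)] lc_add lc_sgm a d e by simp
  qed
  have hd: "?X (gComp (Chb A) (delta X) (hd fs) # tl fs) = D 0"
  proof -
    obtain y t where yt: "fs = y # t" using Bf_Cons[OF fs] .
    show ?thesis using B(7) by (simp add: D_def yt)
  qed
  have last: "?X (butlast fs @ [gComp (Chb A) (last fs) (delta X')]) = L (r + 1)"
  proof -
    have l1: "fs ! (r + 1) = last fs" using last_conv_nth[OF ne] lr by simp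
    have lb: "length (butlast fs) = r + 1" using lr by simp
    have "fs[r + 1 := x] = butlast fs @ [x]" for x by (metis append_butlast_last_id[OF ne] lb list_update_length)
    then show ?thesis unfolding L_def l1 using last_src[OF fs] by simp
  qed
  have mu: "wd.X (Suc b) (wd.mu (cw X X' (n + 1))) fs = (\<Sum>i<r + 1. sgm (int (r + 1) + S (i + 1)) (L i) - sgm (int (r + 1) + S (i + 1)) (D (i + 1)) + m i)"
  proof -
    have l: "length fs - 1 = r + 1" using lr by simp
    have a: "(\<Sum>j\<le>i. deg (fs ! j)) = S (i + 1)" for i by (simp add: S_def lessThan_Suc_atMost)
    have d: "?X (fs[Suc i := gComp (Chb A) (delta (src (fs ! i))) (fs ! Suc i)]) = D (i + 1)" if "i < r + 1" for i
      unfolding D_def using B(3)[of i] that lr by simp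
    show ?thesis unfolding wd.X_mu[OF ne cw_delta_sq cw_replicate] l a L_def[symmetric] m_def[symmetric]
      by (intro sum.cong refl) (use d in simp)
  qed
  have 2: "wd.X (Suc b) ?c fs = (\<Sum>i\<in>{0..r + 1}. sgm (int r + S i) (D i + sgm (deg (fs ! i) + 1) (L i))) + (\<Sum>i<r + 1. m i)"
  proof -
    have Sr: "S (r + 2) = n + int r" using B(9) lr by (simp add: S_def)
    have SS: "S (Suc i) = S i + deg (fs ! i)" for i by (simp add: S_def)
    have s1: "sgm (int r + S i) (D i + sgm (deg (fs ! i) + 1) (L i)) = sgm (int r + S i) (D i) + sgm (int (r + 1) + S (i + 1)) (L i)" for i
      by (simp add: sgm_simps SS algebra_simps)
    have I: "{0..r + 1} = {..<Suc (r + 1)}" by auto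
    have "(\<Sum>i\<in>{0..r + 1}. sgm (int r + S i) (D i + sgm (deg (fs ! i) + 1) (L i))) =
      (\<Sum>i<Suc (r + 1). sgm (int r + S i) (D i)) + (\<Sum>i<Suc (r + 1). sgm (int (r + 1) + S (i + 1)) (L i))"
      unfolding s1 I by (rule sum.distrib)
    also have "(\<Sum>i<Suc (r + 1). sgm (int r + S i) (D i)) = sgm (int r) (D 0) + (\<Sum>i<r + 1. sgm (int r + S (i + 1)) (D (i + 1)))"
      unfolding sum.lessThan_Suc_shift[of _ "r + 1"] by (simp add: S_def)
    also have "(\<Sum>i<Suc (r + 1). sgm (int (r + 1) + S (i + 1)) (L i)) = (\<Sum>i<r + 1. sgm (int (r + 1) + S (i + 1)) (L i)) + sgm (n + 1) (L (r + 1))"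
    proof -
      have "sgm (int (r + 1) + S (r + 1 + 1)) (L (r + 1)) = sgm (n + 1) (L (r + 1))"
        using Sr by (intro sgm_cong) simp
      then show ?thesis unfolding sum.lessThan_Suc[of _ "r + 1"] by simp
    qed
    finally have R: "(\<Sum>i\<in>{0..r + 1}. sgm (int r + S i) (D i + sgm (deg (fs ! i) + 1) (L i))) =
      sgm (int r) (D 0) + (\<Sum>i<r + 1. sgm (int r + S (i + 1)) (D (i + 1))) +
      ((\<Sum>i<r + 1. sgm (int (r + 1) + S (i + 1)) (L i)) + sgm (n + 1) (L (r + 1)))" .
    \<comment> \<open>The minus sign in \<open>X_mu\<close> makes up for its exponent
      \<open>r + 1\<close> in place of the \<open>r\<close> of the internal differential.\<close>
    have neg: "- sgm (int (r + 1) + S (i + 1)) (D (i + 1)) = sgm (int r + S (i + 1)) (D (i + 1))" for i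
      by (rule sgm_neg[symmetric]) simp
    have mu': "wd.X (Suc b) (wd.mu (cw X X' (n + 1))) fs = (\<Sum>i<r + 1. sgm (int (r + 1) + S (i + 1)) (L i)) +
      (\<Sum>i<r + 1. sgm (int r + S (i + 1)) (D (i + 1))) + (\<Sum>i<r + 1. m i)"
      unfolding mu diff_conv_add_uminus neg by (simp only: sum.distrib)
    have "wd.X (Suc b) ?c fs = sgm (int r) (D 0) + (sgm (n + 1) (L (r + 1)) + wd.X (Suc b) (wd.mu (cw X X' (n + 1))) fs)"
      unfolding wd.X_add X_head_cw[OF dX(1)] wd.X_sgm wd.X_last[OF ne] hd last r_def[symmetric] by simp
    then show ?thesis unfolding R mu' by (simp only: add_ac)
  qed
  have short: "?X u = 0" if "length u < 2" for u
  proof (cases u)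
    case (Cons x t)
    then have "u = [x]" using that by (cases t) simp_all
    then show ?thesis using cw_short[of "[x]"] by simp
  qed simp
  have mm: "?l (\<Sum>i<r + 1. m i) = finsum ?P (\<lambda>i. signed ?P (int i) (Xi_el X X' (n + 1) (dg.merge i fs))) {i. 0 < length fs - 2 \<and> i \<le> length fs - 2}"
  proof -
    have l: "r + 1 = length fs - 1" using lr by simp
    show ?thesis unfolding m_def l by (rule lc_mrg[OF fs sub_\<Omega> short Xi_el_lc[symmetric]])
  qed
  have dd: "?l (\<Sum>i\<in>{0..r + 1}. sgm (int r + S i) (D i + sgm (deg (fs ! i) + 1) (L i))) =
    finsum ?P (\<lambda>i. signed ?P (int r + S i) (Xi_el X X' (n + 1) (fs[i := dif (Chb A) (fs ! i)]))) {0..r + 1}"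
    unfolding lc_sum[OF finite_atLeastAtMost] lc_sgm
  proof (rule P.M.finsum_cong'[OF refl])
    have e: "?l (D i + sgm (deg (fs ! i) + 1) (L i)) = Xi_el X X' (n + 1) (fs[i := dif (Chb A) (fs ! i)])" if "i \<in> {0..r + 1}" for i
      unfolding D_def L_def by (rule Xi_dif[symmetric]) (use that lr in simp)
    show "(\<lambda>i. signed ?P (int r + S i) (Xi_el X X' (n + 1) (fs[i := dif (Chb A) (fs ! i)]))) \<in> {0..r + 1} \<rightarrow> carrier ?P"
      by (intro Pi_I signed_closed[OF P.module_axioms]) (simp only: e[symmetric] lc_closed)
    show "signed ?P (int r + S i) (?l (D i + sgm (deg (fs ! i) + 1) (L i))) =
      signed ?P (int r + S i) (Xi_el X X' (n + 1) (fs[i := dif (Chb A) (fs ! i)]))" if "i \<in> {0..r + 1}" for i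
      by (simp only: e[OF that])
  qed
  show ?thesis unfolding 1 2 lc_add mm dd unfolding Bf.bar_dif_ext_def r_def[symmetric] S_def ..
qed

end

section \<open>The closed bimodule map \<open>\<Xi>\<close>\<close>

context cplx_cat
begin

lemma Xi_symbol: "fs \<in> Bf.Sym X X' n \<Longrightarrow> finite E \<Longrightarrow> Xi_symbol K A X X' n fs E"
  by unfold_locales

lemma Xi_bimodule_map: "bimodule_map K (Chb A) (Bar K (Chb A)) RB 0 (Xi K A)"
proof -
  have b: "bmod RB = R.BM" by (simp add: rel_Bar_def)
  have "bimodule_map K (Chb A) (rel_Bar K (Chb A) Ob) RB 0 (\<lambda>X Y n. lin_ext K (bmod RB X Y n) (Xi_el X Y n))"
  proof (rule Bf.bimodule_map_lin_ext[OF R.lin_bimodule_rel_Bar], goal_cases)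
    case (1 X Y n)
    show ?case unfolding b by (rule Xi_el_multilinear)
  next
    case (2 X X' Y j n f fs)
    interpret S: Xi_symbol K A X Y n fs "{}" by (rule Xi_symbol[OF 2(5)]) simp
    show ?case unfolding b by (rule S.Xi_left[OF 2(4,2)])
  next
    case (3 X Y Y' m n g fs)
    \<comment> \<open>The right action introduces \<open>Y'\<close> as a source, so it joins the
      sources covered by the bound.\<close>
    interpret S: Xi_symbol K A X Y n fs "{Y'}" by (rule Xi_symbol[OF 3(5)]) simp
    show ?case by (rule S.Xi_right[OF 3(4,3)]) (simp add: S.\<Omega>_def)
  qed
  then show ?thesis unfolding Bar_def b Xi_eq[symmetric] .
qed

lemma Xi_closed_map: "closed_map (Chb A) (Bar K (Chb A)) RB 0 (Xi K A)"
proof -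
  have b: "bmod RB = R.BM" by (simp add: rel_Bar_def)
  have "closed_map (Chb A) (rel_Bar K (Chb A) Ob) RB 0 (\<lambda>X Y n. lin_ext K (bmod RB X Y n) (Xi_el X Y n))"
  proof (rule Bf.closed_map_lin_ext[OF R.lin_bimodule_rel_Bar], goal_cases)
    case (1 X Y n)
    show ?case unfolding b by (rule Xi_el_multilinear)
  next
    case (2 X Y n fs)
    interpret S: Xi_symbol K A X Y n fs "{}" by (rule Xi_symbol[OF 2(3)]) simp
    show ?case unfolding b by (rule S.Xi_closed)
  qed
  then show ?thesis unfolding Bar_def b Xi_eq[symmetric] .
qed

section \<open>Restriction of the extension to \<open>A\<close> and its explicit values\<close>

lemma emb_mor_simps: "src (emb_mor f) = emb_ob (src f)" "tgt (emb_mor f) = emb_ob (tgt f)" "deg (emb_mor f) = deg f"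
  by (simp_all add: emb_mor_def)

lemma emb_arr:
  assumes "D.dg.arr f"
  shows "dg.arr (emb_mor f)" "unemb (emb_mor f) = f"
proof -
  have c: "src f \<in> Obj A" "tgt f \<in> Obj A" "f \<in> carrier (gHom (dg_of A) (src f) (tgt f) (deg f))"
    using assms by (simp_all add: D.dg.arr_def Ob_dg_of)
  show "dg.arr (emb_mor f)" by (rule dg.arrI[OF emb_Ob[OF c(1)] emb_Ob[OF c(2)] emb_mor_closed[OF c(3)]])
  show "unemb (emb_mor f) = f" by (rule unemb_emb[OF c(3)])
qed

lemma emb_Sym:
  assumes "fs \<in> Bd.Sym Y Y' n"
  shows "map emb_mor fs \<in> R.Sym (emb_ob Y) (emb_ob Y') n"
proof -
  note S = assms[unfolded Bd.Sym_iff]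
  note S2 = S[THEN conjunct2] note S3 = S2[THEN conjunct2] note S4 = S3[THEN conjunct2] note S5 = S4[THEN conjunct2]
  have l: "2 \<le> length fs" by (rule S[THEN conjunct1])
  then have ne: "fs \<noteq> []" by auto
  show ?thesis unfolding R.Sym_iff
  proof (intro conjI)
    show "2 \<le> length (map emb_mor fs)" using l by simp
    show "\<forall>f\<in>set (map emb_mor fs). dg.arr f" using S2[THEN conjunct1] emb_arr(1) by simp
    show "successively (\<lambda>f g. src f = tgt g \<and> src f \<in> emb_ob ` Obj A) (map emb_mor fs)"
      unfolding successively_map
      by (rule successively_mono[OF S3[THEN conjunct1]], simp only: emb_mor_simps, elim conjE, intro conjI imageI, simp_all)
    show "tgt (hd (map emb_mor fs)) = emb_ob Y" "src (last (map emb_mor fs)) = emb_ob Y'"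
      using S4[THEN conjunct1] S5[THEN conjunct1] ne by (simp_all add: hd_map last_map emb_mor_simps)
    have m: "map deg (map emb_mor fs) = map deg fs" by (simp add: emb_mor_simps)
    show "sum_list (map deg (map emb_mor fs)) - (int (length (map emb_mor fs)) - 2) = n"
      unfolding m length_map by (rule S5[THEN conjunct2])
  qed
qed

lemma map_unemb_emb:
  assumes "us @ fs @ vs \<in> Bd.Sym Y Y' n"
  shows "map unemb (map emb_mor fs) = fs"
proof -
  have "\<forall>f\<in>set (us @ fs @ vs). D.dg.arr f" using assms unfolding Bd.Sym_iff by (elim conjE)
  then show ?thesis using emb_arr(2) by (simp add: map_idI)
qed

end

context nat_lift
begin

text \<open>The lifts restrict to \<open>F\<close> and \<open>G\<close> by \<open>LM_emb\<close>, so
  the formula for \<open>tau'\<close> becomes the value that \<open>T_act\<close> gives for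
  \<open>\<tau>\<close> on the same symbol.\<close>

lemma tau'_extends:
  assumes o: "Y \<in> Obj A" "Y' \<in> Obj A" and fs: "fs \<in> DSym Y Y' n"
  shows "tau' (emb_ob Y) (emb_ob Y') n (bar_elem K (Chb A) (emb_ob ` Obj A) (emb_ob Y) (emb_ob Y') n (map emb_mor fs)) = T Y Y' n fs"
proof -
  note W = LF.A.emb_Sym[OF fs]
  have l2: "2 \<le> length fs" using fs unfolding LF.A.Bd.Sym_iff by (elim conjE)
  obtain f mid g where e: "fs = f # mid @ [g]" using length_ge_2_split[OF l2] .
  obtain f0 mid' fl y0 yr where s: "map emb_mor fs = f0 # mid' @ [fl]" "y0 \<in> Obj A" "yr \<in> Obj A"
    "(emb_ob Y :: ('o,'m) cplx) \<in> ObA" "(emb_ob Y' :: ('o,'m) cplx) \<in> ObA"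
    "f0 \<in> carrier (HA (emb_ob y0) (emb_ob Y) (deg f0))" "fl \<in> carrier (HA (emb_ob Y') (emb_ob yr) (deg fl))"
    "id0 y0 # map ue mid' @ [id0 yr] \<in> DSym y0 yr (n - deg f0 - deg fl)" using W by (rule LF.A.rel_sym_split)
  have eq: "f0 = emb_mor f" "mid' = map emb_mor mid" "fl = emb_mor g" using s(1) unfolding e by simp_all
  have ar: "LF.A.D.dg.arr f" "LF.A.D.dg.arr g"
  proof -
    have "\<forall>f\<in>set fs. LF.A.D.dg.arr f" using fs unfolding LF.A.Bd.Sym_iff by (elim conjE)
    then show "LF.A.D.dg.arr f" "LF.A.D.dg.arr g" by (simp_all add: e)
  qed
  have ue: "ue f0 = f" "ue fl = g" unfolding eq by (rule LF.A.emb_arr(2)[OF ar(1)], rule LF.A.emb_arr(2)[OF ar(2)])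
  have m: "map ue mid' = mid" unfolding eq by (rule LF.A.map_unemb_emb[of "[f]" mid "[g]"]) (use fs e in simp)
  have fc: "f \<in> carrier (gHom (dg_of A) y0 Y (deg f0))" using LF.A.unemb_closed[OF s(6)] unfolding ue .
  have gc: "g \<in> carrier (gHom (dg_of A) Y' yr (deg fl))" using LF.A.unemb_closed[OF s(7)] unfolding ue .
  have L: "LF.LM f0 = fmor F f" "LG.LM fl = fmor G g"
    using LF.LM_emb[OF s(2) o(1) s(6)] LG.LM_emb[OF o(2) s(3,7)] by (simp_all only: ue)
  have se: "src f0 = emb_ob y0" "tgt fl = emb_ob yr" using s(6,7) by (auto simp: LF.A.HC_iff)
  have n: "deg f0 + (n - deg f0 - deg fl) + deg fl = n" by simp
  have LO: "LF.LO (emb_ob Y) = fobj F Y" "LG.LO (emb_ob Y') = fobj G Y'"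
    by (rule LF.LO_emb[OF o(1) s(4)], rule LG.LO_emb[OF o(2) s(5)])
  have "mid' = map emb_mor mid" by (rule eq)
  then have lm: "length mid' = length mid" by simp
  show ?thesis unfolding tau'_el[OF s(4,5) W] unfolding s(1) Phi_eq[OF se] L LO m lm
    using T_act[OF o s(2,3) fc gc s(8)[unfolded m]] unfolding n e by (rule sym)
qed

text \<open>That \<open>f\<close>, the middle part and \<open>f'\<close> form a relative symbol is
  derived from the symbol flanked by identities: act by \<open>f\<close> and \<open>f'\<close>, then
  exchange the composite with an identity for \<open>f\<close> or \<open>f'\<close> inside the same
  Hom module.\<close>

lemma tau'_formula:
  assumes o: "X \<in> ObA" "X' \<in> ObA" "Y \<in> Obj A" "Y' \<in> Obj A"
    and f: "f \<in> carrier (HA (emb_ob Y) X k)" and f': "f' \<in> carrier (HA X' (emb_ob Y') l)"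
    and fs: "[id0 Y] @ fs @ [id0 Y'] \<in> DSym Y Y' m"
  shows "tau' X X' (k + m + l) (bar_elem K (Chb A) (emb_ob ` Obj A) X X' (k + m + l) ([f] @ map emb_mor fs @ [f'])) =
    signed (HM X X' (k + m + l)) (int (length fs) * k) (cB (LF.LM f) (cB (T Y Y' m ([id0 Y] @ fs @ [id0 Y'])) (LG.LM f')))"
proof -
  note E = LF.A.emb_Ob[OF o(3)] LF.A.emb_Ob[OF o(4)]
  let ?e = "emb_mor (id0 Y)" and ?e' = "emb_mor (id0 Y')"
  have ec: "?e \<in> carrier (HA (emb_ob Y) (emb_ob Y) 0)" "?e' \<in> carrier (HA (emb_ob Y') (emb_ob Y') 0)"
    using LF.A.D.dg.idt_closed o(3,4) by (auto intro!: LF.A.emb_mor_closed simp: LF.A.Ob_dg_of)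
  have W0: "?e # map emb_mor fs @ [?e'] \<in> RSym (emb_ob Y) (emb_ob Y') m" using LF.A.emb_Sym[OF fs] by simp
  have W1: "cA f ?e # map emb_mor fs @ [?e'] \<in> RSym X (emb_ob Y') (k + m)" using LF.A.R.Sym_left[OF W0 f o(1)] by simp
  have fe: "cA f ?e \<in> carrier (HA (emb_ob Y) X k)" using LF.A.gComp_closed[OF E(1,1) o(1) ec(1) f] by simp
  have W2: "f # map emb_mor fs @ [?e'] \<in> RSym X (emb_ob Y') (k + m)"
    using LF.A.R.Sym_replace[of "[]", OF _ fe f] W1 by simp
  have W3: "f # map emb_mor fs @ [cA ?e' f'] \<in> RSym X X' (k + m + l)"
    using LF.A.R.Sym_right[OF W2 f' o(2)] by (simp add: butlast_append)
  have ef: "cA ?e' f' \<in> carrier (HA X' (emb_ob Y') l)" using LF.A.gComp_closed[OF o(2) E(2,2) f' ec(2)] by simp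
  have W: "f # map emb_mor fs @ [f'] \<in> RSym X X' (k + m + l)"
    using LF.A.R.Sym_replace[of "f # map emb_mor fs" _ "[]", OF _ ef f'] W3 by simp
  have se: "src f = emb_ob Y" "tgt f' = emb_ob Y'" and d: "deg f = k" "deg f' = l" using f f' by (auto simp: LF.A.HC_iff)
  have n: "k + m + l - k - l = m" by simp
  show ?thesis unfolding append_Cons append_Nil tau'_el[OF o(1,2) W] Phi_eq[OF se] d n LF.A.map_unemb_emb[OF fs] length_map ..
qed

end

text \<open>In the displayed value of \<open>\<tau>'\<close> the number \<open>r\<close> is
  \<open>length fs\<close> and \<open>|f_0|\<close> is \<open>k\<close>. The equation before it says
  that \<open>\<tau>'\<close> restricts to \<open>\<tau>\<close> on objects of \<open>A\<close>, the
  sense in which it is a lift.\<close>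

theorem theorem4p13:
  fixes K :: "'k ring"
    and A :: "('k,'o,'m) lincat" and B :: "('k,'p,'n) lincat"
    and F G :: "('o,'m,('p,'n) cplx,int \<Rightarrow> 'n) dgfun"
    and \<tau> :: "'o \<Rightarrow> 'o \<Rightarrow> int \<Rightarrow> (('o,'m) harr list \<Rightarrow> 'k) set \<Rightarrow> (('p,'n) cplx,int \<Rightarrow> 'n) harr"
  assumes "linear_category K A" and "linear_category K B" and "additive B"
    and "dg_functor K (dg_of A) (Chb B) F" and "dg_functor K (dg_of A) (Chb B) G"
    and "A_inf_nat_trans K (dg_of A) (Chb B) G F 0 \<tau>"
    and "closed_map (dg_of A) (Bar K (dg_of A)) (functor_bimodule (Chb B) F G) 0 \<tau>"
  shows "\<exists>\<tau>'.
    bimodule_map K (Chb A) (rel_Bar_Chb K A)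
      (functor_bimodule (Chb B) (lift B F) (lift B G)) 0 \<tau>' \<and>
    closed_map (Chb A) (rel_Bar_Chb K A)
      (functor_bimodule (Chb B) (lift B F) (lift B G)) 0 \<tau>' \<and>
    (\<forall>Y\<in>Obj A. \<forall>Y'\<in>Obj A. \<forall>n. \<forall>fs\<in>bar_symbols (dg_of A) (Obj A) Y Y' n.
      \<tau>' (emb_ob Y) (emb_ob Y') n
        (bar_elem K (Chb A) (emb_ob ` Obj A) (emb_ob Y) (emb_ob Y') n (map emb_mor fs)) =
      \<tau> Y Y' n (bar_elem K (dg_of A) (Obj A) Y Y' n fs)) \<and>
    (\<forall>X\<in>dgOb (Chb A). \<forall>X'\<in>dgOb (Chb A). \<forall>Y\<in>Obj A. \<forall>Y'\<in>Obj A. \<forall>k l m.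
      \<forall>f\<in>carrier (gHom (Chb A) (emb_ob Y) X k). \<forall>f'\<in>carrier (gHom (Chb A) X' (emb_ob Y') l).
      \<forall>fs. [idt (dg_of A) Y] @ fs @ [idt (dg_of A) Y'] \<in> bar_symbols (dg_of A) (Obj A) Y Y' m \<longrightarrow>
        \<tau>' X X' (k + m + l)
          (bar_elem K (Chb A) (emb_ob ` Obj A) X X' (k + m + l) ([f] @ map emb_mor fs @ [f'])) =
        signed (gHom (Chb B) (lift_ob B G X') (lift_ob B F X) (k + m + l)) (int (length fs) * k)
          (gComp (Chb B) (lift_mor B F f)
            (gComp (Chb B)
              (\<tau> Y Y' m (bar_elem K (dg_of A) (Obj A) Y Y' m
                ([idt (dg_of A) Y] @ fs @ [idt (dg_of A) Y'])))
              (lift_mor B G f')))) \<and>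
    bimodule_map K (Chb A) (Bar K (Chb A))
      (functor_bimodule (Chb B) (lift B F) (lift B G)) 0 (\<lambda>X X' n. \<tau>' X X' n \<circ> Xi K A X X' n) \<and>
    closed_map (Chb A) (Bar K (Chb A))
      (functor_bimodule (Chb B) (lift B F) (lift B G)) 0 (\<lambda>X X' n. \<tau>' X X' n \<circ> Xi K A X X' n)"
proof -
  interpret LA: linear_category K A by (rule assms(1))
  interpret LB: linear_category K B by (rule assms(2))
  have ob: "dgOb (dg_of A) = Obj A" by (simp add: dg_of_def)
  have tb: "bimodule_map K (dg_of A) (rel_Bar K (dg_of A) (Obj A)) (functor_bimodule (Chb B) F G) 0 \<tau>"
    using assms(6) by (simp add: A_inf_nat_trans_def Bar_def ob)
  have tc: "closed_map (dg_of A) (rel_Bar K (dg_of A) (Obj A)) (functor_bimodule (Chb B) F G) 0 \<tau>"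
    using assms(7) by (simp add: Bar_def ob)
  interpret N: nat_lift K A B F G \<tau>
    by unfold_locales (rule assms(3) assms(4) assms(5) tb tc)+
  show ?thesis
  proof (intro exI[of _ N.tau'] conjI ballI allI impI)
    show "bimodule_map K (Chb A) (rel_Bar_Chb K A) (functor_bimodule (Chb B) (lift B F) (lift B G)) 0 N.tau'"
      unfolding rel_Bar_Chb_def by (rule N.tau'_bimodule_map)
    show "closed_map (Chb A) (rel_Bar_Chb K A) (functor_bimodule (Chb B) (lift B F) (lift B G)) 0 N.tau'"
      unfolding rel_Bar_Chb_def by (rule N.tau'_closed)
    show "bimodule_map K (Chb A) (Bar K (Chb A)) (functor_bimodule (Chb B) (lift B F) (lift B G)) 0 (\<lambda>X X' n. N.tau' X X' n \<circ> Xi K A X X' n)"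
      by (rule bimodule_map_comp[OF N.LF.A.Xi_bimodule_map N.tau'_bimodule_map])
    show "closed_map (Chb A) (Bar K (Chb A)) (functor_bimodule (Chb B) (lift B F) (lift B G)) 0 (\<lambda>X X' n. N.tau' X X' n \<circ> Xi K A X X' n)"
      by (rule closed_map_comp[OF N.LF.A.Xi_bimodule_map N.LF.A.Xi_closed_map N.tau'_closed])
  qed (rule N.tau'_extends[unfolded N.T_def], assumption+, rule N.tau'_formula[unfolded N.T_def], assumption+)
qed

end
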